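(* Let $\mathcal F$ be a $\Delta$-field of characteristic $0$, where $\Delta=\{\delta_1,\ldots,\delta_m\}$, $m>1$, and let $u_1,\ldots,u_n$ be a set of $\Delta$-indeterminates over $\mathcal F$. Let $\mathcal G$ be a $\Delta$-field with $\mathcal F\subsetneq\mathcal G\subseteq\mathcal F\langle u_1,\ldots,u_n\rangle$. Suppose that the differential dimension polynomial of the point $\mathbf u=(u_1,\ldots,u_n)$ over $\mathcal G$ is of the form $$\omega_{\mathbf u/\mathcal G}(t)=n\binom{t+m}{m}-\binom{t+m-s}{m}$$ for some $s\in\mathbb N$. Then there exists $v\in\mathcal G$ such that $\mathcal G=\mathcal F\langle v\rangle$. Moreover, if $v_1$ and $v_2$ are two such elements (i.e. $v_1,v_2\in\mathcal G$ and $\mathcal G=\mathcal F\langle v_1\rangle=\mathcal F\langle v_2\rangle$), then there exist $a,b,c,d\in\mathcal F$ such that $v_2=\dfrac{av_1+b}{cv_1+d}$.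
   Context: A $\Delta$-field is a field endowed with a finite set $\Delta=\{\delta_1,\ldots,\delta_m\}$ of pairwise commuting derivations; a $\Delta$-subfield is a subfield closed under the $\delta_i$, with the induced derivations. $\mathbb N$ includes $0$. $\Theta=\{\delta_1^{e_1}\cdots\delta_m^{e_m}: e_i\in\mathbb N\}$, and $\mathrm{ord}(\delta_1^{e_1}\cdots\delta_m^{e_m})=\sum_i e_i$. Elements $u_1,\ldots,u_n$ of a $\Delta$-extension field of $\mathcal F$ are $\Delta$-indeterminates over $\mathcal F$ if the family $(\theta u_j)_{\theta\in\Theta,\,1\le j\le n}$ is algebraically independent over $\mathcal F$. $\mathcal F\langle a_1,\ldots,a_k\rangle$ denotes the $\Delta$-field generated over $\mathcal F$ by $a_1,\ldots,a_k$, i.e. $\mathcal F(\theta a_j:\theta\in\Theta,\ 1\le j\le k)$. For $t\in\mathbb N$, $u_j^{[t]}=\{\theta(u_j):\theta\in\Theta,\ \mathrm{ord}(\theta)\le t\}$. The differential dimension polynomial (Kolchin polynomial) $\omega_{\mathbf u/\mathcal G}(t)\in\mathbb Q[t]$ is the unique polynomial such that, for all sufficiently large $t\in\mathbb N$, $\omega_{\mathbf u/\mathcal G}(t)$ equals the transcendence degree of $\mathcal G(u_1^{[t]},\ldots,u_n^{[t]})$ over $\mathcal G$ (it exists by a theorem of Kolchin). Binomial coefficients $\binom{t+m-s}{m}$ are regarded as polynomials in $t$. *)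

theory Defs
  imports
    Complex_Main
    "HOL-Library.Poly_Mapping"
    "HOL-Computational_Algebra.Polynomial"
begin

section \<open>Subfields, algebraic independence, transcendence degree\<close>

text \<open>All fields are subfields of one ambient field, the type \<open>'a\<close>.\<close>

definition is_subfield :: "'a::field set \<Rightarrow> bool" where
  "is_subfield K \<longleftrightarrow> 1 \<in> K \<and> (\<forall>x\<in>K. \<forall>y\<in>K. x - y \<in> K \<and> x * y \<in> K) \<and> (\<forall>x\<in>K. inverse x \<in> K)"

definition field_adjoin :: "'a::field set \<Rightarrow> 'a set \<Rightarrow> 'a set" where
  "field_adjoin K S = is_subfield hull (K \<union> S)"

text \<open>
  A polynomial over \<open>'a\<close> in variables indexed by \<open>'i\<close> is a finitely supported map from
  monomials to coefficients, a monomial being a finitely supported map from variables to exponents.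
\<close>

definition mpoly_eval :: "('i \<Rightarrow> 'a::comm_semiring_1) \<Rightarrow> (('i \<Rightarrow>\<^sub>0 nat) \<Rightarrow>\<^sub>0 'a) \<Rightarrow> 'a" where
  "mpoly_eval x p =
     (\<Sum>\<mu>\<in>Poly_Mapping.keys p. Poly_Mapping.lookup p \<mu> *
        (\<Prod>i\<in>Poly_Mapping.keys \<mu>. x i ^ Poly_Mapping.lookup \<mu> i))"

definition alg_independent :: "'a::field set \<Rightarrow> 'i set \<Rightarrow> ('i \<Rightarrow> 'a) \<Rightarrow> bool" where
  "alg_independent K I x \<longleftrightarrow>
     (\<forall>p :: ('i \<Rightarrow>\<^sub>0 nat) \<Rightarrow>\<^sub>0 'a.
        (\<forall>\<mu>. Poly_Mapping.lookup p \<mu> \<in> K) \<longrightarrow>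
        (\<forall>\<mu>\<in>Poly_Mapping.keys p. Poly_Mapping.keys \<mu> \<subseteq> I) \<longrightarrow>
        mpoly_eval x p = 0 \<longrightarrow> p = 0)"

definition algebraic_over :: "'a::field set \<Rightarrow> 'a \<Rightarrow> bool" where
  "algebraic_over K x \<longleftrightarrow> (\<exists>p. p \<noteq> 0 \<and> (\<forall>i. coeff p i \<in> K) \<and> poly p x = 0)"

definition transcendence_basis :: "'a::field set \<Rightarrow> 'a set \<Rightarrow> 'a set \<Rightarrow> bool" where
  "transcendence_basis K L B \<longleftrightarrow>
     B \<subseteq> L \<and> alg_independent K B (\<lambda>b. b) \<and> (\<forall>x\<in>L. algebraic_over (field_adjoin K B) x)"

text \<open>
  Meaningful for extensions of finite transcendence degree only, in particular for finitely
  generated ones: the cardinality of an infinite set is \<open>0\<close> here.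
\<close>

definition trdeg :: "'a::field set \<Rightarrow> 'a set \<Rightarrow> nat" where
  "trdeg K L = card (SOME B. transcendence_basis K L B)"


section \<open>Differential fields\<close>

definition derivation :: "('a::field \<Rightarrow> 'a) \<Rightarrow> bool" where
  "derivation d \<longleftrightarrow> (\<forall>x y. d (x + y) = d x + d y) \<and> (\<forall>x y. d (x * y) = d x * y + x * d y)"

text \<open>\<open>\<delta> 1, \<dots>, \<delta> m\<close> make the ambient field a \<open>\<Delta>\<close>-field; the other \<open>\<delta> i\<close> are irrelevant.\<close>

definition delta_structure :: "nat \<Rightarrow> (nat \<Rightarrow> 'a::field \<Rightarrow> 'a) \<Rightarrow> bool" where
  "delta_structure m \<delta> \<longleftrightarrow>
     (\<forall>i\<in>{1..m}. derivation (\<delta> i)) \<and>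
     (\<forall>i\<in>{1..m}. \<forall>j\<in>{1..m}. \<forall>x. \<delta> i (\<delta> j x) = \<delta> j (\<delta> i x))"

definition delta_subfield :: "nat \<Rightarrow> (nat \<Rightarrow> 'a::field \<Rightarrow> 'a) \<Rightarrow> 'a set \<Rightarrow> bool" where
  "delta_subfield m \<delta> K \<longleftrightarrow> is_subfield K \<and> (\<forall>i\<in>{1..m}. \<forall>x\<in>K. \<delta> i x \<in> K)"

text \<open>
  The elements of \<open>\<Theta>\<close> are represented by their exponent vectors \<open>(e 1, \<dots>, e m)\<close>; the condition
  outside \<open>{1..m}\<close> makes this representation unique.
\<close>

definition Theta :: "nat \<Rightarrow> (nat \<Rightarrow> nat) set" where
  "Theta m = {e. \<forall>i. i \<notin> {1..m} \<longrightarrow> e i = 0}"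

definition theta_ord :: "nat \<Rightarrow> (nat \<Rightarrow> nat) \<Rightarrow> nat" where
  "theta_ord m e = (\<Sum>i=1..m. e i)"

primrec theta :: "(nat \<Rightarrow> 'a \<Rightarrow> 'a) \<Rightarrow> nat \<Rightarrow> (nat \<Rightarrow> nat) \<Rightarrow> 'a \<Rightarrow> 'a" where
  "theta \<delta> 0 e = id"
| "theta \<delta> (Suc k) e = theta \<delta> k e \<circ> (\<delta> (Suc k) ^^ e (Suc k))"

definition delta_indeterminates ::
    "nat \<Rightarrow> (nat \<Rightarrow> 'a::field \<Rightarrow> 'a) \<Rightarrow> 'a set \<Rightarrow> nat \<Rightarrow> (nat \<Rightarrow> 'a) \<Rightarrow> bool" where
  "delta_indeterminates m \<delta> F n u \<longleftrightarrow>
     alg_independent F (Theta m \<times> {1..n}) (\<lambda>(e, j). theta \<delta> m e (u j))"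

definition delta_adjoin :: "nat \<Rightarrow> (nat \<Rightarrow> 'a::field \<Rightarrow> 'a) \<Rightarrow> 'a set \<Rightarrow> 'a set \<Rightarrow> 'a set" where
  "delta_adjoin m \<delta> F A = field_adjoin F {theta \<delta> m e a | e a. e \<in> Theta m \<and> a \<in> A}"

definition derivs_upto :: "nat \<Rightarrow> (nat \<Rightarrow> 'a \<Rightarrow> 'a) \<Rightarrow> nat \<Rightarrow> 'a \<Rightarrow> 'a set" where
  "derivs_upto m \<delta> t x = {theta \<delta> m e x | e. e \<in> Theta m \<and> theta_ord m e \<le> t}"

definition is_diff_dim_poly ::
    "nat \<Rightarrow> (nat \<Rightarrow> 'a::field \<Rightarrow> 'a) \<Rightarrow> 'a set \<Rightarrow> nat \<Rightarrow> (nat \<Rightarrow> 'a) \<Rightarrow> rat poly \<Rightarrow> bool" where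
  "is_diff_dim_poly m \<delta> G n u \<omega> \<longleftrightarrow>
     (\<forall>\<^sub>F t in sequentially.
        poly \<omega> (of_nat t) = of_nat (trdeg G (field_adjoin G (\<Union>j\<in>{1..n}. derivs_upto m \<delta> t (u j)))))"

lemma is_diff_dim_poly_unique:
  assumes "is_diff_dim_poly m \<delta> G n u p" and "is_diff_dim_poly m \<delta> G n u q"
  shows "p = q"
proof (rule ccontr)
  assume "p \<noteq> q"
  from assms have "\<forall>\<^sub>F t in sequentially. poly (p - q) (of_nat t) = 0"
    unfolding is_diff_dim_poly_def by eventually_elim simp
  then obtain N where N: "\<And>t. t \<ge> N \<Longrightarrow> poly (p - q) (of_nat t) = 0"
    unfolding eventually_sequentially by blast
  have "of_nat ` {N..} \<subseteq> {x. poly (p - q) x = 0}"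
    using N by auto
  moreover have "finite {x. poly (p - q) x = 0}"
    using \<open>p \<noteq> q\<close> by (intro poly_roots_finite) simp
  ultimately have "finite ((of_nat :: nat \<Rightarrow> rat) ` {N..})"
    by (rule finite_subset)
  then have "finite {N..}"
    by (rule finite_imageD) (simp add: inj_on_def)
  then show False
    using infinite_Ici by blast
qed

text \<open>The binomial coefficient \<open>t + c\<close> over \<open>k\<close> as a polynomial in \<open>t\<close>.\<close>

definition binomial_poly :: "int \<Rightarrow> nat \<Rightarrow> rat poly" where
  "binomial_poly c k = smult (1 / fact k) (\<Prod>i=0..<k. [:of_int c - of_nat i, 1:])"

lemma poly_binomial_poly: "poly (binomial_poly c k) x = (x + of_int c) gchoose k"
  by (simp add: binomial_poly_def gbinomial_prod_rev poly_prod algebra_simps)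

end

theory Submission
  imports "HOL-Algebra.Algebraic_Closure_Type" Defs
begin

text \<open>
  In characteristic zero, algebraic dependence is detected by derivations of the ambient field. Rank the
  derivatives \<open>\<theta> u\<^sub>j\<close> by an orderly ranking and call a derivative a leader if it is algebraic over \<open>G\<close> and the lower
  ones. The leaders form an order ideal, and the transcendence degrees count the remaining derivatives; so
  the given dimension polynomial forces the leaders to be exactly the derivatives of one \<open>w0\<close> of order \<open>s\<close>.

  Let \<open>f0\<close> be the minimal polynomial of \<open>w0\<close> over \<open>G\<close> and the derivatives below \<open>w0\<close>. Using the conjugates
  of \<open>w0\<close> and the partial derivations with respect to the \<open>\<theta> u\<^sub>j\<close>, one shows that the coefficients of \<open>f0\<close> are
  rational functions of the lower derivatives over the subfield \<open>\<Gamma>\<close> of those elements of \<open>G\<close> that involve no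
  derivative above \<open>w0\<close>. The classical theorem of Lueroth, followed by a specialisation, gives
  \<open>\<Gamma> = F(v)\<close>. As \<open>w0\<close> has the same degree over \<open>F\<langle>v\<rangle>\<close> and the non-leaders as over \<open>G\<close> and the
  non-leaders, \<open>G = F\<langle>v\<rangle>\<close>.

  If \<open>v1\<close> and \<open>v2\<close> both generate \<open>G\<close>, the orders of \<open>v1\<close> in terms of \<open>v2\<close> and conversely add up to zero, so
  \<open>F(v1) = F(v2)\<close>.
\<close>

section \<open>Subfields and polynomials over them\<close>

text \<open>The obstacle: the coefficients of \<open>f0\<close> lie in \<open>G(U Lo)\<close>, and
  the elements of \<open>G\<close> in them may involve derivatives far above \<open>w0\<close>. Let
  \<rho> = \<open>w0\<close> + \<tau>0 be the highest of these. A conjugation \<sigma> that is the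
  identity on \<open>G\<close> fixes some \<gamma> in \<open>G\<close> with leader \<rho>. If the
  conjugate of \<open>w0\<close> involved \<rho>, then, by differentiation, that of \<rho> would
  involve \<rho> + \<tau>0, and so would \<sigma> \<gamma> = \<gamma>, which is impossible. Hence no
  conjugate involves \<rho>, and neither do the coefficients of \<open>f0\<close>. This does not yet
  remove \<rho> from the elements of \<open>G\<close> inside a coefficient: partial derivation leads
  from \<open>G\<close> into \<open>KK\<close>, over which the \<open>U Lo\<close> are not
  independent, so coefficients cannot be compared. Therefore \<sigma> may also multiply each
  derivative in \<open>Lo\<close> by a positive integer. A relation that holds at enough rescaled
  points is an identity of polynomials and can be read off at integer points. Powers of primes
  supply such points; they serve again when the Lueroth generator over \<open>F(U Lo)\<close> is
  specialised to one over \<open>F\<close>.\<close>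

lemma subfield_one: "is_subfield K \<Longrightarrow> 1 \<in> K"
  by (simp add: is_subfield_def)

lemma subfield_diff: "is_subfield K \<Longrightarrow> x \<in> K \<Longrightarrow> y \<in> K \<Longrightarrow> x - y \<in> K"
  by (simp add: is_subfield_def)

lemma subfield_mult: "is_subfield K \<Longrightarrow> x \<in> K \<Longrightarrow> y \<in> K \<Longrightarrow> x * y \<in> K"
  by (simp add: is_subfield_def)

lemma subfield_inverse: "is_subfield K \<Longrightarrow> x \<in> K \<Longrightarrow> inverse x \<in> K"
  by (simp add: is_subfield_def)

lemma subfield_zero: "is_subfield K \<Longrightarrow> 0 \<in> K"
  using subfield_diff[of K 1 1] subfield_one by auto

lemma subfield_uminus: "is_subfield K \<Longrightarrow> x \<in> K \<Longrightarrow> - x \<in> K"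
  using subfield_diff[of K 0 x] subfield_zero by auto

lemma subfield_add: "is_subfield K \<Longrightarrow> x \<in> K \<Longrightarrow> y \<in> K \<Longrightarrow> x + y \<in> K"
  using subfield_diff[of K x "- y"] subfield_uminus by auto

lemma subfield_divide: "is_subfield K \<Longrightarrow> x \<in> K \<Longrightarrow> y \<in> K \<Longrightarrow> x / y \<in> K"
  by (simp add: divide_inverse subfield_inverse subfield_mult)

lemma subfield_power: "is_subfield K \<Longrightarrow> x \<in> K \<Longrightarrow> x ^ n \<in> K"
  by (induction n) (auto intro: subfield_mult subfield_one)

lemma subfield_of_nat: "is_subfield K \<Longrightarrow> of_nat n \<in> K"
  by (induction n) (auto intro: subfield_add subfield_zero subfield_one)

lemma subfield_sum: "is_subfield K \<Longrightarrow> (\<And>i. i \<in> A \<Longrightarrow> g i \<in> K) \<Longrightarrow> sum g A \<in> K"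
  by (induction A rule: infinite_finite_induct) (auto intro: subfield_add subfield_zero)

lemma subfield_prod: "is_subfield K \<Longrightarrow> (\<And>i. i \<in> A \<Longrightarrow> g i \<in> K) \<Longrightarrow> prod g A \<in> K"
  by (induction A rule: infinite_finite_induct) (auto intro: subfield_mult subfield_one)

lemmas subfield_closed = subfield_one subfield_diff subfield_mult subfield_inverse subfield_zero
  subfield_uminus subfield_add subfield_divide subfield_power subfield_of_nat subfield_sum
  subfield_prod

lemma is_subfield_UNIV: "is_subfield UNIV"
  by (simp add: is_subfield_def)

lemma is_subfield_adjoin: "is_subfield (field_adjoin K S)"
  unfolding field_adjoin_def hull_def by (auto simp: is_subfield_def)

lemma adjoin_base: "K \<subseteq> field_adjoin K S"
  unfolding field_adjoin_def using hull_subset[of "K \<union> S" is_subfield] by auto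

lemma adjoin_gens: "S \<subseteq> field_adjoin K S"
  unfolding field_adjoin_def using hull_subset[of "K \<union> S" is_subfield] by auto

lemma adjoin_least: "is_subfield T \<Longrightarrow> K \<subseteq> T \<Longrightarrow> S \<subseteq> T \<Longrightarrow> field_adjoin K S \<subseteq> T"
  unfolding field_adjoin_def by (rule hull_minimal) auto

lemma adjoin_mono: "K \<subseteq> K' \<Longrightarrow> S \<subseteq> S' \<Longrightarrow> field_adjoin K S \<subseteq> field_adjoin K' S'"
  unfolding field_adjoin_def by (rule hull_mono) auto

section \<open>Polynomials with coefficients in a subfield\<close>

definition poly_over :: "'a::field set \<Rightarrow> 'a poly \<Rightarrow> bool" where
  "poly_over M p \<longleftrightarrow> (\<forall>i. coeff p i \<in> M)"

lemma poly_overD: "poly_over M p \<Longrightarrow> coeff p i \<in> M"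
  by (simp add: poly_over_def)

lemma poly_over_mono: "poly_over M p \<Longrightarrow> M \<subseteq> M' \<Longrightarrow> poly_over M' p"
  by (auto simp: poly_over_def)

lemma poly_over_add: "is_subfield M \<Longrightarrow> poly_over M p \<Longrightarrow> poly_over M q \<Longrightarrow> poly_over M (p + q)"
  by (simp add: poly_over_def subfield_add)

lemma poly_over_diff: "is_subfield M \<Longrightarrow> poly_over M p \<Longrightarrow> poly_over M q \<Longrightarrow> poly_over M (p - q)"
  by (simp add: poly_over_def subfield_diff)

lemma poly_over_uminus: "is_subfield M \<Longrightarrow> poly_over M p \<Longrightarrow> poly_over M (- p)"
  by (simp add: poly_over_def subfield_uminus)

lemma poly_over_mult: "is_subfield M \<Longrightarrow> poly_over M p \<Longrightarrow> poly_over M q \<Longrightarrow> poly_over M (p * q)"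
  by (simp add: poly_over_def coeff_mult subfield_sum subfield_mult)

lemma poly_over_smult: "is_subfield M \<Longrightarrow> c \<in> M \<Longrightarrow> poly_over M p \<Longrightarrow> poly_over M (smult c p)"
  by (simp add: poly_over_def subfield_mult)

lemma poly_over_pCons: "is_subfield M \<Longrightarrow> c \<in> M \<Longrightarrow> poly_over M p \<Longrightarrow> poly_over M (pCons c p)"
  by (auto simp: poly_over_def coeff_pCons split: nat.splits)

lemma poly_over_0: "is_subfield M \<Longrightarrow> poly_over M 0"
  by (simp add: poly_over_def subfield_zero)

lemma poly_over_1: "is_subfield M \<Longrightarrow> poly_over M 1"
  by (simp add: one_pCons poly_over_pCons poly_over_0 subfield_one)

lemma poly_over_monom: "is_subfield M \<Longrightarrow> c \<in> M \<Longrightarrow> poly_over M (monom c k)"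
  by (auto simp: poly_over_def subfield_zero)

lemma poly_over_pderiv: "is_subfield M \<Longrightarrow> poly_over M p \<Longrightarrow> poly_over M (pderiv p)"
  unfolding poly_over_def coeff_pderiv by (intro allI subfield_mult subfield_of_nat) auto

lemma poly_over_power: "is_subfield M \<Longrightarrow> poly_over M p \<Longrightarrow> poly_over M (p ^ k)"
  by (induction k) (auto intro: poly_over_mult poly_over_1)

lemmas poly_over_closed = poly_over_add poly_over_diff poly_over_uminus poly_over_mult
  poly_over_smult poly_over_pCons poly_over_0 poly_over_1 poly_over_monom poly_over_pderiv
  poly_over_power

lemma poly_over_eval: "is_subfield M \<Longrightarrow> poly_over M p \<Longrightarrow> x \<in> M \<Longrightarrow> poly p x \<in> M"
  unfolding poly_altdef by (auto intro!: subfield_sum subfield_mult subfield_power simp: poly_over_def)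

text \<open>Long division is carried out explicitly so that quotient and remainder are seen to keep
  their coefficients in \<open>M\<close>.\<close>

lemma poly_over_division:
  assumes M: "is_subfield M" and q: "poly_over M q" "q \<noteq> 0" and p: "poly_over M p"
  shows "\<exists>a r. poly_over M a \<and> poly_over M r \<and> p = q * a + r \<and> (r = 0 \<or> degree r < degree q)"
  using p
proof (induction "degree p" arbitrary: p rule: less_induct)
  case less
  show ?case
  proof (cases "p = 0 \<or> degree p < degree q")
    case True
    then show ?thesis
      using less.prems poly_over_0[OF M] by (intro exI[of _ 0] exI[of _ p]) auto
  next
    case False
    then have dq: "degree q \<le> degree p" and "p \<noteq> 0" by auto
    define c where "c = lead_coeff p / lead_coeff q"
    define t where "t = monom c (degree p - degree q)"
    define p' where "p' = p - q * t"
    have c: "c \<in> M" "c \<noteq> 0"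
      using less.prems q M \<open>p \<noteq> 0\<close> by (auto simp: c_def poly_over_def intro: subfield_divide)
    have t: "poly_over M t" using c M by (auto simp: t_def intro: poly_over_monom)
    have p': "poly_over M p'" using t q less.prems M by (auto simp: p'_def intro: poly_over_closed)
    have dt: "degree (q * t) = degree p"
      using q c dq by (simp add: t_def degree_mult_eq degree_monom_eq monom_eq_0_iff)
    have lc: "coeff (q * t) (degree p) = coeff p (degree p)"
    proof -
      have "coeff (q * t) (degree p) = lead_coeff (q * t)" by (simp only: dt)
      also have "\<dots> = lead_coeff q * c" by (simp only: lead_coeff_mult) (simp only: t_def lead_coeff_monom)
      also have "\<dots> = lead_coeff p" using q by (simp add: c_def)
      finally show ?thesis .
    qed
    have le: "degree p' \<le> degree p"
      unfolding p'_def using dt by (intro degree_diff_le) auto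
    have "p' = 0 \<or> degree p' < degree p"
    proof (rule ccontr)
      assume "\<not> ?thesis"
      then have "p' \<noteq> 0" "degree p' = degree p" using le by auto
      then have "coeff p' (degree p) \<noteq> 0" by (metis leading_coeff_0_iff)
      then show False using lc by (simp add: p'_def)
    qed
    then show ?thesis
    proof
      assume "p' = 0"
      then show ?thesis using t poly_over_0[OF M]
        by (intro exI[of _ t] exI[of _ 0]) (auto simp: p'_def)
    next
      assume "degree p' < degree p"
      from less.hyps[OF this p'] obtain a r where ar: "poly_over M a" "poly_over M r"
        "p' = q * a + r" "r = 0 \<or> degree r < degree q" by blast
      then have "p = q * (t + a) + r" by (simp add: p'_def algebra_simps)
      then show ?thesis using ar t M by (intro exI[of _ "t + a"] exI[of _ r]) (auto intro: poly_over_add)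
    qed
  qed
qed

section \<open>Minimal polynomials and simple extensions\<close>

definition min_poly :: "'a::field set \<Rightarrow> 'a \<Rightarrow> 'a poly \<Rightarrow> bool" where
  "min_poly M x f \<longleftrightarrow> poly_over M f \<and> lead_coeff f = 1 \<and> poly f x = 0 \<and>
     (\<forall>p. poly_over M p \<longrightarrow> p \<noteq> 0 \<longrightarrow> poly p x = 0 \<longrightarrow> degree f \<le> degree p)"

lemma min_poly_exists:
  assumes M: "is_subfield M" and x: "algebraic_over M x"
  shows "\<exists>f. min_poly M x f"
proof -
  define P where "P = (\<lambda>p. poly_over M p \<and> p \<noteq> 0 \<and> poly p x = 0)"
  obtain p0 where "P p0" using x by (auto simp: algebraic_over_def P_def poly_over_def)
  then obtain p where p: "P p" "\<And>q. P q \<Longrightarrow> degree p \<le> degree q"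
    using arg_min_nat_lemma[of P p0 degree] by blast
  have "min_poly M x (smult (inverse (lead_coeff p)) p)"
    unfolding min_poly_def
  proof (intro conjI)
    show "poly_over M (smult (inverse (lead_coeff p)) p)"
      using p(1) M by (auto simp: P_def poly_over_def intro: subfield_closed)
  qed (use p in \<open>auto simp: P_def\<close>)
  then show ?thesis ..
qed

lemma min_poly_degree_pos: "min_poly M x f \<Longrightarrow> degree f > 0"
proof (rule ccontr)
  assume f: "min_poly M x f" and "\<not> degree f > 0"
  then obtain c where "f = [:c:]" by (auto elim: degree_eq_zeroE)
  then show False using f by (auto simp: min_poly_def)
qed

lemma min_poly_small:
  "min_poly M x f \<Longrightarrow> poly_over M p \<Longrightarrow> poly p x = 0 \<Longrightarrow> degree p < degree f \<Longrightarrow> p = 0"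
  by (auto simp: min_poly_def)

lemma min_poly_dvd:
  assumes M: "is_subfield M" and f: "min_poly M x f" and p: "poly_over M p" "poly p x = 0"
  shows "\<exists>a. poly_over M a \<and> p = f * a"
proof -
  have "poly_over M f" "f \<noteq> 0" using f by (auto simp: min_poly_def)
  from poly_over_division[OF M this p(1)] obtain a r where ar: "poly_over M a" "poly_over M r"
    "p = f * a + r" "r = 0 \<or> degree r < degree f" by blast
  have "poly r x = 0" using ar p f by (simp add: min_poly_def)
  then have "r = 0" using ar min_poly_small[OF f] by blast
  then show ?thesis using ar by auto
qed

lemma min_poly_reduce:
  assumes M: "is_subfield M" and f: "min_poly M x f" and p: "poly_over M p"
  shows "\<exists>r. poly_over M r \<and> degree r < degree f \<and> poly r x = poly p x"
proof -
  have "poly_over M f" "f \<noteq> 0" using f by (auto simp: min_poly_def)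
  from poly_over_division[OF M this p(1)] obtain a r where ar: "poly_over M a" "poly_over M r"
    "p = f * a + r" "r = 0 \<or> degree r < degree f" by blast
  have "poly r x = poly p x" using ar f by (simp add: min_poly_def)
  then show ?thesis using ar min_poly_degree_pos[OF f] by (intro exI[of _ r]) auto
qed

text \<open>A Euclidean descent: the remainder \<open>r\<close> of \<open>f\<close> modulo
  \<open>p\<close> satisfies \<open>r(x) = - p(x) a(x)\<close> and has smaller degree, so an inverse
  of \<open>r(x)\<close> yields one of \<open>p(x)\<close>. It is nonzero, since otherwise
  \<open>a\<close> would vanish at \<open>x\<close> with degree below that of
  \<open>f\<close>.\<close>

lemma min_poly_inverse:
  assumes M: "is_subfield M" and f: "min_poly M x f" and p: "poly_over M p" "poly p x \<noteq> 0"
  shows "\<exists>q. poly_over M q \<and> poly p x * poly q x = 1"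
  using p
proof (induction "degree p" arbitrary: p rule: less_induct)
  case less
  have pf: "poly_over M f" "f \<noteq> 0" "poly f x = 0" using f by (auto simp: min_poly_def)
  show ?case
  proof (cases "degree p < degree f")
    case False
    obtain r where r: "poly_over M r" "degree r < degree f" "poly r x = poly p x"
      using min_poly_reduce[OF M f less.prems(1)] by blast
    then show ?thesis using less.hyps[of r] less.prems False by auto
  next
    case True
    show ?thesis
    proof (cases "degree p = 0")
      case True
      then obtain c where c: "p = [:c:]" by (auto elim: degree_eq_zeroE)
      have "c \<in> M" using less.prems c by (auto simp: poly_over_def dest: spec[of _ 0])
      then show ?thesis using less.prems c M
        by (intro exI[of _ "[:inverse c:]"]) (auto intro!: poly_over_closed subfield_inverse)
    next
      case d0: False
      have "p \<noteq> 0" using d0 by auto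
      from poly_over_division[OF M less.prems(1) this pf(1)] obtain a r where ar: "poly_over M a"
        "poly_over M r" "f = p * a + r" "r = 0 \<or> degree r < degree p" by blast
      have rx: "poly r x = - (poly p x * poly a x)"
        using ar(3) pf(3) by (simp add: eq_neg_iff_add_eq_0 add.commute)
      have "a \<noteq> 0" using ar True by auto
      have "r \<noteq> 0"
      proof
        assume "r = 0"
        then have "poly a x = 0" "degree f = degree p + degree a"
          using rx less.prems ar(3) \<open>p \<noteq> 0\<close> \<open>a \<noteq> 0\<close> by (auto simp: degree_mult_eq)
        then show False using min_poly_small[OF f ar(1)] \<open>a \<noteq> 0\<close> d0 by auto
      qed
      then have dr: "degree r < degree p" using ar by auto
      have "poly r x \<noteq> 0"
        using min_poly_small[OF f ar(2)] \<open>r \<noteq> 0\<close> dr True by auto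
      from less.hyps[OF dr ar(2) this] obtain q where q: "poly_over M q" "poly r x * poly q x = 1"
        by blast
      then show ?thesis using rx ar M
        by (intro exI[of _ "- (a * q)"]) (auto intro!: poly_over_closed simp: algebra_simps)
    qed
  qed
qed

text \<open>Characteristic zero enters here: \<open>pderiv f\<close> is a nonzero polynomial over
  \<open>M\<close> of smaller degree than \<open>f\<close>, so minimality forbids the root
  \<open>x\<close>.\<close>

lemma min_poly_pderiv:
  fixes x :: "'a::field_char_0"
  assumes M: "is_subfield M" and f: "min_poly M x f"
  shows "poly (pderiv f) x \<noteq> 0"
proof
  assume "poly (pderiv f) x = 0"
  then have "pderiv f = 0"
    using min_poly_small[OF f poly_over_pderiv[OF M]] f min_poly_degree_pos[OF f]
    by (auto simp: min_poly_def degree_pderiv)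
  then show False using min_poly_degree_pos[OF f] by (simp add: pderiv_eq_0_iff)
qed

lemma adjoin_singleton_quotient:
  assumes M: "is_subfield M" and z: "z \<in> field_adjoin M {x}"
  shows "\<exists>p q. poly_over M p \<and> poly_over M q \<and> poly q x \<noteq> 0 \<and> z = poly p x / poly q x"
proof -
  define T where "T = {z. \<exists>p q. poly_over M p \<and> poly_over M q \<and> poly q x \<noteq> 0 \<and> z = poly p x / poly q x}"
  have TI: "poly p x / poly q x \<in> T" if "poly_over M p" "poly_over M q" "poly q x \<noteq> 0" for p q
    using that unfolding T_def by blast
  have M1: "poly_over M 1" by (rule poly_over_1[OF M])
  have "is_subfield T"
    unfolding is_subfield_def
  proof (intro conjI ballI)
    show "1 \<in> T" using TI[OF M1 M1] by simp
    fix a b assume "a \<in> T" "b \<in> T"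
    then obtain p q p' q' where a: "poly_over M p" "poly_over M q" "poly q x \<noteq> 0" "a = poly p x / poly q x"
      and b: "poly_over M p'" "poly_over M q'" "poly q' x \<noteq> 0" "b = poly p' x / poly q' x"
      unfolding T_def by blast
    have 1: "a - b = poly (p * q' - p' * q) x / poly (q * q') x"
      using a b by (simp add: diff_frac_eq)
    show "a - b \<in> T" unfolding 1 using a b M by (intro TI) (simp_all add: poly_over_diff poly_over_mult)
    have 2: "a * b = poly (p * p') x / poly (q * q') x"
      using a b by simp
    show "a * b \<in> T" unfolding 2 using a b M by (intro TI) (simp_all add: poly_over_mult)
  next
    fix a assume "a \<in> T"
    then obtain p q where a: "poly_over M p" "poly_over M q" "poly q x \<noteq> 0" "a = poly p x / poly q x"
      unfolding T_def by blast
    show "inverse a \<in> T"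
    proof (cases "poly p x = 0")
      case True
      then show ?thesis using a TI[OF poly_over_0[OF M] M1] by simp
    next
      case False
      then show ?thesis using TI[OF a(2,1)] a(4) by simp
    qed
  qed
  moreover have "M \<subseteq> T"
  proof
    fix c assume "c \<in> M"
    then have "poly_over M [:c:]" using M by (intro poly_over_pCons poly_over_0)
    from TI[OF this M1] show "c \<in> T" by simp
  qed
  moreover have "poly_over M [:0, 1:]"
    using M by (intro poly_over_pCons poly_over_0 subfield_one subfield_zero)
  from TI[OF this M1] have "{x} \<subseteq> T" by simp
  ultimately have "field_adjoin M {x} \<subseteq> T" by (rule adjoin_least)
  then show ?thesis using z unfolding T_def by blast
qed

text \<open>\<open>min_poly_inverse\<close> removes the denominator and
  \<open>min_poly_reduce\<close> bounds the degree. The bound makes it possible to compare degrees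
  over different base fields.\<close>

lemma adjoin_algebraic_poly:
  assumes M: "is_subfield M" and f: "min_poly M x f" and z: "z \<in> field_adjoin M {x}"
  shows "\<exists>r. poly_over M r \<and> degree r < degree f \<and> z = poly r x"
proof -
  obtain p q where pq: "poly_over M p" "poly_over M q" "poly q x \<noteq> 0" "z = poly p x / poly q x"
    using adjoin_singleton_quotient[OF M z] by blast
  obtain q' where q': "poly_over M q'" "poly q x * poly q' x = 1"
    using min_poly_inverse[OF M f pq(2,3)] by blast
  have "poly q' x = 1 / poly q x" using q'(2) pq(3) by (simp add: field_simps)
  then have "z = poly (p * q') x" using pq by simp
  moreover have "poly_over M (p * q')" using pq q' M by (blast intro: poly_over_mult)
  ultimately show ?thesis using min_poly_reduce[OF M f, of "p * q'"] by metis
qed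

section \<open>Partial homomorphisms and derivations\<close>

text \<open>The codomain is only a ring because two targets occur: an algebraic closure, and
  polynomials \<open>[:c:]\<close> that serve as dual numbers. Only the values on \<open>M\<close>
  matter.\<close>

definition hom_on :: "'a::field set \<Rightarrow> ('a \<Rightarrow> 'b::comm_ring_1) \<Rightarrow> bool" where
  "hom_on M h \<longleftrightarrow> h 1 = 1 \<and> (\<forall>x\<in>M. \<forall>y\<in>M. h (x + y) = h x + h y \<and> h (x * y) = h x * h y)"

lemma hom_on_subset: "hom_on M h \<Longrightarrow> M' \<subseteq> M \<Longrightarrow> hom_on M' h"
  by (auto simp: hom_on_def)

lemma hom_on_one: "hom_on M h \<Longrightarrow> h 1 = 1"
  by (simp add: hom_on_def)

lemma hom_on_add: "hom_on M h \<Longrightarrow> x \<in> M \<Longrightarrow> y \<in> M \<Longrightarrow> h (x + y) = h x + h y"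
  by (simp add: hom_on_def)

lemma hom_on_mult: "hom_on M h \<Longrightarrow> x \<in> M \<Longrightarrow> y \<in> M \<Longrightarrow> h (x * y) = h x * h y"
  by (simp add: hom_on_def)

lemma hom_on_zero: "is_subfield M \<Longrightarrow> hom_on M h \<Longrightarrow> h 0 = 0"
  using hom_on_add[of M h 0 0] subfield_zero[of M] by simp

lemma hom_on_uminus: "is_subfield M \<Longrightarrow> hom_on M h \<Longrightarrow> x \<in> M \<Longrightarrow> h (- x) = - h x"
  using hom_on_add[of M h x "- x"] hom_on_zero[of M h] subfield_uminus[of M x]
  by (simp add: eq_neg_iff_add_eq_0 add.commute)

lemma hom_on_diff: "is_subfield M \<Longrightarrow> hom_on M h \<Longrightarrow> x \<in> M \<Longrightarrow> y \<in> M \<Longrightarrow> h (x - y) = h x - h y"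
  using hom_on_add[of M h x "- y"] hom_on_uminus[of M h y] subfield_uminus[of M y] by simp

lemma hom_on_sum:
  "is_subfield M \<Longrightarrow> hom_on M h \<Longrightarrow> (\<And>i. i \<in> A \<Longrightarrow> g i \<in> M) \<Longrightarrow> h (sum g A) = (\<Sum>i\<in>A. h (g i))"
  by (induction A rule: infinite_finite_induct) (auto simp: hom_on_zero hom_on_add subfield_sum)

lemma hom_on_power: "is_subfield M \<Longrightarrow> hom_on M h \<Longrightarrow> x \<in> M \<Longrightarrow> h (x ^ k) = h x ^ k"
  by (induction k) (auto simp: hom_on_one hom_on_mult subfield_power)

lemma hom_on_inverse:
  fixes h :: "'a::field \<Rightarrow> 'b::field"
  assumes "is_subfield M" "hom_on M h" "x \<in> M"
  shows "h (inverse x) = inverse (h x)"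
proof (cases "x = 0")
  case True
  then show ?thesis using assms by (simp add: hom_on_zero)
next
  case False
  then have "h x * h (inverse x) = 1"
    using assms hom_on_mult[of M h x "inverse x"] by (simp add: subfield_inverse hom_on_one)
  then show ?thesis by (metis inverse_unique)
qed

lemma hom_on_eq_0_iff:
  fixes h :: "'a::field \<Rightarrow> 'b::field"
  assumes "is_subfield M" "hom_on M h" "x \<in> M"
  shows "h x = 0 \<longleftrightarrow> x = 0"
proof
  assume "h x = 0"
  show "x = 0"
  proof (rule ccontr)
    assume "x \<noteq> 0"
    then have "h x * h (inverse x) = 1"
      using assms hom_on_mult[of M h x "inverse x"] by (simp add: subfield_inverse hom_on_one)
    then show False using \<open>h x = 0\<close> by simp
  qed
qed (use assms in \<open>simp add: hom_on_zero\<close>)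

lemma hom_on_to_ac: "hom_on M to_ac"
  by (simp add: hom_on_def)

lemma hom_on_id: "hom_on M (\<lambda>x. x)"
  by (simp add: hom_on_def)

lemma coeff_map_poly_hom: "is_subfield M \<Longrightarrow> hom_on M h \<Longrightarrow> coeff (map_poly h p) i = h (coeff p i)"
  by (simp add: coeff_map_poly hom_on_zero)

lemma map_poly_hom_mult:
  assumes "is_subfield M" "hom_on M h" "poly_over M p" "poly_over M q"
  shows "map_poly h (p * q) = map_poly h p * map_poly h q"
  using assms
  by (intro poly_eqI) (simp add: coeff_map_poly_hom[OF assms(1,2)] coeff_mult hom_on_sum[OF assms(1,2)]
      hom_on_mult[OF assms(2)] poly_overD subfield_mult)

lemma map_poly_hom_diff:
  assumes "is_subfield M" "hom_on M h" "poly_over M p" "poly_over M q"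
  shows "map_poly h (p - q) = map_poly h p - map_poly h q"
  using assms
  by (intro poly_eqI) (simp add: coeff_map_poly_hom[OF assms(1,2)] hom_on_diff[OF assms(1,2)] poly_overD)

lemma degree_map_poly_hom:
  fixes h :: "'a::field \<Rightarrow> 'b::field"
  assumes "is_subfield M" "hom_on M h" "poly_over M p"
  shows "degree (map_poly h p) = degree p"
proof (cases "p = 0")
  case False
  then have "coeff (map_poly h p) (degree p) \<noteq> 0"
    by (simp add: coeff_map_poly_hom[OF assms(1,2)] hom_on_eq_0_iff[OF assms(1,2)] poly_overD[OF assms(3)])
  then have "degree p \<le> degree (map_poly h p)" by (rule le_degree)
  moreover have "degree (map_poly h p) \<le> degree p"
    by (rule degree_le) (simp add: coeff_map_poly_hom[OF assms(1,2)] coeff_eq_0 hom_on_zero[OF assms(1,2)])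
  ultimately show ?thesis by simp
qed simp

text \<open>Derivations of \<open>M\<close> into a field that is an \<open>M\<close>-module through
  \<open>h\<close>. The main case is \<open>D (\<sigma> z)\<close> with a conjugation \<sigma> into
  the algebraic closure and a derivation \<open>D\<close> there.\<close>

definition der_on :: "'a::field set \<Rightarrow> ('a \<Rightarrow> 'b::field) \<Rightarrow> ('a \<Rightarrow> 'b) \<Rightarrow> bool" where
  "der_on M h D \<longleftrightarrow> (\<forall>x\<in>M. \<forall>y\<in>M. D (x + y) = D x + D y \<and> D (x * y) = D x * h y + h x * D y)"

lemma der_on_subset: "der_on M h D \<Longrightarrow> M' \<subseteq> M \<Longrightarrow> der_on M' h D"
  unfolding der_on_def by blast

lemma der_on_add: "der_on M h D \<Longrightarrow> x \<in> M \<Longrightarrow> y \<in> M \<Longrightarrow> D (x + y) = D x + D y"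
  by (simp add: der_on_def)

lemma der_on_mult: "der_on M h D \<Longrightarrow> x \<in> M \<Longrightarrow> y \<in> M \<Longrightarrow> D (x * y) = D x * h y + h x * D y"
  by (simp add: der_on_def)

lemma der_on_minus: "der_on M h D \<Longrightarrow> der_on M h D' \<Longrightarrow> der_on M h (\<lambda>x. D x - D' x)"
  unfolding der_on_def by (simp add: algebra_simps)

lemma der_on_scale: "der_on M h D \<Longrightarrow> der_on M h (\<lambda>x. D x * c)"
  unfolding der_on_def by (simp add: algebra_simps)

context
  fixes M :: "'a::field set" and h D :: "'a \<Rightarrow> 'b::field"
  assumes M: "is_subfield M" and h: "hom_on M h" and D: "der_on M h D"
begin

lemma der_on_zero: "D 0 = 0"
  using der_on_add[OF D, of 0 0] subfield_zero[OF M] by (metis add_0 add_cancel_right_right)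

lemma der_on_one: "D 1 = 0"
  using der_on_mult[OF D, of 1 1] subfield_one[OF M] hom_on_one[OF h]
  by (metis add_cancel_right_right mult_1 mult_1_right)

lemma der_on_uminus: "x \<in> M \<Longrightarrow> D (- x) = - D x"
  using der_on_add[OF D, of x "- x"] subfield_uminus[OF M, of x] der_on_zero
  by (simp add: eq_neg_iff_add_eq_0 add.commute)

lemma der_on_diff: "x \<in> M \<Longrightarrow> y \<in> M \<Longrightarrow> D (x - y) = D x - D y"
  using der_on_add[OF D, of x "- y"] der_on_uminus[of y] subfield_uminus[OF M, of y] by simp

lemma der_on_sum: "(\<And>i. i \<in> A \<Longrightarrow> g i \<in> M) \<Longrightarrow> D (sum g A) = (\<Sum>i\<in>A. D (g i))"
  by (induction A rule: infinite_finite_induct)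
    (auto simp: der_on_zero der_on_add[OF D] subfield_sum[OF M])

text \<open>Vanishing on generators spreads to the generated field in this way; most vanishing
  arguments come down to a check on generators. For inverses, differentiate
  \<open>x * inverse x = 1\<close>.\<close>

lemma der_on_kernel_subfield: "is_subfield {x\<in>M. D x = 0}"
  unfolding is_subfield_def
proof (intro conjI ballI)
  show "1 \<in> {x\<in>M. D x = 0}" using der_on_one subfield_one[OF M] by simp
next
  fix x y assume "x \<in> {x\<in>M. D x = 0}" "y \<in> {x\<in>M. D x = 0}"
  then show "x - y \<in> {x\<in>M. D x = 0}" "x * y \<in> {x\<in>M. D x = 0}"
    using M by (auto simp: der_on_diff der_on_mult[OF D] intro: subfield_closed)
next
  fix x assume x: "x \<in> {x\<in>M. D x = 0}"
  show "inverse x \<in> {x\<in>M. D x = 0}"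
  proof (cases "x = 0")
    case False
    have i: "inverse x \<in> M" using x M by (auto intro: subfield_inverse)
    then have "D (x * inverse x) = h x * D (inverse x)"
      using x by (simp add: der_on_mult[OF D])
    then have "h x * D (inverse x) = 0" using False der_on_one by simp
    then show ?thesis using i x False hom_on_eq_0_iff[OF M h, of x] by auto
  qed (use x in simp)
qed

lemma der_on_vanish_adjoin:
  assumes "K \<subseteq> M" "S \<subseteq> M" "\<And>x. x \<in> K \<Longrightarrow> D x = 0" "\<And>x. x \<in> S \<Longrightarrow> D x = 0" "z \<in> field_adjoin K S"
  shows "D z = 0"
  using adjoin_least[OF der_on_kernel_subfield, of K S] assms by auto

text \<open>The chain rule: the first summand differentiates the coefficients, the second the
  argument.\<close>

lemma der_on_poly:
  assumes p: "poly_over M p" and x: "x \<in> M"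
  shows "D (poly p x) = poly (map_poly D p) (h x) + h (poly (pderiv p) x) * D x"
  using p
proof (induction p)
  case 0
  then show ?case by (simp add: der_on_zero hom_on_zero[OF M h])
next
  case (pCons a p)
  have a: "a \<in> M" using poly_overD[OF pCons.prems, of 0] by simp
  have p: "poly_over M p" unfolding poly_over_def
  proof
    fix i show "coeff p i \<in> M" using poly_overD[OF pCons.prems, of "Suc i"] by simp
  qed
  have m: "poly p x \<in> M" "poly (pderiv p) x \<in> M" "x * poly p x \<in> M" "x * poly (pderiv p) x \<in> M"
    using p x M by (auto intro!: poly_over_eval poly_over_pderiv subfield_mult)
  show ?case
    using a x m pCons.IH[OF p]
    by (simp add: pderiv_pCons map_poly_pCons der_on_zero der_on_add[OF D] der_on_mult[OF D]
        hom_on_add[OF h] hom_on_mult[OF h] algebra_simps)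
qed

end

lemma der_on_min_poly:
  assumes "is_subfield M" "hom_on M h" "der_on M h D" "K \<subseteq> M" "poly_over K p" "x \<in> M"
    and "\<And>y. y \<in> K \<Longrightarrow> D y = 0"
  shows "D (poly p x) = h (poly (pderiv p) x) * D x"
proof -
  have "map_poly D p = 0"
    using assms by (intro poly_eqI) (simp add: coeff_map_poly der_on_zero[OF assms(1-3)] poly_overD)
  then show ?thesis
    using der_on_poly[OF assms(1-3) poly_over_mono[OF assms(5,4)] assms(6)] by simp
qed

text \<open>The coefficients of the minimal polynomial are constants, so applying \<open>D\<close>
  to \<open>f x = 0\<close> leaves \<open>h (f' x) * D x = 0\<close>; here \<open>f' x\<close> is
  nonzero and \<open>h\<close> is injective.\<close>

lemma der_on_vanish_algebraic:
  fixes D :: "'a::field_char_0 \<Rightarrow> 'b::field"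
  assumes M: "is_subfield M" "hom_on M h" "der_on M h D" and K: "K \<subseteq> M" "is_subfield K" and x: "x \<in> M"
    and 0: "\<And>y. y \<in> K \<Longrightarrow> D y = 0" and alg: "algebraic_over K x"
  shows "D x = 0"
proof -
  obtain f where f: "min_poly K x f" using min_poly_exists[OF K(2) alg] by blast
  have po: "poly_over K f" "poly f x = 0" using f by (auto simp: min_poly_def)
  have "D (poly f x) = h (poly (pderiv f) x) * D x"
    using der_on_min_poly[OF M K(1) po(1) x 0] .
  moreover have "D (poly f x) = 0" using po der_on_zero[OF M] by simp
  moreover have "poly (pderiv f) x \<in> M"
    using po x K M poly_over_mono by (blast intro: poly_over_eval poly_over_pderiv)
  ultimately show ?thesis
    using min_poly_pderiv[OF K(2) f] hom_on_eq_0_iff[OF M(1,2)] by auto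
qed

lemma derivation_der_on: "derivation D \<longleftrightarrow> der_on UNIV (\<lambda>x. x) D"
  by (auto simp: derivation_def der_on_def)

lemmas derivation_der = derivation_der_on[THEN iffD1]
lemmas derivation_zero = der_on_zero[OF is_subfield_UNIV hom_on_id derivation_der]
lemmas derivation_one = der_on_one[OF is_subfield_UNIV hom_on_id derivation_der]
lemmas derivation_diff = der_on_diff[OF is_subfield_UNIV hom_on_id derivation_der UNIV_I UNIV_I]
lemmas derivation_sum = der_on_sum[OF is_subfield_UNIV hom_on_id derivation_der UNIV_I]
lemmas derivation_poly = der_on_poly[OF is_subfield_UNIV hom_on_id derivation_der _ UNIV_I]

lemma derivation_add: "derivation D \<Longrightarrow> D (x + y) = D x + D y"
  by (simp add: derivation_def)

lemma derivation_mult: "derivation D \<Longrightarrow> D (x * y) = D x * y + x * D y"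
  by (simp add: derivation_def)

lemma derivation_kernel: "derivation D \<Longrightarrow> is_subfield {x. D x = 0}"
  using der_on_kernel_subfield[OF is_subfield_UNIV hom_on_id derivation_der, of D] by simp

lemma derivation_vanish_adjoin:
  "derivation D \<Longrightarrow> (\<And>x. x \<in> K \<Longrightarrow> D x = 0) \<Longrightarrow> (\<And>x. x \<in> S \<Longrightarrow> D x = 0) \<Longrightarrow>
    z \<in> field_adjoin K S \<Longrightarrow> D z = 0"
  using der_on_vanish_adjoin[OF is_subfield_UNIV hom_on_id derivation_der, of D K S z] by simp

lemma derivation_of_nat:
  assumes "derivation D"
  shows "D (of_nat k) = 0"
  by (induction k) (simp_all add: derivation_zero[OF assms] derivation_add[OF assms] derivation_one[OF assms])

lemma derivation_power:
  assumes "derivation D"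
  shows "D (x ^ k) = of_nat k * x ^ (k - 1) * D x"
proof (induction k)
  case (Suc k)
  then show ?case by (cases k) (simp_all add: derivation_mult[OF assms] algebra_simps)
qed (simp add: derivation_one[OF assms])

lemma derivation_inverse:
  assumes "derivation D"
  shows "D (inverse x) = - D x / (x * x)"
proof (cases "x = 0")
  case False
  have "D (x * inverse x) = 0" using False by (simp add: derivation_one[OF assms])
  then have "x * D (inverse x) = - D x / x"
    by (simp add: derivation_mult[OF assms] divide_inverse eq_neg_iff_add_eq_0 add.commute)
  then show ?thesis using False by (simp add: field_simps)
qed (simp add: derivation_zero[OF assms])

lemma derivation_divide:
  assumes "derivation D" "y \<noteq> 0"
  shows "D (x / y) = (D x * y - x * D y) / (y * y)"
proof -
  have "D (x / y) = D x * inverse y + x * (- D y / (y * y))"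
    unfolding divide_inverse[of x y] derivation_mult[OF assms(1)] derivation_inverse[OF assms(1)] ..
  also have "\<dots> = (D x * y - x * D y) / (y * y)"
    using assms(2) by (simp add: divide_simps)
  finally show ?thesis .
qed

lemma derivation_lincomb:
  assumes "derivation D" "derivation D'"
  shows "derivation (\<lambda>x. a * D x + b * D' x)"
  unfolding derivation_def[of "\<lambda>x. a * D x + b * D' x"]
    derivation_add[OF assms(1)] derivation_add[OF assms(2)]
    derivation_mult[OF assms(1)] derivation_mult[OF assms(2)]
  by (simp add: algebra_simps)

lemma derivation_sum_scaled:
  "(\<And>i. i \<in> A \<Longrightarrow> derivation (D i)) \<Longrightarrow> derivation (\<lambda>x. \<Sum>i\<in>A. c i * D i x)"
proof (induction A rule: infinite_finite_induct)
  case (insert i A)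
  then show ?case using derivation_lincomb[of "D i" "\<lambda>x. \<Sum>i\<in>A. c i * D i x" "c i" 1] by simp
qed (auto simp: derivation_def)

lemma derivation_commutator:
  assumes "derivation D" "derivation D'"
  shows "derivation (\<lambda>x. D (D' x) - D' (D x))"
  unfolding derivation_def[of "\<lambda>x. D (D' x) - D' (D x)"]
    derivation_add[OF assms(1)] derivation_add[OF assms(2)]
    derivation_mult[OF assms(1)] derivation_mult[OF assms(2)]
  by (simp add: algebra_simps)

text \<open>A partial derivation is stored as its graph, so that extension is inclusion and unions
  of chains are available for Zorn's lemma. As the graph is closed under subtraction,
  single-valuedness need only be demanded at \<open>0\<close>.\<close>

definition derivation_graph :: "('a::field \<times> 'a) set \<Rightarrow> bool" where
  "derivation_graph R \<longleftrightarrow> (1, 0) \<in> R \<and>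
     (\<forall>x d y e. (x, d) \<in> R \<longrightarrow> (y, e) \<in> R \<longrightarrow> (x - y, d - e) \<in> R \<and> (x * y, d * y + x * e) \<in> R) \<and>
     (\<forall>d. (0, d) \<in> R \<longrightarrow> d = 0)"

lemma derivation_graphI:
  assumes "(1, 0) \<in> R"
    and "\<And>x d y e. (x, d) \<in> R \<Longrightarrow> (y, e) \<in> R \<Longrightarrow> (x - y, d - e) \<in> R"
    and "\<And>x d y e. (x, d) \<in> R \<Longrightarrow> (y, e) \<in> R \<Longrightarrow> (x * y, d * y + x * e) \<in> R"
    and "\<And>d. (0, d) \<in> R \<Longrightarrow> d = 0"
  shows "derivation_graph R"
  using assms unfolding derivation_graph_def by blast

context
  fixes R :: "('a::field \<times> 'a) set"
  assumes R: "derivation_graph R"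
begin

lemma dg_one: "(1, 0) \<in> R" using R by (simp add: derivation_graph_def)
lemma dg_diff: "(x, d) \<in> R \<Longrightarrow> (y, e) \<in> R \<Longrightarrow> (x - y, d - e) \<in> R"
  using R unfolding derivation_graph_def by blast
lemma dg_mult: "(x, d) \<in> R \<Longrightarrow> (y, e) \<in> R \<Longrightarrow> (x * y, d * y + x * e) \<in> R"
  using R unfolding derivation_graph_def by blast
lemma dg_single: "(0, d) \<in> R \<Longrightarrow> d = 0"
  using R unfolding derivation_graph_def by blast
lemma dg_zero: "(0, 0) \<in> R" using dg_diff[OF dg_one dg_one] by simp
lemma dg_uminus: "(x, d) \<in> R \<Longrightarrow> (- x, - d) \<in> R" using dg_diff[OF dg_zero] by fastforce
lemma dg_add: "(x, d) \<in> R \<Longrightarrow> (y, e) \<in> R \<Longrightarrow> (x + y, d + e) \<in> R"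
  using dg_diff[OF _ dg_uminus] by fastforce
lemma dg_unique: "(x, d) \<in> R \<Longrightarrow> (x, e) \<in> R \<Longrightarrow> d = e"
  using dg_diff[of x d x e] dg_single[of "d - e"] by simp

text \<open>The second component is the quotient rule: the derivation is extended to the fractions
  of its domain.\<close>

definition dg_frac :: "('a \<times> 'a) set" where
  "dg_frac = {(a / b, (a' * b - a * b') / (b * b)) | a a' b b'. (a, a') \<in> R \<and> (b, b') \<in> R \<and> b \<noteq> 0}"

lemma dg_fracI: "(a, a') \<in> R \<Longrightarrow> (b, b') \<in> R \<Longrightarrow> b \<noteq> 0 \<Longrightarrow> (a / b, (a' * b - a * b') / (b * b)) \<in> dg_frac"
  unfolding dg_frac_def by blast

lemma dg_frac: "derivation_graph dg_frac"
proof (rule derivation_graphI)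
  show "(1, 0) \<in> dg_frac" using dg_fracI[OF dg_one dg_one] by simp
next
  fix x d y e assume "(x, d) \<in> dg_frac" "(y, e) \<in> dg_frac"
  then obtain a a' b b' c c' f f' where
    R: "(a, a') \<in> R" "(b, b') \<in> R" "(c, c') \<in> R" "(f, f') \<in> R" and nz: "b \<noteq> 0" "f \<noteq> 0"
    and eq: "x = a / b" "d = (a' * b - a * b') / (b * b)" "y = c / f" "e = (c' * f - c * f') / (f * f)"
    unfolding dg_frac_def by blast
  have bf: "(b * f, b' * f + b * f') \<in> R" using R by (intro dg_mult)
  have nz': "b * f \<noteq> 0" using nz by simp
  have "(a * f - c * b, (a' * f + a * f') - (c' * b + c * b')) \<in> R" using R by (intro dg_diff dg_mult)
  from dg_fracI[OF this bf nz'] show "(x - y, d - e) \<in> dg_frac"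
    unfolding eq using nz by (auto elim!: back_subst[of "\<lambda>p. p \<in> dg_frac"] simp: field_simps)
  have "(a * c, a' * c + a * c') \<in> R" using R by (intro dg_mult)
  from dg_fracI[OF this bf nz'] show "(x * y, d * y + x * e) \<in> dg_frac"
    unfolding eq using nz by (auto elim!: back_subst[of "\<lambda>p. p \<in> dg_frac"] simp: field_simps)
next
  fix d assume "(0, d) \<in> dg_frac"
  then obtain a a' b b' where "(a, a') \<in> R" "(b, b') \<in> R" "b \<noteq> 0" "0 = a / b" "d = (a' * b - a * b') / (b * b)"
    unfolding dg_frac_def by blast
  then show "d = 0" using dg_single by auto
qed

lemma dg_sub_frac: "R \<subseteq> dg_frac"
proof
  fix p assume "p \<in> R"
  then obtain a a' where "p = (a, a')" "(a, a') \<in> R" by (cases p) auto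
  then show "p \<in> dg_frac" using dg_fracI[OF _ dg_one] by force
qed

lemma dg_domain_subfield:
  assumes "dg_frac = R"
  shows "is_subfield (Domain R)"
  unfolding is_subfield_def
proof (intro conjI ballI)
  show "1 \<in> Domain R" using dg_one by blast
  fix x y assume "x \<in> Domain R" "y \<in> Domain R"
  then show "x - y \<in> Domain R" "x * y \<in> Domain R" using dg_diff dg_mult by blast+
next
  fix x assume "x \<in> Domain R"
  then obtain d where d: "(x, d) \<in> R" by blast
  show "inverse x \<in> Domain R"
  proof (cases "x = 0")
    case True then show ?thesis using dg_zero by auto
  next
    case False
    from dg_fracI[OF dg_one d this] show ?thesis unfolding assms by (auto simp: divide_inverse)
  qed
qed

text \<open>A value \<open>x'\<close> for the derivative of \<open>x\<close> is admissible if every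
  relation \<open>p x = 0\<close> over \<open>M\<close> implies
  \<open>(D p) x + p' x * x' = 0\<close>, where \<open>D p\<close> differentiates the coefficients:
  then the extension to \<open>M[x]\<close> is well defined. For transcendental \<open>x\<close>
  this is no condition.\<close>

lemma dg_adjoin:
  assumes ch: "\<And>f. min_poly (Domain R) x f \<Longrightarrow> poly (pderiv f) x \<noteq> 0"
    and M: "is_subfield (Domain R)"
  shows "\<exists>R'. derivation_graph R' \<and> R \<subseteq> R' \<and> x \<in> Domain R'"
proof -
  define M where "M = Domain R"
  have M: "is_subfield M" using assms by (simp add: M_def)
  define D where "D = (\<lambda>y. THE d. (y, d) \<in> R)"
  have DR: "D y = d" if "(y, d) \<in> R" for y d
    unfolding D_def using that dg_unique by blast
  have RD: "(y, D y) \<in> R" if "y \<in> M" for y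
    using that DR unfolding M_def by blast
  have D: "der_on M (\<lambda>x. x) D"
    unfolding der_on_def by (simp add: DR[OF dg_add[OF RD RD]] DR[OF dg_mult[OF RD RD]])
  have D0: "D 0 = 0" and D1: "D 1 = 0" using DR[OF dg_zero] DR[OF dg_one] .
  note DD = der_on_add[OF D] der_on_mult[OF D] der_on_diff[OF M hom_on_id D] der_on_sum[OF M hom_on_id D]
  have cD: "coeff (map_poly D p) i = D (coeff p i)" for p i by (simp add: coeff_map_poly D0)
  have mult: "map_poly D (p * q) = map_poly D p * q + p * map_poly D q"
    if "poly_over M p" "poly_over M q" for p q
  proof (rule poly_eqI)
    fix i
    have "D (coeff (p * q) i) = (\<Sum>j\<le>i. D (coeff p j * coeff q (i - j)))"
      unfolding coeff_mult using that M by (intro DD) (auto intro: subfield_mult poly_overD)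
    also have "\<dots> = (\<Sum>j\<le>i. D (coeff p j) * coeff q (i - j) + coeff p j * D (coeff q (i - j)))"
      using that by (intro sum.cong refl DD) (auto intro: poly_overD)
    finally show "coeff (map_poly D (p * q)) i = coeff (map_poly D p * q + p * map_poly D q) i"
      by (simp add: cD coeff_mult sum.distrib)
  qed
  have diff: "map_poly D (p - q) = map_poly D p - map_poly D q" if "poly_over M p" "poly_over M q" for p q
    using that by (intro poly_eqI) (simp add: cD DD poly_overD)
  have "\<exists>x'. \<forall>p. poly_over M p \<longrightarrow> poly p x = 0 \<longrightarrow> poly (map_poly D p) x + poly (pderiv p) x * x' = 0"
  proof (cases "algebraic_over M x")
    case False
    then have "p = 0" if "poly_over M p" "poly p x = 0" for p
      using that unfolding algebraic_over_def poly_over_def by blast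
    then have "\<forall>p. poly_over M p \<longrightarrow> poly p x = 0 \<longrightarrow> p = 0" by blast
    then show ?thesis by (metis add_0 map_poly_0 mult_zero_left pderiv_0 poly_0)
  next
    case True
    then obtain f where f: "min_poly M x f" using min_poly_exists[OF M] by blast
    then have fo: "poly_over M f" "poly f x = 0" by (auto simp: min_poly_def)
    have nz: "poly (pderiv f) x \<noteq> 0" using ch f unfolding M_def by blast
    \<comment> \<open>Forced by differentiating \<open>f x = 0\<close>; every other relation is a
      multiple of \<open>f\<close>.\<close>
    define x' where "x' = - poly (map_poly D f) x / poly (pderiv f) x"
    show ?thesis
    proof (intro exI[of _ x'] allI impI)
      fix p assume p: "poly_over M p" "poly p x = 0"
      then obtain a where a: "poly_over M a" "p = f * a" using min_poly_dvd[OF M f] by blast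
      have "poly (pderiv f) x * x' = - poly (map_poly D f) x" using nz by (simp add: x'_def)
      moreover have "poly (map_poly D p) x + poly (pderiv p) x * x' =
          poly a x * (poly (map_poly D f) x + poly (pderiv f) x * x')"
        unfolding a(2) mult[OF fo(1) a(1)] pderiv_mult using fo(2) by (simp add: algebra_simps)
      ultimately show "poly (map_poly D p) x + poly (pderiv p) x * x' = 0" by simp
    qed
  qed
  then obtain x' where x': "\<And>p. poly_over M p \<Longrightarrow> poly p x = 0 \<Longrightarrow>
      poly (map_poly D p) x + poly (pderiv p) x * x' = 0" by blast
  define v where "v = (\<lambda>p. (poly p x, poly (map_poly D p) x + poly (pderiv p) x * x'))"
  define R' where "R' = v ` {p. poly_over M p}"
  have R'I: "v p \<in> R'" if "poly_over M p" for p using that by (simp add: R'_def)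
  have "derivation_graph R'"
  proof (rule derivation_graphI)
    have "map_poly D 1 = 0" by (rule poly_eqI) (simp add: cD D0 D1 one_pCons coeff_pCons split: nat.split)
    then have "v 1 = (1, 0)" by (simp add: v_def)
    then show "(1, 0) \<in> R'" using R'I[OF poly_over_1[OF M]] by simp
  next
    fix a d b e assume "(a, d) \<in> R'" "(b, e) \<in> R'"
    then obtain p q where p: "poly_over M p" "(a, d) = v p" and q: "poly_over M q" "(b, e) = v q"
      unfolding R'_def by blast
    have "(a - b, d - e) = v (p - q)"
      using p(2) q(2) by (simp add: v_def pderiv_diff diff[OF p(1) q(1)] algebra_simps)
    then show "(a - b, d - e) \<in> R'" using R'I[OF poly_over_diff[OF M p(1) q(1)]] by simp
    have "(a * b, d * b + a * e) = v (p * q)"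
      using p(2) q(2) unfolding v_def mult[OF p(1) q(1)] pderiv_mult by (simp add: algebra_simps)
    then show "(a * b, d * b + a * e) \<in> R'" using R'I[OF poly_over_mult[OF M p(1) q(1)]] by simp
  next
    fix d assume "(0, d) \<in> R'"
    then obtain p where "poly_over M p" "(0, d) = v p" unfolding R'_def by blast
    then show "d = 0" using x'[of p] by (simp add: v_def)
  qed
  moreover have "R \<subseteq> R'"
  proof
    fix r assume "r \<in> R"
    then obtain y d where r: "r = (y, d)" "(y, d) \<in> R" by (cases r) auto
    then have "y \<in> M" by (auto simp: M_def)
    then have "poly_over M [:y:]" using M by (intro poly_over_pCons poly_over_0)
    moreover have "v [:y:] = (y, d)" using DR[OF r(2)] by (simp add: v_def map_poly_pCons D0 pderiv_pCons)
    ultimately show "r \<in> R'" using R'I r by metis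
  qed
  moreover have "x \<in> Domain R'"
  proof -
    have "poly_over M [:0, 1:]"
      using M by (intro poly_over_pCons poly_over_0 subfield_one subfield_zero)
    from R'I[OF this] show ?thesis by (auto simp: v_def)
  qed
  ultimately show ?thesis by blast
qed

end

text \<open>A maximal graph is closed under fractions by \<open>dg_frac\<close>, so its domain is a
  field, and by \<open>dg_adjoin\<close> that field contains every element.\<close>

theorem derivation_extend:
  fixes R :: "('a::field_char_0 \<times> 'a) set"
  assumes R: "derivation_graph R"
  shows "\<exists>D. derivation D \<and> (\<forall>x d. (x, d) \<in> R \<longrightarrow> D x = d)"
proof -
  define A where "A = {S. derivation_graph S \<and> R \<subseteq> S}"
  have "\<exists>S\<in>A. \<forall>T\<in>A. S \<subseteq> T \<longrightarrow> T = S"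
  proof (rule subset_Zorn_nonempty)
    show "A \<noteq> {}" using R by (auto simp: A_def)
    fix C assume C: "C \<noteq> {}" "subset.chain A C"
    then have CA: "\<And>S. S \<in> C \<Longrightarrow> derivation_graph S \<and> R \<subseteq> S"
      by (auto simp: subset.chain_def A_def)
    have two: "\<exists>S\<in>C. p \<in> S \<and> q \<in> S" if "p \<in> \<Union>C" "q \<in> \<Union>C" for p q
    proof -
      from that obtain S T where "S \<in> C" "p \<in> S" "T \<in> C" "q \<in> T" by blast
      moreover from this have "S \<subseteq> T \<or> T \<subseteq> S" using C(2) by (auto simp: subset.chain_def)
      ultimately show ?thesis by blast
    qed
    have "derivation_graph (\<Union>C)"
    proof (rule derivation_graphI)
      show "(1, 0) \<in> \<Union>C" using C(1) CA dg_one by blast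
      show "(x - y, d - e) \<in> \<Union>C" if "(x, d) \<in> \<Union>C" "(y, e) \<in> \<Union>C" for x d y e
        using two[OF that] CA dg_diff by blast
      show "(x * y, d * y + x * e) \<in> \<Union>C" if "(x, d) \<in> \<Union>C" "(y, e) \<in> \<Union>C" for x d y e
        using two[OF that] CA dg_mult by blast
      show "d = 0" if "(0, d) \<in> \<Union>C" for d using that CA dg_single by blast
    qed
    moreover have "R \<subseteq> \<Union>C" using C(1) CA by blast
    ultimately show "\<Union>C \<in> A" by (simp add: A_def)
  qed
  then obtain S where SA: "S \<in> A" and SM: "\<forall>T\<in>A. S \<subseteq> T \<longrightarrow> T = S" by blast
  have S: "derivation_graph S" "R \<subseteq> S" using SA by (auto simp: A_def)
  have max: "T = S" if "derivation_graph T" "S \<subseteq> T" for T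
    using SM that S(2) by (auto simp: A_def)
  have fr: "dg_frac S = S" using max[OF dg_frac[OF S(1)] dg_sub_frac[OF S(1)]] .
  have sub: "is_subfield (Domain S)" by (rule dg_domain_subfield[OF S(1) fr])
  have dom: "x \<in> Domain S" for x
  proof -
    obtain S' where "derivation_graph S'" "S \<subseteq> S'" "x \<in> Domain S'"
      using dg_adjoin[OF S(1) min_poly_pderiv[OF sub] sub, of x] by blast
    then show ?thesis using max by blast
  qed
  define D where "D = (\<lambda>y. THE d. (y, d) \<in> S)"
  have DS: "D y = d" if "(y, d) \<in> S" for y d
    unfolding D_def using that dg_unique[OF S(1)] by blast
  have SD: "(y, D y) \<in> S" for y using dom[of y] DS by blast
  have "derivation D"
    unfolding derivation_def
    by (simp add: DS[OF dg_add[OF S(1) SD SD]] DS[OF dg_mult[OF S(1) SD SD]])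
  then show ?thesis using DS S(2) by blast
qed

text \<open>The embedding transports the graph of \<open>D\<close> to a partial derivation of the
  algebraic closure, which can be extended.\<close>

lemma derivation_lift_ac:
  fixes D :: "'a::field_char_0 \<Rightarrow> 'a"
  assumes D: "derivation D"
  shows "\<exists>D'. derivation D' \<and> (\<forall>x. D' (to_ac x) = to_ac (D x))"
proof -
  have "derivation_graph (range (\<lambda>x. (to_ac x, to_ac (D x))))"
  proof (rule derivation_graphI)
    show "(1, 0) \<in> range (\<lambda>x. (to_ac x, to_ac (D x)))"
      using derivation_one[OF D] by (intro range_eqI[of _ _ 1]) simp
  next
    fix x d y e
    assume "(x, d) \<in> range (\<lambda>x. (to_ac x, to_ac (D x)))" "(y, e) \<in> range (\<lambda>x. (to_ac x, to_ac (D x)))"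
    then obtain a b where ab: "x = to_ac a" "d = to_ac (D a)" "y = to_ac b" "e = to_ac (D b)" by auto
    show "(x - y, d - e) \<in> range (\<lambda>x. (to_ac x, to_ac (D x)))"
      by (rule range_eqI[of _ _ "a - b"]) (simp add: ab derivation_diff[OF D])
    show "(x * y, d * y + x * e) \<in> range (\<lambda>x. (to_ac x, to_ac (D x)))"
      by (rule range_eqI[of _ _ "a * b"]) (simp add: ab derivation_mult[OF D])
  next
    fix d assume "(0, d) \<in> range (\<lambda>x. (to_ac x, to_ac (D x)))"
    then obtain a where a: "0 = to_ac a" "d = to_ac (D a)" by auto
    then have "a = 0" by (metis to_ac_eq_0_iff)
    then show "d = 0" using a derivation_zero[OF D] by simp
  qed
  from derivation_extend[OF this] show ?thesis by blast
qed

section \<open>The closure operator defined by derivations\<close>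

text \<open>In characteristic zero this is relative algebraic closure, so statements about algebraic
  dependence become linear algebra over the derivations of the ambient field.\<close>

definition dcl :: "'a::field set \<Rightarrow> 'a set" where
  "dcl S = {x. \<forall>D. derivation D \<longrightarrow> (\<forall>s\<in>S. D s = 0) \<longrightarrow> D x = 0}"

lemma dclI: "(\<And>D. derivation D \<Longrightarrow> (\<And>s. s \<in> S \<Longrightarrow> D s = 0) \<Longrightarrow> D x = 0) \<Longrightarrow> x \<in> dcl S"
  by (auto simp: dcl_def)

lemma dclD: "x \<in> dcl S \<Longrightarrow> derivation D \<Longrightarrow> (\<And>s. s \<in> S \<Longrightarrow> D s = 0) \<Longrightarrow> D x = 0"
  by (auto simp: dcl_def)

lemma dcl_mono: "S \<subseteq> T \<Longrightarrow> dcl S \<subseteq> dcl T"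
  by (auto simp: dcl_def)

lemma dcl_base: "S \<subseteq> dcl S"
  by (auto simp: dcl_def)

lemma dcl_closed: "S \<subseteq> dcl T \<Longrightarrow> dcl S \<subseteq> dcl T"
  unfolding dcl_def by blast

lemma is_subfield_dcl: "is_subfield (dcl S)"
  unfolding is_subfield_def
proof (intro conjI ballI dclI)
  fix D assume D: "derivation D" "\<And>s. s \<in> S \<Longrightarrow> D s = 0"
  note K = derivation_kernel[OF D(1)]
  show "D 1 = 0" by (rule derivation_one[OF D(1)])
  show "D (x - y) = 0" if "x \<in> dcl S" "y \<in> dcl S" for x y
    using subfield_diff[OF K, of x y] dclD[OF that(1) D] dclD[OF that(2) D] by simp
  show "D (x * y) = 0" if "x \<in> dcl S" "y \<in> dcl S" for x y
    using subfield_mult[OF K, of x y] dclD[OF that(1) D] dclD[OF that(2) D] by simp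
  show "D (inverse x) = 0" if "x \<in> dcl S" for x
    using subfield_inverse[OF K, of x] dclD[OF that(1) D] by simp
qed

lemma dcl_adjoin: "dcl (field_adjoin K S) = dcl (K \<union> S)"
proof
  have "field_adjoin K S \<subseteq> dcl (K \<union> S)"
    using dcl_base[of "K \<union> S"] by (intro adjoin_least is_subfield_dcl) auto
  then show "dcl (field_adjoin K S) \<subseteq> dcl (K \<union> S)" by (rule dcl_closed)
  show "dcl (K \<union> S) \<subseteq> dcl (field_adjoin K S)"
    using adjoin_base adjoin_gens by (intro dcl_mono) blast
qed

text \<open>Formal differentiation on \<open>M[x]\<close> is well defined because no nonzero
  polynomial over \<open>M\<close> vanishes at \<open>x\<close>; then it is extended to the ambient
  field.\<close>

lemma transcendental_derivation:
  fixes x :: "'a::field_char_0"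
  assumes M: "is_subfield M" and x: "\<not> algebraic_over M x"
  shows "\<exists>D. derivation D \<and> (\<forall>c\<in>M. D c = 0) \<and> D x = 1"
proof -
  define v where "v = (\<lambda>p. (poly p x, poly (pderiv p) x))"
  have "derivation_graph (v ` {p. poly_over M p})" (is "derivation_graph ?R")
  proof (rule derivation_graphI)
    have "v 1 = (1, 0)" by (simp add: v_def)
    then show "(1, 0) \<in> ?R" using poly_over_1[OF M] by (metis image_eqI mem_Collect_eq)
  next
    fix a d b e assume "(a, d) \<in> ?R" "(b, e) \<in> ?R"
    then obtain p q where p: "poly_over M p" "(a, d) = v p" and q: "poly_over M q" "(b, e) = v q"
      by blast
    have "(a - b, d - e) = v (p - q)" using p q by (simp add: v_def pderiv_diff)
    then show "(a - b, d - e) \<in> ?R" using poly_over_diff[OF M p(1) q(1)] by blast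
    have "(a * b, d * b + a * e) = v (p * q)" using p q by (simp add: v_def pderiv_mult algebra_simps)
    then show "(a * b, d * b + a * e) \<in> ?R" using poly_over_mult[OF M p(1) q(1)] by blast
  next
    fix d assume "(0, d) \<in> ?R"
    then obtain p where "poly_over M p" "poly p x = 0" "d = poly (pderiv p) x" by (auto simp: v_def)
    moreover from this have "p = 0" using x unfolding algebraic_over_def poly_over_def by blast
    ultimately show "d = 0" by simp
  qed
  from derivation_extend[OF this] obtain D where D: "derivation D" "\<And>p. poly_over M p \<Longrightarrow> D (poly p x) = poly (pderiv p) x"
    by (auto simp: v_def)
  have "poly_over M [:0, 1:]"
    using M by (intro poly_over_pCons poly_over_0 subfield_one subfield_zero)
  from D(2)[OF this] have "D x = 1" by (simp add: pderiv_pCons)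
  moreover have "D c = 0" if "c \<in> M" for c
  proof -
    have "poly_over M [:c:]" using M that by (intro poly_over_pCons poly_over_0)
    from D(2)[OF this] show ?thesis by simp
  qed
  ultimately show ?thesis using D(1) by blast
qed

theorem algebraic_over_iff_dcl:
  fixes x :: "'a::field_char_0"
  assumes M: "is_subfield M"
  shows "algebraic_over M x \<longleftrightarrow> x \<in> dcl M"
proof
  assume "algebraic_over M x"
  then show "x \<in> dcl M"
    by (intro dclI) (rule der_on_vanish_algebraic[OF is_subfield_UNIV hom_on_id derivation_der _ M], auto)
next
  assume "x \<in> dcl M"
  show "algebraic_over M x"
  proof (rule ccontr)
    assume "\<not> algebraic_over M x"
    then obtain D where "derivation D" "\<forall>c\<in>M. D c = 0" "D x = 1"
      using transcendental_derivation[OF M] by blast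
    then show False using dclD[OF \<open>x \<in> dcl M\<close>, of D] by simp
  qed
qed

section \<open>Multivariate polynomials\<close>

definition monoval :: "('i \<Rightarrow> 'b::comm_ring_1) \<Rightarrow> ('i \<Rightarrow>\<^sub>0 nat) \<Rightarrow> 'b" where
  "monoval y \<mu> = (\<Prod>i\<in>Poly_Mapping.keys \<mu>. y i ^ Poly_Mapping.lookup \<mu> i)"

text \<open>The map \<open>h\<close> on coefficients varies: a conjugation, the constants
  \<open>[:c:]\<close> of dual numbers, or a derivation as in
  \<open>derivation_ev_const_point\<close>.\<close>

definition meval :: "('a::comm_ring_1 \<Rightarrow> 'b::comm_ring_1) \<Rightarrow> ('i \<Rightarrow> 'b) \<Rightarrow> (('i \<Rightarrow>\<^sub>0 nat) \<Rightarrow>\<^sub>0 'a) \<Rightarrow> 'b" where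
  "meval h y p = (\<Sum>\<mu>\<in>Poly_Mapping.keys p. h (Poly_Mapping.lookup p \<mu>) * monoval y \<mu>)"

abbreviation ev :: "('i \<Rightarrow> 'a::comm_ring_1) \<Rightarrow> (('i \<Rightarrow>\<^sub>0 nat) \<Rightarrow>\<^sub>0 'a) \<Rightarrow> 'a" where
  "ev \<equiv> meval (\<lambda>c. c)"

definition mp_over :: "'a::zero set \<Rightarrow> 'i set \<Rightarrow> (('i \<Rightarrow>\<^sub>0 nat) \<Rightarrow>\<^sub>0 'a) \<Rightarrow> bool" where
  "mp_over M J p \<longleftrightarrow> (\<forall>\<mu>. Poly_Mapping.lookup p \<mu> \<in> M) \<and> (\<forall>\<mu>\<in>Poly_Mapping.keys p. Poly_Mapping.keys \<mu> \<subseteq> J)"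

lemma meval_0 [simp]: "meval h y 0 = 0"
  by (simp add: meval_def)

lemma alg_independent_alt:
  "alg_independent M J x \<longleftrightarrow> (\<forall>p. mp_over M J p \<longrightarrow> ev x p = 0 \<longrightarrow> p = 0)"
  unfolding alg_independent_def mp_over_def meval_def mpoly_eval_def monoval_def by (simp only: imp_conjL)

lemma monoval_superset:
  "finite S \<Longrightarrow> Poly_Mapping.keys \<mu> \<subseteq> S \<Longrightarrow> monoval y \<mu> = (\<Prod>i\<in>S. y i ^ Poly_Mapping.lookup \<mu> i)"
  unfolding monoval_def by (rule prod.mono_neutral_left) (auto simp: in_keys_iff)

lemma monoval_0: "monoval y 0 = 1"
  by (simp add: monoval_def)

lemma monoval_add: "monoval y (\<mu> + \<nu>) = monoval y \<mu> * monoval y \<nu>"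
proof -
  let ?S = "Poly_Mapping.keys \<mu> \<union> Poly_Mapping.keys \<nu>"
  have "monoval y (\<mu> + \<nu>) = (\<Prod>i\<in>?S. y i ^ Poly_Mapping.lookup (\<mu> + \<nu>) i)"
    by (rule monoval_superset) (use keys_add[of \<mu> \<nu>] in auto)
  also have "\<dots> = monoval y \<mu> * monoval y \<nu>"
    by (simp add: monoval_superset[of ?S] lookup_add power_add prod.distrib)
  finally show ?thesis .
qed

lemma monoval_single: "monoval y (Poly_Mapping.single i 1) = y i"
  by (simp add: monoval_def)

lemma monoval_mult_point: "monoval (\<lambda>i. a i * y i) \<mu> = monoval a \<mu> * monoval y \<mu>"
  by (simp add: monoval_def power_mult_distrib prod.distrib)

lemma mp_decompose: "p = (\<Sum>\<mu>\<in>Poly_Mapping.keys p. Poly_Mapping.single \<mu> (Poly_Mapping.lookup p \<mu>))"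
proof (rule poly_mapping_eqI)
  fix k
  have "Poly_Mapping.lookup (\<Sum>\<mu>\<in>Poly_Mapping.keys p. Poly_Mapping.single \<mu> (Poly_Mapping.lookup p \<mu>)) k
      = (\<Sum>\<mu>\<in>Poly_Mapping.keys p. if \<mu> = k then Poly_Mapping.lookup p \<mu> else 0)"
    unfolding lookup_sum by (intro sum.cong refl) (simp add: lookup_single when_def)
  also have "\<dots> = Poly_Mapping.lookup p k" by (simp add: in_keys_iff)
  finally show "Poly_Mapping.lookup p k =
    Poly_Mapping.lookup (\<Sum>\<mu>\<in>Poly_Mapping.keys p. Poly_Mapping.single \<mu> (Poly_Mapping.lookup p \<mu>)) k" by simp
qed

lemma mp_over_mono: "mp_over M J p \<Longrightarrow> M \<subseteq> M' \<Longrightarrow> J \<subseteq> J' \<Longrightarrow> mp_over M' J' p"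
  unfolding mp_over_def by blast

lemma mp_over_lookup: "mp_over M J p \<Longrightarrow> Poly_Mapping.lookup p \<mu> \<in> M"
  unfolding mp_over_def by blast

lemma mp_over_keys: "mp_over M J p \<Longrightarrow> \<mu> \<in> Poly_Mapping.keys p \<Longrightarrow> Poly_Mapping.keys \<mu> \<subseteq> J"
  unfolding mp_over_def by blast

lemma mp_over_single:
  "is_subfield M \<Longrightarrow> c \<in> M \<Longrightarrow> Poly_Mapping.keys \<mu> \<subseteq> J \<Longrightarrow> mp_over M J (Poly_Mapping.single \<mu> c)"
  unfolding mp_over_def by (auto simp: lookup_single when_def subfield_zero split: if_splits)

lemma mp_over_0: "is_subfield M \<Longrightarrow> mp_over M J 0"
  unfolding mp_over_def by (auto simp: subfield_zero)

lemma mp_over_1: "is_subfield M \<Longrightarrow> mp_over M J 1"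
  using mp_over_single[of M 1 0 J] by (simp add: subfield_one)

lemma mp_over_const: "is_subfield M \<Longrightarrow> c \<in> M \<Longrightarrow> mp_over M J (Poly_Mapping.single 0 c)"
  by (rule mp_over_single) auto

lemma mp_over_var: "is_subfield M \<Longrightarrow> i \<in> J \<Longrightarrow> mp_over M J (Poly_Mapping.single (Poly_Mapping.single i 1) 1)"
  by (rule mp_over_single) (auto simp: subfield_one)

lemma mp_over_add: "is_subfield M \<Longrightarrow> mp_over M J p \<Longrightarrow> mp_over M J q \<Longrightarrow> mp_over M J (p + q)"
  unfolding mp_over_def lookup_add using subsetD[OF keys_add[of p q]]
  by (simp add: subfield_add) blast

lemma mp_over_diff: "is_subfield M \<Longrightarrow> mp_over M J p \<Longrightarrow> mp_over M J q \<Longrightarrow> mp_over M J (p - q)"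
  unfolding mp_over_def lookup_minus using subsetD[OF keys_diff[of p q]]
  by (simp add: subfield_diff) blast

lemma mp_over_sum: "is_subfield M \<Longrightarrow> (\<And>i. i \<in> A \<Longrightarrow> mp_over M J (g i)) \<Longrightarrow> mp_over M J (sum g A)"
  by (induction A rule: infinite_finite_induct) (auto intro: mp_over_0 mp_over_add)

lemma mp_mult_decompose:
  fixes p q :: "('i \<Rightarrow>\<^sub>0 nat) \<Rightarrow>\<^sub>0 'a::comm_ring_1"
  shows "p * q = (\<Sum>\<mu>\<in>Poly_Mapping.keys p. \<Sum>\<nu>\<in>Poly_Mapping.keys q.
    Poly_Mapping.single (\<mu> + \<nu>) (Poly_Mapping.lookup p \<mu> * Poly_Mapping.lookup q \<nu>))"
proof -
  have "p * q = (\<Sum>\<mu>\<in>Poly_Mapping.keys p. Poly_Mapping.single \<mu> (Poly_Mapping.lookup p \<mu>)) *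
      (\<Sum>\<nu>\<in>Poly_Mapping.keys q. Poly_Mapping.single \<nu> (Poly_Mapping.lookup q \<nu>))"
    using mp_decompose[of p] mp_decompose[of q] by simp
  then show ?thesis by (simp only: sum_product mult_single)
qed

lemma mp_over_mult:
  assumes "is_subfield M" "mp_over M J p" "mp_over M J q"
  shows "mp_over M J (p * q)"
  unfolding mp_mult_decompose[of p q]
proof (intro mp_over_sum mp_over_single assms(1))
  fix \<mu> \<nu> assume "\<mu> \<in> Poly_Mapping.keys p" "\<nu> \<in> Poly_Mapping.keys q"
  then show "Poly_Mapping.keys (\<mu> + \<nu>) \<subseteq> J"
    using mp_over_keys[OF assms(2)] mp_over_keys[OF assms(3)] keys_add[of \<mu> \<nu>] by blast
qed (use assms in \<open>simp add: mp_over_lookup subfield_mult\<close>)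

context
  fixes M :: "'a::field set" and h :: "'a \<Rightarrow> 'b::comm_ring_1"
  assumes M: "is_subfield M" and h: "hom_on M h"
begin

lemma meval_single: "meval h y (Poly_Mapping.single \<mu> c) = h c * monoval y \<mu>"
  by (cases "c = 0") (simp_all add: meval_def hom_on_zero[OF M h])

lemma meval_const: "meval h y (Poly_Mapping.single 0 c) = h c"
  by (simp add: meval_single monoval_0)

lemma meval_one: "meval h y 1 = 1"
  using meval_const[of y 1] by (simp add: hom_on_one[OF h])

lemma meval_var: "meval h y (Poly_Mapping.single (Poly_Mapping.single i 1) 1) = y i"
  unfolding meval_single monoval_single hom_on_one[OF h] by simp

lemma meval_add:
  assumes "mp_over M J p" "mp_over M J q"
  shows "meval h y (p + q) = meval h y p + meval h y q"
  unfolding meval_def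
  by (rule setsum_keys_plus_distrib[of "\<lambda>\<mu> c. h c * monoval y \<mu>"])
    (simp_all add: hom_on_zero[OF M h] hom_on_add[OF h] mp_over_lookup[OF assms(1)]
      mp_over_lookup[OF assms(2)] distrib_right)

lemma meval_diff:
  assumes "mp_over M J p" "mp_over M J q"
  shows "meval h y (p - q) = meval h y p - meval h y q"
proof -
  have "meval h y ((p - q) + q) = meval h y (p - q) + meval h y q"
    by (rule meval_add[OF mp_over_diff[OF M assms] assms(2)])
  then show ?thesis by simp
qed

lemma meval_sum:
  "(\<And>i. i \<in> A \<Longrightarrow> mp_over M J (g i)) \<Longrightarrow> meval h y (sum g A) = (\<Sum>i\<in>A. meval h y (g i))"
proof (induction A rule: infinite_finite_induct)
  case (insert i A)
  then show ?case using meval_add[OF _ mp_over_sum[OF M], of J "g i" A g] by simp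
qed (simp_all add: meval_def)

lemma meval_mult:
  assumes "mp_over M J p" "mp_over M J q"
  shows "meval h y (p * q) = meval h y p * meval h y q"
proof -
  have o: "mp_over M J (Poly_Mapping.single (\<mu> + \<nu>) (Poly_Mapping.lookup p \<mu> * Poly_Mapping.lookup q \<nu>))"
    if "\<mu> \<in> Poly_Mapping.keys p" "\<nu> \<in> Poly_Mapping.keys q" for \<mu> \<nu>
  proof (rule mp_over_single[OF M])
    show "Poly_Mapping.keys (\<mu> + \<nu>) \<subseteq> J"
      using mp_over_keys[OF assms(1) that(1)] mp_over_keys[OF assms(2) that(2)] keys_add[of \<mu> \<nu>] by blast
  qed (intro subfield_mult[OF M] mp_over_lookup[OF assms(1)] mp_over_lookup[OF assms(2)])
  have "meval h y (p * q) = (\<Sum>\<mu>\<in>Poly_Mapping.keys p. \<Sum>\<nu>\<in>Poly_Mapping.keys q.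
      meval h y (Poly_Mapping.single (\<mu> + \<nu>) (Poly_Mapping.lookup p \<mu> * Poly_Mapping.lookup q \<nu>)))"
    unfolding mp_mult_decompose[of p q]
    by (subst meval_sum[where J = J], intro mp_over_sum[OF M] o, assumption+, rule sum.cong[OF refl],
        subst meval_sum[where J = J], rule o, assumption+, rule refl)
  also have "\<dots> = meval h y p * meval h y q"
    unfolding meval_single monoval_add hom_on_mult[OF h mp_over_lookup[OF assms(1)] mp_over_lookup[OF assms(2)]]
    unfolding meval_def sum_product by (intro sum.cong refl) (simp add: algebra_simps)
  finally show ?thesis .
qed

end

lemmas ev_single = meval_single[OF is_subfield_UNIV hom_on_id]
lemmas ev_const = meval_const[OF is_subfield_UNIV hom_on_id]
lemmas ev_one = meval_one[OF is_subfield_UNIV hom_on_id]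
lemmas ev_var = meval_var[OF is_subfield_UNIV hom_on_id]

lemma mp_over_UNIV: "mp_over UNIV UNIV p"
  by (simp add: mp_over_def)

lemmas ev_add = meval_add[OF is_subfield_UNIV hom_on_id mp_over_UNIV mp_over_UNIV]
lemmas ev_diff = meval_diff[OF is_subfield_UNIV hom_on_id mp_over_UNIV mp_over_UNIV]
lemmas ev_mult = meval_mult[OF is_subfield_UNIV hom_on_id mp_over_UNIV mp_over_UNIV]

lemma meval_compose:
  fixes y :: "'i \<Rightarrow> 'b::comm_ring_1" and \<phi> :: "'b \<Rightarrow> 'c::comm_ring_1"
  assumes "\<And>a b. \<phi> (a + b) = \<phi> a + \<phi> b" "\<And>a b. \<phi> (a * b) = \<phi> a * \<phi> b" "\<phi> 1 = 1" "\<phi> 0 = 0"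
  shows "\<phi> (meval h y p) = meval (\<lambda>c. \<phi> (h c)) (\<lambda>i. \<phi> (y i)) p"
proof -
  have s: "\<phi> (sum g A) = (\<Sum>a\<in>A. \<phi> (g a))" for g and A :: "('i \<Rightarrow>\<^sub>0 nat) set"
    by (induction A rule: infinite_finite_induct) (simp_all add: assms)
  have p: "\<phi> (prod g A) = (\<Prod>a\<in>A. \<phi> (g a))" for g and A :: "'i set"
    by (induction A rule: infinite_finite_induct) (simp_all add: assms)
  have w: "\<phi> (a ^ k) = \<phi> a ^ k" for a k by (induction k) (simp_all add: assms)
  show ?thesis unfolding meval_def monoval_def s assms(2) p w ..
qed

lemma meval_in_subfield:
  assumes "is_subfield M'" "\<And>c. c \<in> M \<Longrightarrow> h c \<in> M'" "mp_over M J p" "\<And>i. i \<in> J \<Longrightarrow> y i \<in> M'"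
  shows "meval h y p \<in> M'"
  unfolding meval_def monoval_def
proof (intro subfield_sum[OF assms(1)] subfield_mult[OF assms(1)] subfield_prod[OF assms(1)] subfield_power[OF assms(1)])
  fix \<mu> show "h (Poly_Mapping.lookup p \<mu>) \<in> M'" by (rule assms(2)[OF mp_over_lookup[OF assms(3)]])
next
  fix \<mu> i assume "\<mu> \<in> Poly_Mapping.keys p" "i \<in> Poly_Mapping.keys \<mu>"
  then show "y i \<in> M'" using mp_over_keys[OF assms(3)] assms(4) by blast
qed

lemma adjoin_quotient:
  fixes x :: "'i \<Rightarrow> 'a::field"
  assumes M: "is_subfield M" and z: "z \<in> field_adjoin M (x ` J)"
  shows "\<exists>p q. mp_over M J p \<and> mp_over M J q \<and> ev x q \<noteq> 0 \<and> z = ev x p / ev x q"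
proof -
  define T where "T = {z. \<exists>p q. mp_over M J p \<and> mp_over M J q \<and> ev x q \<noteq> 0 \<and> z = ev x p / ev x q}"
  have TI: "ev x p / ev x q \<in> T" if "mp_over M J p" "mp_over M J q" "ev x q \<noteq> 0" for p q
    using that unfolding T_def by blast
  have TE: "\<exists>p q. mp_over M J p \<and> mp_over M J q \<and> ev x q \<noteq> 0 \<and> z = ev x p / ev x q" if "z \<in> T" for z
    using that unfolding T_def by blast
  have M1: "mp_over M J 1" by (rule mp_over_1[OF M])
  have "is_subfield T"
    unfolding is_subfield_def
  proof (intro conjI ballI)
    show "1 \<in> T" using TI[OF M1 M1] by (simp add: ev_one)
    fix a b assume "a \<in> T" "b \<in> T"
    then obtain p q p' q' where a: "mp_over M J p" "mp_over M J q" "ev x q \<noteq> 0" "a = ev x p / ev x q"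
      and b: "mp_over M J p'" "mp_over M J q'" "ev x q' \<noteq> 0" "b = ev x p' / ev x q'"
      using TE by metis
    have 1: "a - b = ev x (p * q' - p' * q) / ev x (q * q')"
      using a b by (simp add: diff_frac_eq ev_diff ev_mult)
    show "a - b \<in> T" unfolding 1 using a b M
      by (intro TI mp_over_diff mp_over_mult) (simp_all add: ev_mult)
    have 2: "a * b = ev x (p * p') / ev x (q * q')"
      using a b by (simp add: ev_mult)
    show "a * b \<in> T" unfolding 2 using a b M by (intro TI mp_over_mult) (simp_all add: ev_mult)
  next
    fix a assume "a \<in> T"
    then obtain p q where a: "mp_over M J p" "mp_over M J q" "ev x q \<noteq> 0" "a = ev x p / ev x q"
      using TE by metis
    show "inverse a \<in> T"
    proof (cases "ev x p = 0")
      case True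
      then show ?thesis using a TI[OF mp_over_0[OF M] M1] by (simp add: ev_one)
    next
      case False
      then show ?thesis using TI[OF a(2,1)] a(4) by simp
    qed
  qed
  moreover have "M \<subseteq> T"
  proof
    fix c assume "c \<in> M"
    from TI[OF mp_over_const[OF M this] M1] show "c \<in> T" by (simp add: ev_one ev_const)
  qed
  moreover have "x ` J \<subseteq> T"
  proof
    fix c assume "c \<in> x ` J"
    then obtain i where i: "i \<in> J" "c = x i" by blast
    from TI[OF mp_over_var[OF M i(1)] M1] show "c \<in> T" unfolding ev_var i(2) by (simp add: ev_one)
  qed
  ultimately have "field_adjoin M (x ` J) \<subseteq> T" by (rule adjoin_least)
  then show ?thesis using z TE by blast
qed

lemma ev_in_adjoin:
  assumes "mp_over M J p"
  shows "ev x p \<in> field_adjoin M (x ` J)"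
  by (rule meval_in_subfield[OF is_subfield_adjoin _ assms])
    (use adjoin_base[of M "x ` J"] adjoin_gens[of "x ` J" M] in auto)

section \<open>Algebraic independence and transcendence degree\<close>

lemma alg_independent_subset:
  assumes "alg_independent M J x" "J' \<subseteq> J"
  shows "alg_independent M J' x"
  unfolding alg_independent_alt
proof (intro allI impI)
  fix p assume p: "mp_over M J' p" "ev x p = 0"
  have "mp_over M J p" by (rule mp_over_mono[OF p(1) subset_refl assms(2)])
  then show "p = 0" using assms(1) p(2) unfolding alg_independent_alt by simp
qed

lemma alg_independent_finitary:
  assumes "\<And>J'. finite J' \<Longrightarrow> J' \<subseteq> J \<Longrightarrow> alg_independent M J' x"
  shows "alg_independent M J x"
  unfolding alg_independent_alt
proof (intro allI impI)
  fix p assume p: "mp_over M J p" "ev x p = 0"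
  let ?J = "\<Union>\<mu>\<in>Poly_Mapping.keys p. Poly_Mapping.keys \<mu>"
  have "finite ?J" by simp
  moreover have "?J \<subseteq> J" using mp_over_keys[OF p(1)] by blast
  ultimately have "alg_independent M ?J x" by (rule assms)
  moreover have "mp_over M ?J p" unfolding mp_over_def using mp_over_lookup[OF p(1)] by blast
  ultimately show "p = 0" using p(2) unfolding alg_independent_alt by simp
qed

text \<open>Dual numbers: \<open>y\<close> is the point \<open>x + T e_i\<close>, and the
  coefficients of \<open>T^0\<close> and \<open>T^1\<close> in \<open>p(y)\<close> are
  \<open>p(x)\<close> and the partial derivative of \<open>p\<close> at \<open>x\<close>. By
  independence \<open>p(x) = 0\<close> only for \<open>p = 0\<close>, so these pairs form a
  derivation graph.\<close>

lemma alg_independent_dual: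
  fixes x :: "'i \<Rightarrow> 'a::field_char_0"
  assumes M: "is_subfield M" and ind: "alg_independent M J x" and i: "i \<in> J"
  shows "\<exists>D. derivation D \<and> (\<forall>c\<in>M. D c = 0) \<and> (\<forall>j\<in>J. D (x j) = (if j = i then 1 else 0))"
proof -
  define h :: "'a \<Rightarrow> 'a poly" where "h = (\<lambda>c. [:c:])"
  define y where "y = (\<lambda>j. [:x j, if j = i then 1 else 0:])"
  define v where "v = (\<lambda>p. (coeff (meval h y p) 0, coeff (meval h y p) 1))"
  have h: "hom_on M h" unfolding h_def hom_on_def by (simp add: one_pCons)
  have c0: "coeff (meval h y p) 0 = ev x p" for p
  proof -
    have "poly (meval h y p) 0 = meval (\<lambda>c. poly (h c) 0) (\<lambda>i. poly (y i) 0) p"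
      by (rule meval_compose) simp_all
    then show ?thesis by (simp add: poly_0_coeff_0 h_def y_def)
  qed
  have c1: "coeff (A * B) 1 = coeff A 1 * coeff B 0 + coeff A 0 * coeff B 1" for A B :: "'a poly"
    unfolding coeff_mult One_nat_def by (simp add: atMost_Suc)
  let ?R = "v ` {p. mp_over M J p}"
  have "derivation_graph ?R"
  proof (rule derivation_graphI)
    have "v 1 = (1, 0)" unfolding v_def meval_one[OF M h] by simp
    then show "(1, 0) \<in> ?R" using mp_over_1[OF M, of J] by (metis image_eqI mem_Collect_eq)
  next
    fix a d b e assume "(a, d) \<in> ?R" "(b, e) \<in> ?R"
    then obtain p q where p: "mp_over M J p" "(a, d) = v p" and q: "mp_over M J q" "(b, e) = v q" by blast
    have "(a - b, d - e) = v (p - q)" using p(2) q(2) by (simp add: v_def meval_diff[OF M h p(1) q(1)])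
    then show "(a - b, d - e) \<in> ?R" using mp_over_diff[OF M p(1) q(1)] by blast
    have "(a * b, d * b + a * e) = v (p * q)"
      using p(2) q(2) unfolding v_def meval_mult[OF M h p(1) q(1)] c1 coeff_mult_0 by simp
    then show "(a * b, d * b + a * e) \<in> ?R" using mp_over_mult[OF M p(1) q(1)] by blast
  next
    fix d assume "(0, d) \<in> ?R"
    then obtain p where p: "mp_over M J p" "(0, d) = v p" by blast
    then have "ev x p = 0" by (simp add: v_def c0)
    then have "p = 0" using ind p(1) unfolding alg_independent_alt by simp
    then show "d = 0" using p(2) by (simp add: v_def meval_def)
  qed
  from derivation_extend[OF this] obtain D where D: "derivation D"
    "\<And>p. mp_over M J p \<Longrightarrow> D (ev x p) = coeff (meval h y p) 1"
    unfolding v_def c0 by blast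
  have "D c = 0" if "c \<in> M" for c
    using D(2)[OF mp_over_const[OF M that]] unfolding ev_const meval_const[OF M h] by (simp add: h_def)
  moreover have "D (x j) = (if j = i then 1 else 0)" if "j \<in> J" for j
    using D(2)[OF mp_over_var[OF M that]] unfolding ev_var meval_var[OF M h] by (simp add: y_def)
  ultimately show ?thesis using D(1) by blast
qed

text \<open>Euler's operator \<open>x_i d/dx_i\<close>: once the power of \<open>x i\<close> is
  split off, the remaining factor \<open>?r\<close> is a constant for \<open>D\<close>.\<close>

lemma derivation_monoval_eigen:
  fixes x :: "'i \<Rightarrow> 'a::field"
  assumes D: "derivation D" "\<And>j. j \<in> J \<Longrightarrow> D (x j) = (if j = i then 1 else 0)" and k: "Poly_Mapping.keys \<kappa> \<subseteq> J"
  shows "x i * D (monoval x \<kappa>) = of_nat (Poly_Mapping.lookup \<kappa> i) * monoval x \<kappa>"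
proof -
  let ?r = "\<Prod>j\<in>Poly_Mapping.keys \<kappa> - {i}. x j ^ Poly_Mapping.lookup \<kappa> j"
  have r: "D ?r = 0"
  proof -
    have "?r \<in> {z. D z = 0}"
      using k D(2) by (intro subfield_prod subfield_power derivation_kernel[OF D(1)]) auto
    then show ?thesis by simp
  qed
  have e: "monoval x \<kappa> = x i ^ Poly_Mapping.lookup \<kappa> i * ?r"
  proof (cases "i \<in> Poly_Mapping.keys \<kappa>")
    case True
    then show ?thesis unfolding monoval_def by (simp add: prod.remove)
  next
    case False
    then show ?thesis unfolding monoval_def by (simp add: in_keys_iff)
  qed
  show ?thesis
  proof (cases "i \<in> Poly_Mapping.keys \<kappa>")
    case True
    then have "i \<in> J" "Poly_Mapping.lookup \<kappa> i > 0" using k by (blast, simp add: in_keys_iff)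
    moreover from this have "D (x i) = 1" using D(2) by simp
    ultimately show ?thesis unfolding e derivation_mult[OF D(1)] derivation_power[OF D(1)] r
      by (cases "Poly_Mapping.lookup \<kappa> i") (simp_all add: algebra_simps)
  next
    case False
    then have "Poly_Mapping.lookup \<kappa> i = 0" by (simp add: in_keys_iff)
    then show ?thesis unfolding e using r by simp
  qed
qed

lemma derivation_ev_const_point:
  assumes D: "derivation D" "\<And>i. i \<in> J \<Longrightarrow> D (y i) = 0" and k: "\<And>\<mu>. \<mu> \<in> Poly_Mapping.keys p \<Longrightarrow> Poly_Mapping.keys \<mu> \<subseteq> J"
  shows "D (ev y p) = meval D y p"
proof -
  have "D (monoval y \<mu>) = 0" if "\<mu> \<in> Poly_Mapping.keys p" for \<mu>
  proof -
    have "monoval y \<mu> \<in> {z. D z = 0}" unfolding monoval_def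
      using k[OF that] D(2) by (intro subfield_prod subfield_power derivation_kernel[OF D(1)]) auto
    then show ?thesis by simp
  qed
  then show ?thesis unfolding meval_def derivation_sum[OF D(1)] derivation_mult[OF D(1)] by simp
qed

text \<open>The operators \<open>x i * D i\<close> act diagonally on the monomials, with distinct eigenvalue tuples;
  so a shortest relation between monomials can always be shortened.\<close>

lemma dual_imp_alg_independent:
  fixes x :: "'i \<Rightarrow> 'a::field_char_0"
  assumes M: "is_subfield M"
    and dual: "\<And>i. i \<in> J \<Longrightarrow> \<exists>D. derivation D \<and> (\<forall>c\<in>M. D c = 0) \<and> (\<forall>j\<in>J. D (x j) = (if j = i then 1 else 0))"
  shows "alg_independent M J x"
  unfolding alg_independent_alt
proof (intro allI impI)
  fix p assume "mp_over M J p" "ev x p = 0"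
  then show "p = 0"
  proof (induction "card (Poly_Mapping.keys p)" arbitrary: p rule: less_induct)
    case less
    show ?case
    proof (rule ccontr)
      assume "p \<noteq> 0"
      then obtain \<mu> where mu: "\<mu> \<in> Poly_Mapping.keys p" by (metis all_not_in_conv keys_eq_empty)
      have xnz: "x i \<noteq> 0" if "i \<in> J" for i
      proof -
        from dual[OF that] obtain D where D: "derivation D" "\<forall>j\<in>J. D (x j) = (if j = i then 1 else 0)" by blast
        then have "D (x i) = 1" using that by simp
        then show ?thesis using derivation_zero[OF D(1)] by auto
      qed
      have mnz: "monoval x \<mu> \<noteq> 0"
        unfolding monoval_def using xnz mp_over_keys[OF less.prems(1) mu] by auto
      have "\<exists>\<nu>\<in>Poly_Mapping.keys p. \<nu> \<noteq> \<mu>"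
      proof (rule ccontr)
        assume "\<not> ?thesis"
        then have "Poly_Mapping.keys p = {\<mu>}" using mu by blast
        then have "Poly_Mapping.lookup p \<mu> * monoval x \<mu> = 0" using less.prems(2) by (simp add: meval_def)
        then show False using mnz mu by (simp add: in_keys_iff)
      qed
      then obtain \<nu> where nu: "\<nu> \<in> Poly_Mapping.keys p" "\<nu> \<noteq> \<mu>" by blast
      then obtain i where i: "Poly_Mapping.lookup \<nu> i \<noteq> Poly_Mapping.lookup \<mu> i"
        by (metis poly_mapping_eqI)
      then have "i \<in> Poly_Mapping.keys \<nu> \<or> i \<in> Poly_Mapping.keys \<mu>" by (auto simp: in_keys_iff)
      then have iJ: "i \<in> J" using mp_over_keys[OF less.prems(1)] mu nu(1) by blast
      from dual[OF iJ] obtain D where D: "derivation D" "\<And>c. c \<in> M \<Longrightarrow> D c = 0"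
        "\<And>j. j \<in> J \<Longrightarrow> D (x j) = (if j = i then 1 else 0)" by blast
      define e :: "('i \<Rightarrow>\<^sub>0 nat) \<Rightarrow> 'a" where
        "e = (\<lambda>\<kappa>. of_nat (Poly_Mapping.lookup \<kappa> i) - of_nat (Poly_Mapping.lookup \<mu> i))"
      \<comment> \<open>\<open>q\<close> arises from \<open>p\<close> by the operator
        \<open>x_i D\<close> minus its eigenvalue at \<mu>: the monomial \<mu> disappears, \<nu>
        survives, and the value at \<open>x\<close> remains \<open>0\<close>.\<close>
      define q where "q = Poly_Mapping.mapp (\<lambda>\<kappa> c. e \<kappa> * c) p"
      have lq: "Poly_Mapping.lookup q \<kappa> = e \<kappa> * Poly_Mapping.lookup p \<kappa>" for \<kappa>
        by (simp add: q_def lookup_mapp when_def in_keys_iff)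
      have kq: "Poly_Mapping.keys q \<subseteq> Poly_Mapping.keys p - {\<mu>}"
        by (auto simp: in_keys_iff lq e_def)
      have "mp_over M J q"
        unfolding mp_over_def lq e_def using kq mp_over_keys[OF less.prems(1)] mp_over_lookup[OF less.prems(1)] M
        by (auto intro!: subfield_mult subfield_diff subfield_of_nat)
      moreover have "ev x q = 0"
      proof -
        have "ev x q = (\<Sum>\<kappa>\<in>Poly_Mapping.keys p. e \<kappa> * Poly_Mapping.lookup p \<kappa> * monoval x \<kappa>)"
          unfolding meval_def lq
          by (rule sum.mono_neutral_left) (use kq in \<open>auto simp: in_keys_iff lq\<close>)
        also have "\<dots> = (\<Sum>\<kappa>\<in>Poly_Mapping.keys p. x i * D (Poly_Mapping.lookup p \<kappa> * monoval x \<kappa>)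
            - of_nat (Poly_Mapping.lookup \<mu> i) * (Poly_Mapping.lookup p \<kappa> * monoval x \<kappa>))"
        proof (rule sum.cong[OF refl])
          fix \<kappa> assume "\<kappa> \<in> Poly_Mapping.keys p"
          then have "x i * D (monoval x \<kappa>) = of_nat (Poly_Mapping.lookup \<kappa> i) * monoval x \<kappa>"
            using mp_over_keys[OF less.prems(1)] by (intro derivation_monoval_eigen[OF D(1,3)])
          moreover have "D (Poly_Mapping.lookup p \<kappa> * monoval x \<kappa>) = Poly_Mapping.lookup p \<kappa> * D (monoval x \<kappa>)"
            by (simp add: derivation_mult[OF D(1)] D(2)[OF mp_over_lookup[OF less.prems(1)]])
          ultimately show "e \<kappa> * Poly_Mapping.lookup p \<kappa> * monoval x \<kappa> =
             x i * D (Poly_Mapping.lookup p \<kappa> * monoval x \<kappa>)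
            - of_nat (Poly_Mapping.lookup \<mu> i) * (Poly_Mapping.lookup p \<kappa> * monoval x \<kappa>)"
            by (simp add: e_def algebra_simps)
        qed
        also have "\<dots> = x i * D (ev x p) - of_nat (Poly_Mapping.lookup \<mu> i) * ev x p"
          unfolding meval_def derivation_sum[OF D(1)] by (simp add: sum_subtractf sum_distrib_left)
        also have "\<dots> = 0" using less.prems(2) by (simp add: derivation_zero[OF D(1)])
        finally show ?thesis .
      qed
      moreover have "card (Poly_Mapping.keys q) < card (Poly_Mapping.keys p)"
        by (rule psubset_card_mono) (use kq mu in auto)
      ultimately have "q = 0" using less.hyps by blast
      then have "e \<nu> * Poly_Mapping.lookup p \<nu> = 0" using lq[of \<nu>] by simp
      then show False using nu(1) i by (simp add: e_def in_keys_iff)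
    qed
  qed
qed

text \<open>The derivation dual to \<open>i\<close> kills \<open>S\<close> but not
  \<open>x i\<close>.\<close>

lemma alg_independent_not_dcl:
  fixes x :: "'i \<Rightarrow> 'a::field_char_0"
  assumes "is_subfield M" "alg_independent M J x" "i \<in> J" "S \<subseteq> M \<union> x ` (J - {i})"
  shows "x i \<notin> dcl S"
proof
  assume d: "x i \<in> dcl S"
  obtain D where D: "derivation D" "\<forall>c\<in>M. D c = 0" "\<forall>j\<in>J. D (x j) = (if j = i then 1 else 0)"
    using alg_independent_dual[OF assms(1-3)] by blast
  have "D (x i) = 0"
  proof (rule dclD[OF d D(1)])
    fix s assume "s \<in> S"
    then have "s \<in> M \<or> (\<exists>j\<in>J. j \<noteq> i \<and> s = x j)" using assms(4) by blast
    then show "D s = 0" using D(2,3) by auto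
  qed
  then show False using D assms(3) by simp
qed

lemma alg_independent_insert:
  fixes x :: "'i \<Rightarrow> 'a::field_char_0"
  assumes M: "is_subfield M" and ind: "alg_independent M J x" and x: "x i \<notin> dcl (M \<union> x ` J)"
  shows "alg_independent M (insert i J) x"
proof -
  obtain D0 where D0: "derivation D0" "\<And>s. s \<in> M \<union> x ` J \<Longrightarrow> D0 s = 0" "D0 (x i) = 1"
  proof -
    have "\<not> algebraic_over (field_adjoin M (x ` J)) (x i)"
      using x by (simp add: algebraic_over_iff_dcl[OF is_subfield_adjoin] dcl_adjoin)
    from transcendental_derivation[OF is_subfield_adjoin this] show ?thesis
      using that adjoin_base[of M "x ` J"] adjoin_gens[of "x ` J" M] by blast
  qed
  have i: "i \<notin> J" using x dcl_base[of "M \<union> x ` J"] by blast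
  show ?thesis
  proof (rule dual_imp_alg_independent[OF M])
    fix j assume "j \<in> insert i J"
    show "\<exists>D. derivation D \<and> (\<forall>c\<in>M. D c = 0) \<and> (\<forall>k\<in>insert i J. D (x k) = (if k = j then 1 else 0))"
    proof (cases "j = i")
      case True
      then show ?thesis using D0 i by (intro exI[of _ D0]) auto
    next
      case False
      then have "j \<in> J" using \<open>j \<in> insert i J\<close> by simp
      then obtain D where D: "derivation D" "\<forall>c\<in>M. D c = 0" "\<forall>k\<in>J. D (x k) = (if k = j then 1 else 0)"
        using alg_independent_dual[OF M ind] by blast
      \<comment> \<open>Subtracting a multiple of \<open>D0\<close> makes \<open>D\<close> vanish at
        \<open>x i\<close> too; on \<open>M\<close> and \<open>J\<close> nothing changes, since
        \<open>D0\<close> is zero there.\<close>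
      let ?D = "\<lambda>z. 1 * D z + (- D (x i)) * D0 z"
      have "derivation ?D" by (rule derivation_lincomb[OF D(1) D0(1)])
      then show ?thesis using D D0 i False by (intro exI[of _ ?D]) auto
    qed
  qed
qed

lemma finite_strict_max:
  assumes "finite J" "J \<noteq> {}"
    and "\<And>a b. a \<in> J \<Longrightarrow> b \<in> J \<Longrightarrow> a \<noteq> b \<Longrightarrow> lt a b \<or> lt b a"
    and "\<And>a b c. a \<in> J \<Longrightarrow> b \<in> J \<Longrightarrow> c \<in> J \<Longrightarrow> lt a b \<Longrightarrow> lt b c \<Longrightarrow> lt a c"
  shows "\<exists>m\<in>J. \<forall>j\<in>J. j \<noteq> m \<longrightarrow> lt j m"
  using assms
proof (induction J rule: finite_ne_induct)
  case (insert a J)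
  have "\<exists>m\<in>J. \<forall>j\<in>J. j \<noteq> m \<longrightarrow> lt j m"
    using insert.prems by (intro insert.IH) blast+
  then obtain m where m: "m \<in> J" "\<forall>j\<in>J. j \<noteq> m \<longrightarrow> lt j m" by blast
  show ?case
  proof (cases "lt a m")
    case True
    then show ?thesis using m by blast
  next
    case False
    then have "lt m a" using insert.prems(1)[of a m] m insert.hyps by blast
    moreover have "lt j a" if "j \<in> J" "j \<noteq> m" for j
      by (rule insert.prems(2)[of j m a]) (use that m \<open>lt m a\<close> in simp_all)
    ultimately have "\<forall>j\<in>J. lt j a" by metis
    then show ?thesis by simp
  qed
next
  case (singleton a)
  show ?case by simp
qed

text \<open>In a finite subset the largest element is transcendental over the others, which are all
  smaller, so the subset can be built up in the order \<open>lt\<close>. Independence of derivatives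
  is always obtained in this form.\<close>

lemma alg_independent_triangular:
  fixes x :: "'i \<Rightarrow> 'a::field_char_0"
  assumes M: "is_subfield M"
    and tot: "\<And>a b. a \<in> J \<Longrightarrow> b \<in> J \<Longrightarrow> a \<noteq> b \<Longrightarrow> lt a b \<or> lt b a"
    and tr: "\<And>a b c. a \<in> J \<Longrightarrow> b \<in> J \<Longrightarrow> c \<in> J \<Longrightarrow> lt a b \<Longrightarrow> lt b c \<Longrightarrow> lt a c"
    and x: "\<And>i. i \<in> J \<Longrightarrow> x i \<notin> dcl (M \<union> x ` {j\<in>J. lt j i})"
  shows "alg_independent M J x"
proof (rule alg_independent_finitary)
  fix J' assume "finite J'" "J' \<subseteq> J"
  then show "alg_independent M J' x"
  proof (induction "card J'" arbitrary: J')
    case 0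
    then show ?case by (intro dual_imp_alg_independent[OF M]) auto
  next
    case (Suc k)
    then have "J' \<noteq> {}" by auto
    obtain m where m: "m \<in> J'" "\<forall>j\<in>J'. j \<noteq> m \<longrightarrow> lt j m"
    proof -
      have "\<exists>m\<in>J'. \<forall>j\<in>J'. j \<noteq> m \<longrightarrow> lt j m"
      proof (rule finite_strict_max[OF \<open>finite J'\<close> \<open>J' \<noteq> {}\<close>])
        show "lt a b \<or> lt b a" if "a \<in> J'" "b \<in> J'" "a \<noteq> b" for a b
          by (rule tot) (use that \<open>J' \<subseteq> J\<close> in auto)
        show "lt a c" if "a \<in> J'" "b \<in> J'" "c \<in> J'" "lt a b" "lt b c" for a b c
          by (rule tr[of a b c]) (use that \<open>J' \<subseteq> J\<close> in auto)
      qed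
      then show ?thesis using that by blast
    qed
    have "alg_independent M (J' - {m}) x"
      using Suc m by (intro Suc.hyps(1)) auto
    moreover have "x m \<notin> dcl (M \<union> x ` (J' - {m}))"
    proof -
      have "M \<union> x ` (J' - {m}) \<subseteq> M \<union> x ` {j\<in>J. lt j m}" using m \<open>J' \<subseteq> J\<close> by blast
      then show ?thesis using x[of m] m \<open>J' \<subseteq> J\<close> dcl_mono by blast
    qed
    ultimately show ?case using alg_independent_insert[OF M, of "J' - {m}" x m] m
      by (simp add: insert_absorb)
  qed
qed

section \<open>Linear algebra on dual derivations, and the transcendence degree\<close>

lemma underdetermined_system:
  fixes a :: "'c \<Rightarrow> 'd \<Rightarrow> 'a::field"
  assumes "finite B" "finite C" "card B < card C"
  shows "\<exists>l. (\<exists>c\<in>C. l c \<noteq> 0) \<and> (\<forall>b\<in>B. (\<Sum>c\<in>C. l c * a c b) = 0)"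
  using assms
proof (induction B arbitrary: C a rule: finite_induct)
  case empty
  then have "C \<noteq> {}" by auto
  then show ?case by (intro exI[of _ "\<lambda>_. 1"]) auto
next
  case (insert b B)
  show ?case
  proof (cases "\<forall>c\<in>C. a c b = 0")
    case True
    have "\<exists>l. (\<exists>c\<in>C. l c \<noteq> 0) \<and> (\<forall>b\<in>B. (\<Sum>c\<in>C. l c * a c b) = 0)"
      using insert.prems insert.hyps by (intro insert.IH) auto
    then show ?thesis using True by auto
  next
    case False
    then obtain c0 where c0: "c0 \<in> C" "a c0 b \<noteq> 0" by blast
    define a' where "a' = (\<lambda>c b'. a c b' - a c b / a c0 b * a c0 b')"
    have "\<exists>l. (\<exists>c\<in>C - {c0}. l c \<noteq> 0) \<and> (\<forall>b\<in>B. (\<Sum>c\<in>C - {c0}. l c * a' c b) = 0)"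
      using insert.prems insert.hyps c0 by (intro insert.IH) auto
    then obtain l where l: "\<exists>c\<in>C - {c0}. l c \<noteq> 0" "\<And>b. b \<in> B \<Longrightarrow> (\<Sum>c\<in>C - {c0}. l c * a' c b) = 0" by blast
    \<comment> \<open>Equation \<open>b\<close> forces the value \<open>- s\<close> of the pivot
      unknown \<open>c0\<close>.\<close>
    define s where "s = (\<Sum>c\<in>C - {c0}. l c * (a c b / a c0 b))"
    define l' where "l' = l(c0 := - s)"
    have sum: "(\<Sum>c\<in>C. l' c * a c d) = (\<Sum>c\<in>C - {c0}. l c * a c d) - s * a c0 d" for d
    proof -
      have "(\<Sum>c\<in>C. l' c * a c d) = l' c0 * a c0 d + (\<Sum>c\<in>C - {c0}. l' c * a c d)"
        using insert.prems(1) c0 by (simp add: sum.remove)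
      also have "(\<Sum>c\<in>C - {c0}. l' c * a c d) = (\<Sum>c\<in>C - {c0}. l c * a c d)"
        by (intro sum.cong) (auto simp: l'_def)
      finally show ?thesis by (simp add: l'_def)
    qed
    have "(\<Sum>c\<in>C. l' c * a c d) = 0" if "d \<in> insert b B" for d
    proof (cases "d = b")
      case True
      have "s * a c0 b = (\<Sum>c\<in>C - {c0}. l c * a c b)"
        unfolding s_def sum_distrib_right using c0 by (intro sum.cong) auto
      then show ?thesis unfolding sum True by simp
    next
      case False
      then have "(\<Sum>c\<in>C - {c0}. l c * a' c d) = 0" using that l by simp
      then show ?thesis unfolding sum s_def a'_def
        by (simp add: right_diff_distrib sum_subtractf sum_distrib_right mult.assoc)
    qed
    moreover have "\<exists>c\<in>C. l' c \<noteq> 0" using l(1) by (auto simp: l'_def)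
    ultimately show ?thesis by blast
  qed
qed

text \<open>This replaces the exchange lemma. If finitely many elements of \<open>C\<close>
  outnumbered \<open>B\<close>, a nontrivial combination of their dual derivations would vanish on
  \<open>B\<close>, hence on \<open>dcl (M \<union> B)\<close>; yet its values at these elements are
  its coefficients.\<close>

lemma independent_card_le:
  fixes B C :: "'a::field_char_0 set"
  assumes M: "is_subfield M" and B: "finite B" "C \<subseteq> dcl (M \<union> B)" and C: "alg_independent M C (\<lambda>c. c)"
  shows "finite C \<and> card C \<le> card B"
proof -
  have fin: "card C' \<le> card B" if C': "finite C'" "C' \<subseteq> C" for C'
  proof (rule ccontr)
    assume gt: "\<not> card C' \<le> card B"
    have "\<forall>c\<in>C'. \<exists>D. derivation D \<and> (\<forall>x\<in>M. D x = 0) \<and> (\<forall>j\<in>C. D j = (if j = c then 1 else 0))"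
      using alg_independent_dual[OF M C] C' by blast
    then obtain D where D: "\<And>c. c \<in> C' \<Longrightarrow> derivation (D c)" "\<And>c x. c \<in> C' \<Longrightarrow> x \<in> M \<Longrightarrow> D c x = 0"
      "\<And>c j. c \<in> C' \<Longrightarrow> j \<in> C \<Longrightarrow> D c j = (if j = c then 1 else 0)" by metis
    obtain l where l: "\<exists>c\<in>C'. l c \<noteq> 0" "\<And>b. b \<in> B \<Longrightarrow> (\<Sum>c\<in>C'. l c * D c b) = 0"
      using underdetermined_system[OF B(1) C'(1), of D] gt by (metis not_le)
    define E where "E = (\<lambda>x. \<Sum>c\<in>C'. l c * D c x)"
    have E: "derivation E" unfolding E_def by (rule derivation_sum_scaled) (rule D(1))
    have E0: "E s = 0" if "s \<in> M \<union> B" for s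
    proof (cases "s \<in> B")
      case True
      then show ?thesis unfolding E_def by (rule l(2))
    next
      case False
      then show ?thesis unfolding E_def using that D(2) by (intro sum.neutral) auto
    qed
    have "l c = 0" if "c \<in> C'" for c
    proof -
      have cC: "c \<in> C" using that C' by blast
      have "E c = (\<Sum>d\<in>C'. if d = c then l d else 0)"
        unfolding E_def using D(3) cC by (intro sum.cong) auto
      also have "\<dots> = l c" using that C' by simp
      finally have "E c = l c" .
      moreover have "E c = 0" by (rule dclD[OF _ E E0]) (use B(2) cC in auto)
      ultimately show ?thesis by simp
    qed
    then show False using l(1) by blast
  qed
  have "finite C"
  proof (rule ccontr)
    assume "infinite C"
    then obtain C' where "C' \<subseteq> C" "finite C'" "card C' = Suc (card B)"
      using infinite_arbitrarily_large by blast
    then show False using fin by force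
  qed
  then show ?thesis using fin by blast
qed

lemma transcendence_basis_dcl:
  fixes B :: "'a::field_char_0 set"
  shows "transcendence_basis M L B \<longleftrightarrow> B \<subseteq> L \<and> alg_independent M B (\<lambda>b. b) \<and> L \<subseteq> dcl (M \<union> B)"
  unfolding transcendence_basis_def algebraic_over_iff_dcl[OF is_subfield_adjoin] dcl_adjoin by blast

text \<open>\<open>trdeg\<close> measures an arbitrarily chosen basis. Comparison with
  \<open>B\<close> in both directions also shows that this basis is finite, so the value
  \<open>0\<close> for the cardinality of infinite sets does no harm.\<close>

lemma trdeg_eq_card:
  fixes B :: "'a::field_char_0 set"
  assumes M: "is_subfield M" and B: "transcendence_basis M L B" "finite B"
  shows "trdeg M L = card B"
proof -
  define C where "C = (SOME B. transcendence_basis M L B)"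
  have C: "transcendence_basis M L C" unfolding C_def using B(1) by (rule someI)
  have "finite C \<and> card C \<le> card B"
    using B C by (intro independent_card_le[OF M]) (auto simp: transcendence_basis_dcl)
  moreover from this have "finite B \<and> card B \<le> card C"
    using B C by (intro independent_card_le[OF M]) (auto simp: transcendence_basis_dcl)
  ultimately show ?thesis unfolding trdeg_def C_def[symmetric] by simp
qed

section \<open>Intersections of extensions and fields of constants\<close>

lemma adjoin_adjoin: "field_adjoin (field_adjoin K S) T = field_adjoin K (S \<union> T)"
proof
  show "field_adjoin (field_adjoin K S) T \<subseteq> field_adjoin K (S \<union> T)"
  proof (rule adjoin_least[OF is_subfield_adjoin])
    show "field_adjoin K S \<subseteq> field_adjoin K (S \<union> T)" by (rule adjoin_mono) auto
    show "T \<subseteq> field_adjoin K (S \<union> T)" using adjoin_gens[of "S \<union> T" K] by simp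
  qed
  show "field_adjoin K (S \<union> T) \<subseteq> field_adjoin (field_adjoin K S) T"
  proof (rule adjoin_least[OF is_subfield_adjoin])
    show "K \<subseteq> field_adjoin (field_adjoin K S) T"
      using adjoin_base[of K S] adjoin_base[of "field_adjoin K S" T] by (rule subset_trans)
    have "S \<subseteq> field_adjoin (field_adjoin K S) T"
      using adjoin_gens[of S K] adjoin_base[of "field_adjoin K S" T] by (rule subset_trans)
    then show "S \<union> T \<subseteq> field_adjoin (field_adjoin K S) T"
      using adjoin_gens[of T "field_adjoin K S"] by simp
  qed
qed

lemma adjoin_finite:
  fixes x :: "'i \<Rightarrow> 'a::field"
  assumes M: "is_subfield M" and z: "z \<in> field_adjoin M (x ` J)"
  shows "\<exists>T. finite T \<and> T \<subseteq> J \<and> z \<in> field_adjoin M (x ` T)"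
proof -
  obtain p q where pq: "mp_over M J p" "mp_over M J q" "z = ev x p / ev x q"
    using adjoin_quotient[OF M z] by blast
  let ?T = "(\<Union>\<mu>\<in>Poly_Mapping.keys p. Poly_Mapping.keys \<mu>) \<union> (\<Union>\<mu>\<in>Poly_Mapping.keys q. Poly_Mapping.keys \<mu>)"
  have "?T \<subseteq> J" using mp_over_keys[OF pq(1)] mp_over_keys[OF pq(2)] by blast
  moreover have "finite ?T" by simp
  moreover have "mp_over M ?T p" "mp_over M ?T q"
    using mp_over_lookup[OF pq(1)] mp_over_lookup[OF pq(2)] unfolding mp_over_def by blast+
  then have "z \<in> field_adjoin M (x ` ?T)"
    unfolding pq(3) by (intro subfield_divide is_subfield_adjoin ev_in_adjoin)
  ultimately show ?thesis by blast
qed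

lemma alg_independentD: "alg_independent M J x \<Longrightarrow> mp_over M J p \<Longrightarrow> ev x p = 0 \<Longrightarrow> p = 0"
  unfolding alg_independent_alt by simp

lemma lookup_const_mult:
  fixes q :: "('i \<Rightarrow>\<^sub>0 nat) \<Rightarrow>\<^sub>0 'a::comm_ring_1"
  shows "Poly_Mapping.lookup (Poly_Mapping.single 0 z * q) \<mu> = z * Poly_Mapping.lookup q \<mu>"
  by (simp add: mult_map_scale_conv_mult[symmetric] Poly_Mapping.map.rep_eq when_def)

text \<open>If \<open>z = p / q\<close>, then \<open>z * q - p\<close> is a polynomial over
  \<open>M'\<close> that vanishes at the independent family, so each of its coefficients is
  zero.\<close>

lemma adjoin_inter:
  fixes x :: "'i \<Rightarrow> 'a::field"
  assumes M: "is_subfield M" "M \<subseteq> M'" "is_subfield M'" and ind: "alg_independent M' J x"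
    and z: "z \<in> M'" "z \<in> field_adjoin M (x ` J)"
  shows "z \<in> M"
proof -
  obtain p q where pq: "mp_over M J p" "mp_over M J q" "ev x q \<noteq> 0" "z = ev x p / ev x q"
    using adjoin_quotient[OF M(1) z(2)] by blast
  let ?r = "Poly_Mapping.single 0 z * q - p"
  have "mp_over M' J p" "mp_over M' J q"
    by (rule mp_over_mono[OF pq(1) M(2) subset_refl], rule mp_over_mono[OF pq(2) M(2) subset_refl])
  then have "mp_over M' J ?r" using M(3) z(1) by (intro mp_over_diff mp_over_mult mp_over_const)
  moreover have "ev x ?r = 0" unfolding ev_diff ev_mult ev_const using pq(3,4) by simp
  ultimately have "?r = 0" by (rule alg_independentD[OF ind])
  then have eq: "z * Poly_Mapping.lookup q \<mu> = Poly_Mapping.lookup p \<mu>" for \<mu>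
    by (metis eq_iff_diff_eq_0 lookup_const_mult)
  have "q \<noteq> 0" using pq(3) by auto
  then obtain \<mu> where "Poly_Mapping.lookup q \<mu> \<noteq> 0" by (metis lookup_zero poly_mapping_eqI)
  then have "z = Poly_Mapping.lookup p \<mu> / Poly_Mapping.lookup q \<mu>" using eq[of \<mu>] by (simp add: field_simps)
  then show ?thesis using M(1) mp_over_lookup[OF pq(1)] mp_over_lookup[OF pq(2)] by (simp add: subfield_divide)
qed

text \<open>\<open>D\<close> acts as \<open>d/dy\<close>. A fraction \<open>p / q\<close> with
  derivative zero equals \<open>p' / q'\<close> unless \<open>q'\<close> is zero; if the degree of
  \<open>q\<close> is least possible, then \<open>q\<close>, and after it \<open>p\<close>, must be
  constant.\<close>

lemma constant_of_simple_extension: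
  fixes y :: "'a::field_char_0"
  assumes M: "is_subfield M" and D: "derivation D" "\<And>c. c \<in> M \<Longrightarrow> D c = 0" "D y = 1"
    and z: "z \<in> field_adjoin M {y}" "D z = 0"
  shows "z \<in> M"
proof -
  have tr: "p = 0" if "poly_over M p" "poly p y = 0" for p
  proof (rule ccontr)
    assume "p \<noteq> 0"
    then have "algebraic_over M y" using that unfolding algebraic_over_def poly_over_def by blast
    then have "y \<in> dcl M" by (simp add: algebraic_over_iff_dcl[OF M])
    then show False using dclD[OF _ D(1,2)] D(3) by fastforce
  qed
  have Dp: "D (poly p y) = poly (pderiv p) y" if "poly_over M p" for p
    using der_on_min_poly[OF is_subfield_UNIV hom_on_id derivation_der[OF D(1)] _ that _ D(2)] D(3) by simp
  define P where "P = (\<lambda>q. \<exists>p. poly_over M p \<and> poly_over M q \<and> poly q y \<noteq> 0 \<and> z = poly p y / poly q y)"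
  obtain q0 where "P q0" using adjoin_singleton_quotient[OF M z(1)] unfolding P_def by blast
  then obtain q where q: "P q" "\<And>q'. P q' \<Longrightarrow> degree q \<le> degree q'"
    using arg_min_nat_lemma[of P q0 degree] by blast
  then obtain p where p: "poly_over M p" "poly_over M q" "poly q y \<noteq> 0" "z = poly p y / poly q y"
    unfolding P_def by blast
  have "D (poly p y) * poly q y = poly p y * D (poly q y)"
    using z(2) p(3) unfolding p(4) derivation_divide[OF D(1) p(3)] by simp
  then have eq: "poly (pderiv p) y * poly q y = poly p y * poly (pderiv q) y"
    using Dp[OF p(1)] Dp[OF p(2)] by simp
  have "poly (pderiv q) y = 0"
  proof (rule ccontr)
    assume nz: "poly (pderiv q) y \<noteq> 0"
    then have "z = poly (pderiv p) y / poly (pderiv q) y"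
      using eq p(3) unfolding p(4) by (simp add: frac_eq_eq)
    then have "P (pderiv q)" unfolding P_def using nz p(1,2) poly_over_pderiv[OF M] by blast
    then have "degree q \<le> degree (pderiv q)" by (rule q(2))
    then have "pderiv q = 0" by (simp add: degree_pderiv pderiv_eq_0_iff)
    then show False using nz by simp
  qed
  then have q0: "degree q = 0" using tr[OF poly_over_pderiv[OF M p(2)]] by (simp add: pderiv_eq_0_iff)
  have "poly (pderiv p) y = 0" using eq p(3) \<open>poly (pderiv q) y = 0\<close> by simp
  then have p0: "degree p = 0" using tr[OF poly_over_pderiv[OF M p(1)]] by (simp add: pderiv_eq_0_iff)
  obtain a b where ab: "p = [:a:]" "q = [:b:]" using p0 q0 by (auto elim!: degree_eq_zeroE)
  have "a \<in> M" "b \<in> M" using poly_overD[OF p(1), of 0] poly_overD[OF p(2), of 0] ab by auto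
  then show ?thesis unfolding p(4) ab using M by (simp add: subfield_divide)
qed

text \<open>Variables outside \<open>S\<close> are removed one at a time: over the field generated
  by the others, \<open>D i\<close> is differentiation by \<open>x i\<close>, and its constants form
  that field.\<close>

lemma constants_of_dual_derivations:
  fixes x :: "'i \<Rightarrow> 'a::field_char_0"
  assumes M: "is_subfield M" and D: "\<And>i. i \<in> J \<Longrightarrow> derivation (D i)"
    "\<And>i c. i \<in> J \<Longrightarrow> c \<in> M \<Longrightarrow> D i c = 0"
    "\<And>i j. i \<in> J \<Longrightarrow> j \<in> J \<Longrightarrow> D i (x j) = (if j = i then 1 else 0)"
    and z: "z \<in> field_adjoin M (x ` J)" "\<And>i. i \<in> J \<Longrightarrow> i \<notin> S \<Longrightarrow> D i z = 0"
  shows "z \<in> field_adjoin M (x ` (J \<inter> S))"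
proof -
  obtain T where "finite T" "T \<subseteq> J" "z \<in> field_adjoin M (x ` T)" using adjoin_finite[OF M z(1)] by blast
  then show ?thesis
  proof (induction "card (T - S)" arbitrary: T)
    case 0
    then have "T \<subseteq> J \<inter> S" by auto
    then have "field_adjoin M (x ` T) \<subseteq> field_adjoin M (x ` (J \<inter> S))" by (intro adjoin_mono) auto
    then show ?case using 0 by blast
  next
    case (Suc k)
    then obtain i where i: "i \<in> T" "i \<notin> S" by (metis DiffE card_eq_0_iff equals0I nat.distinct(1))
    then have iJ: "i \<in> J" using Suc.prems by blast
    have "x ` T = x ` (T - {i}) \<union> {x i}" using i by blast
    then have zz: "z \<in> field_adjoin (field_adjoin M (x ` (T - {i}))) {x i}"
      using Suc.prems(3) by (simp only: adjoin_adjoin)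
    have D0: "D i c = 0" if "c \<in> field_adjoin M (x ` (T - {i}))" for c
    proof (rule derivation_vanish_adjoin[OF D(1)[OF iJ] _ _ that])
      show "D i c = 0" if "c \<in> M" for c using D(2)[OF iJ that] .
      fix c assume "c \<in> x ` (T - {i})"
      then obtain j where "j \<in> J" "j \<noteq> i" "c = x j" using Suc.prems(2) by blast
      then show "D i c = 0" using D(3)[OF iJ] by simp
    qed
    have "z \<in> field_adjoin M (x ` (T - {i}))"
      using constant_of_simple_extension[OF is_subfield_adjoin D(1)[OF iJ] D0 _ zz z(2)[OF iJ i(2)]]
        D(3)[OF iJ iJ] by simp
    moreover have "k = card (T - {i} - S)"
    proof -
      have "T - {i} - S = (T - S) - {i}" by blast
      then show ?thesis using Suc(2) i Suc.prems(1) by simp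
    qed
    ultimately show ?case using Suc.prems by (intro Suc.hyps(1)[of "T - {i}"]) auto
  qed
qed

section \<open>Extending homomorphisms\<close>

text \<open>Extension by fractions. That both components vanish simultaneously makes the
  correspondence single-valued and keeps denominators nonzero on both sides.\<close>

lemma hom_graph_extend:
  fixes R :: "('a::field \<times> 'b::field) set"
  assumes one: "(1, 1) \<in> R"
    and diff: "\<And>x d y e. (x, d) \<in> R \<Longrightarrow> (y, e) \<in> R \<Longrightarrow> (x - y, d - e) \<in> R"
    and mult: "\<And>x d y e. (x, d) \<in> R \<Longrightarrow> (y, e) \<in> R \<Longrightarrow> (x * y, d * e) \<in> R"
    and inj: "\<And>x d. (x, d) \<in> R \<Longrightarrow> x = 0 \<longleftrightarrow> d = 0"
    and S: "\<And>s. s \<in> S \<Longrightarrow> s \<in> Domain R"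
  shows "\<exists>h. hom_on (field_adjoin {} S) h \<and> (\<forall>x d. (x, d) \<in> R \<longrightarrow> h x = d)"
proof -
  define Q where "Q = {(a / b, a' / b') | a a' b b'. (a, a') \<in> R \<and> (b, b') \<in> R \<and> b \<noteq> 0}"
  have QI: "(a / b, a' / b') \<in> Q" if "(a, a') \<in> R" "(b, b') \<in> R" "b \<noteq> 0" for a a' b b'
    using that unfolding Q_def by blast
  have QE: "\<exists>a a' b b'. (a, a') \<in> R \<and> (b, b') \<in> R \<and> b \<noteq> 0 \<and> b' \<noteq> 0 \<and> x = a / b \<and> d = a' / b'"
    if "(x, d) \<in> Q" for x d
  proof -
    have "\<exists>a a' b b'. (x, d) = (a / b, a' / b') \<and> (a, a') \<in> R \<and> (b, b') \<in> R \<and> b \<noteq> 0"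
      using that unfolding Q_def by (rule CollectD)
    then obtain a a' b b' where "(a, a') \<in> R" "(b, b') \<in> R" "b \<noteq> 0" "x = a / b" "d = a' / b'" by auto
    then show ?thesis using inj[of b b'] by blast
  qed
  have zero: "(0, 0) \<in> R" using diff[OF one one] by simp
  have uni: "d = e" if xd: "(x, d) \<in> Q" and xe: "(x, e) \<in> Q" for x d e
  proof -
    obtain a a' b b' where 1: "(a, a') \<in> R" "(b, b') \<in> R" "b \<noteq> 0" "b' \<noteq> 0" "x = a / b" "d = a' / b'"
      using QE[OF xd] by blast
    obtain c c' f f' where 2: "(c, c') \<in> R" "(f, f') \<in> R" "f \<noteq> 0" "f' \<noteq> 0" "x = c / f" "e = c' / f'"
      using QE[OF xe] by blast
    have "(a * f - c * b, a' * f' - c' * b') \<in> R" using 1 2 by (intro diff mult)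
    moreover have "a * f - c * b = 0" using 1 2 by (simp add: field_simps)
    ultimately have "a' * f' - c' * b' = 0" using inj by blast
    then show ?thesis unfolding 1(6) 2(6) using 1(4) 2(4) by (simp add: frac_eq_eq)
  qed
  have Qdiff: "(x - y, d - e) \<in> Q" and Qmult: "(x * y, d * e) \<in> Q" if xd: "(x, d) \<in> Q" and ye: "(y, e) \<in> Q" for x d y e
  proof -
    obtain a a' b b' where 1: "(a, a') \<in> R" "(b, b') \<in> R" "b \<noteq> 0" "b' \<noteq> 0" "x = a / b" "d = a' / b'"
      using QE[OF xd] by blast
    obtain c c' f f' where 2: "(c, c') \<in> R" "(f, f') \<in> R" "f \<noteq> 0" "f' \<noteq> 0" "y = c / f" "e = c' / f'"
      using QE[OF ye] by blast
    have nz: "b * f \<noteq> 0" using 1 2 by simp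
    have "((a * f - c * b) / (b * f), (a' * f' - c' * b') / (b' * f')) \<in> Q"
      using 1 2 by (intro QI diff mult nz)
    then show "(x - y, d - e) \<in> Q" using 1 2 by (simp add: diff_frac_eq)
    have "((a * c) / (b * f), (a' * c') / (b' * f')) \<in> Q"
      using 1 2 by (intro QI mult nz)
    then show "(x * y, d * e) \<in> Q" using 1 2 by simp
  qed
  have RQ: "(x, d) \<in> Q" if "(x, d) \<in> R" for x d using QI[OF that one] by simp
  have "is_subfield (Domain Q)"
    unfolding is_subfield_def
  proof (intro conjI ballI)
    show "1 \<in> Domain Q" using RQ[OF one] by blast
    fix x y assume "x \<in> Domain Q" "y \<in> Domain Q"
    then show "x - y \<in> Domain Q" "x * y \<in> Domain Q" using Qdiff Qmult by blast+
  next
    fix x assume "x \<in> Domain Q"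
    then obtain d where "(x, d) \<in> Q" by blast
    then obtain a a' b b' where 1: "(a, a') \<in> R" "(b, b') \<in> R" "b \<noteq> 0" "x = a / b" using QE by blast
    show "inverse x \<in> Domain Q"
    proof (cases "a = 0")
      case True then show ?thesis using 1 RQ[OF zero] by auto
    next
      case False
      from QI[OF 1(2,1) this] show ?thesis using 1(4) by auto
    qed
  qed
  then have dom: "field_adjoin {} S \<subseteq> Domain Q"
  proof (rule adjoin_least)
    show "S \<subseteq> Domain Q"
    proof
      fix s assume "s \<in> S"
      then obtain d where "(s, d) \<in> R" using S by blast
      then show "s \<in> Domain Q" using RQ by blast
    qed
  qed simp
  define h where "h = (\<lambda>y. THE d. (y, d) \<in> Q)"
  have hQ: "h y = d" if "(y, d) \<in> Q" for y d
    unfolding h_def using that uni by blast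
  have Qh: "(y, h y) \<in> Q" if "y \<in> field_adjoin {} S" for y
    using dom that hQ by blast
  have Qadd: "(x + y, d + e) \<in> Q" if xd: "(x, d) \<in> Q" and ye: "(y, e) \<in> Q" for x d y e
    using Qdiff[OF xd Qdiff[OF RQ[OF zero] ye]] by simp
  have "hom_on (field_adjoin {} S) h"
    unfolding hom_on_def using hQ[OF RQ[OF one]] by (simp add: hQ[OF Qadd[OF Qh Qh]] hQ[OF Qmult[OF Qh Qh]])
  then show ?thesis using hQ RQ by blast
qed

lemma adjoin_empty_union: "field_adjoin {} (K \<union> S) = field_adjoin K S"
  by (simp add: field_adjoin_def)

text \<open>Polynomial expressions in \<open>x\<close> are matched with those in \<open>y\<close>.
  On either side only the zero polynomial gives zero; for \<open>y\<close> this uses that the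
  injective \<open>h\<close> does not shrink the support.\<close>

lemma hom_extend_independent:
  fixes h :: "'a::field \<Rightarrow> 'b::field"
  assumes M: "is_subfield M" and h: "hom_on M h" and x: "alg_independent M J x"
    and y: "alg_independent (h ` M) J y"
  shows "\<exists>h'. hom_on (field_adjoin M (x ` J)) h' \<and> (\<forall>z\<in>M. h' z = h z) \<and> (\<forall>j\<in>J. h' (x j) = y j)"
proof -
  define v where "v = (\<lambda>p. (ev x p, meval h y p))"
  let ?R = "v ` {p. mp_over M J p}"
  have "\<exists>g. hom_on (field_adjoin {} (M \<union> x ` J)) g \<and> (\<forall>x d. (x, d) \<in> ?R \<longrightarrow> g x = d)"
  proof (rule hom_graph_extend)
    have "v 1 = (1, 1)" unfolding v_def ev_one meval_one[OF M h] ..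
    then show "(1, 1) \<in> ?R" using mp_over_1[OF M, of J] by (metis image_eqI mem_Collect_eq)
  next
    fix a d b e assume "(a, d) \<in> ?R" "(b, e) \<in> ?R"
    then obtain p q where p: "mp_over M J p" "(a, d) = v p" and q: "mp_over M J q" "(b, e) = v q" by blast
    have "(a - b, d - e) = v (p - q)"
      using p(2) q(2) unfolding v_def ev_diff meval_diff[OF M h p(1) q(1)] by simp
    then show "(a - b, d - e) \<in> ?R" using mp_over_diff[OF M p(1) q(1)] by blast
    have "(a * b, d * e) = v (p * q)"
      using p(2) q(2) unfolding v_def ev_mult meval_mult[OF M h p(1) q(1)] by simp
    then show "(a * b, d * e) \<in> ?R" using mp_over_mult[OF M p(1) q(1)] by blast
  next
    fix a d assume "(a, d) \<in> ?R"
    then obtain p where p: "mp_over M J p" "a = ev x p" "d = meval h y p" unfolding v_def by blast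
    have "p = 0" if "meval h y p = 0"
    proof -
      let ?q = "Poly_Mapping.map h p"
      have lq: "Poly_Mapping.lookup ?q \<mu> = h (Poly_Mapping.lookup p \<mu>)" for \<mu>
        by (simp add: Poly_Mapping.map.rep_eq when_def hom_on_zero[OF M h])
      have kq: "Poly_Mapping.keys ?q = Poly_Mapping.keys p"
        by (rule Set.set_eqI) (simp add: in_keys_iff lq hom_on_eq_0_iff[OF M h mp_over_lookup[OF p(1)]])
      have "mp_over (h ` M) J ?q"
        unfolding mp_over_def lq kq using mp_over_lookup[OF p(1)] mp_over_keys[OF p(1)] by blast
      moreover have "ev y ?q = 0" using that unfolding meval_def lq kq .
      ultimately have "?q = 0" using y unfolding alg_independent_alt by simp
      then show ?thesis using kq by (metis keys_eq_empty)
    qed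
    moreover have "p = 0" if "ev x p = 0" using that x p(1) unfolding alg_independent_alt by simp
    ultimately show "a = 0 \<longleftrightarrow> d = 0" using p by auto
  next
    fix s assume "s \<in> M \<union> x ` J"
    then show "s \<in> Domain ?R"
    proof
      assume "s \<in> M"
      then have "v (Poly_Mapping.single 0 s) = (s, h s)" "mp_over M J (Poly_Mapping.single 0 s)"
        unfolding v_def ev_const meval_const[OF M h] by (simp_all add: mp_over_const[OF M])
      then show ?thesis by (metis Domain.DomainI image_eqI mem_Collect_eq)
    next
      assume "s \<in> x ` J"
      then obtain j where j: "j \<in> J" "s = x j" by blast
      let ?p = "Poly_Mapping.single (Poly_Mapping.single j 1) 1"
      have "v ?p = (s, y j)" "mp_over M J ?p"
        unfolding v_def ev_var meval_var[OF M h] by (simp_all only: j mp_over_var[OF M])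
      then show ?thesis by (metis Domain.DomainI image_eqI mem_Collect_eq)
    qed
  qed
  then obtain g where g: "hom_on (field_adjoin M (x ` J)) g" "\<And>p. mp_over M J p \<Longrightarrow> g (ev x p) = meval h y p"
    unfolding adjoin_empty_union v_def by blast
  have "g c = h c" if "c \<in> M" for c
    using g(2)[OF mp_over_const[OF M that]] unfolding ev_const meval_const[OF M h] .
  moreover have "g (x j) = y j" if "j \<in> J" for j
    using g(2)[OF mp_over_var[OF M that]] unfolding ev_var meval_var[OF M h] .
  ultimately show ?thesis using g(1) by blast
qed

text \<open>The value of a polynomial at \<open>x\<close> determines that of its image at
  \<open>y\<close>, because polynomials with root \<open>x\<close> are multiples of
  \<open>f\<close>; that nonzero values go to nonzero values follows from inverses in
  \<open>M[x]\<close>.\<close>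

lemma hom_extend_algebraic:
  fixes h :: "'a::field \<Rightarrow> 'b::field"
  assumes M: "is_subfield M" and h: "hom_on M h" and f: "min_poly M x f"
    and y: "poly (map_poly h f) y = 0"
  shows "\<exists>h'. hom_on (field_adjoin M {x}) h' \<and> (\<forall>z\<in>M. h' z = h z) \<and> h' x = y"
proof -
  define v where "v = (\<lambda>p. (poly p x, poly (map_poly h p) y))"
  have h0: "h 0 = 0" by (rule hom_on_zero[OF M h])
  let ?R = "v ` {p. poly_over M p}"
  have fo: "poly_over M f" using f by (simp add: min_poly_def)
  have c: "poly_over M [:c:]" if "c \<in> M" for c using M that by (intro poly_over_pCons poly_over_0)
  have vc: "v [:c:] = (c, h c)" for c by (simp add: v_def map_poly_pCons h0)
  have v1: "v 1 = (1, 1)" using vc[of 1] hom_on_one[OF h] by (simp add: one_pCons)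
  have vm: "v (p * q) = (fst (v p) * fst (v q), snd (v p) * snd (v q))"
    if "poly_over M p" "poly_over M q" for p q
    unfolding v_def map_poly_hom_mult[OF M h that] by simp
  have xx: "poly_over M [:0, 1:]"
    using M by (intro poly_over_pCons poly_over_0 subfield_one subfield_zero)
  have vx: "v [:0, 1:] = (x, y)" by (simp add: v_def map_poly_pCons h0 hom_on_one[OF h])
  have zero: "poly (map_poly h p) y = 0" if p: "poly_over M p" "poly p x = 0" for p
  proof -
    obtain a where a: "poly_over M a" "p = f * a" using min_poly_dvd[OF M f p] by blast
    show ?thesis unfolding a(2) map_poly_hom_mult[OF M h fo a(1)] using y by simp
  qed
  have "\<exists>g. hom_on (field_adjoin {} (M \<union> {x})) g \<and> (\<forall>x d. (x, d) \<in> ?R \<longrightarrow> g x = d)"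
  proof (rule hom_graph_extend)
    show "(1, 1) \<in> ?R" using v1 poly_over_1[OF M] by (metis image_eqI mem_Collect_eq)
  next
    fix a d b e assume "(a, d) \<in> ?R" "(b, e) \<in> ?R"
    then obtain p q where p: "poly_over M p" "(a, d) = v p" and q: "poly_over M q" "(b, e) = v q" by blast
    have "(a - b, d - e) = v (p - q)"
      using p(2) q(2) unfolding v_def map_poly_hom_diff[OF M h p(1) q(1)] by simp
    then show "(a - b, d - e) \<in> ?R" using poly_over_diff[OF M p(1) q(1)] by blast
    have "(a * b, d * e) = v (p * q)" unfolding vm[OF p(1) q(1)] p(2)[symmetric] q(2)[symmetric] by simp
    then show "(a * b, d * e) \<in> ?R" using poly_over_mult[OF M p(1) q(1)] by blast
  next
    fix a d assume "(a, d) \<in> ?R"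
    then obtain p where p: "poly_over M p" "(a, d) = v p" by blast
    have "a = 0" if "d = 0"
    proof (rule ccontr)
      assume "a \<noteq> 0"
      then have "poly p x \<noteq> 0" using p(2) by (simp add: v_def)
      then obtain q where q: "poly_over M q" "poly p x * poly q x = 1" using min_poly_inverse[OF M f p(1)] by blast
      have "poly_over M (p * q - 1)" using p q M by (intro poly_over_diff poly_over_mult poly_over_1)
      moreover have "poly (p * q - 1) x = 0" using q(2) by simp
      ultimately have "poly (map_poly h (p * q - 1)) y = 0" by (rule zero)
      moreover have "poly (map_poly h (p * q - 1)) y = poly (map_poly h p) y * poly (map_poly h q) y - 1"
        using v1 unfolding map_poly_hom_diff[OF M h poly_over_mult[OF M p(1) q(1)] poly_over_1[OF M]]
          map_poly_hom_mult[OF M h p(1) q(1)] by (simp add: v_def)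
      ultimately show False using that p(2) by (simp add: v_def)
    qed
    moreover have "d = 0" if "a = 0" using zero[OF p(1)] that p(2) by (simp add: v_def)
    ultimately show "a = 0 \<longleftrightarrow> d = 0" by blast
  next
    fix s assume "s \<in> M \<union> {x}"
    then show "s \<in> Domain ?R"
    proof
      assume "s \<in> M"
      then show ?thesis using c[of s] vc[of s] by (metis Domain.DomainI image_eqI mem_Collect_eq)
    next
      assume "s \<in> {x}"
      then show ?thesis using xx vx by (metis Domain.DomainI image_eqI mem_Collect_eq singletonD)
    qed
  qed
  then obtain g where g: "hom_on (field_adjoin M {x}) g" "\<And>p a d. poly_over M p \<Longrightarrow> v p = (a, d) \<Longrightarrow> g a = d"
    unfolding adjoin_empty_union by (metis image_eqI mem_Collect_eq)
  show ?thesis using g(1) g(2)[OF c vc] g(2)[OF xx vx] by blast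
qed

section \<open>Recovering polynomials and rational functions from values\<close>

text \<open>At the points \<open>(b i ^ t)\<close> with distinct primes \<open>b i\<close> distinct monomials take the values \<open>N ^ t\<close>
  for distinct natural numbers \<open>N\<close>, so that they can be separated by a Vandermonde argument.\<close>

definition prime_family :: "('i \<Rightarrow> nat) \<Rightarrow> 'i set \<Rightarrow> bool" where
  "prime_family b J \<longleftrightarrow> inj_on b J \<and> (\<forall>i\<in>J. Factorial_Ring.prime (b i))"

definition pt :: "('i \<Rightarrow> nat) \<Rightarrow> nat \<Rightarrow> 'i \<Rightarrow> 'a::comm_ring_1" where
  "pt b t i = of_nat (b i) ^ t"

lemma prime_family_exists:
  assumes "finite J"
  shows "\<exists>b. prime_family b J"
proof -
  obtain P where P: "P \<subseteq> {p::nat. Factorial_Ring.prime p}" "finite P" "card P = card J"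
    using infinite_arbitrarily_large[OF primes_infinite, of "card J"] by blast
  then obtain b where "bij_betw b J P" using finite_same_card_bij[OF assms, of P] by auto
  then show ?thesis using P by (intro exI[of _ b]) (auto simp: prime_family_def bij_betw_def)
qed

text \<open>Unique factorisation: the exponents are the multiplicities of the primes
  \<open>b i\<close>.\<close>

lemma prime_monomials_inj:
  assumes b: "prime_family b J" and J: "finite J"
    and k: "Poly_Mapping.keys \<mu> \<subseteq> J" "Poly_Mapping.keys \<nu> \<subseteq> J"
    and eq: "(\<Prod>i\<in>J. b i ^ Poly_Mapping.lookup \<mu> i) = (\<Prod>i\<in>J. b i ^ Poly_Mapping.lookup \<nu> i)"
  shows "\<mu> = \<nu>"
proof (rule poly_mapping_eqI)
  fix i
  have inj: "inj_on b J" and pr: "\<And>i. i \<in> J \<Longrightarrow> Factorial_Ring.prime (b i)"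
    using b by (auto simp: prime_family_def)
  have mult: "multiplicity (b i) (\<Prod>j\<in>J. b j ^ g j) = g i" if "i \<in> J" for g
  proof -
    have "(\<Prod>j\<in>J. b j ^ g j) = (\<Prod>p\<in>b ` J. p ^ g (the_inv_into J b p))"
      unfolding prod.reindex[OF inj] comp_def by (intro prod.cong refl) (simp add: the_inv_into_f_f[OF inj])
    also have "multiplicity (b i) \<dots> = g i"
      using that J pr by (subst multiplicity_prod_prime_powers) (auto simp: the_inv_into_f_f[OF inj])
    finally show ?thesis .
  qed
  show "Poly_Mapping.lookup \<mu> i = Poly_Mapping.lookup \<nu> i"
  proof (cases "i \<in> J")
    case True
    then show ?thesis using mult[OF True, of "Poly_Mapping.lookup \<mu>"] mult[OF True, of "Poly_Mapping.lookup \<nu>"] eq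
      by simp
  next
    case False
    then have "i \<notin> Poly_Mapping.keys \<mu>" "i \<notin> Poly_Mapping.keys \<nu>" using k by auto
    then show ?thesis by (simp add: in_keys_iff)
  qed
qed

text \<open>By linearity the powers may be replaced by the values of any polynomial
  \<open>g\<close>, for instance one that vanishes at all nodes except \<open>N s\<close>.\<close>

lemma vandermonde_zero:
  fixes d :: "'s \<Rightarrow> 'a::field_char_0" and N :: "'s \<Rightarrow> nat"
  assumes S: "finite S" "inj_on N S" and 0: "\<And>t. (\<Sum>s\<in>S. d s * of_nat (N s) ^ t) = 0" and s: "s \<in> S"
  shows "d s = 0"
proof -
  have lin: "(\<Sum>s\<in>S. d s * poly g (of_nat (N s))) = 0" for g
  proof -
    have "(\<Sum>s\<in>S. d s * poly g (of_nat (N s))) = (\<Sum>s\<in>S. \<Sum>i\<le>degree g. coeff g i * (d s * of_nat (N s) ^ i))"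
      unfolding poly_altdef sum_distrib_left by (intro sum.cong refl) (simp add: algebra_simps)
    also have "\<dots> = (\<Sum>i\<le>degree g. coeff g i * (\<Sum>s\<in>S. d s * of_nat (N s) ^ i))"
      unfolding sum_distrib_left by (rule sum.swap)
    finally show ?thesis using 0 by simp
  qed
  define g where "g = (\<Prod>r\<in>S - {s}. [:- of_nat (N r), 1 :: 'a:])"
  have g: "poly g x = (\<Prod>r\<in>S - {s}. x - of_nat (N r))" for x
    by (simp add: g_def poly_prod)
  have "(\<Sum>r\<in>S. d r * poly g (of_nat (N r))) = d s * poly g (of_nat (N s)) + (\<Sum>r\<in>S - {s}. d r * poly g (of_nat (N r)))"
    by (rule sum.remove[OF S(1) s])
  also have "(\<Sum>r\<in>S - {s}. d r * poly g (of_nat (N r))) = 0"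
    using S(1) by (intro sum.neutral) (auto simp: g prod_zero_iff)
  finally have "d s * poly g (of_nat (N s)) = 0" using lin[of g] by simp
  moreover have "poly g (of_nat (N s)) \<noteq> 0"
    unfolding g using S s by (auto simp: inj_on_def)
  ultimately show ?thesis by simp
qed

text \<open>A monomial \<mu> contributes \<open>N \<mu> ^ t\<close> times a factor that is nonzero
  because the \<open>y i\<close> are. So the coefficients of \<open>p\<close> may come from a field
  over which the \<open>y i\<close> are algebraic.\<close>

lemma mp_vanish:
  fixes p :: "('i \<Rightarrow>\<^sub>0 nat) \<Rightarrow>\<^sub>0 'a::field_char_0"
  assumes b: "prime_family b J" "finite J" and p: "mp_over UNIV J p" and y: "\<And>i. i \<in> J \<Longrightarrow> y i \<noteq> 0"
    and 0: "\<And>t. ev (\<lambda>i. pt b t i * y i) p = 0"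
  shows "p = 0"
proof -
  define N where "N = (\<lambda>\<mu>. \<Prod>i\<in>J. b i ^ Poly_Mapping.lookup \<mu> i)"
  have m: "monoval (pt b t) \<mu> = (of_nat (N \<mu>) :: 'a) ^ t" if "\<mu> \<in> Poly_Mapping.keys p" for \<mu> t
    unfolding monoval_superset[OF b(2) mp_over_keys[OF p that]] N_def pt_def
    by (simp add: prod_power_distrib power_mult[symmetric] mult.commute)
  have "Poly_Mapping.lookup p \<mu> * monoval y \<mu> = 0" if mu: "\<mu> \<in> Poly_Mapping.keys p" for \<mu>
  proof (rule vandermonde_zero[OF _ _ _ mu, where N = N])
    show "inj_on N (Poly_Mapping.keys p)"
      unfolding inj_on_def N_def using prime_monomials_inj[OF b] mp_over_keys[OF p] by blast
    fix t
    show "(\<Sum>\<nu>\<in>Poly_Mapping.keys p. Poly_Mapping.lookup p \<nu> * monoval y \<nu> * of_nat (N \<nu>) ^ t) = 0"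
      using 0[of t] unfolding meval_def monoval_mult_point by (simp add: m algebra_simps)
  qed simp
  moreover have "monoval y \<mu> \<noteq> 0" if "\<mu> \<in> Poly_Mapping.keys p" for \<mu>
    unfolding monoval_def using y mp_over_keys[OF p that] by auto
  ultimately have "\<mu> \<notin> Poly_Mapping.keys p" for \<mu> by (metis in_keys_iff mult_eq_0_iff)
  then show ?thesis by (metis all_not_in_conv keys_eq_empty)
qed

lemma mp_vanish_pt:
  fixes p :: "('i \<Rightarrow>\<^sub>0 nat) \<Rightarrow>\<^sub>0 'a::field_char_0"
  assumes "prime_family b J" "finite J" "mp_over UNIV J p" "\<And>t. ev (pt b t) p = 0"
  shows "p = 0"
  using mp_vanish[OF assms(1-3), of "\<lambda>_. 1"] assms(4) by simp

text \<open>Gaussian elimination does not leave \<open>M\<close>, so a nontrivial solution over the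
  ambient field entails one over \<open>M\<close>. The unknowns \<open>S\<close> are finite in
  number; the equations \<open>A\<close> may be infinitely many.\<close>

lemma system_subfield_solution:
  fixes a :: "'r \<Rightarrow> 's \<Rightarrow> 'a::field"
  assumes "finite S" "is_subfield M" "\<And>r s. r \<in> A \<Longrightarrow> s \<in> S \<Longrightarrow> a r s \<in> M"
    and "\<exists>s\<in>S. l s \<noteq> 0" "\<And>r. r \<in> A \<Longrightarrow> (\<Sum>s\<in>S. a r s * l s) = 0"
  shows "\<exists>l'. (\<forall>s\<in>S. l' s \<in> M) \<and> (\<exists>s\<in>S. l' s \<noteq> 0) \<and> (\<forall>r\<in>A. (\<Sum>s\<in>S. a r s * l' s) = 0)"
  using assms(1,3-)
proof (induction S arbitrary: a l rule: finite_induct)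
  case (insert s S)
  note M = \<open>is_subfield M\<close>
  show ?case
  proof (cases "\<forall>r\<in>A. a r s = 0")
    case True
    let ?l = "\<lambda>s'. if s' = s then 1 else 0"
    have "(\<Sum>s'\<in>insert s S. a r s' * ?l s') = 0" if "r \<in> A" for r
      using True that insert.hyps by (intro sum.neutral) auto
    then show ?thesis using subfield_zero[OF M] subfield_one[OF M] by (intro exI[of _ ?l]) auto
  next
    case False
    then obtain r0 where r0: "r0 \<in> A" "a r0 s \<noteq> 0" by blast
    define a' where "a' = (\<lambda>r s'. a r s' - a r s / a r0 s * a r0 s')"
    have sum': "(\<Sum>s'\<in>S. a' r s' * g s') = (\<Sum>s'\<in>S. a r s' * g s') - a r s / a r0 s * (\<Sum>s'\<in>S. a r0 s' * g s')" for r g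
      unfolding a'_def by (simp add: left_diff_distrib sum_subtractf sum_distrib_left mult.assoc)
    have row: "(\<Sum>s'\<in>S. a r s' * l s') = - (a r s * l s)" if "r \<in> A" for r
      using insert.prems(3)[OF that] insert.hyps by (simp add: eq_neg_iff_add_eq_0 add.commute)
    have "\<exists>l'. (\<forall>s\<in>S. l' s \<in> M) \<and> (\<exists>s\<in>S. l' s \<noteq> 0) \<and> (\<forall>r\<in>A. (\<Sum>s\<in>S. a' r s * l' s) = 0)"
    proof (rule insert.IH)
      fix r s' assume rs: "r \<in> A" "s' \<in> S"
      then have "a r s' \<in> M" "a r s \<in> M" "a r0 s \<in> M" "a r0 s' \<in> M" using insert.prems(1) r0 by auto
      then show "a' r s' \<in> M"
        unfolding a'_def by (intro subfield_diff[OF M] subfield_mult[OF M] subfield_divide[OF M])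
    next
      show "\<exists>s\<in>S. l s \<noteq> 0"
      proof (rule ccontr)
        assume no: "\<not> (\<exists>s\<in>S. l s \<noteq> 0)"
        then have "(\<Sum>s'\<in>S. a r0 s' * l s') = 0" by (intro sum.neutral) auto
        then have "l s = 0" using row[OF r0(1)] r0(2) by simp
        then show False using insert.prems(2) no by auto
      qed
    next
      fix r assume "r \<in> A"
      then show "(\<Sum>s'\<in>S. a' r s' * l s') = 0"
        unfolding sum' using row r0 by simp
    qed
    then obtain l' where l': "\<forall>s\<in>S. l' s \<in> M" "\<exists>s\<in>S. l' s \<noteq> 0" "\<And>r. r \<in> A \<Longrightarrow> (\<Sum>s\<in>S. a' r s * l' s) = 0"
      by blast
    define c where "c = - (\<Sum>s'\<in>S. a r0 s' * l' s') / a r0 s"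
    define k where "k = l'(s := c)"
    have cM: "c \<in> M"
      unfolding c_def using l'(1) insert.prems(1)[OF r0(1)]
      by (intro subfield_divide[OF M] subfield_uminus[OF M] subfield_sum[OF M] subfield_mult[OF M]) auto
    have kS: "k s' = l' s'" if "s' \<in> S" for s' using that insert.hyps by (auto simp: k_def)
    have "(\<Sum>s'\<in>insert s S. a r s' * k s') = 0" if "r \<in> A" for r
    proof -
      have "(\<Sum>s'\<in>insert s S. a r s' * k s') = a r s * c + (\<Sum>s'\<in>S. a r s' * l' s')"
        using insert.hyps by (simp add: kS) (simp add: k_def)
      also have "\<dots> = (\<Sum>s'\<in>S. a' r s' * l' s')" unfolding sum' c_def by simp
      finally show ?thesis using l'(3)[OF that] by simp
    qed
    moreover have "\<forall>s'\<in>insert s S. k s' \<in> M" using cM l'(1) kS by (auto simp: k_def)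
    moreover have "\<exists>s'\<in>insert s S. k s' \<noteq> 0" using l'(2) kS by (metis insertCI)
    ultimately show ?thesis by blast
  qed
qed simp

text \<open>The linear equations \<open>p'(pt) = c t * q'(pt)\<close> for the coefficients of
  \<open>p'\<close> and \<open>q'\<close> have entries in \<open>M\<close> and the solution
  \<open>p\<close>, \<open>q\<close>. So they have a nonzero solution over \<open>M\<close>, and
  this represents the same function because the points separate polynomials.\<close>

lemma rational_function_descent:
  fixes y :: "'i \<Rightarrow> 'a::field_char_0"
  assumes G: "is_subfield G" and M: "is_subfield M" "M \<subseteq> G" and b: "prime_family b J" "finite J"
    and y: "alg_independent G J y" and pq: "mp_over G J p" "mp_over G J q" "ev y q \<noteq> 0"
    and val: "\<And>t. ev (pt b t) q \<noteq> 0 \<Longrightarrow> ev (pt b t) p / ev (pt b t) q \<in> M"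
  shows "ev y p / ev y q \<in> field_adjoin M (y ` J)"
proof -
  define A where "A = {t. ev (pt b t) q \<noteq> 0}"
  define S where "S = Inl ` Poly_Mapping.keys p \<union> Inr ` Poly_Mapping.keys q"
  define c where "c = (\<lambda>t. ev (pt b t) p / ev (pt b t) q)"
  define a where "a = (\<lambda>t s. case s of Inl \<mu> \<Rightarrow> monoval (pt b t) \<mu> | Inr \<mu> \<Rightarrow> - (c t * monoval (pt b t) \<mu>))"
  have S: "finite S" by (simp add: S_def)
  have split: "(\<Sum>s\<in>S. a t s * l s) = (\<Sum>\<mu>\<in>Poly_Mapping.keys p. l (Inl \<mu>) * monoval (pt b t) \<mu>)
      - c t * (\<Sum>\<mu>\<in>Poly_Mapping.keys q. l (Inr \<mu>) * monoval (pt b t) \<mu>)" for t l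
  proof -
    have "(\<Sum>s\<in>S. a t s * l s) = (\<Sum>s\<in>Inl ` Poly_Mapping.keys p. a t s * l s) + (\<Sum>s\<in>Inr ` Poly_Mapping.keys q. a t s * l s)"
      unfolding S_def by (rule sum.union_disjoint) auto
    also have "\<dots> = (\<Sum>\<mu>\<in>Poly_Mapping.keys p. l (Inl \<mu>) * monoval (pt b t) \<mu>)
      + (\<Sum>\<mu>\<in>Poly_Mapping.keys q. - (c t * (l (Inr \<mu>) * monoval (pt b t) \<mu>)))"
      by (simp add: sum.reindex a_def algebra_simps)
    finally show ?thesis by (simp add: sum_negf sum_distrib_left)
  qed
  define l0 where "l0 = (\<lambda>s. case s of Inl \<mu> \<Rightarrow> Poly_Mapping.lookup p \<mu> | Inr \<mu> \<Rightarrow> Poly_Mapping.lookup q \<mu>)"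
  have bM: "monoval (pt b t) \<mu> \<in> M" for t \<mu>
    unfolding monoval_def pt_def using M(1) by (intro subfield_prod subfield_power subfield_of_nat)
  have "\<exists>l'. (\<forall>s\<in>S. l' s \<in> M) \<and> (\<exists>s\<in>S. l' s \<noteq> 0) \<and> (\<forall>t\<in>A. (\<Sum>s\<in>S. a t s * l' s) = 0)"
  proof (rule system_subfield_solution[OF S M(1), where l = l0])
    fix t s assume t: "t \<in> A"
    have "c t \<in> M" using val t by (simp add: A_def c_def)
    then show "a t s \<in> M" unfolding a_def using bM M(1)
      by (cases s) (auto intro: subfield_uminus subfield_mult)
  next
    have "q \<noteq> 0" using pq(3) by auto
    then obtain \<mu> where "\<mu> \<in> Poly_Mapping.keys q" by (metis all_not_in_conv keys_eq_empty)
    then show "\<exists>s\<in>S. l0 s \<noteq> 0" by (intro bexI[of _ "Inr \<mu>"]) (auto simp: S_def l0_def in_keys_iff)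
  next
    fix t assume "t \<in> A"
    then show "(\<Sum>s\<in>S. a t s * l0 s) = 0" unfolding split by (simp add: l0_def c_def A_def meval_def)
  qed
  then obtain l where l: "\<forall>s\<in>S. l s \<in> M" "\<exists>s\<in>S. l s \<noteq> 0" "\<And>t. t \<in> A \<Longrightarrow> (\<Sum>s\<in>S. a t s * l s) = 0" by blast
  define p' where "p' = (\<Sum>\<mu>\<in>Poly_Mapping.keys p. Poly_Mapping.single \<mu> (l (Inl \<mu>)))"
  define q' where "q' = (\<Sum>\<mu>\<in>Poly_Mapping.keys q. Poly_Mapping.single \<mu> (l (Inr \<mu>)))"
  have p'o: "mp_over M J p'" and q'o: "mp_over M J q'"
    unfolding p'_def q'_def using l(1) mp_over_keys[OF pq(1)] mp_over_keys[OF pq(2)]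
    by (intro mp_over_sum[OF M(1)] mp_over_single[OF M(1)]; force simp: S_def)+
  have lk: "Poly_Mapping.lookup p' \<mu> = (if \<mu> \<in> Poly_Mapping.keys p then l (Inl \<mu>) else 0)"
    "Poly_Mapping.lookup q' \<mu> = (if \<mu> \<in> Poly_Mapping.keys q then l (Inr \<mu>) else 0)" for \<mu>
    unfolding p'_def q'_def lookup_sum lookup_single when_def by (simp_all add: sum.delta)
  have ev': "ev z p' = (\<Sum>\<mu>\<in>Poly_Mapping.keys p. l (Inl \<mu>) * monoval z \<mu>)"
     "ev z q' = (\<Sum>\<mu>\<in>Poly_Mapping.keys q. l (Inr \<mu>) * monoval z \<mu>)" for z
    unfolding p'_def q'_def by (subst meval_sum[OF is_subfield_UNIV hom_on_id mp_over_UNIV], simp only: ev_single)+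
  \<comment> \<open>The last factor makes \<open>?r\<close> vanish also at those points where
    \<open>q\<close> does and where the equations say nothing.\<close>
  let ?r = "(p' * q - p * q') * q"
  have mono: "mp_over UNIV J r" if "mp_over K J r" for r and K :: "'a set" by (rule mp_over_mono[OF that]) auto
  have "?r = 0"
  proof (rule mp_vanish_pt[OF b])
    show "mp_over UNIV J ?r"
      by (intro mp_over_mult mp_over_diff is_subfield_UNIV mono[OF pq(1)] mono[OF pq(2)] mono[OF p'o] mono[OF q'o])
    fix t
    show "ev (pt b t) ?r = 0"
    proof (cases "t \<in> A")
      case True
      then have "ev (pt b t) p' = c t * ev (pt b t) q'" using l(3)[OF True] unfolding split ev' by simp
      then show ?thesis using True unfolding ev_mult ev_diff by (simp add: c_def A_def)
    next
      case False
      then show ?thesis unfolding ev_mult by (simp add: A_def)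
    qed
  qed
  then have "ev y ?r = 0" by simp
  then have e: "ev y p' * ev y q = ev y p * ev y q'" using pq(3) unfolding ev_mult ev_diff by simp
  have "ev y q' \<noteq> 0"
  proof
    assume "ev y q' = 0"
    moreover from this have "ev y p' = 0" using e pq(3) by simp
    moreover have "mp_over G J p'" "mp_over G J q'"
      by (rule mp_over_mono[OF p'o M(2) subset_refl], rule mp_over_mono[OF q'o M(2) subset_refl])
    ultimately have "p' = 0" "q' = 0" using y unfolding alg_independent_alt by simp_all
    then have "l s = 0" if "s \<in> S" for s
      using that lk unfolding S_def by (auto split: if_splits) (metis lookup_zero)+
    then show False using l(2) by blast
  qed
  then have "ev y p / ev y q = ev y p' / ev y q'" using e pq(3) by (simp add: frac_eq_eq)
  then show ?thesis using ev_in_adjoin[OF p'o] ev_in_adjoin[OF q'o]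
    by (simp add: subfield_divide is_subfield_adjoin)
qed

text \<open>With \<open>D\<close> acting on coefficients only, the quotient rule turns the
  hypothesis into the vanishing of \<open>(Dp q - p Dq) q\<close> at all points
  \<open>pt b t i * y i\<close>. By \<open>mp_vanish\<close> this polynomial is zero, so it vanishes
  at the points \<open>pt b t\<close> as well.\<close>

lemma scaled_derivation_zero:
  fixes y :: "'i \<Rightarrow> 'a::field_char_0"
  assumes b: "prime_family b J" "finite J" and D: "derivation D" "\<And>i. i \<in> J \<Longrightarrow> D (y i) = 0"
    and y: "\<And>i. i \<in> J \<Longrightarrow> y i \<noteq> 0" and pq: "mp_over UNIV J p" "mp_over UNIV J q"
    and 0: "\<And>t. D (ev (\<lambda>i. pt b t i * y i) p / ev (\<lambda>i. pt b t i * y i) q) = 0"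
    and t: "ev (pt b t) q \<noteq> 0"
  shows "D (ev (pt b t) p / ev (pt b t) q) = 0"
proof -
  let ?Dp = "Poly_Mapping.map D p" and ?Dq = "Poly_Mapping.map D q"
  have D0: "D 0 = 0" by (rule derivation_zero[OF D(1)])
  have lk: "Poly_Mapping.lookup (Poly_Mapping.map D r) \<mu> = D (Poly_Mapping.lookup r \<mu>)" for r :: "('i \<Rightarrow>\<^sub>0 nat) \<Rightarrow>\<^sub>0 'a" and \<mu>
    by (simp add: Poly_Mapping.map.rep_eq when_def D0)
  have ks: "Poly_Mapping.keys (Poly_Mapping.map D r) \<subseteq> Poly_Mapping.keys r" for r :: "('i \<Rightarrow>\<^sub>0 nat) \<Rightarrow>\<^sub>0 'a"
    by (auto simp: in_keys_iff lk D0)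
  have o: "mp_over UNIV J (Poly_Mapping.map D r)" if "mp_over UNIV J r" for r
    using that ks[of r] unfolding mp_over_def by blast
  have Dev: "D (ev z r) = ev z (Poly_Mapping.map D r)" if "mp_over UNIV J r" "\<And>i. i \<in> J \<Longrightarrow> D (z i) = 0" for r z
  proof -
    have "D (ev z r) = meval D z r" by (rule derivation_ev_const_point[OF D(1) that(2) mp_over_keys[OF that(1)]])
    also have "\<dots> = ev z (Poly_Mapping.map D r)"
      unfolding meval_def lk
      by (rule sum.mono_neutral_right) (use ks[of r] in \<open>auto simp: in_keys_iff lk\<close>)
    finally show ?thesis .
  qed
  have pt0: "D (pt b t i) = 0" for t i
    using derivation_of_nat[OF D(1), of "b i ^ t"] by (simp add: pt_def)
  let ?r = "(?Dp * q - p * ?Dq) * q"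
  have quot: "D (ev z p / ev z q) = (ev z ?Dp * ev z q - ev z p * ev z ?Dq) / (ev z q * ev z q)"
    if "ev z q \<noteq> 0" "\<And>i. i \<in> J \<Longrightarrow> D (z i) = 0" for z
    using derivation_divide[OF D(1) that(1)] Dev[OF pq(1) that(2)] Dev[OF pq(2) that(2)] by simp
  have "?r = 0"
  proof (rule mp_vanish[OF b, of _ y])
    show "mp_over UNIV J ?r"
      by (intro mp_over_mult mp_over_diff is_subfield_UNIV o pq)
    fix t
    let ?z = "\<lambda>i. pt b t i * y i"
    have z0: "D (?z i) = 0" if "i \<in> J" for i using D(2)[OF that] pt0 by (simp add: derivation_mult[OF D(1)])
    show "ev ?z ?r = 0"
    proof (cases "ev ?z q = 0")
      case True
      then show ?thesis unfolding ev_mult by simp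
    next
      case False
      then show ?thesis using 0[of t] quot[OF False z0] unfolding ev_mult ev_diff by simp
    qed
  qed (rule y)
  then have "ev (pt b t) ?r = 0" by simp
  then have "ev (pt b t) ?Dp * ev (pt b t) q - ev (pt b t) p * ev (pt b t) ?Dq = 0"
    using t unfolding ev_mult ev_diff by simp
  then show ?thesis using quot[OF t pt0] by simp
qed

section \<open>Lueroth's theorem in one variable\<close>

text \<open>Take a denominator of least degree. The ideal of \<open>M[X]\<close> generated by
  \<open>p\<close> and \<open>q\<close> is principal; its generator \<open>r\<close> could be
  cancelled from the fraction, so it is constant, and its expression by \<open>p\<close> and
  \<open>q\<close> provides \<open>s\<close> and \<open>t\<close>.\<close>

lemma coprime_quotient:
  fixes x :: "'a::field"
  assumes M: "is_subfield M" and z: "z \<in> field_adjoin M {x}"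
  shows "\<exists>p q s t. poly_over M p \<and> poly_over M q \<and> poly_over M s \<and> poly_over M t \<and>
    s * p + t * q = 1 \<and> poly q x \<noteq> 0 \<and> z = poly p x / poly q x"
proof -
  define P where "P = (\<lambda>q. \<exists>p. poly_over M p \<and> poly_over M q \<and> poly q x \<noteq> 0 \<and> z = poly p x / poly q x)"
  obtain q0 where "P q0" using adjoin_singleton_quotient[OF M z] unfolding P_def by blast
  then obtain q where q: "P q" "\<And>q'. P q' \<Longrightarrow> degree q \<le> degree q'"
    using arg_min_nat_lemma[of P q0 degree] by blast
  then obtain p where p: "poly_over M p" "poly_over M q" "poly q x \<noteq> 0" "z = poly p x / poly q x"
    unfolding P_def by blast
  define I where "I = (\<lambda>r. r \<noteq> 0 \<and> (\<exists>s t. poly_over M s \<and> poly_over M t \<and> r = s * p + t * q))"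
  have "I q" unfolding I_def using p(3) poly_over_0[OF M] poly_over_1[OF M]
    by (metis add_0 mult_1 mult_zero_left poly_0)
  then obtain r where r: "I r" "\<And>r'. I r' \<Longrightarrow> degree r \<le> degree r'"
    using arg_min_nat_lemma[of I q degree] by blast
  then obtain s t where st: "r \<noteq> 0" "poly_over M s" "poly_over M t" "r = s * p + t * q"
    unfolding I_def by blast
  have ro: "poly_over M r" unfolding st(4) using st p M by (intro poly_over_add poly_over_mult)
  have dvd: "\<exists>a. poly_over M a \<and> w = r * a"
    if w: "poly_over M w" "\<exists>s t. poly_over M s \<and> poly_over M t \<and> w = s * p + t * q" for w
  proof -
    obtain a e where ae: "poly_over M a" "poly_over M e" "w = r * a + e" "e = 0 \<or> degree e < degree r"
      using poly_over_division[OF M ro st(1) w(1)] by blast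
    obtain s' t' where w': "poly_over M s'" "poly_over M t'" "w = s' * p + t' * q" using w(2) by blast
    have "e = w - r * a" using ae(3) by simp
    also have "\<dots> = (s' - s * a) * p + (t' - t * a) * q" unfolding st(4) w'(3) by (simp add: algebra_simps)
    finally have e: "e = (s' - s * a) * p + (t' - t * a) * q" .
    have "poly_over M (s' - s * a)" "poly_over M (t' - t * a)"
      using w' st ae M by (auto intro: poly_over_diff poly_over_mult)
    then have "e \<noteq> 0 \<Longrightarrow> I e" unfolding I_def using e by blast
    then have "e = 0" using r(2) ae(4) by fastforce
    then show ?thesis using ae by auto
  qed
  obtain p' where p': "poly_over M p'" "p = r * p'"
    using dvd[OF p(1)] poly_over_0[OF M] poly_over_1[OF M] by (metis add.right_neutral mult_1 mult_zero_left)
  obtain q' where q': "poly_over M q'" "q = r * q'"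
    using dvd[OF p(2)] poly_over_0[OF M] poly_over_1[OF M] by (metis add_0 mult_1 mult_zero_left)
  have nz: "poly r x \<noteq> 0" "poly q' x \<noteq> 0" using p(3) q'(2) by auto
  have "P q'" unfolding P_def using p' q' nz p(4) by (intro exI[of _ p']) simp
  then have "degree q \<le> degree q'" by (rule q(2))
  moreover have "q' \<noteq> 0" using nz by auto
  ultimately have "degree r = 0" using st(1) q'(2) by (simp add: degree_mult_eq)
  then obtain c where c: "r = [:c:]" by (auto elim: degree_eq_zeroE)
  then have cM: "c \<in> M" "c \<noteq> 0" using poly_overD[OF ro, of 0] st(1) by auto
  have "smult (inverse c) s * p + smult (inverse c) t * q = smult (inverse c) r"
    unfolding st(4) by (simp add: smult_add_right)
  also have "\<dots> = 1" using c cM by (simp add: one_pCons)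
  finally have "smult (inverse c) s * p + smult (inverse c) t * q = 1" .
  moreover have "poly_over M (smult (inverse c) s)" "poly_over M (smult (inverse c) t)"
    using st cM M by (auto intro!: poly_over_smult subfield_inverse)
  ultimately show ?thesis using p by blast
qed

lemma common_denominator:
  fixes x :: "'a::field" and n :: nat
  assumes M: "is_subfield M" and z: "\<And>i. i \<le> n \<Longrightarrow> z i \<in> field_adjoin M {x}"
  shows "\<exists>d A. poly_over M d \<and> poly d x \<noteq> 0 \<and> (\<forall>i\<le>n. poly_over M (A i) \<and> z i = poly (A i) x / poly d x)"
  using z
proof (induction n)
  case 0
  obtain p q where "poly_over M p" "poly_over M q" "poly q x \<noteq> 0" "z 0 = poly p x / poly q x"
    using adjoin_singleton_quotient[OF M 0[of 0]] by blast
  then show ?case by (intro exI[of _ q] exI[of _ "\<lambda>_. p"]) simp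
next
  case (Suc n)
  have "\<exists>d A. poly_over M d \<and> poly d x \<noteq> 0 \<and> (\<forall>i\<le>n. poly_over M (A i) \<and> z i = poly (A i) x / poly d x)"
    by (rule Suc.IH) (simp add: Suc.prems)
  then obtain d A where d: "poly_over M d" "poly d x \<noteq> 0"
    and A: "\<And>i. i \<le> n \<Longrightarrow> poly_over M (A i) \<and> z i = poly (A i) x / poly d x" by blast
  obtain p q where pq: "poly_over M p" "poly_over M q" "poly q x \<noteq> 0" "z (Suc n) = poly p x / poly q x"
    using adjoin_singleton_quotient[OF M Suc.prems[of "Suc n"]] by blast
  let ?A = "\<lambda>i. if i \<le> n then A i * q else p * d"
  have "poly_over M (?A i) \<and> z i = poly (?A i) x / poly (d * q) x" if "i \<le> Suc n" for i
  proof (cases "i \<le> n")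
    case True
    then show ?thesis using A[OF True] pq M by (auto intro: poly_over_mult)
  next
    case False
    then have "i = Suc n" using that by simp
    then show ?thesis using pq d M by (auto intro: poly_over_mult)
  qed
  moreover have "poly_over M (d * q)" "poly (d * q) x \<noteq> 0" using d pq M by (auto intro: poly_over_mult)
  ultimately show ?case by (intro exI[of _ "d * q"] exI[of _ ?A]) blast
qed

text \<open>The coefficients of a bivariate polynomial are polynomials in the first variable;
  \<open>ev1 a\<close> specialises that variable.\<close>

definition ev1 :: "'a::comm_ring_1 \<Rightarrow> 'a poly poly \<Rightarrow> 'a poly" where
  "ev1 a B = map_poly (\<lambda>q. poly q a) B"

lemma coeff_ev1: "coeff (ev1 a B) i = poly (coeff B i) a"
  by (simp add: ev1_def coeff_map_poly)

lemma ev1_mult: "ev1 a (B * C) = ev1 a B * ev1 a C"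
  by (rule poly_eqI) (simp add: coeff_ev1 coeff_mult poly_sum)

lemma ev1_diff: "ev1 a (B - C) = ev1 a B - ev1 a C"
  by (rule poly_eqI) (simp add: coeff_ev1)

lemma ev1_smult: "ev1 a (smult q B) = smult (poly q a) (ev1 a B)"
  by (rule poly_eqI) (simp add: coeff_ev1)

text \<open>With inner variable \<open>X\<close> and outer variable \<open>Y\<close> this is
  \<open>p(Y)\<close>, whereas a scalar \<open>q\<close> in \<open>smult q\<close> stands for
  \<open>q(X)\<close>.\<close>

definition lift_outer :: "'a::comm_ring_1 poly \<Rightarrow> 'a poly poly" where
  "lift_outer p = map_poly (\<lambda>c. [:c:]) p"

lemma coeff_lift_outer: "coeff (lift_outer p) i = [:coeff p i:]"
  by (simp add: lift_outer_def coeff_map_poly)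

lemma ev1_lift_outer: "ev1 a (lift_outer p) = p"
  by (rule poly_eqI) (simp add: coeff_ev1 coeff_lift_outer)

text \<open>Gauss' lemma, by induction over the roots of \<open>h\<close>.\<close>

lemma gauss_cancel:
  fixes D B C :: "'a::alg_closed_field poly poly"
  assumes prim: "\<And>a. ev1 a D \<noteq> 0" and h: "h \<noteq> 0" and eq: "smult h B = D * C"
  shows "\<exists>C'. B = D * C'"
  using h eq
proof (induction "degree h" arbitrary: h C)
  case 0
  then obtain c where c: "h = [:c:]" "c \<noteq> 0" by (metis degree_eq_zeroE pCons_0_0)
  have "B = smult [:inverse c:] (smult h B)" using c by (simp add: one_pCons[symmetric])
  also have "\<dots> = D * smult [:inverse c:] C" unfolding 0(3) by simp
  finally show ?case by blast
next
  case (Suc n)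
  then obtain a where a: "poly h a = 0" using alg_closed_imp_poly_has_root[of h] by auto
  then obtain h1 where h1: "h = [:- a, 1:] * h1" using poly_eq_0_iff_dvd[of h a] by (auto elim: dvdE)
  \<comment> \<open>At a root \<open>a\<close> of \<open>h\<close> the product vanishes;
    \<open>D\<close> does not, so \<open>X - a\<close> divides all coefficients of
    \<open>C\<close>.\<close>
  have "ev1 a D * ev1 a C = 0"
    unfolding ev1_mult[symmetric] Suc(4)[symmetric] ev1_smult a by simp
  then have "ev1 a C = 0" using prim[of a] by simp
  then have "poly (coeff C i) a = 0" for i by (metis coeff_0 coeff_ev1)
  then have "[:- a, 1:] dvd coeff C i" for i by (simp add: poly_eq_0_iff_dvd)
  then have ex: "\<forall>i. \<exists>c. coeff C i = [:- a, 1:] * c" unfolding dvd_def by blast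
  define C1 where "C1 = map_poly (\<lambda>c. c div [:- a, 1:]) C"
  have C: "C = smult [:- a, 1:] C1"
  proof (rule poly_eqI)
    fix i
    obtain c where c: "coeff C i = [:- a, 1:] * c" using ex by blast
    have "coeff C i div [:- a, 1:] = c" unfolding c by (rule nonzero_mult_div_cancel_left) simp
    then have "coeff C1 i = c" by (simp add: C1_def coeff_map_poly)
    then show "coeff C i = coeff (smult [:- a, 1:] C1) i" by (simp only: coeff_smult c)
  qed
  have "smult [:- a, 1:] (smult h1 B) = smult [:- a, 1:] (D * C1)"
    using Suc(4) unfolding h1 C by simp
  then have eq1: "smult h1 B = D * C1" by (metis one_neq_zero pCons_eq_0_iff smult_cancel)
  have "h1 \<noteq> 0" using Suc(3) h1 by auto
  moreover from this have "degree h = Suc (degree h1)" unfolding h1 by (subst degree_mult_eq) auto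
  then have "n = degree h1" using Suc(2) by simp
  ultimately show ?case using Suc(1)[OF _ _ eq1] by blast
qed

lemma coeff_mult_bounds:
  fixes p q :: "'a::idom poly"
  assumes "degree p \<le> e" "degree q \<le> l"
  shows "coeff (p * q) (e + l) = coeff p e * coeff q l"
proof (cases "degree p = e \<and> degree q = l")
  case True
  then show ?thesis using coeff_mult_degree_sum[of p q] by auto
next
  case False
  then have lt: "degree p < e \<or> degree q < l" using assms by auto
  then have "degree p + degree q < e + l" using assms by auto
  then have "degree (p * q) < e + l" using degree_mult_le[of p q] by linarith
  moreover have "coeff p e = 0 \<or> coeff q l = 0" using lt coeff_eq_0 by blast
  ultimately show ?thesis by (auto simp: coeff_eq_0)
qed

text \<open>Leading terms in \<open>X\<close>: collecting the coefficients of \<open>X^e\<close> in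
  \<open>D\<close> and of \<open>X^l\<close> in \<open>C\<close> gives two nonzero polynomials in
  \<open>Y\<close>, and their product collects those of \<open>X^(e+l)\<close> in
  \<open>D * C\<close>.\<close>

lemma inner_degree_mult:
  fixes D C :: "'a::idom poly poly"
  assumes D: "\<And>i. degree (coeff D i) \<le> e" "coeff (coeff D i0) e \<noteq> 0"
    and C: "\<And>i. degree (coeff C i) \<le> l" "coeff (coeff C j0) l \<noteq> 0"
  shows "\<exists>i. coeff (coeff (D * C) i) (e + l) \<noteq> 0"
proof (rule ccontr)
  assume no: "\<not> ?thesis"
  let ?T = "\<lambda>k. map_poly (\<lambda>q. coeff q k)"
  have "?T e D * ?T l C = 0"
  proof (rule poly_eqI)
    fix i
    have "coeff (?T e D * ?T l C) i = (\<Sum>j\<le>i. coeff (coeff D j * coeff C (i - j)) (e + l))"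
      by (simp add: coeff_mult[of "?T e D"] coeff_map_poly coeff_mult_bounds[OF D(1) C(1)])
    also have "\<dots> = coeff (coeff (D * C) i) (e + l)"
      by (simp add: coeff_mult[of D C] coeff_sum)
    finally show "coeff (?T e D * ?T l C) i = coeff 0 i" using no by simp
  qed
  moreover have "?T e D \<noteq> 0" "?T l C \<noteq> 0"
    using D(2) C(2) by (metis coeff_0 coeff_map_poly)+
  ultimately show False by simp
qed

lemma inner_degree_attained:
  fixes C :: "'a::idom poly poly"
  assumes "C \<noteq> 0"
  shows "\<exists>l j. (\<forall>i. degree (coeff C i) \<le> l) \<and> coeff (coeff C j) l \<noteq> 0 \<and> degree (coeff C j) = l"
proof -
  define S where "S = (\<lambda>i. degree (coeff C i)) ` {i. coeff C i \<noteq> 0}"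
  have fin: "finite S"
    unfolding S_def by (rule finite_imageI, rule finite_subset[of _ "{..degree C}"]) (auto intro: le_degree)
  have ne: "S \<noteq> {}" unfolding S_def using assms leading_coeff_0_iff by blast
  have "Max S \<in> S" by (rule Max_in[OF fin ne])
  then obtain j where j: "coeff C j \<noteq> 0" "degree (coeff C j) = Max S" unfolding S_def by force
  have "degree (coeff C i) \<le> Max S" for i
  proof (cases "coeff C i = 0")
    case False
    then show ?thesis using fin by (intro Max_ge) (auto simp: S_def)
  qed simp
  then show ?thesis using j by (metis leading_coeff_0_iff)
qed

text \<open>Let \<open>f\<close> be the minimal polynomial of \<open>x\<close> over \<open>H\<close>
  and \<open>c = P(x)/Q(x)\<close> one of its coefficients outside \<open>M\<close>. Then
  \<open>f\<close> divides \<open>P(Y) - c Q(Y)\<close>, and a comparison of degrees in both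
  variables gives \<open>[M(x) : M(c)] \<le> max (deg P) (deg Q) \<le> deg f\<close>, whence
  \<open>H = M(c)\<close>. Over an algebraically closed field one can argue with roots instead of
  irreducible factors.\<close>

theorem lueroth_alg_closed:
  fixes x :: "'a::{alg_closed_field, field_char_0}"
  assumes M: "is_subfield M" and H: "is_subfield H" "M \<subset> H" "H \<subseteq> field_adjoin M {x}"
    and x: "\<not> algebraic_over M x"
  shows "\<exists>c\<in>H. H = field_adjoin M {c}"
proof -
  have tr: "p = 0" if "poly_over M p" "poly p x = 0" for p
    using that x unfolding algebraic_over_def poly_over_def by blast
  have nonconst: "P - smult c Q \<noteq> 0" if "c \<notin> M" "poly_over M P" "poly_over M Q" "Q \<noteq> 0" for c P Q
  proof
    assume "P - smult c Q = 0"
    then have "coeff P (degree Q) = c * lead_coeff Q" by (metis coeff_smult eq_iff_diff_eq_0)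
    then have "c = coeff P (degree Q) / lead_coeff Q" using that(4) by simp
    then show False using that M by (auto intro: subfield_divide poly_overD)
  qed
  have killer: "P - smult c Q \<noteq> 0 \<and> poly (P - smult c Q) x = 0"
    if "c \<notin> M" "poly_over M P" "poly_over M Q" "poly Q x \<noteq> 0" "c = poly P x / poly Q x" for c P Q
  proof -
    have "Q \<noteq> 0" using that(4) by auto
    then show ?thesis using nonconst[OF that(1-3)] that(4,5) by simp
  qed
  have algH: "algebraic_over L x" if w: "is_subfield L" "M \<subseteq> L" "c \<in> L" "c \<notin> M" "c \<in> field_adjoin M {x}" for L c
  proof -
    obtain P Q where PQ: "poly_over M P" "poly_over M Q" "poly Q x \<noteq> 0" "c = poly P x / poly Q x"
      using adjoin_singleton_quotient[OF M w(5)] by blast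
    have "poly_over L (P - smult c Q)"
      using w(1,3) poly_over_mono[OF PQ(1) w(2)] poly_over_mono[OF PQ(2) w(2)]
      by (intro poly_over_diff poly_over_smult)
    then show ?thesis using killer[OF w(4) PQ] unfolding algebraic_over_def poly_over_def by blast
  qed
  obtain h0 where "h0 \<in> H" "h0 \<notin> M" using H(2) by blast
  then have "algebraic_over H x" using algH[of H h0] H by blast
  then obtain f where f: "min_poly H x f" using min_poly_exists[OF H(1)] by blast
  define k where "k = degree f"
  have fo: "poly_over H f" "poly f x = 0" "coeff f k = 1" "f \<noteq> 0" using f by (auto simp: min_poly_def k_def)
  have "\<exists>i. coeff f i \<notin> M"
  proof (rule ccontr)
    assume "\<not> ?thesis"
    then have "poly_over M f" by (simp add: poly_over_def)
    then show False using tr fo by blast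
  qed
  then obtain i where i: "coeff f i \<notin> M" by blast
  define c where "c = coeff f i"
  have cH: "c \<in> H" "c \<notin> M" using i poly_overD[OF fo(1)] by (auto simp: c_def)
  have ik: "i \<le> k" using cH subfield_zero[OF M] coeff_eq_0[of f i] by (fastforce simp: c_def k_def)
  obtain P Q s t where PQ: "poly_over M P" "poly_over M Q" "poly_over M s" "poly_over M t"
    "s * P + t * Q = 1" "poly Q x \<noteq> 0" "c = poly P x / poly Q x"
    using coprime_quotient[OF M, of c x] cH H(3) by blast
  have Q0: "Q \<noteq> 0" using PQ(6) by auto
  \<comment> \<open>a primitive numerator \<open>D\<close> of \<open>f\<close>: take the common denominator of smallest degree\<close>
  define den where "den = (\<lambda>d. \<exists>A. poly_over M d \<and> poly d x \<noteq> 0 \<and>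
    (\<forall>i\<le>k. poly_over M (A i) \<and> coeff f i = poly (A i) x / poly d x))"
  have "\<exists>d. den d"
    unfolding den_def using common_denominator[OF M, of k "coeff f" x] H(3) poly_overD[OF fo(1)] by blast
  then obtain d0 where "den d0" by blast
  then obtain d where d: "den d" "\<And>d'. den d' \<Longrightarrow> degree d \<le> degree d'"
    using arg_min_nat_lemma[of den d0 degree] by blast
  then obtain A where A: "poly_over M d" "poly d x \<noteq> 0"
    "\<And>i. i \<le> k \<Longrightarrow> poly_over M (A i)" "\<And>i. i \<le> k \<Longrightarrow> coeff f i = poly (A i) x / poly d x"
    unfolding den_def by blast
  \<comment> \<open>\<open>f\<close> is monic, so the numerator of its leading coefficient is the
    denominator.\<close>
  have Ak: "A k = d"
  proof -
    have "poly (A k) x = poly d x" using A(4)[of k] fo(3) A(2) by simp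
    then show ?thesis using tr[of "A k - d"] A(3)[of k] A(1) poly_over_diff[OF M] by simp
  qed
  define D where "D = (\<Sum>j\<le>k. monom (A j) j)"
  have cD: "coeff D j = (if j \<le> k then A j else 0)" for j
    by (simp add: D_def coeff_sum)
  have D0: "D \<noteq> 0"
  proof
    assume "D = 0"
    then have "d = 0" using cD[of k] Ak by simp
    then show False using A(2) by simp
  qed
  have degD: "degree D = k"
  proof (rule antisym)
    show "degree D \<le> k" by (rule degree_le) (simp add: cD)
    show "k \<le> degree D" using A(2) Ak by (intro le_degree) (auto simp: cD)
  qed
  have evD: "ev1 x D = smult (poly d x) f"
  proof (rule poly_eqI)
    fix j
    show "coeff (ev1 x D) j = coeff (smult (poly d x) f) j"
      using A(2) A(4)[of j] coeff_eq_0[of f j] by (cases "j \<le> k") (auto simp: coeff_ev1 cD k_def)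
  qed
  have prim: "ev1 a D \<noteq> 0" for a
  proof
    assume a: "ev1 a D = 0"
    \<comment> \<open>the ideal of \<open>M[X]\<close> generated by the \<open>A j\<close> is principal\<close>
    define I where "I = (\<lambda>r. r \<noteq> 0 \<and> (\<exists>s. (\<forall>j\<le>k. poly_over M (s j)) \<and> r = (\<Sum>j\<le>k. s j * A j)))"
    have Ij: "\<exists>s. (\<forall>j\<le>k. poly_over M (s j)) \<and> A j = (\<Sum>j\<le>k. s j * A j)" if "j \<le> k" for j
    proof -
      have "(\<Sum>l\<le>k. (if l = j then 1 else 0) * A l) = (\<Sum>l\<le>k. if l = j then A l else 0)"
        by (intro sum.cong) auto
      also have "\<dots> = A j" using that by simp
      finally show ?thesis using poly_over_0[OF M] poly_over_1[OF M]
        by (intro exI[of _ "\<lambda>l. if l = j then 1 else 0"]) auto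
    qed
    have "I d" unfolding I_def using Ij[of k] Ak A(2) by auto
    then obtain r where r: "I r" "\<And>r'. I r' \<Longrightarrow> degree r \<le> degree r'"
      using arg_min_nat_lemma[of I d degree] by blast
    then obtain s where s: "r \<noteq> 0" "\<And>j. j \<le> k \<Longrightarrow> poly_over M (s j)" "r = (\<Sum>j\<le>k. s j * A j)"
      unfolding I_def by blast
    have sum_over: "poly_over M (\<Sum>j\<le>k. w j * A j)" if "\<And>j. j \<le> k \<Longrightarrow> poly_over M (w j)" for w
    proof -
      have "poly_over M (\<Sum>j\<in>S. w j * A j)" if "finite S" "S \<subseteq> {..k}" for S
        using that \<open>\<And>j. j \<le> k \<Longrightarrow> poly_over M (w j)\<close> A(3)
        by (induction S rule: finite_induct) (auto intro!: poly_over_0[OF M] poly_over_add[OF M] poly_over_mult[OF M])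
      then show ?thesis by simp
    qed
    have ro: "poly_over M r" unfolding s(3) by (rule sum_over) (rule s(2))
    have dvd: "\<exists>a. poly_over M a \<and> A j = r * a" if j: "j \<le> k" for j
    proof -
      obtain a e where ae: "poly_over M a" "poly_over M e" "A j = r * a + e" "e = 0 \<or> degree e < degree r"
        using poly_over_division[OF M ro s(1) A(3)[OF j]] by blast
      obtain w where w: "\<And>j. j \<le> k \<Longrightarrow> poly_over M (w j)" "A j = (\<Sum>j\<le>k. w j * A j)" using Ij[OF j] by blast
      have "e = A j - r * a" using ae(3) by simp
      also have "\<dots> = (\<Sum>j\<le>k. (w j - s j * a) * A j)"
        unfolding s(3) by (subst w(2)) (simp add: sum_distrib_left sum_subtractf algebra_simps)
      finally have e: "e = (\<Sum>j\<le>k. (w j - s j * a) * A j)" .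
      have "\<forall>j\<le>k. poly_over M (w j - s j * a)"
        using w(1) s(2) ae(1) by (simp add: poly_over_diff[OF M] poly_over_mult[OF M])
      then have Ie: "e \<noteq> 0 \<Longrightarrow> I e" unfolding I_def using e by (intro conjI exI[of _ "\<lambda>j. w j - s j * a"])
      have "e = 0"
      proof (rule ccontr)
        assume "e \<noteq> 0"
        then have "degree r \<le> degree e" using r(2) Ie by simp
        then show False using ae(4) \<open>e \<noteq> 0\<close> by simp
      qed
      then show ?thesis using ae by auto
    qed
    then obtain A' where A': "\<And>j. j \<le> k \<Longrightarrow> poly_over M (A' j) \<and> A j = r * A' j" by metis
    have "poly d x = poly r x * poly (A' k) x" using A'[of k] Ak by (metis le_refl poly_mult)
    then have rx: "poly r x \<noteq> 0" "poly (A' k) x \<noteq> 0" using A(2) by auto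
    have "den (A' k)"
      unfolding den_def
    proof (intro exI[of _ A'] conjI allI impI)
      fix j assume j: "j \<le> k"
      show "coeff f j = poly (A' j) x / poly (A' k) x"
      proof -
        have "poly d x = poly r x * poly (A' k) x" using A'[of k] Ak by (metis le_refl poly_mult)
        moreover have "poly (A j) x = poly r x * poly (A' j) x" using A'[OF j] by (metis poly_mult)
        ultimately show ?thesis using A(4)[OF j] rx by simp
      qed
      show "poly_over M (A' j)" using A'[OF j] by blast
    next
      show "poly_over M (A' k)" using A'[of k] by blast
      show "poly (A' k) x \<noteq> 0" by (rule rx(2))
    qed
    then have "degree d \<le> degree (A' k)" by (rule d(2))
    moreover have "degree d = degree r + degree (A' k)"
      using A'[of k] Ak s(1) rx by (metis degree_mult_eq le_refl poly_0)
    ultimately have "degree r = 0" by simp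
    then obtain c0 where c0: "r = [:c0:]" by (auto elim: degree_eq_zeroE)
    have "poly (A j) a = 0" if "j \<le> k" for j using a that by (metis cD coeff_0 coeff_ev1)
    then have "poly r a = 0" unfolding s(3) by (simp add: poly_sum)
    then show False using c0 s(1) by simp
  qed
  \<comment> \<open>\<open>B\<close> is \<open>Q(X) P(Y) - P(X) Q(Y)\<close>; at
    \<open>X = x\<close> it becomes \<open>Q(x)\<close> times \<open>P - c Q\<close>, a multiple of
    \<open>f\<close>.\<close>
  define B where "B = smult Q (lift_outer P) - smult P (lift_outer Q)"
  have evB: "ev1 a B = smult (poly Q a) P - smult (poly P a) Q" for a
    by (simp add: B_def ev1_diff ev1_smult ev1_lift_outer)
  have cB: "coeff B j = smult (coeff P j) Q - smult (coeff Q j) P" for j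
    by (simp add: B_def coeff_lift_outer)
  have Bo: "poly_over M (coeff B j)" for j
    unfolding cB using PQ M by (intro poly_over_diff poly_over_smult) (auto intro: poly_overD)
  obtain a where a: "poly_over H a" "P - smult c Q = f * a"
  proof -
    have "poly_over H (P - smult c Q)"
      using cH(1) H(1) poly_over_mono[OF PQ(1)] poly_over_mono[OF PQ(2)] H(2)
      by (intro poly_over_diff poly_over_smult) blast+
    moreover have "poly (P - smult c Q) x = 0" using PQ(6,7) by simp
    ultimately show ?thesis using min_poly_dvd[OF H(1) f] that by blast
  qed
  obtain e A2 where e: "poly_over M e" "poly e x \<noteq> 0"
    and A2: "\<And>i. i \<le> degree a \<Longrightarrow> poly_over M (A2 i) \<and> coeff a i = poly (A2 i) x / poly e x"
    using common_denominator[OF M, of "degree a" "coeff a" x] H(3) poly_overD[OF a(1)] by blast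
  define C2 where "C2 = (\<Sum>j\<le>degree a. monom (A2 j) j)"
  have cC2: "coeff C2 j = (if j \<le> degree a then A2 j else 0)" for j
    by (simp add: C2_def coeff_sum)
  have evC2: "ev1 x C2 = smult (poly e x) a"
  proof (rule poly_eqI)
    fix j
    show "coeff (ev1 x C2) j = coeff (smult (poly e x) a) j"
      using e(2) A2[of j] coeff_eq_0[of a j] by (cases "j \<le> degree a") (auto simp: coeff_ev1 cC2)
  qed
  \<comment> \<open>The coefficients with respect to \<open>Y\<close> are polynomials in
    \<open>X\<close> over \<open>M\<close>, so equality may be tested at the transcendental
    \<open>x\<close>.\<close>
  have "smult (d * e) B = D * smult Q C2"
  proof -
    let ?Z = "smult (d * e) B - D * smult Q C2"
    have "ev1 x ?Z = smult (poly d x * poly e x * poly Q x) (P - smult c Q) - smult (poly d x * poly e x * poly Q x) (f * a)"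
      using PQ(6,7) unfolding ev1_diff ev1_mult ev1_smult evB evD evC2
      by (simp add: smult_diff_right mult_ac)
    then have "ev1 x ?Z = 0" using a(2) by simp
    then have "poly (coeff ?Z j) x = 0" for j by (metis coeff_0 coeff_ev1)
    moreover have "poly_over M (coeff ?Z j)" for j
    proof -
      have "poly_over M (coeff D l)" "poly_over M (coeff (smult Q C2) l)" for l
        using A(3)[of l] A2[of l] PQ(2) by (simp_all add: cD cC2 poly_over_0[OF M] poly_over_mult[OF M])
      then have "poly_over M (\<Sum>l\<in>S. coeff D l * coeff (smult Q C2) (j - l))" for S
        by (induction S rule: infinite_finite_induct)
          (simp_all add: poly_over_0[OF M] poly_over_add[OF M] poly_over_mult[OF M])
      then have "poly_over M (coeff (D * smult Q C2) j)" unfolding coeff_mult .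
      moreover have "poly_over M (coeff (smult (d * e) B) j)"
        using Bo A(1) e(1) M by (simp add: poly_over_mult)
      ultimately show ?thesis unfolding coeff_diff by (rule poly_over_diff[OF M, rotated])
    qed
    ultimately have "coeff ?Z j = 0" for j using tr by blast
    then have "?Z = 0" by (intro poly_eqI) simp
    then show ?thesis by simp
  qed
  moreover have "d * e \<noteq> 0" using A(2) e(2) by auto
  ultimately obtain C where C: "B = D * C" using gauss_cancel[OF prim] by blast
  \<comment> \<open>If \<open>P\<close> and \<open>Q\<close> were proportional, \<open>c\<close>
    would lie in \<open>M\<close>.\<close>
  have nonprop: False if "smult u Q = smult w P" "u \<noteq> 0 \<or> w \<noteq> 0" for u w
  proof -
    have "w \<noteq> 0"
    proof
      assume "w = 0"
      then have "smult u Q = 0" "u \<noteq> 0" using that by auto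
      then show False using Q0 by simp
    qed
    have "poly (smult u Q) x = poly (smult w P) x" using that by simp
    have "coeff P (degree Q) = u / w * lead_coeff Q"
      using that(1) \<open>w \<noteq> 0\<close> by (metis coeff_smult nonzero_mult_div_cancel_left times_divide_eq_left)
    then have "u / w = coeff P (degree Q) / lead_coeff Q" using Q0 by simp
    then have "u / w \<in> M" using PQ(1,2) M by (auto intro: subfield_divide poly_overD)
    moreover have "c = u / w"
      using \<open>poly (smult u Q) x = poly (smult w P) x\<close> PQ(6) \<open>w \<noteq> 0\<close> unfolding PQ(7)
      by (simp add: frac_eq_eq mult.commute)
    ultimately show False using cH by simp
  qed
  define m where "m = max (degree P) (degree Q)"
  have Bdeg: "degree (coeff B j) \<le> m" for j
    unfolding cB m_def by (intro degree_diff_le order_trans[OF degree_smult_le]) auto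
  have cBm: "coeff B m \<noteq> 0"
  proof
    assume "coeff B m = 0"
    then have "smult (coeff P m) Q = smult (coeff Q m) P" unfolding cB by simp
    moreover have "coeff P m \<noteq> 0 \<or> coeff Q m \<noteq> 0"
    proof (cases "degree Q \<le> degree P")
      case True
      have "P \<noteq> 0"
      proof
        assume "P = 0"
        then have "c = 0" using PQ(7) by simp
        then show False using cH(2) subfield_zero[OF M] by simp
      qed
      then show ?thesis using True by (simp add: m_def max_def)
    next
      case False
      then show ?thesis using Q0 by (simp add: m_def max_def)
    qed
    ultimately show False by (rule nonprop)
  qed
  then have B0: "B \<noteq> 0" by auto
  then have C0: "C \<noteq> 0" using C by auto
  \<comment> \<open>\<open>D\<close> has the full degree in the first variable\<close>
  have AQ: "A i * Q = d * P"
  proof -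
    have "poly (A i * Q - d * P) x = 0"
      using A(4)[OF ik] PQ(6,7) A(2) unfolding c_def[symmetric] by (simp add: field_simps)
    moreover have "poly_over M (A i * Q - d * P)"
      using A(1) A(3)[OF ik] PQ M by (intro poly_over_diff poly_over_mult)
    ultimately show ?thesis using tr by fastforce
  qed
  \<comment> \<open>Coprimality of \<open>P\<close> and \<open>Q\<close> turns
    \<open>A i * Q = d * P\<close> into divisibility: \<open>Q\<close> divides \<open>d\<close>, and
    \<open>P\<close> divides \<open>A i\<close>.\<close>
  have dQ: "d = Q * (s * A i + t * d)"
  proof -
    have "d = d * (s * P + t * Q)" using PQ(5) by simp
    also have "\<dots> = s * (A i * Q) + t * d * Q" unfolding AQ by (simp add: algebra_simps)
    finally show ?thesis by (simp add: algebra_simps)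
  qed
  have AP: "A i = P * (s * A i + t * d)"
  proof -
    have "A i = A i * (s * P + t * Q)" using PQ(5) by simp
    also have "\<dots> = A i * s * P + t * (d * P)" unfolding AQ[symmetric] by (simp add: algebra_simps)
    finally show ?thesis by (simp add: algebra_simps)
  qed
  have g0: "s * A i + t * d \<noteq> 0" using dQ A(2) by auto
  have "degree Q \<le> degree d" using dQ g0 Q0 by (metis degree_mult_eq le_add1)
  moreover have "degree P \<le> degree (A i)" using AP g0 by (metis degree_mult_eq degree_0 le_add1 le0)
  ultimately have Dm: "\<exists>j. degree (coeff D j) \<ge> m"
    using ik unfolding m_def by (metis cD Ak le_refl max_def)
  obtain e1 j1 where e1: "\<And>i. degree (coeff D i) \<le> e1" "coeff (coeff D j1) e1 \<noteq> 0"
    using inner_degree_attained[OF D0] by blast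
  obtain l1 j2 where l1: "\<And>i. degree (coeff C i) \<le> l1" "coeff (coeff C j2) l1 \<noteq> 0"
    using inner_degree_attained[OF C0] by blast
  obtain j3 where "coeff (coeff B j3) (e1 + l1) \<noteq> 0" using inner_degree_mult[OF e1 l1] C by blast
  \<comment> \<open>Degrees in \<open>X\<close> add up; \<open>B\<close> has at most
    \<open>m\<close> and \<open>D\<close> at least \<open>m\<close>, so the cofactor
    \<open>C\<close> is free of \<open>X\<close>.\<close>
  then have "e1 + l1 \<le> m" using Bdeg[of j3] le_degree le_trans by blast
  moreover have "m \<le> e1" using Dm e1(1) le_trans by blast
  ultimately have "l1 = 0" by simp
  then have Cc: "degree (coeff C j) = 0" for j using l1(1) by simp
  have evC: "ev1 b C = ev1 0 C" for b
  proof (rule poly_eqI)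
    fix j
    obtain u where "coeff C j = [:u:]" using Cc[of j] by (auto elim: degree_eq_zeroE)
    then show "coeff (ev1 b C) j = coeff (ev1 0 C) j" by (simp add: coeff_ev1)
  qed
  have "degree C = 0"
  proof (rule ccontr)
    assume "degree C \<noteq> 0"
    moreover have "degree (ev1 0 C) = degree C"
    proof (rule antisym)
      show "degree (ev1 0 C) \<le> degree C" by (rule degree_le) (simp add: coeff_ev1 coeff_eq_0)
      obtain u where u: "coeff C (degree C) = [:u:]" using Cc[of "degree C"] by (auto elim: degree_eq_zeroE)
      then have "u \<noteq> 0" using C0 by auto
      then show "degree C \<le> degree (ev1 0 C)" using u by (intro le_degree) (simp add: coeff_ev1)
    qed
    ultimately obtain z where z: "poly (ev1 0 C) z = 0" using alg_closed_imp_poly_has_root[of "ev1 0 C"] by auto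
    \<comment> \<open>A root \<open>z\<close> of the cofactor makes \<open>B(b, z) = 0\<close> for
      every \<open>b\<close>. As \<open>P(z)\<close> and \<open>Q(z)\<close> do not both vanish,
      \<open>P\<close> and \<open>Q\<close> would be proportional.\<close>
    have "poly Q b * poly P z = poly P b * poly Q z" for b
    proof -
      have "ev1 b B = ev1 b D * ev1 0 C" using C evC[of b] by (simp add: ev1_mult)
      then have "poly (ev1 b B) z = 0" using z by simp
      then show ?thesis unfolding evB by simp
    qed
    then have "poly (smult (poly P z) Q) b = poly (smult (poly Q z) P) b" for b by (simp add: mult.commute)
    then have "smult (poly P z) Q = smult (poly Q z) P" by (intro poly_eq_poly_eq_iff[THEN iffD1] ext)
    moreover have "poly P z \<noteq> 0 \<or> poly Q z \<noteq> 0"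
    proof (rule ccontr)
      assume "\<not> ?thesis"
      then have "poly (s * P + t * Q) z = 0" by simp
      then show False unfolding PQ(5) by simp
    qed
    ultimately show False by (rule nonprop)
  qed
  then have "degree B = k" using C C0 D0 degD by (simp add: degree_mult_eq)
  then have mk: "m \<le> k" using cBm le_degree by blast
  define L where "L = field_adjoin M {c}"
  have L: "is_subfield L" "M \<subseteq> L" "c \<in> L"
    using is_subfield_adjoin adjoin_base[of M "{c}"] adjoin_gens[of "{c}" M] by (auto simp: L_def)
  have LH: "L \<subseteq> H" unfolding L_def using H cH by (intro adjoin_least) auto
  have cx: "c \<in> field_adjoin M {x}" using cH H by blast
  obtain f1 where f1: "min_poly L x f1"
    using min_poly_exists[OF L(1) algH[OF L cH(2) cx]] by blast
  have "degree f1 \<le> degree (P - smult c Q)"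
  proof -
    have "poly_over L (P - smult c Q)"
      using L(1,3) poly_over_mono[OF PQ(1) L(2)] poly_over_mono[OF PQ(2) L(2)]
      by (intro poly_over_diff poly_over_smult)
    then show ?thesis using f1 killer[OF cH(2) PQ(1,2,6,7)] unfolding min_poly_def by blast
  qed
  also have "\<dots> \<le> m" unfolding m_def by (intro degree_diff_le order_trans[OF degree_smult_le]) auto
  finally have f1k: "degree f1 \<le> k" using mk by simp
  \<comment> \<open>An element \<open>g\<close> of \<open>H\<close> is a polynomial in
    \<open>x\<close> over \<open>L\<close> of degree below \<open>k\<close>. Subtracting
    \<open>g\<close> gives a relation for \<open>x\<close> over \<open>H\<close> of degree below
    \<open>k\<close>, which must be trivial.\<close>
  have "H \<subseteq> L"
  proof
    fix g assume g: "g \<in> H"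
    have "field_adjoin M {x} \<subseteq> field_adjoin L {x}" using L(2) by (intro adjoin_mono) auto
    then have "g \<in> field_adjoin L {x}" using g H(3) by blast
    then obtain r where r: "poly_over L r" "degree r < degree f1" "g = poly r x"
      using adjoin_algebraic_poly[OF L(1) f1] by blast
    have "poly_over H [:g:]" using g H(1) by (intro poly_over_pCons poly_over_0)
    then have "poly_over H (r - [:g:])" using poly_over_mono[OF r(1) LH] by (intro poly_over_diff[OF H(1)])
    moreover have "poly (r - [:g:]) x = 0" using r(3) by simp
    moreover have "degree (r - [:g:]) < degree f"
    proof -
      have "degree (r - [:g:]) \<le> degree r" by (intro degree_diff_le) auto
      then show ?thesis using r(2) f1k unfolding k_def by simp
    qed
    ultimately have "r - [:g:] = 0" by (rule min_poly_small[OF f])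
    then have "g = coeff r 0" by (metis coeff_pCons_0 eq_iff_diff_eq_0)
    then show "g \<in> L" using poly_overD[OF r(1), of 0] by simp
  qed
  then show ?thesis using LH cH(1) L_def by blast
qed

lemma to_ac_subfield: "is_subfield M \<Longrightarrow> is_subfield (to_ac ` M)"
  unfolding is_subfield_def
proof (intro conjI ballI)
  assume M: "1 \<in> M \<and> (\<forall>x\<in>M. \<forall>y\<in>M. x - y \<in> M \<and> x * y \<in> M) \<and> (\<forall>x\<in>M. inverse x \<in> M)"
  show "1 \<in> to_ac ` M" using M by (intro image_eqI[of _ _ 1]) auto
  fix x y assume "x \<in> to_ac ` M"
  then obtain a where a: "x = to_ac a" "a \<in> M" by blast
  show "inverse x \<in> to_ac ` M" using M a by (intro image_eqI[of _ _ "inverse a"]) auto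
  assume "y \<in> to_ac ` M"
  then obtain b where b: "y = to_ac b" "b \<in> M" by blast
  show "x - y \<in> to_ac ` M" using M a b by (intro image_eqI[of _ _ "a - b"]) auto
  show "x * y \<in> to_ac ` M" using M a b by (intro image_eqI[of _ _ "a * b"]) auto
qed

lemma to_ac_adjoin: "to_ac ` field_adjoin M S = field_adjoin (to_ac ` M) (to_ac ` S)"
proof
  have "is_subfield {z. to_ac z \<in> field_adjoin (to_ac ` M) (to_ac ` S)}"
    using is_subfield_adjoin[of "to_ac ` M" "to_ac ` S"] unfolding is_subfield_def by simp
  then have "field_adjoin M S \<subseteq> {z. to_ac z \<in> field_adjoin (to_ac ` M) (to_ac ` S)}"
    using adjoin_base[of "to_ac ` M" "to_ac ` S"] adjoin_gens[of "to_ac ` S" "to_ac ` M"]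
    by (intro adjoin_least) auto
  then show "to_ac ` field_adjoin M S \<subseteq> field_adjoin (to_ac ` M) (to_ac ` S)" by blast
  show "field_adjoin (to_ac ` M) (to_ac ` S) \<subseteq> to_ac ` field_adjoin M S"
    using adjoin_base[of M S] adjoin_gens[of S M]
    by (intro adjoin_least to_ac_subfield is_subfield_adjoin image_mono)
qed

text \<open>The statement is pulled back from the algebraic closure along the injective embedding.
  \<open>x\<close> remains transcendental there because a derivation that witnesses this
  lifts.\<close>

theorem lueroth:
  fixes x :: "'a::field_char_0"
  assumes M: "is_subfield M" and H: "is_subfield H" "M \<subset> H" "H \<subseteq> field_adjoin M {x}"
    and x: "\<not> algebraic_over M x"
  shows "\<exists>c\<in>H. H = field_adjoin M {c}"
proof -
  have inj: "inj (to_ac :: 'a \<Rightarrow> _)" by (rule inj_to_ac)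
  have na: "\<not> algebraic_over (to_ac ` M) (to_ac x)"
  proof
    assume "algebraic_over (to_ac ` M) (to_ac x)"
    then have d: "to_ac x \<in> dcl (to_ac ` M)" by (simp add: algebraic_over_iff_dcl[OF to_ac_subfield[OF M]])
    obtain D where D: "derivation D" "\<forall>c\<in>M. D c = 0" "D x = 1" using transcendental_derivation[OF M x] by blast
    obtain D' where D': "derivation D'" "\<And>x. D' (to_ac x) = to_ac (D x)" using derivation_lift_ac[OF D(1)] by blast
    have "D' (to_ac x) = 0" by (rule dclD[OF d D'(1)]) (use D(2) D'(2) in auto)
    then show False using D'(2)[of x] D(3) by simp
  qed
  have s1: "to_ac ` M \<subset> to_ac ` H" using H(2) inj by (metis image_strict_mono inj_on_subset subset_UNIV)
  have s2: "to_ac ` H \<subseteq> field_adjoin (to_ac ` M) {to_ac x}"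
    using image_mono[OF H(3), of to_ac] unfolding to_ac_adjoin by simp
  obtain c' where c': "c' \<in> to_ac ` H" "to_ac ` H = field_adjoin (to_ac ` M) {c'}"
    using lueroth_alg_closed[OF to_ac_subfield[OF M] to_ac_subfield[OF H(1)] s1 s2 na] by blast
  then obtain c where c: "c \<in> H" "c' = to_ac c" by blast
  have "to_ac ` H = to_ac ` field_adjoin M {c}" unfolding to_ac_adjoin c'(2) c(2) by simp
  then have "H = field_adjoin M {c}" using inj_image_eq_iff[OF inj] by blast
  then show ?thesis using c(1) by blast
qed

text \<open>Write \<open>x = R(v)/S(v)\<close> and \<open>v = P(x)/Q(x)\<close>. For
  \<open>a\<close> in \<open>F\<close>, the zeros of \<open>R - a S\<close> are the places where
  \<open>x\<close> takes the value \<open>a\<close>, and there \<open>P(a) - v Q(a) = 0\<close>. So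
  \<open>R - a S\<close> divides a polynomial of degree at most one; \<open>a = 0\<close> and
  \<open>a = 1\<close> then bound the degrees of \<open>R\<close> and \<open>S\<close>.\<close>

lemma moebius_of_mutual_generators:
  fixes v x :: "'a::field_char_0"
  assumes F: "is_subfield F" and v: "\<not> algebraic_over F v"
    and xv: "x \<in> field_adjoin F {v}" and vx: "v \<in> field_adjoin F {x}"
  shows "\<exists>a\<in>F. \<exists>b\<in>F. \<exists>c\<in>F. \<exists>d\<in>F. c * v + d \<noteq> 0 \<and> x = (a * v + b) / (c * v + d)"
proof -
  have tr: "p = 0" if "poly_over F p" "poly p v = 0" for p
    using that v unfolding algebraic_over_def poly_over_def by blast
  obtain R S s t where RS: "poly_over F R" "poly_over F S" "s * R + t * S = 1" "poly S v \<noteq> 0" "x = poly R v / poly S v"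
    using coprime_quotient[OF F xv] by blast
  obtain P Q s' t' where PQ: "poly_over F P" "poly_over F Q" "s' * P + t' * Q = 1" "poly Q x \<noteq> 0" "v = poly P x / poly Q x"
    using coprime_quotient[OF F vx] by blast
  \<comment> \<open>The homogenisation \<open>S^N p(R/S)\<close>.\<close>
  define hm where "hm = (\<lambda>N p. \<Sum>i\<le>N. smult (coeff p i) (R ^ i * S ^ (N - i)))"
  have hm_over: "poly_over F (hm N p)" if "poly_over F p" for N p
  proof -
    have "poly_over F (\<Sum>i\<in>A. smult (coeff p i) (R ^ i * S ^ (N - i)))" for A
      by (induction A rule: infinite_finite_induct)
        (simp_all add: poly_over_0[OF F] poly_over_add[OF F] poly_over_smult[OF F] poly_overD[OF that]
          poly_over_mult[OF F] poly_over_power[OF F] RS(1,2))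
    then show ?thesis unfolding hm_def .
  qed
  have hm_eval: "poly (hm N p) v = poly S v ^ N * poly p x" if "degree p \<le> N" for N p
  proof -
    have "poly S v ^ N * poly p x = (\<Sum>i\<le>N. poly S v ^ N * (coeff p i * x ^ i))"
      unfolding poly_altdef sum_distrib_left using that
      by (intro sum.mono_neutral_left) (auto simp: coeff_eq_0)
    also have "\<dots> = (\<Sum>i\<le>N. coeff p i * (poly R v ^ i * poly S v ^ (N - i)))"
    proof (rule sum.cong[OF refl])
      fix i assume "i \<in> {..N}"
      then have "poly S v ^ N = poly S v ^ i * poly S v ^ (N - i)" by (simp add: power_add[symmetric])
      then show "poly S v ^ N * (coeff p i * x ^ i) = coeff p i * (poly R v ^ i * poly S v ^ (N - i))"
        using RS(4) unfolding RS(5) by (simp add: power_divide)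
    qed
    finally show ?thesis by (simp add: hm_def poly_sum)
  qed
  have deg: "degree (R - smult a S) \<le> 1" if a: "a \<in> F" for a
  proof -
    have lin: "poly_over F [:- a, 1:]" using a F by (intro poly_over_pCons poly_over_0 subfield_one subfield_uminus)
    have split: "\<exists>p1. poly_over F p1 \<and> p = [:- a, 1:] * p1 + [:poly p a:]" if p: "poly_over F p" for p
    proof -
      obtain p1 r where "poly_over F p1" "poly_over F r" "p = [:- a, 1:] * p1 + r" "r = 0 \<or> degree r < degree [:- a, 1:]"
        using poly_over_division[OF F lin _ p] by auto
      moreover from this have "degree r = 0" by auto
      then obtain c where "r = [:c:]" by (auto elim: degree_eq_zeroE)
      ultimately show ?thesis by (intro exI[of _ p1]) simp
    qed
    obtain P1 where P1: "poly_over F P1" "P = [:- a, 1:] * P1 + [:poly P a:]" using split[OF PQ(1)] by blast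
    obtain Q1 where Q1: "poly_over F Q1" "Q = [:- a, 1:] * Q1 + [:poly Q a:]" using split[OF PQ(2)] by blast
    define N where "N = max (degree P1) (degree Q1)"
    \<comment> \<open>With \<open>P = (X - a) P1 + P(a)\<close> and likewise for \<open>Q\<close>,
      the identity \<open>P(x) = v Q(x)\<close> multiplied by \<open>S^(N+1)\<close> becomes
      \<open>?E = 0\<close>; \<open>?B\<close> is \<open>P(a) - Q(a) X\<close>.\<close>
    let ?A = "R - smult a S" and ?B = "[:poly P a, - poly Q a:]"
    let ?E = "?A * (hm N P1 - [:0, 1:] * hm N Q1) + ?B * S ^ Suc N"
    have Px: "poly P x = poly P a + (x - a) * poly P1 x"
      using arg_cong[OF P1(2), of "\<lambda>p. poly p x"] by (simp add: algebra_simps)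
    have Qx: "poly Q x = poly Q a + (x - a) * poly Q1 x"
      using arg_cong[OF Q1(2), of "\<lambda>p. poly p x"] by (simp add: algebra_simps)
    have "poly R v = x * poly S v" using RS(4,5) by simp
    then have Av: "poly ?A v = poly S v * (x - a)" by (simp add: algebra_simps)
    have "poly ?E v = poly S v ^ Suc N * ((x - a) * (poly P1 x - v * poly Q1 x) + (poly P a - v * poly Q a))"
      unfolding poly_add poly_mult Av by (simp add: hm_eval N_def algebra_simps)
    also have "\<dots> = poly S v ^ Suc N * (poly P x - v * poly Q x)"
      unfolding Px Qx by (simp add: algebra_simps)
    also have "\<dots> = 0" using PQ(4,5) by simp
    finally have "poly ?E v = 0" .
    moreover have "poly_over F ?E"
    proof -
      have "poly_over F ?A" using RS(1,2) a F by (intro poly_over_diff poly_over_smult)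
      moreover have "poly_over F [:0, 1:]" using F by (intro poly_over_pCons poly_over_0 subfield_one subfield_zero)
      moreover have "poly_over F ?B"
        using F poly_over_eval[OF F PQ(1) a] poly_over_eval[OF F PQ(2) a]
        by (intro poly_over_pCons poly_over_0 subfield_uminus)
      ultimately show ?thesis using F hm_over[OF P1(1)] hm_over[OF Q1(1)] RS(2)
        by (simp only: poly_over_add poly_over_mult poly_over_diff poly_over_power)
    qed
    ultimately have "?E = 0" using tr by blast
    then have "?B * S ^ Suc N = ?A * (- (hm N P1 - [:0, 1:] * hm N Q1))"
      by (simp only: mult_minus_right eq_neg_iff_add_eq_0 add.commute)
    then have dvd: "?A dvd ?B * S ^ Suc N" by (rule dvdI)
    \<comment> \<open>\<open>?A\<close> is coprime to \<open>S\<close>, so the power of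
      \<open>S\<close> can be cancelled from the divisibility.\<close>
    have bez: "s * ?A + (t + smult a s) * S = 1" using RS(3) by (simp add: algebra_simps)
    have cancel: "?A dvd B" if "?A dvd B * S ^ n" for B n
      using that
    proof (induction n)
      case (Suc n)
      have "B * S ^ n = B * S ^ n * (s * ?A + (t + smult a s) * S)" unfolding bez by simp
      also have "\<dots> = ?A * (B * S ^ n * s) + B * S ^ Suc n * (t + smult a s)" by (simp add: algebra_simps)
      finally have "?A dvd B * S ^ n" using Suc.prems by (metis dvd_add dvd_mult2 dvd_triv_left)
      then show ?case by (rule Suc.IH)
    qed simp
    have "?B \<noteq> 0"
    proof
      assume "?B = 0"
      then have "poly P a = 0" "poly Q a = 0" by auto
      then have "poly (s' * P + t' * Q) a = 0" by simp
      then show False unfolding PQ(3) by simp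
    qed
    then have "degree ?A \<le> degree ?B" by (rule dvd_imp_degree_le[OF cancel[OF dvd]])
    also have "\<dots> \<le> 1" by simp
    finally show ?thesis .
  qed
  have dR: "degree R \<le> 1" using deg[OF subfield_zero[OF F]] by simp
  have "degree (R - (R - smult 1 S)) \<le> 1" using dR deg[OF subfield_one[OF F]] by (rule degree_diff_le)
  then have dS: "degree S \<le> 1" by simp
  have lin: "poly p v = coeff p 1 * v + coeff p 0" if "degree p \<le> 1" for p
  proof -
    have "poly p v = (\<Sum>i\<le>1. coeff p i * v ^ i)"
      unfolding poly_altdef using that by (intro sum.mono_neutral_left) (auto simp: coeff_eq_0)
    then show ?thesis by simp
  qed
  show ?thesis
    using RS(4,5) unfolding lin[OF dR] lin[OF dS] using poly_overD[OF RS(1)] poly_overD[OF RS(2)] by blast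
qed

lemma ev_power: "ev y (q ^ N) = ev y q ^ N" for y :: "'i \<Rightarrow> 'a::field"
  by (induction N) (simp_all add: ev_one ev_mult)

lemma mp_over_power: "is_subfield M \<Longrightarrow> mp_over M J q \<Longrightarrow> mp_over M J (q ^ N)"
  by (induction N) (simp_all add: mp_over_1 mp_over_mult)

text \<open>Replacing the \<open>y i\<close> in \<open>c\<close> by suitable integers yields
  \<open>v\<close>. The coefficients of \<open>c\<close> are rational in \<open>y\<close> and
  \<open>c\<close> over \<open>F\<close> and are not changed by this replacement, so they lie in
  \<open>F(v)\<close>. Then \<open>c\<close> lies in \<open>F(v)(y)\<close>, and so does
  \<open>M\<close>; intersecting with \<open>M\<close> leaves \<open>F(v)\<close>.\<close>

lemma field_generator_by_specialisation:
  fixes y :: "'i \<Rightarrow> 'a::field_char_0"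
  assumes F: "is_subfield F" and M: "is_subfield M" "F \<subseteq> M" and J: "finite J"
    and ind: "alg_independent M J y" and c: "c \<in> field_adjoin M (y ` J)"
    and gen: "M \<subseteq> field_adjoin (field_adjoin F (y ` J)) {c}"
  shows "\<exists>v\<in>M. M = field_adjoin F {v}"
proof -
  obtain b where b: "prime_family b J" using prime_family_exists[OF J] by blast
  obtain p q where pq: "mp_over M J p" "mp_over M J q" "ev y q \<noteq> 0" "c = ev y p / ev y q"
    using adjoin_quotient[OF M(1) c] by blast
  define v where "v = (\<lambda>t. ev (pt b t) p / ev (pt b t) q)"
  \<comment> \<open>\<open>z\<close> is a polynomial in \<open>y\<close> over \<open>M\<close>
    divided by a power of \<open>q\<close>, and \<phi> \<open>t\<close> is its value at
    \<open>pt b t\<close>. As a relation this needs no choice of a representation; independence of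
    \<open>y\<close> enters in \<open>reg_0\<close>.\<close>
  define reg where "reg = (\<lambda>z \<phi>. \<exists>A N. mp_over M J A \<and> z * ev y q ^ N = ev y A \<and>
    (\<forall>t. ev (pt b t) q \<noteq> 0 \<longrightarrow> \<phi> t * ev (pt b t) q ^ N = ev (pt b t) A))"
  have regI: "reg z \<phi>" if "mp_over M J A" "z * ev y q ^ N = ev y A"
    "\<And>t. ev (pt b t) q \<noteq> 0 \<Longrightarrow> \<phi> t * ev (pt b t) q ^ N = ev (pt b t) A" for z \<phi> A N
    using that unfolding reg_def by blast
  have reg_add: "reg (z + z') (\<lambda>t. \<phi> t + \<phi>' t)" and reg_mult: "reg (z * z') (\<lambda>t. \<phi> t * \<phi>' t)"
    if r: "reg z \<phi>" "reg z' \<phi>'" for z z' \<phi> \<phi>'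
  proof -
    obtain A N where A: "mp_over M J A" "z * ev y q ^ N = ev y A"
      "\<And>t. ev (pt b t) q \<noteq> 0 \<Longrightarrow> \<phi> t * ev (pt b t) q ^ N = ev (pt b t) A" using r(1) unfolding reg_def by blast
    obtain A' N' where A': "mp_over M J A'" "z' * ev y q ^ N' = ev y A'"
      "\<And>t. ev (pt b t) q \<noteq> 0 \<Longrightarrow> \<phi>' t * ev (pt b t) q ^ N' = ev (pt b t) A'" using r(2) unfolding reg_def by blast
    show "reg (z + z') (\<lambda>t. \<phi> t + \<phi>' t)"
    proof (rule regI[of "A * q ^ N' + A' * q ^ N" _ "N + N'"])
      show "mp_over M J (A * q ^ N' + A' * q ^ N)"
        using A(1) A'(1) pq(2) M(1) by (intro mp_over_add mp_over_mult mp_over_power)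
    qed (simp_all add: ev_add ev_mult ev_power A(2)[symmetric] A'(2)[symmetric] A(3)[symmetric] A'(3)[symmetric]
        power_add algebra_simps)
    show "reg (z * z') (\<lambda>t. \<phi> t * \<phi>' t)"
    proof (rule regI[of "A * A'" _ "N + N'"])
      show "mp_over M J (A * A')" using A(1) A'(1) M(1) by (intro mp_over_mult)
    qed (simp_all add: ev_mult A(2)[symmetric] A'(2)[symmetric] A(3)[symmetric] A'(3)[symmetric]
        power_add algebra_simps)
  qed
  have reg_const: "reg g (\<lambda>_. g)" if "g \<in> M" for g
    by (rule regI[of "Poly_Mapping.single 0 g" _ 0]) (simp_all add: ev_const mp_over_const[OF M(1) that])
  have reg_var: "reg (y i) (\<lambda>t. pt b t i)" if "i \<in> J" for i
  proof (rule regI[of "Poly_Mapping.single (Poly_Mapping.single i 1) 1" _ 0])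
    show "mp_over M J (Poly_Mapping.single (Poly_Mapping.single i 1) 1)" by (rule mp_over_var[OF M(1) that])
  qed (simp_all only: ev_var power_0 mult_1_right)
  have reg_c: "reg c v"
    by (rule regI[of p _ 1]) (use pq in \<open>simp_all add: v_def\<close>)
  have reg_sum: "reg (sum g A) (\<lambda>t. \<Sum>a\<in>A. \<psi> t a)" if "\<And>a. a \<in> A \<Longrightarrow> reg (g a) (\<lambda>t. \<psi> t a)"
    for g \<psi> and A :: "('i option \<Rightarrow>\<^sub>0 nat) set"
    using that
  proof (induction A rule: infinite_finite_induct)
    case (insert a A)
    then show ?case using reg_add[of "g a" "\<lambda>t. \<psi> t a" "sum g A" "\<lambda>t. \<Sum>a\<in>A. \<psi> t a"] by simp
  qed (use reg_const[OF subfield_zero[OF M(1)]] in simp_all)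
  have reg_prod: "reg (prod g A) (\<lambda>t. \<Prod>a\<in>A. \<psi> t a)" if "\<And>a. a \<in> A \<Longrightarrow> reg (g a) (\<lambda>t. \<psi> t a)"
    for g \<psi> and A :: "'i option set"
    using that
  proof (induction A rule: infinite_finite_induct)
    case (insert a A)
    then show ?case using reg_mult[of "g a" "\<lambda>t. \<psi> t a" "prod g A" "\<lambda>t. \<Prod>a\<in>A. \<psi> t a"] by simp
  qed (use reg_const[OF subfield_one[OF M(1)]] in simp_all)
  have reg_prod': "reg (prod g A) (\<lambda>t. \<Prod>a\<in>A. \<psi> t a)" if "\<And>a. a \<in> A \<Longrightarrow> reg (g a) (\<lambda>t. \<psi> t a)"
    for g \<psi> and A :: "'a set"
    using that
  proof (induction A rule: infinite_finite_induct)
    case (insert a A)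
    then show ?case using reg_mult[of "g a" "\<lambda>t. \<psi> t a" "prod g A" "\<lambda>t. \<Prod>a\<in>A. \<psi> t a"] by simp
  qed (use reg_const[OF subfield_one[OF M(1)]] in simp_all)
  have reg_power: "reg (z ^ k) (\<lambda>t. \<phi> t ^ k)" if "reg z \<phi>" for z \<phi> k
  proof (induction k)
    case 0
    show ?case using reg_const[OF subfield_one[OF M(1)]] by simp
  next
    case (Suc k)
    then show ?case using reg_mult[OF that Suc] by simp
  qed
  \<comment> \<open>\<open>None\<close> stands for the additional generator \<open>c\<close>, whose
    specialised value is \<open>v t\<close>.\<close>
  define x where "x = (\<lambda>i. case i of None \<Rightarrow> c | Some i \<Rightarrow> y i)"
  define w where "w = (\<lambda>t i. case i of None \<Rightarrow> v t | Some i \<Rightarrow> pt b t i)"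
  define J' where "J' = insert None (Some ` J)"
  have reg_x: "reg (x i) (\<lambda>t. w t i)" if "i \<in> J'" for i
    using that reg_c reg_var by (auto simp: J'_def x_def w_def)
  have reg_ev: "reg (ev x P) (\<lambda>t. ev (w t) P)" if P: "mp_over F J' P" for P
    unfolding meval_def monoval_def
  proof (intro reg_sum reg_mult reg_prod reg_power reg_x)
    fix \<mu> show "reg (Poly_Mapping.lookup P \<mu>) (\<lambda>t. Poly_Mapping.lookup P \<mu>)"
      using mp_over_lookup[OF P] M(2) by (intro reg_const) blast
  next
    fix \<mu> i assume "\<mu> \<in> Poly_Mapping.keys P" "i \<in> Poly_Mapping.keys \<mu>"
    then show "i \<in> J'" using mp_over_keys[OF P] by blast
  qed
  have reg_0: "\<phi> t = 0" if r: "reg 0 \<phi>" and t: "ev (pt b t) q \<noteq> 0" for \<phi> t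
  proof -
    obtain A N where A: "mp_over M J A" "0 * ev y q ^ N = ev y A"
      "\<And>t. ev (pt b t) q \<noteq> 0 \<Longrightarrow> \<phi> t * ev (pt b t) q ^ N = ev (pt b t) A" using r unfolding reg_def by blast
    have "A = 0" by (rule alg_independentD[OF ind A(1)]) (use A(2) in simp)
    then show ?thesis using A(3)[OF t] t by simp
  qed
  \<comment> \<open>Only the finitely many coefficients of \<open>p\<close> and \<open>q\<close>
    have to be specialised.\<close>
  define C where "C = Poly_Mapping.lookup p ` Poly_Mapping.keys p \<union> Poly_Mapping.lookup q ` Poly_Mapping.keys q"
  have CM: "C \<subseteq> M" unfolding C_def using mp_over_lookup[OF pq(1)] mp_over_lookup[OF pq(2)] by blast
  have "finite C" by (simp add: C_def)
  have im: "x ` J' = y ` J \<union> {c}" unfolding J'_def image_insert image_image by (simp add: x_def)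
  have "\<forall>g\<in>C. \<exists>P Q. mp_over F J' P \<and> mp_over F J' Q \<and> ev x Q \<noteq> 0 \<and> g = ev x P / ev x Q"
  proof
    fix g assume "g \<in> C"
    then have "g \<in> field_adjoin F (x ` J')" using CM gen unfolding im adjoin_adjoin by blast
    then show "\<exists>P Q. mp_over F J' P \<and> mp_over F J' Q \<and> ev x Q \<noteq> 0 \<and> g = ev x P / ev x Q"
      by (rule adjoin_quotient[OF F])
  qed
  then obtain P Q where PQ: "\<And>g. g \<in> C \<Longrightarrow> mp_over F J' (P g)" "\<And>g. g \<in> C \<Longrightarrow> mp_over F J' (Q g)"
    "\<And>g. g \<in> C \<Longrightarrow> ev x (Q g) \<noteq> 0" "\<And>g. g \<in> C \<Longrightarrow> g = ev x (P g) / ev x (Q g)" by metis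
  have "reg (\<Prod>g\<in>C. ev x (Q g)) (\<lambda>t. \<Prod>g\<in>C. ev (w t) (Q g))"
    by (intro reg_prod' reg_ev PQ(2))
  then obtain A N where A: "mp_over M J A" "(\<Prod>g\<in>C. ev x (Q g)) * ev y q ^ N = ev y A"
      "\<And>t. ev (pt b t) q \<noteq> 0 \<Longrightarrow> (\<Prod>g\<in>C. ev (w t) (Q g)) * ev (pt b t) q ^ N = ev (pt b t) A"
    unfolding reg_def by blast
  have "ev y (q * A) \<noteq> 0" unfolding ev_mult A(2)[symmetric] using pq(3) PQ(3) \<open>finite C\<close> by simp
  then have "q * A \<noteq> 0" by auto
  moreover have "mp_over UNIV J (q * A)"
    by (rule mp_over_mono[OF mp_over_mult[OF M(1) pq(2) A(1)]]) auto
  \<comment> \<open>The product of all denominators, times powers of \<open>q\<close>, is a nonzero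
    polynomial in \<open>y\<close>, so some point avoids its zeros.\<close>
  ultimately obtain t where "ev (pt b t) (q * A) \<noteq> 0" using mp_vanish_pt[OF b J, of "q * A"] by blast
  then have t: "ev (pt b t) q \<noteq> 0" "ev (pt b t) A \<noteq> 0" by (auto simp: ev_mult)
  have "(\<Prod>g\<in>C. ev (w t) (Q g)) \<noteq> 0"
  proof
    assume "(\<Prod>g\<in>C. ev (w t) (Q g)) = 0"
    then show False using A(3)[OF t(1)] t(2) by simp
  qed
  then have Qt: "ev (w t) (Q g) \<noteq> 0" if "g \<in> C" for g
    using that \<open>finite C\<close> by (simp add: prod_zero_iff)
  define L where "L = field_adjoin F {v t}"
  have L: "is_subfield L" "F \<subseteq> L" "v t \<in> L"
    using adjoin_base[of F "{v t}"] adjoin_gens[of "{v t}" F] is_subfield_adjoin by (auto simp: L_def)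
  have evL: "ev (w t) R \<in> L" if "mp_over F J' R" for R
  proof (rule meval_in_subfield[OF L(1) _ that])
    show "w t i \<in> L" for i
      unfolding w_def pt_def using L by (cases i) (auto intro!: subfield_power subfield_of_nat)
  qed (use L in blast)
  have CL: "g \<in> L" if g: "g \<in> C" for g
  proof -
    have e: "g * ev x (Q g) + (- 1) * ev x (P g) = 0"
    proof -
      have "ev x (P g) = g * ev x (Q g)" using PQ(3)[OF g] PQ(4)[OF g] by (metis nonzero_divide_eq_eq)
      then show ?thesis by simp
    qed
    have m1: "- 1 \<in> M" by (intro subfield_uminus[OF M(1)] subfield_one[OF M(1)])
    have "reg (g * ev x (Q g) + (- 1) * ev x (P g)) (\<lambda>t. g * ev (w t) (Q g) + (- 1) * ev (w t) (P g))"
      using CM g by (intro reg_add reg_mult reg_ev reg_const PQ(1,2) m1) auto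
    then have "g * ev (w t) (Q g) + (- 1) * ev (w t) (P g) = 0" unfolding e using reg_0[OF _ t(1)] by blast
    then have "g = ev (w t) (P g) / ev (w t) (Q g)" using Qt[OF g] by (simp add: field_simps)
    then show ?thesis using evL[OF PQ(1)[OF g]] evL[OF PQ(2)[OF g]] L(1) by (metis subfield_divide)
  qed
  have vM: "v t \<in> M"
  proof -
    have "ev (pt b t) r \<in> M" if "mp_over M J r" for r
      by (rule meval_in_subfield[OF M(1) _ that])
        (auto simp: pt_def intro!: subfield_power subfield_of_nat M(1))
    then show ?thesis unfolding v_def using pq M(1) by (intro subfield_divide)
  qed
  have LM: "L \<subseteq> M" unfolding L_def using vM M by (intro adjoin_least) auto
  have over: "mp_over L J r" if r: "mp_over M J r" "Poly_Mapping.lookup r ` Poly_Mapping.keys r \<subseteq> C" for r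
    unfolding mp_over_def
  proof (intro conjI allI ballI)
    fix \<mu>
    show "Poly_Mapping.lookup r \<mu> \<in> L"
    proof (cases "\<mu> \<in> Poly_Mapping.keys r")
      case True
      then show ?thesis using r(2) CL by blast
    next
      case False
      then show ?thesis using subfield_zero[OF L(1)] by (simp add: in_keys_iff)
    qed
  qed (use mp_over_keys[OF r(1)] in blast)
  have "mp_over L J p" "mp_over L J q" using over[OF pq(1)] over[OF pq(2)] by (auto simp: C_def)
  then have cL: "c \<in> field_adjoin L (y ` J)"
    unfolding pq(4) by (intro subfield_divide is_subfield_adjoin ev_in_adjoin)
  have "field_adjoin (field_adjoin F (y ` J)) {c} \<subseteq> field_adjoin L (y ` J)"
    by (rule adjoin_least[OF is_subfield_adjoin]) (use cL adjoin_mono[OF L(2), of "y ` J" "y ` J"] in auto)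
  then have "M \<subseteq> L" using adjoin_inter[OF L(1) LM M(1) ind] gen by blast
  then show ?thesis using LM vM L_def by blast
qed

section \<open>Order ideals of exponent vectors\<close>

lemma Theta_Suc: "e \<in> Theta (Suc m) \<longleftrightarrow> e(Suc m := 0) \<in> Theta m"
  unfolding Theta_def by (auto simp: le_Suc_eq)

lemma theta_ord_Suc: "theta_ord (Suc m) e = theta_ord m (e(Suc m := 0)) + e (Suc m)"
proof -
  have "(\<Sum>i=1..m. e i) = (\<Sum>i=1..m. (e(Suc m := 0)) i)" by (rule sum.cong) auto
  then show ?thesis unfolding theta_ord_def by simp
qed

lemma Theta_upd_0: "e \<in> Theta m \<Longrightarrow> e(Suc m := 0) = e"
  unfolding Theta_def by auto

text \<open>Split by the last exponent and apply the hockey-stick identity.\<close>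

lemma finite_card_Theta: "finite {e\<in>Theta m. theta_ord m e \<le> t} \<and> card {e\<in>Theta m. theta_ord m e \<le> t} = (t + m) choose m"
proof (induction m arbitrary: t)
  case 0
  have "{e\<in>Theta 0. theta_ord 0 e \<le> t} = {\<lambda>_. 0}"
    unfolding Theta_def theta_ord_def by auto
  then show ?case by simp
next
  case (Suc m)
  let ?T = "\<lambda>t. {e\<in>Theta m. theta_ord m e \<le> t}"
  let ?f = "\<lambda>(c, e). e(Suc m := c) :: nat \<Rightarrow> nat"
  have eq: "{e\<in>Theta (Suc m). theta_ord (Suc m) e \<le> t} = ?f ` (SIGMA c:{..t}. ?T (t - c))"
  proof (intro subset_antisym subsetI)
    fix e assume e: "e \<in> {e\<in>Theta (Suc m). theta_ord (Suc m) e \<le> t}"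
    have "e = ?f (e (Suc m), e(Suc m := 0))" by simp
    moreover have "(e (Suc m), e(Suc m := 0)) \<in> (SIGMA c:{..t}. ?T (t - c))"
      using e by (auto simp: Theta_Suc theta_ord_Suc)
    ultimately show "e \<in> ?f ` (SIGMA c:{..t}. ?T (t - c))" by (rule image_eqI)
  next
    fix e assume "e \<in> ?f ` (SIGMA c:{..t}. ?T (t - c))"
    then obtain c e' where "c \<le> t" "e' \<in> Theta m" "theta_ord m e' \<le> t - c" "e = e'(Suc m := c)" by auto
    then show "e \<in> {e\<in>Theta (Suc m). theta_ord (Suc m) e \<le> t}"
      by (simp add: Theta_Suc theta_ord_Suc Theta_upd_0)
  qed
  have fin: "finite (SIGMA c:{..t}. ?T (t - c))" using Suc by auto
  have "inj_on ?f (SIGMA c:{..t}. ?T (t - c))"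
  proof (rule inj_onI, clarify)
    fix c e c' e' assume *: "e \<in> Theta m" "e' \<in> Theta m" "e(Suc m := c) = e'(Suc m := c')"
    have "c = c'" using fun_cong[OF *(3), of "Suc m"] by simp
    moreover have "e = e'" using *(3) Theta_upd_0[OF *(1)] Theta_upd_0[OF *(2)] by (metis fun_upd_upd)
    ultimately show "c = c' \<and> e = e'" by simp
  qed
  then have "card {e\<in>Theta (Suc m). theta_ord (Suc m) e \<le> t} = (\<Sum>c\<le>t. card (?T (t - c)))"
    unfolding eq using Suc by (simp add: card_image card_SigmaI)
  also have "\<dots> = (\<Sum>c\<le>t. (t - c + m) choose m)" using Suc by simp
  also have "\<dots> = (\<Sum>c\<le>t. (m + c) choose m)"
    by (rule sum.reindex_bij_witness[of _ "\<lambda>c. t - c" "\<lambda>c. t - c"]) (auto simp: add.commute)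
  also have "\<dots> = (t + Suc m) choose Suc m" unfolding choose_rising_sum(1) by (simp add: add.commute)
  finally show ?case using fin eq by simp
qed

lemma card_principal:
  assumes f: "f \<in> Theta m"
  shows "finite {e\<in>Theta m. (\<forall>i. f i \<le> e i) \<and> theta_ord m e \<le> t}"
    and "theta_ord m f \<le> t \<Longrightarrow> card {e\<in>Theta m. (\<forall>i. f i \<le> e i) \<and> theta_ord m e \<le> t} = (t - theta_ord m f + m) choose m"
proof -
  show "finite {e\<in>Theta m. (\<forall>i. f i \<le> e i) \<and> theta_ord m e \<le> t}"
    by (rule finite_subset[of _ "{e\<in>Theta m. theta_ord m e \<le> t}"]) (use finite_card_Theta in auto)
  assume t: "theta_ord m f \<le> t"
  have ord: "theta_ord m (\<lambda>i. f i + e i) = theta_ord m f + theta_ord m e" for e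
    by (simp add: theta_ord_def sum.distrib)
  have "bij_betw (\<lambda>e i. f i + e i) {e\<in>Theta m. theta_ord m e \<le> t - theta_ord m f} {e\<in>Theta m. (\<forall>i. f i \<le> e i) \<and> theta_ord m e \<le> t}"
  proof (rule bij_betw_byWitness[where f' = "\<lambda>e i. e i - f i"])
    show "\<forall>e\<in>{e \<in> Theta m. theta_ord m e \<le> t - theta_ord m f}. (\<lambda>i. f i + e i - f i) = e" by simp
    show "\<forall>e\<in>{e \<in> Theta m. (\<forall>i. f i \<le> e i) \<and> theta_ord m e \<le> t}. (\<lambda>i. f i + (e i - f i)) = e" by auto
    show "(\<lambda>e i. f i + e i) ` {e \<in> Theta m. theta_ord m e \<le> t - theta_ord m f} \<subseteq> {e \<in> Theta m. (\<forall>i. f i \<le> e i) \<and> theta_ord m e \<le> t}"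
      using f t by (auto simp: ord Theta_def)
    show "(\<lambda>e i. e i - f i) ` {e \<in> Theta m. (\<forall>i. f i \<le> e i) \<and> theta_ord m e \<le> t} \<subseteq> {e \<in> Theta m. theta_ord m e \<le> t - theta_ord m f}"
    proof clarify
      fix e assume e: "e \<in> Theta m" "\<forall>i. f i \<le> e i" "theta_ord m e \<le> t"
      have "(\<lambda>i. f i + (e i - f i)) = e" using e(2) by auto
      then have "theta_ord m e = theta_ord m f + theta_ord m (\<lambda>i. e i - f i)" by (metis ord)
      then show "(\<lambda>i. e i - f i) \<in> Theta m \<and> theta_ord m (\<lambda>i. e i - f i) \<le> t - theta_ord m f"
        using e by (auto simp: Theta_def)
    qed
  qed
  then have "card {e\<in>Theta m. (\<forall>i. f i \<le> e i) \<and> theta_ord m e \<le> t} = card {e\<in>Theta m. theta_ord m e \<le> t - theta_ord m f}"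
    by (rule bij_betw_same_card[symmetric])
  then show "card {e\<in>Theta m. (\<forall>i. f i \<le> e i) \<and> theta_ord m e \<le> t} = (t - theta_ord m f + m) choose m"
    using finite_card_Theta by simp
qed

lemma upset_ge:
  assumes up: "\<And>e k. e \<in> E \<Longrightarrow> k \<in> {1..m} \<Longrightarrow> e(k := Suc (e k)) \<in> E"
    and g: "g \<in> E" "g \<in> Theta m" and e: "e \<in> Theta m" "\<forall>i. g i \<le> e i"
  shows "e \<in> E"
  using g e
proof (induction "\<Sum>i\<in>{1..m}. e i - g i" arbitrary: g)
  case 0
  have "e i = g i" for i
  proof (cases "i \<in> {1..m}")
    case True
    then have "e i - g i = 0" using 0(1) by simp
    then show ?thesis using 0(5) by (simp add: antisym)
  next
    case False
    then show ?thesis using 0(3,4) by (simp add: Theta_def)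
  qed
  then have "e = g" by blast
  then show ?case using 0 by simp
next
  case (Suc k)
  have "\<exists>j\<in>{1..m}. e j - g j \<noteq> 0"
  proof (rule ccontr)
    assume "\<not> ?thesis"
    then have "(\<Sum>i\<in>{1..m}. e i - g i) = 0" by (intro sum.neutral) auto
    then show False using Suc(2) by simp
  qed
  then obtain j where j: "j \<in> {1..m}" "e j - g j \<noteq> 0" by blast
  let ?g = "g(j := Suc (g j))"
  have "(\<Sum>i\<in>{1..m}. e i - g i) = (e j - g j) + (\<Sum>i\<in>{1..m} - {j}. e i - g i)"
    using j by (simp add: sum.remove)
  moreover have "(\<Sum>i\<in>{1..m}. e i - ?g i) = (e j - ?g j) + (\<Sum>i\<in>{1..m} - {j}. e i - ?g i)"
    using j by (simp add: sum.remove)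
  moreover have "(\<Sum>i\<in>{1..m} - {j}. e i - ?g i) = (\<Sum>i\<in>{1..m} - {j}. e i - g i)"
    by (intro sum.cong) auto
  ultimately have "k = (\<Sum>i\<in>{1..m}. e i - ?g i)" using Suc(2) j by simp
  moreover have "?g \<in> E" using up[OF Suc(3) j(1)] .
  moreover have "?g \<in> Theta m" using Suc(4) j by (auto simp: Theta_def)
  moreover have "\<forall>i. ?g i \<le> e i" using Suc(6) j by auto
  ultimately show ?case using Suc(1)[of ?g] Suc(5) by blast
qed

text \<open>Pascal's rule, applied \<open>A\<close> times; each step costs at most the largest lower
  binomial coefficient.\<close>

lemma binomial_diff_le:
  assumes "m \<ge> 1" "A \<le> t"
  shows "(t + m) choose m \<le> ((t - A + m) choose m) + A * ((t + m - 1) choose (m - 1))"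
  using assms(2)
proof (induction A)
  case (Suc A)
  have "t - A + m = Suc (t - Suc A + m)" "m = Suc (m - 1)" using Suc.prems assms(1) by auto
  then have "(t - A + m) choose m = ((t - Suc A + m) choose (m - 1)) + ((t - Suc A + m) choose m)"
    by (metis binomial_Suc_Suc)
  moreover have "(t - Suc A + m) choose (m - 1) \<le> (t + m - 1) choose (m - 1)"
    by (rule binomial_right_mono) (use Suc.prems assms in auto)
  ultimately show ?case using Suc by simp
qed simp

text \<open>A shift by \<open>A\<close> costs at most \<open>A * ?d\<close>, and
  \<open>m * ?C = (t + m) * ?d\<close> shows that this is less than half of \<open>?C\<close> once
  \<open>t\<close> exceeds \<open>2 * A * m\<close>.\<close>

lemma binomial_shift_growth:
  assumes m: "m \<ge> 1" and t: "t > 2 * A * m" "A \<le> t"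
  shows "(t + m) choose m < 2 * ((t - A + m) choose m)"
proof -
  let ?C = "(t + m) choose m" and ?d = "(t + m - 1) choose (m - 1)"
  have 1: "?C \<le> ((t - A + m) choose m) + A * ?d" by (rule binomial_diff_le[OF m t(2)])
  have "m * ?C = (t + m) * ?d" using m by (intro times_binomial_minus1_eq) auto
  then have "2 * A * (m * ?C) = 2 * A * ((t + m) * ?d)" by simp
  then have "2 * A * m * ?C = 2 * A * ?d * (t + m)" by (simp only: mult_ac)
  moreover have "2 * A * m * ?C < (t + m) * ?C"
    using t by (intro mult_strict_right_mono) (auto simp: zero_less_binomial_iff)
  ultimately have "2 * A * ?d * (t + m) < (t + m) * ?C" by (simp only:)
  then have "2 * A * ?d * (t + m) < ?C * (t + m)" by (simp only: mult.commute[of "t + m" ?C])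
  then have "2 * A * ?d < ?C" using mult_less_cancel2 by blast
  then show ?thesis using 1 by simp
qed

text \<open>Only \<open>m - 2\<close> coordinates remain free, so the growth is two orders below
  that of a full cone.\<close>

lemma card_two_small_coordinates:
  assumes k: "k \<in> {1..m}" "k' \<in> {1..m}" "k \<noteq> k'"
  shows "card {e\<in>Theta m. e k < c \<and> e k' < c \<and> theta_ord m e \<le> t} \<le> c * c * (t + 1) ^ (m - 2)"
proof -
  let ?S = "{e\<in>Theta m. e k < c \<and> e k' < c \<and> theta_ord m e \<le> t}"
  let ?B = "\<lambda>i. if i = k \<or> i = k' then {..<c} else {..t}"
  let ?P = "PiE {1..m} ?B"
  have "card ?S \<le> card ?P"
  proof (rule card_inj_on_le[of "\<lambda>e. restrict e {1..m}"])
    show "inj_on (\<lambda>e. restrict e {1..m}) ?S"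
    proof (rule inj_onI)
      fix e e' assume *: "e \<in> ?S" "e' \<in> ?S" "restrict e {1..m} = restrict e' {1..m}"
      show "e = e'"
      proof
        fix i
        show "e i = e' i"
        proof (cases "i \<in> {1..m}")
          case True
          then show ?thesis using fun_cong[OF *(3), of i] by simp
        next
          case False
          then show ?thesis using *(1,2) by (simp add: Theta_def)
        qed
      qed
    qed
    show "(\<lambda>e. restrict e {1..m}) ` ?S \<subseteq> ?P"
    proof clarify
      fix e assume e: "e \<in> Theta m" "e k < c" "e k' < c" "theta_ord m e \<le> t"
      have "e i \<le> t" if "i \<in> {1..m}" for i
        using e(4) member_le_sum[OF that, of e] by (simp add: theta_ord_def)
      then show "restrict e {1..m} \<in> ?P" using e by auto
    qed
    show "finite ?P" by (intro finite_PiE) auto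
  qed
  also have "card ?P = (\<Prod>i\<in>{1..m}. card (?B i))" by (rule card_PiE) simp
  also have "\<dots> = card (?B k) * (card (?B k') * (\<Prod>i\<in>{1..m} - {k} - {k'}. card (?B i)))"
  proof -
    have "(\<Prod>i\<in>{1..m}. card (?B i)) = card (?B k) * (\<Prod>i\<in>{1..m} - {k}. card (?B i))"
      using k by (intro prod.remove) auto
    moreover have "(\<Prod>i\<in>{1..m} - {k}. card (?B i)) = card (?B k') * (\<Prod>i\<in>{1..m} - {k} - {k'}. card (?B i))"
      using k by (intro prod.remove) auto
    ultimately show ?thesis by simp
  qed
  also have "(\<Prod>i\<in>{1..m} - {k} - {k'}. card (?B i)) = (\<Prod>i\<in>{1..m} - {k} - {k'}. t + 1)"
    by (intro prod.cong) auto
  also have "\<dots> = (t + 1) ^ (m - 2)"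
  proof -
    have "card ({1..m} - {k} - {k'}) = m - 2" using k by simp
    then show ?thesis by simp
  qed
  finally show ?thesis by simp
qed

text \<open>Two components \<open>j\<close> would contribute about twice the permitted number.
  Within one component let \<open>f\<close> be the coordinatewise minimum: the cone above
  \<open>f\<close> exceeds \<open>E\<close> only by \<open>O(t^(m-2))\<close> elements, while a
  wrong order of \<open>f\<close> would alter the count by order \<open>t^(m-1)\<close>. So the
  counts agree, and \<open>E\<close> is the cone.\<close>

theorem upset_principal:
  fixes L :: "((nat \<Rightarrow> nat) \<times> nat) set"
  assumes m: "m > 1" and L: "L \<subseteq> Theta m \<times> J" "finite J"
    and up: "\<And>e j k. (e, j) \<in> L \<Longrightarrow> k \<in> {1..m} \<Longrightarrow> (e(k := Suc (e k)), j) \<in> L"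
    and cnt: "\<And>t. t \<ge> t0 \<Longrightarrow> card {i\<in>L. theta_ord m (fst i) \<le> t} = (t - s + m) choose m" and t0: "s \<le> t0"
  shows "\<exists>f\<in>Theta m. \<exists>j0\<in>J. theta_ord m f = s \<and> L = {(e, j0) | e. e \<in> Theta m \<and> (\<forall>i. f i \<le> e i)}"
proof -
  have finT: "finite {e\<in>Theta m. theta_ord m e \<le> t}" for t using finite_card_Theta by blast
  have finL: "finite {i\<in>L. theta_ord m (fst i) \<le> t}" for t
    by (rule finite_subset[of _ "{e\<in>Theta m. theta_ord m e \<le> t} \<times> J"]) (use L finT in auto)
  have upE: "(e', j) \<in> L" if "(e, j) \<in> L" "e' \<in> Theta m" "\<forall>i. e i \<le> e' i" for e e' j
    using upset_ge[of "{e. (e, j) \<in> L}" m e e'] up that L by auto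
  have "card {i\<in>L. theta_ord m (fst i) \<le> t0} > 0"
    unfolding cnt[OF order_refl] by (simp add: zero_less_binomial_iff)
  then have "{i\<in>L. theta_ord m (fst i) \<le> t0} \<noteq> {}" by force
  then obtain e0 j0 where e0: "(e0, j0) \<in> L" by auto
  have j0: "j0 \<in> J" "e0 \<in> Theta m" using e0 L by auto
  have one: "j = j0" if ej: "(e, j) \<in> L" for e j
  proof (rule ccontr)
    assume "j \<noteq> j0"
    have eT: "e \<in> Theta m" using ej L by auto
    define A where "A = max (theta_ord m e) (theta_ord m e0)"
    \<comment> \<open>Large enough for \<open>binomial_shift_growth\<close>: two shifted cones then
      have more elements than the count permits.\<close>
    define t where "t = Suc (2 * A * m + A + t0)"
    let ?P = "\<lambda>f. {e'\<in>Theta m. (\<forall>i. f i \<le> e' i) \<and> theta_ord m e' \<le> t}"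
    have sub: "(\<lambda>e. (e, j)) ` ?P e \<union> (\<lambda>e. (e, j0)) ` ?P e0 \<subseteq> {i\<in>L. theta_ord m (fst i) \<le> t}"
      using upE[OF ej] upE[OF e0] by auto
    have P: "(t - A + m) choose m \<le> card (?P f)" "finite (?P f)" if "f \<in> Theta m" "theta_ord m f \<le> A" for f
    proof -
      have "card (?P f) = (t - theta_ord m f + m) choose m"
        using that by (intro card_principal(2)) (auto simp: t_def)
      then show "(t - A + m) choose m \<le> card (?P f)"
        using that by (simp add: binomial_right_mono)
      show "finite (?P f)" by (rule card_principal(1)[OF that(1)])
    qed
    have le: "theta_ord m e \<le> A" "theta_ord m e0 \<le> A" by (auto simp: A_def)
    have "2 * ((t - A + m) choose m) \<le> card (?P e) + card (?P e0)"
      using P(1)[OF eT le(1)] P(1)[OF j0(2) le(2)] by simp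
    also have "\<dots> = card ((\<lambda>e. (e, j)) ` ?P e) + card ((\<lambda>e. (e, j0)) ` ?P e0)"
      by (simp add: card_image inj_on_def)
    also have "\<dots> = card ((\<lambda>e. (e, j)) ` ?P e \<union> (\<lambda>e. (e, j0)) ` ?P e0)"
      using \<open>j \<noteq> j0\<close> P(2)[OF eT le(1)] P(2)[OF j0(2) le(2)] by (intro card_Un_disjoint[symmetric]) auto
    also have "\<dots> \<le> card {i\<in>L. theta_ord m (fst i) \<le> t}" by (rule card_mono[OF finL sub])
    also have "\<dots> = (t - s + m) choose m" by (rule cnt) (simp add: t_def)
    also have "\<dots> \<le> (t + m) choose m" by (rule binomial_right_mono) simp
    also have "\<dots> < 2 * ((t - A + m) choose m)"
      using m by (intro binomial_shift_growth) (auto simp: t_def)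
    finally show False by simp
  qed
  define E where "E = {e. (e, j0) \<in> L}"
  have LE: "L = (\<lambda>e. (e, j0)) ` E" 
  proof (intro subset_antisym subsetI)
    fix i assume i: "i \<in> L"
    obtain e j where ej: "i = (e, j)" by (cases i)
    then have "j = j0" using one i by blast
    then show "i \<in> (\<lambda>e. (e, j0)) ` E" using ej i by (simp add: E_def)
  next
    fix i assume "i \<in> (\<lambda>e. (e, j0)) ` E"
    then show "i \<in> L" unfolding E_def by blast
  qed
  have ET: "E \<subseteq> Theta m" using L by (auto simp: E_def)
  have upE': "e' \<in> E" if "e \<in> E" "e' \<in> Theta m" "\<forall>i. e i \<le> e' i" for e e'
    using upE[OF _ that(2,3)] that(1) by (simp add: E_def)
  have cntE: "card {e\<in>E. theta_ord m e \<le> t} = (t - s + m) choose m" if "t \<ge> t0" for t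
  proof -
    have "{i\<in>L. theta_ord m (fst i) \<le> t} = (\<lambda>e. (e, j0)) ` {e\<in>E. theta_ord m e \<le> t}" unfolding LE by auto
    then show ?thesis using cnt[OF that] by (simp add: card_image inj_on_def)
  qed
  define f where "f = (\<lambda>i. LEAST c. \<exists>e\<in>E. e i = c)"
  have e0E: "e0 \<in> E" using e0 by (simp add: E_def)
  have "\<exists>e\<in>E. e i = f i" for i unfolding f_def by (rule LeastI_ex) (use e0E in blast)
  \<comment> \<open>\<open>g i\<close> attains the minimum of coordinate \<open>i\<close>; the
    elements \<open>g i\<close> with \<open>i\<close> in \<open>{1..m}\<close> control how much of
    the cone is missing from \<open>E\<close>.\<close>
  then obtain g where g: "\<And>i. g i \<in> E" "\<And>i. g i i = f i" by metis
  have fle: "f i \<le> e i" if "e \<in> E" for e i unfolding f_def using that by (intro Least_le) blast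
  have fT: "f \<in> Theta m"
  proof -
    have "f i = 0" if "i \<notin> {1..m}" for i
    proof -
      have "e0 i = 0" using j0(2) that by (simp add: Theta_def)
      then show ?thesis using fle[OF e0E, of i] by simp
    qed
    then show ?thesis by (simp add: Theta_def)
  qed
  define \<sigma> where "\<sigma> = theta_ord m f"
  let ?P = "\<lambda>t. {e\<in>Theta m. (\<forall>i. f i \<le> e i) \<and> theta_ord m e \<le> t}"
  have EP: "{e\<in>E. theta_ord m e \<le> t} \<subseteq> ?P t" for t using fle ET by auto
  have finP: "finite (?P t)" for t by (rule card_principal(1)[OF fT])
  have cntP: "card (?P t) = (t - \<sigma> + m) choose m" if "\<sigma> \<le> t" for t
    unfolding \<sigma>_def by (rule card_principal(2)[OF fT]) (use that in \<open>simp add: \<sigma>_def\<close>)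
  have "\<sigma> \<le> s"
  proof (rule ccontr)
    assume "\<not> \<sigma> \<le> s"
    define t where "t = t0 + \<sigma>"
    have "card {e\<in>E. theta_ord m e \<le> t} \<le> card (?P t)" by (rule card_mono[OF finP EP])
    then have "(t - s + m) choose m \<le> (t - \<sigma> + m) choose m"
      using cntE[of t] cntP[of t] by (simp add: t_def)
    moreover have "(t - \<sigma> + m) choose m < (t - s + m) choose m"
    proof -
      have "(t - \<sigma> + m) choose m < Suc (t - \<sigma> + m) choose m"
        using m by (cases m) (auto simp: zero_less_binomial_iff)
      also have "\<dots> \<le> (t - s + m) choose m"
        by (rule binomial_right_mono) (use \<open>\<not> \<sigma> \<le> s\<close> in \<open>simp add: t_def\<close>)
      finally show ?thesis .
    qed
    ultimately show False by simp
  qed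
  have "\<sigma> = s"
  proof (rule ccontr)
    assume "\<sigma> \<noteq> s"
    then have lt: "\<sigma> < s" using \<open>\<sigma> \<le> s\<close> by simp
    define c where "c = Suc (\<Sum>i\<in>{1..m}. \<Sum>k\<in>{1..m}. g i k)"
    have gc: "g i k < c" if "i \<in> {1..m}" "k \<in> {1..m}" for i k
    proof -
      have "g i k \<le> (\<Sum>k\<in>{1..m}. g i k)" using that by (intro member_le_sum) auto
      also have "\<dots> \<le> (\<Sum>i\<in>{1..m}. \<Sum>k\<in>{1..m}. g i k)" using that by (intro member_le_sum) auto
      finally show ?thesis by (simp add: c_def)
    qed
    let ?Q = "\<lambda>t (k, k'). {e\<in>Theta m. e k < c \<and> e k' < c \<and> theta_ord m e \<le> t}"
    let ?I = "{(k, k'). k \<in> {1..m} \<and> k' \<in> {1..m} \<and> k \<noteq> k'}"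
    have finI: "finite ?I" by (rule finite_subset[of _ "{1..m} \<times> {1..m}"]) auto
    have cardI: "card ?I \<le> m * m"
    proof -
      have "card ?I \<le> card ({1..m} \<times> {1..m})" by (rule card_mono) auto
      then show ?thesis by (simp add: card_cartesian_product)
    qed
    \<comment> \<open>An element of the cone outside \<open>E\<close> is not above
      \<open>g 1\<close>, so some coordinate \<open>k\<close> is small. It is not above
      \<open>g k\<close> either, which gives a second small coordinate, different from
      \<open>k\<close> because \<open>g k\<close> is minimal there.\<close>
    have cover: "?P t - {e\<in>E. theta_ord m e \<le> t} \<subseteq> (\<Union>p\<in>?I. ?Q t p)" for t
    proof
      fix e assume e: "e \<in> ?P t - {e\<in>E. theta_ord m e \<le> t}"
      then have eT: "e \<in> Theta m" "\<forall>i. f i \<le> e i" "theta_ord m e \<le> t" "e \<notin> E" by auto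
      have ex: "\<exists>k\<in>{1..m}. e k < g i k" for i
      proof (rule ccontr)
        assume no: "\<not> (\<exists>k\<in>{1..m}. e k < g i k)"
        have "g i k \<le> e k" for k
        proof (cases "k \<in> {1..m}")
          case True
          then show ?thesis using no by (meson not_less)
        next
          case False
          then show ?thesis using g(1)[of i] ET by (auto simp: Theta_def)
        qed
        then show False using upE'[OF g(1)[of i] eT(1)] eT(4) by blast
      qed
      obtain k where k: "k \<in> {1..m}" "e k < g 1 k" using ex by blast
      obtain k' where k': "k' \<in> {1..m}" "e k' < g k k'" using ex by blast
      have "k' \<noteq> k" using k'(2) g(2)[of k] eT(2) by (metis not_less)
      moreover have "e k < c" using k gc[of 1 k] m by simp
      moreover have "e k' < c" using k' gc[OF k(1) k'(1)] by simp
      ultimately show "e \<in> (\<Union>p\<in>?I. ?Q t p)" using eT k k' by blast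
    qed
    define K where "K = m * m * (c * c)"
    have bound: "((t - \<sigma> + m) choose m) - ((t - s + m) choose m) \<le> K * (t + 1) ^ (m - 2)" if t: "t \<ge> t0" for t
    proof -
      have "((t - \<sigma> + m) choose m) - ((t - s + m) choose m) = card (?P t) - card {e\<in>E. theta_ord m e \<le> t}"
        using cntE[OF t] cntP[of t] t t0 lt by simp
      also have "\<dots> = card (?P t - {e\<in>E. theta_ord m e \<le> t})"
        using EP finite_subset[OF EP finP] by (simp add: card_Diff_subset)
      also have "\<dots> \<le> card (\<Union>p\<in>?I. ?Q t p)"
        using finI finT by (intro card_mono cover finite_UN_I) (auto intro: rev_finite_subset[OF finT])
      also have "\<dots> \<le> (\<Sum>p\<in>?I. card (?Q t p))" by (rule card_UN_le[OF finI])
      also have "\<dots> \<le> (\<Sum>p\<in>?I. c * c * (t + 1) ^ (m - 2))"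
        by (rule sum_mono) (use card_two_small_coordinates in auto)
      also have "\<dots> \<le> K * (t + 1) ^ (m - 2)" using cardI by (simp add: K_def mult_right_mono)
      finally show ?thesis .
    qed
    define M where "M = m - 1"
    have M: "M \<ge> 1" "m = Suc M" "m - 2 = M - 1" using m by (auto simp: M_def)
    \<comment> \<open>\<open>2 * s\<close> ensures \<open>t + 1 \<le> 2 * (t - s + m)\<close>; the
      last summand makes \<open>t + 1\<close> exceed the bound that a wrong order would
      impose.\<close>
    define t where "t = t0 + 2 * s + K * (2 * M) ^ M"
    have "(t - s + m) choose M \<le> K * (t + 1) ^ (M - 1)"
    proof -
      have "Suc (t - s + m) choose m = ((t - s + m) choose M) + ((t - s + m) choose m)" unfolding M(2) by simp
      moreover have "Suc (t - s + m) choose m \<le> (t - \<sigma> + m) choose m"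
        by (rule binomial_right_mono) (use lt in \<open>simp add: t_def\<close>)
      ultimately show ?thesis using bound[of t] M(3) by (simp add: t_def)
    qed
    moreover have "real ((t - s + m) choose M) \<ge> (real (t - s + m) / real M) ^ M"
      by (rule binomial_ge_n_over_k_pow_k) (simp add: M(2))
    moreover have "(real (t - s + m) / real M) ^ M \<ge> (real (t + 1) / (2 * real M)) ^ M"
    proof (rule power_mono)
      have "t + 1 \<le> 2 * (t - s + m)" using m by (simp add: t_def)
      then have "real (t + 1) \<le> real (2 * (t - s + m))" unfolding of_nat_le_iff .
      then have "real (t + 1) / 2 \<le> real (t - s + m)" by simp
      then have "(real (t + 1) / 2) / real M \<le> real (t - s + m) / real M" by (rule divide_right_mono) simp
      then show "real (t + 1) / (2 * real M) \<le> real (t - s + m) / real M" by simp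
    qed simp
    ultimately have "(real (t + 1) / (2 * real M)) ^ M \<le> real (K * (t + 1) ^ (M - 1))"
      by linarith
    then have "real (t + 1) ^ M \<le> real K * (2 * real M) ^ M * real (t + 1) ^ (M - 1)"
      using M(1) by (simp add: power_divide divide_le_eq mult_ac)
    moreover have "real (t + 1) ^ M = real (t + 1) * real (t + 1) ^ (M - 1)"
      using M(1) by (metis One_nat_def Suc_diff_le Suc_le_lessD diff_Suc_1 le_add_diff_inverse plus_1_eq_Suc power_Suc)
    ultimately have "real (t + 1) \<le> real K * (2 * real M) ^ M" by simp
    also have "\<dots> = real (K * (2 * M) ^ M)" by simp
    also have "\<dots> < real (t + 1)" unfolding of_nat_less_iff by (simp add: t_def)
    finally show False by simp
  qed
  have "e \<in> E" if e: "e \<in> Theta m" "\<forall>i. f i \<le> e i" for e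
  proof -
    define t where "t = t0 + theta_ord m e"
    have "{e\<in>E. theta_ord m e \<le> t} = ?P t"
    proof (rule card_subset_eq[OF finP EP])
      show "card {e\<in>E. theta_ord m e \<le> t} = card (?P t)"
        using cntE[of t] cntP[of t] \<open>\<sigma> = s\<close> t0 by (simp add: t_def)
    qed
    moreover have "e \<in> ?P t" using e by (simp add: t_def)
    ultimately show ?thesis by blast
  qed
  then have "E = {e. e \<in> Theta m \<and> (\<forall>i. f i \<le> e i)}" using fle subsetD[OF ET] by (intro subset_antisym subsetI) simp_all
  then have "L = {(e, j0) | e. e \<in> Theta m \<and> (\<forall>i. f i \<le> e i)}" unfolding LE by auto
  then show ?thesis using fT j0(1) \<open>\<sigma> = s\<close> unfolding \<sigma>_def by blast
qed

section \<open>Ranking of derivatives\<close>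

text \<open>An index is an exponent vector with the number of an indeterminate; applying the
  operator \<tau> to a derivative adds its exponents.\<close>

definition tadd :: "(nat \<Rightarrow> nat) \<times> nat \<Rightarrow> (nat \<Rightarrow> nat) \<Rightarrow> (nat \<Rightarrow> nat) \<times> nat" where
  "tadd i \<tau> = ((\<lambda>l. fst i l + \<tau> l), snd i)"

definition unitv :: "nat \<Rightarrow> nat \<Rightarrow> nat" where
  "unitv k = (\<lambda>_. 0)(k := 1)"

text \<open>To be compared lexicographically: the order, then the exponents, then the number of the
  indeterminate, repeated in all positions beyond \<open>m\<close>.\<close>

definition key :: "nat \<Rightarrow> (nat \<Rightarrow> nat) \<times> nat \<Rightarrow> nat \<Rightarrow> nat" where
  "key m i l = (if l = 0 then theta_ord m (fst i) else if l \<le> m then fst i l else snd i)"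

text \<open>An orderly ranking in the sense of differential algebra.\<close>

definition rlt :: "nat \<Rightarrow> (nat \<Rightarrow> nat) \<times> nat \<Rightarrow> (nat \<Rightarrow> nat) \<times> nat \<Rightarrow> bool" where
  "rlt m i i' \<longleftrightarrow> (\<exists>k. key m i k < key m i' k \<and> (\<forall>l<k. key m i l = key m i' l))"

lemma rlt_irrefl: "\<not> rlt m i i"
  by (simp add: rlt_def)

lemma rlt_trans:
  assumes "rlt m a b" "rlt m b c"
  shows "rlt m a c"
proof -
  obtain k where k: "key m a k < key m b k" "\<forall>l<k. key m a l = key m b l" using assms(1) by (auto simp: rlt_def)
  obtain k' where k': "key m b k' < key m c k'" "\<forall>l<k'. key m b l = key m c l" using assms(2) by (auto simp: rlt_def)
  consider "k < k'" | "k = k'" | "k' < k" by linarith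
  then show ?thesis
  proof cases
    case 1
    then show ?thesis using k k' unfolding rlt_def by (intro exI[of _ k]) auto
  next
    case 2
    then show ?thesis using k k' unfolding rlt_def by (intro exI[of _ k]) auto
  next
    case 3
    then show ?thesis using k k' unfolding rlt_def by (intro exI[of _ k']) auto
  qed
qed

lemma rlt_asym: "rlt m a b \<Longrightarrow> \<not> rlt m b a"
  using rlt_trans rlt_irrefl by blast

lemma rlt_total:
  assumes "a \<in> Theta m \<times> J" "b \<in> Theta m \<times> J" "a \<noteq> b"
  shows "rlt m a b \<or> rlt m b a"
proof -
  have "\<exists>k. key m a k \<noteq> key m b k"
  proof (rule ccontr)
    assume no: "\<not> ?thesis"
    have "snd a = snd b" using no by (auto simp: key_def dest: spec[of _ "Suc m"])
    moreover have "fst a l = fst b l" for l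
    proof (cases "l \<in> {1..m}")
      case True
      have "key m a l = key m b l" using no by blast
      then show ?thesis using True by (simp add: key_def)
    next
      case False
      then show ?thesis using assms(1,2) by (auto simp: Theta_def)
    qed
    then have "fst a = fst b" by blast
    ultimately show False using assms(3) by (simp add: prod_eq_iff)
  qed
  then obtain k where k: "key m a k \<noteq> key m b k" "\<And>l. l < k \<Longrightarrow> key m a l = key m b l"
    using exists_least_iff[of "\<lambda>k. key m a k \<noteq> key m b k"] by blast
  then show ?thesis unfolding rlt_def using nat_neq_iff by metis
qed

lemma theta_ord_tadd: "theta_ord m (fst (tadd i \<tau>)) = theta_ord m (fst i) + theta_ord m \<tau>"
  by (simp add: tadd_def theta_ord_def sum.distrib)

text \<open>Both keys grow by the same sequence; the ranking is thus compatible with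
  differentiation.\<close>

lemma rlt_tadd: "rlt m (tadd a \<tau>) (tadd b \<tau>) \<longleftrightarrow> rlt m a b"
proof -
  define c where "c = (\<lambda>l. if l = 0 then theta_ord m \<tau> else if l \<le> m then \<tau> l else 0)"
  have k: "key m (tadd i \<tau>) l = key m i l + c l" for i l
    unfolding c_def key_def theta_ord_tadd by (simp add: tadd_def)
  show ?thesis unfolding rlt_def k by simp
qed

lemma theta_ord_pos:
  assumes "\<tau> \<in> Theta m" "\<tau> \<noteq> (\<lambda>_. 0)"
  shows "theta_ord m \<tau> > 0"
proof (rule ccontr)
  assume "\<not> ?thesis"
  then have 0: "\<forall>l\<in>{1..m}. \<tau> l = 0" unfolding theta_ord_def by simp
  have "\<tau> l = 0" for l
    using 0 assms(1) unfolding Theta_def mem_Collect_eq by (cases "l \<in> {1..m}") blast+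
  then have "\<tau> = (\<lambda>_. 0)" by (rule ext)
  then show False using assms(2) by contradiction
qed

lemma rlt_tadd_self:
  assumes "\<tau> \<in> Theta m" "\<tau> \<noteq> (\<lambda>_. 0)"
  shows "rlt m i (tadd i \<tau>)"
proof -
  have "key m i 0 < key m (tadd i \<tau>) 0"
    using theta_ord_pos[OF assms] theta_ord_tadd[of m i \<tau>] by (simp add: key_def)
  then show ?thesis unfolding rlt_def by blast
qed

lemma rlt_orderly: "rlt m a b \<Longrightarrow> theta_ord m (fst a) \<le> theta_ord m (fst b)"
proof -
  assume "rlt m a b"
  then obtain k where "key m a k < key m b k" "\<forall>l<k. key m a l = key m b l" by (auto simp: rlt_def)
  then have "key m a 0 \<le> key m b 0" by (cases "k = 0") auto
  then show ?thesis by (simp add: key_def)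
qed

lemma unitv_Theta: "k \<in> {1..m} \<Longrightarrow> unitv k \<in> Theta m"
  by (auto simp: unitv_def Theta_def)

lemma unitv_nonzero: "unitv k \<noteq> (\<lambda>_. 0)"
proof
  assume "unitv k = (\<lambda>_. 0)"
  then have "unitv k k = 0" by simp
  then show False by (simp add: unitv_def)
qed

lemma tadd_in: "i \<in> Theta m \<times> J \<Longrightarrow> \<tau> \<in> Theta m \<Longrightarrow> tadd i \<tau> \<in> Theta m \<times> J"
  by (auto simp: tadd_def Theta_def)

lemma tadd_commute: "tadd (tadd i \<tau>) \<tau>' = tadd (tadd i \<tau>') \<tau>"
  unfolding tadd_def by (simp add: add.assoc add.commute[of "\<tau> _" "\<tau>' _"])

lemma tadd_cancel: "tadd a \<tau> = tadd b \<tau> \<longleftrightarrow> a = b"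
proof
  assume eq: "tadd a \<tau> = tadd b \<tau>"
  have "fst a l = fst b l" for l
    using fun_cong[OF arg_cong[OF eq, of fst], of l] by (simp add: tadd_def)
  moreover have "snd a = snd b" using arg_cong[OF eq, of snd] by (simp add: tadd_def)
  ultimately show "a = b" by (simp add: prod_eq_iff ext)
qed simp

lemma tadd_unitv: "tadd (e, j) (unitv k) = (e(k := Suc (e k)), j)"
  by (auto simp: tadd_def unitv_def)

lemma tadd_unit_ex:
  assumes "i \<in> Theta m \<times> J" "fst i k \<noteq> 0"
  shows "\<exists>i'\<in>Theta m \<times> J. i = tadd i' (unitv k)"
proof -
  let ?i = "((fst i)(k := fst i k - 1), snd i)"
  have "?i \<in> Theta m \<times> J" using assms by (auto simp: Theta_def)
  moreover have "i = tadd ?i (unitv k)" using assms(2) by (auto simp: tadd_def unitv_def prod_eq_iff)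
  ultimately show ?thesis by blast
qed

section \<open>Differential fields of rational functions in indeterminates\<close>

lemma theta_cong: "(\<And>l. l \<in> {1..j} \<Longrightarrow> e l = e' l) \<Longrightarrow> theta \<delta> j e = theta \<delta> j e'"
  by (induction j) auto

lemma funpow_commute:
  assumes "\<And>x. f (g x) = g (f x)"
  shows "f ((g ^^ k) x) = (g ^^ k) (f x)"
  by (induction k) (simp_all add: assms)

lemma theta_commute:
  assumes "\<And>l x. l \<in> {1..j} \<Longrightarrow> d (\<delta> l x) = \<delta> l (d x)"
  shows "d (theta \<delta> j e x) = theta \<delta> j e (d x)"
  using assms
proof (induction j arbitrary: x)
  case (Suc j)
  have "d ((\<delta> (Suc j) ^^ e (Suc j)) x) = (\<delta> (Suc j) ^^ e (Suc j)) (d x)"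
    by (rule funpow_commute) (use Suc.prems in simp)
  moreover have "d (theta \<delta> j e y) = theta \<delta> j e (d y)" for y
    by (rule Suc.IH) (use Suc.prems in simp)
  ultimately show ?case by simp
qed simp

lemma theta_Suc_exponent:
  assumes "\<And>l x. l \<in> {1..j} \<Longrightarrow> \<delta> k (\<delta> l x) = \<delta> l (\<delta> k x)" "k \<in> {1..j}"
  shows "theta \<delta> j (e(k := Suc (e k))) x = theta \<delta> j e (\<delta> k x)"
  using assms
proof (induction j arbitrary: x)
  case (Suc j)
  show ?case
  proof (cases "k = Suc j")
    case True
    have h: "theta \<delta> j (e(k := Suc (e k))) = theta \<delta> j e" by (rule theta_cong) (use True in auto)
    show ?thesis unfolding theta.simps comp_apply h using True by (simp add: funpow_swap1)
  next
    case False
    then have k: "k \<in> {1..j}" using Suc.prems by auto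
    have h: "theta \<delta> j (e(k := Suc (e k))) y = theta \<delta> j e (\<delta> k y)" for y
      by (rule Suc.IH) (use Suc.prems k in simp_all)
    have "\<delta> k ((\<delta> (Suc j) ^^ e (Suc j)) x) = (\<delta> (Suc j) ^^ e (Suc j)) (\<delta> k x)"
      by (rule funpow_commute) (use Suc.prems in simp)
    then show ?thesis unfolding theta.simps comp_apply h using False by simp
  qed
qed simp

lemma theta_zero: "theta \<delta> j (\<lambda>_. 0) x = x"
  by (induction j) auto

lemma delta_theta:
  assumes "delta_structure m \<delta>" "k \<in> {1..m}"
  shows "\<delta> k (theta \<delta> m e x) = theta \<delta> m (e(k := Suc (e k))) x"
proof -
  have c: "\<delta> k (\<delta> l x) = \<delta> l (\<delta> k x)" if "l \<in> {1..m}" for l x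
    using assms that unfolding delta_structure_def by blast
  have "\<delta> k (theta \<delta> m e x) = theta \<delta> m e (\<delta> k x)" by (rule theta_commute) (rule c)
  also have "\<dots> = theta \<delta> m (e(k := Suc (e k))) x"
    by (rule theta_Suc_exponent[symmetric]) (use c assms in auto)
  finally show ?thesis .
qed

lemma derivation_maps_adjoin:
  assumes "derivation d" "is_subfield L" "K \<subseteq> L" "S \<subseteq> L" "\<And>z. z \<in> K \<Longrightarrow> d z \<in> L" "\<And>z. z \<in> S \<Longrightarrow> d z \<in> L"
    and z: "z \<in> field_adjoin K S"
  shows "d z \<in> L"
proof -
  have "is_subfield {z\<in>L. d z \<in> L}"
    unfolding is_subfield_def
  proof (intro conjI ballI)
    show "1 \<in> {z\<in>L. d z \<in> L}"
      using assms(2) by (simp add: derivation_one[OF assms(1)] subfield_one subfield_zero)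
    fix x assume x: "x \<in> {z\<in>L. d z \<in> L}"
    show "inverse x \<in> {z\<in>L. d z \<in> L}"
      using x assms(2)
      by (simp add: derivation_inverse[OF assms(1)] subfield_inverse subfield_divide subfield_uminus subfield_mult)
    fix y assume "y \<in> {z\<in>L. d z \<in> L}"
    then show "x - y \<in> {z\<in>L. d z \<in> L}" "x * y \<in> {z\<in>L. d z \<in> L}"
      using x assms(2) by (simp_all add: derivation_diff[OF assms(1)] derivation_mult[OF assms(1)]
          subfield_diff subfield_mult subfield_add)
  qed
  then have "field_adjoin K S \<subseteq> {z\<in>L. d z \<in> L}" using assms(3-6) by (intro adjoin_least) auto
  then show ?thesis using z by blast
qed

text \<open>Differentiate \<open>f z = 0\<close> and solve for \<open>d z\<close>; the denominator
  \<open>f' z\<close> is nonzero.\<close>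

lemma derivation_maps_algebraic:
  fixes z :: "'a::field_char_0"
  assumes d: "derivation d" and L: "is_subfield L" "is_subfield L0" "L0 \<subseteq> L" "\<And>x. x \<in> L0 \<Longrightarrow> d x \<in> L"
    and z: "z \<in> L" "algebraic_over L0 z"
  shows "d z \<in> L"
proof -
  obtain f where f: "min_poly L0 z f" using min_poly_exists[OF L(2) z(2)] by blast
  then have fo: "poly_over L0 f" "poly f z = 0" by (auto simp: min_poly_def)
  have nz: "poly (pderiv f) z \<noteq> 0" by (rule min_poly_pderiv[OF L(2) f])
  have "poly_over UNIV f" by (simp add: poly_over_def)
  from derivation_poly[OF d this, of z]
  have "poly (map_poly d f) z + poly (pderiv f) z * d z = 0"
    using fo(2) derivation_zero[OF d] by simp
  then have "poly (pderiv f) z * d z = - poly (map_poly d f) z" by (simp add: eq_neg_iff_add_eq_0 add.commute)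
  then have "d z = - poly (map_poly d f) z / poly (pderiv f) z" using nz by (simp add: field_simps)
  moreover have "poly_over L (map_poly d f)"
    unfolding poly_over_def using L(4) poly_overD[OF fo(1)] by (simp add: coeff_map_poly derivation_zero[OF d])
  moreover have "poly_over L (pderiv f)"
    by (rule poly_over_pderiv[OF L(1) poly_over_mono[OF fo(1) L(3)]])
  ultimately show ?thesis using L(1) z(1) by (simp add: subfield_divide subfield_uminus poly_over_eval)
qed

section \<open>Partial derivations with respect to the derivatives of the indeterminates\<close>

locale dframe =
  fixes m :: nat and \<delta> :: "nat \<Rightarrow> 'a::field_char_0 \<Rightarrow> 'a" and F :: "'a set" and n :: nat and u :: "nat \<Rightarrow> 'a"
  assumes ds: "delta_structure m \<delta>" and dF: "delta_subfield m \<delta> F" and indet: "delta_indeterminates m \<delta> F n u"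
begin

definition I where "I = Theta m \<times> {1..n}"
definition U where "U = (\<lambda>(e, j). theta \<delta> m e (u j))"
definition KK where "KK = field_adjoin F (U ` I)"
abbreviation lt (infix "\<prec>" 50) where "i \<prec> i' \<equiv> rlt m i i'"

lemma F: "is_subfield F" using dF by (simp add: delta_subfield_def)
lemma d: "k \<in> {1..m} \<Longrightarrow> derivation (\<delta> k)" using ds by (simp add: delta_structure_def)
lemma dFF: "k \<in> {1..m} \<Longrightarrow> z \<in> F \<Longrightarrow> \<delta> k z \<in> F" using dF by (simp add: delta_subfield_def)
lemma ind: "alg_independent F I U" using indet by (simp add: delta_indeterminates_def I_def U_def)

lemma KK_delta_adjoin: "KK = delta_adjoin m \<delta> F (u ` {1..n})"
proof -
  have "U ` I = {theta \<delta> m e a | e a. e \<in> Theta m \<and> a \<in> u ` {1..n}}" unfolding U_def I_def by force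
  then show ?thesis unfolding KK_def delta_adjoin_def by simp
qed

lemma KK: "is_subfield KK" unfolding KK_def by (rule is_subfield_adjoin)
lemma FK: "F \<subseteq> KK" unfolding KK_def by (rule adjoin_base)
lemma UK: "i \<in> I \<Longrightarrow> U i \<in> KK" unfolding KK_def using adjoin_gens[of "U ` I" F] by blast

lemma lt_total: "a \<in> I \<Longrightarrow> b \<in> I \<Longrightarrow> a \<noteq> b \<Longrightarrow> a \<prec> b \<or> b \<prec> a"
  using rlt_total unfolding I_def by blast

lemma tadd_I: "i \<in> I \<Longrightarrow> \<tau> \<in> Theta m \<Longrightarrow> tadd i \<tau> \<in> I"
  unfolding I_def by (rule tadd_in)

lemma lt_unit: "k \<in> {1..m} \<Longrightarrow> i \<prec> tadd i (unitv k)"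
  by (rule rlt_tadd_self[OF unitv_Theta unitv_nonzero])

lemma dU: "k \<in> {1..m} \<Longrightarrow> \<delta> k (U i) = U (tadd i (unitv k))"
  unfolding U_def using delta_theta[OF ds] by (cases i) (simp add: tadd_unitv)

lemma finite_below: "finite {j\<in>I. j \<prec> i}"
proof (rule finite_subset)
  show "{j\<in>I. j \<prec> i} \<subseteq> {e\<in>Theta m. theta_ord m e \<le> theta_ord m (fst i)} \<times> {1..n}"
    unfolding I_def using rlt_orderly by fastforce
  show "finite ({e\<in>Theta m. theta_ord m e \<le> theta_ord m (fst i)} \<times> {1..n})"
    by (rule finite_cartesian_product[OF conjunct1[OF finite_card_Theta] finite_atLeastAtMost])
qed

text \<open>The ranking is orderly and only finitely many indices have bounded order, so every
  derivative has finitely many predecessors.\<close>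

lemma lt_induct [consumes 1, case_names less]:
  assumes "i \<in> I" and step: "\<And>i. i \<in> I \<Longrightarrow> (\<And>j. j \<in> I \<Longrightarrow> j \<prec> i \<Longrightarrow> P j) \<Longrightarrow> P i"
  shows "P i"
  using assms(1)
proof (induction "card {j\<in>I. j \<prec> i}" arbitrary: i rule: less_induct)
  case less
  show ?case
  proof (rule step[OF less.prems])
    fix j assume j: "j \<in> I" "j \<prec> i"
    have "{l\<in>I. l \<prec> j} \<subset> {l\<in>I. l \<prec> i}"
      using j rlt_trans rlt_irrefl by blast
    then have "card {l\<in>I. l \<prec> j} < card {l\<in>I. l \<prec> i}" by (rule psubset_card_mono[OF finite_below])
    then show "P j" using less.hyps j(1) by blast
  qed
qed

text \<open>The partial derivation by the variable \<open>U i\<close>, extended to the ambient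
  field. Only its values on \<open>KK\<close> are determined; the choice elsewhere is made once and
  for all.\<close>

definition E where
  "E i = (SOME D. derivation D \<and> (\<forall>c\<in>F. D c = 0) \<and> (\<forall>j\<in>I. D (U j) = (if j = i then 1 else 0)))"

lemma E_props:
  assumes "i \<in> I"
  shows "derivation (E i) \<and> (\<forall>c\<in>F. E i c = 0) \<and> (\<forall>j\<in>I. E i (U j) = (if j = i then 1 else 0))"
  using someI_ex[OF alg_independent_dual[OF F ind assms]] unfolding E_def .

lemma E_der: "i \<in> I \<Longrightarrow> derivation (E i)" using E_props by blast
lemma E_F: "i \<in> I \<Longrightarrow> c \<in> F \<Longrightarrow> E i c = 0" using E_props by blast
lemma E_U: "i \<in> I \<Longrightarrow> j \<in> I \<Longrightarrow> E i (U j) = (if j = i then 1 else 0)" using E_props by blast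

lemma E_KK: "i \<in> I \<Longrightarrow> z \<in> KK \<Longrightarrow> E i z \<in> KK"
proof -
  assume i: "i \<in> I" and z: "z \<in> KK"
  show ?thesis
  proof (rule derivation_maps_adjoin[OF E_der[OF i] KK FK _ _ _ z[unfolded KK_def]])
    show "U ` I \<subseteq> KK" using UK by blast
    show "E i c \<in> KK" if "c \<in> F" for c using E_F[OF i that] subfield_zero[OF KK] by simp
    show "E i c \<in> KK" if "c \<in> U ` I" for c
      using that E_U[OF i] subfield_zero[OF KK] subfield_one[OF KK] by auto
  qed
qed

lemma dKK: "k \<in> {1..m} \<Longrightarrow> z \<in> KK \<Longrightarrow> \<delta> k z \<in> KK"
proof -
  assume k: "k \<in> {1..m}" and z: "z \<in> KK"
  show ?thesis
  proof (rule derivation_maps_adjoin[OF d[OF k] KK FK _ _ _ z[unfolded KK_def]])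
    show "U ` I \<subseteq> KK" using UK by blast
    show "\<delta> k c \<in> KK" if "c \<in> F" for c using dFF[OF k that] FK by blast
    show "\<delta> k c \<in> KK" if c: "c \<in> U ` I" for c
    proof -
      obtain i where i: "i \<in> I" "c = U i" using c by blast
      show ?thesis unfolding i(2) dU[OF k] by (rule UK[OF tadd_I[OF i(1) unitv_Theta[OF k]]])
    qed
  qed
qed

lemma derivations_agree:
  assumes "derivation D" "\<And>c. c \<in> F \<Longrightarrow> D c = 0" "\<And>i. i \<in> I \<Longrightarrow> D (U i) = 0" "z \<in> KK"
  shows "D z = 0"
  by (rule derivation_vanish_adjoin[OF assms(1,2) _ assms(4)[unfolded KK_def]]) (use assms(3) in auto)

text \<open>The commutator of \<open>\<delta> k\<close> with the partial derivation by
  \<open>\<delta> k (U \<pi>)\<close> is the partial derivation by \<open>U \<pi>\<close>. All maps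
  involved are derivations, so it suffices to compare them on \<open>F\<close> and on the
  variables.\<close>

lemma E_delta:
  assumes k: "k \<in> {1..m}" and p: "\<pi> \<in> I" and z: "z \<in> KK"
  shows "E (tadd \<pi> (unitv k)) (\<delta> k z) = E \<pi> z + \<delta> k (E (tadd \<pi> (unitv k)) z)"
proof -
  let ?p = "tadd \<pi> (unitv k)"
  have p': "?p \<in> I" by (rule tadd_I[OF p unitv_Theta[OF k]])
  let ?D = "\<lambda>z. 1 * (E ?p (\<delta> k z) - \<delta> k (E ?p z)) + (- 1) * E \<pi> z"
  have "derivation ?D"
    by (rule derivation_lincomb[OF derivation_commutator[OF E_der[OF p'] d[OF k]] E_der[OF p]])
  then have "?D z = 0"
  proof (rule derivations_agree[OF _ _ _ z])
    fix c assume c: "c \<in> F"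
    show "?D c = 0" using E_F[OF p' dFF[OF k c]] E_F[OF p' c] E_F[OF p c] derivation_zero[OF d[OF k]] by simp
  next
    fix i assume i: "i \<in> I"
    have "E ?p (\<delta> k (U i)) = (if i = \<pi> then 1 else 0)"
      unfolding dU[OF k] E_U[OF p' tadd_I[OF i unitv_Theta[OF k]]] tadd_cancel ..
    moreover have "\<delta> k (E ?p (U i)) = 0"
      unfolding E_U[OF p' i] using derivation_zero[OF d[OF k]] derivation_one[OF d[OF k]] by simp
    ultimately show "?D (U i) = 0" using E_U[OF p i] by simp
  qed
  then show ?thesis by (simp add: algebra_simps)
qed

text \<open>No variable has \<open>U \<pi>\<close> as its derivative under
  \<open>\<delta> k\<close>, so the correction term of \<open>E_delta\<close> is absent.\<close>

lemma E_delta_0: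
  assumes k: "k \<in> {1..m}" and p: "\<pi> \<in> I" "fst \<pi> k = 0" and z: "z \<in> KK"
  shows "E \<pi> (\<delta> k z) = \<delta> k (E \<pi> z)"
proof -
  let ?D = "\<lambda>z. E \<pi> (\<delta> k z) - \<delta> k (E \<pi> z)"
  have "derivation ?D" by (rule derivation_commutator[OF E_der[OF p(1)] d[OF k]])
  then have "?D z = 0"
  proof (rule derivations_agree[OF _ _ _ z])
    fix c assume c: "c \<in> F"
    show "?D c = 0" using E_F[OF p(1) dFF[OF k c]] E_F[OF p(1) c] derivation_zero[OF d[OF k]] by simp
  next
    fix i assume i: "i \<in> I"
    have "tadd i (unitv k) \<noteq> \<pi>" using p(2) by (auto simp: tadd_def unitv_def)
    then have "E \<pi> (\<delta> k (U i)) = 0"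
      unfolding dU[OF k] E_U[OF p(1) tadd_I[OF i unitv_Theta[OF k]]] by simp
    moreover have "\<delta> k (E \<pi> (U i)) = 0"
      unfolding E_U[OF p(1) i] using derivation_zero[OF d[OF k]] derivation_one[OF d[OF k]] by simp
    ultimately show "?D (U i) = 0" by simp
  qed
  then show ?thesis by simp
qed

text \<open>If \<pi> is \<pi>' plus a unit vector, then \<pi>' still lies above \<rho> and
  \<open>E_delta\<close> applies; otherwise \<open>E_delta_0\<close> does.\<close>

lemma E_delta_vanish:
  assumes k: "k \<in> {1..m}" and z: "z \<in> KK" and van: "\<And>\<pi>. \<pi> \<in> I \<Longrightarrow> \<rho> \<prec> \<pi> \<Longrightarrow> E \<pi> z = 0"
    and p: "\<pi> \<in> I" "tadd \<rho> (unitv k) \<prec> \<pi>"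
  shows "E \<pi> (\<delta> k z) = 0"
proof -
  have "\<rho> \<prec> \<pi>" using rlt_trans[OF lt_unit[OF k] p(2)] .
  then have 0: "E \<pi> z = 0" using van p(1) by blast
  show ?thesis
  proof (cases "fst \<pi> k = 0")
    case True
    then show ?thesis using E_delta_0[OF k p(1) True z] 0 derivation_zero[OF d[OF k]] by simp
  next
    case False
    then obtain \<pi>' where p': "\<pi>' \<in> I" "\<pi> = tadd \<pi>' (unitv k)" using tadd_unit_ex p(1) unfolding I_def by blast
    then have "\<rho> \<prec> \<pi>'" using p(2) rlt_tadd by simp
    then have "E \<pi>' z = 0" using van p'(1) by blast
    then show ?thesis using E_delta[OF k p'(1) z] 0 derivation_zero[OF d[OF k]] unfolding p'(2) by simp
  qed
qed

text \<open>The classical behaviour of leaders: differentiation shifts the leader and preserves the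
  partial derivative by it, which plays the part of the separant.\<close>

lemma E_leading:
  assumes z: "z \<in> KK" and r: "\<rho> \<in> I" and van: "\<And>\<pi>. \<pi> \<in> I \<Longrightarrow> \<rho> \<prec> \<pi> \<Longrightarrow> E \<pi> z = 0" and e: "e \<in> Theta m"
  shows "theta \<delta> m e z \<in> KK \<and> (\<forall>\<pi>\<in>I. tadd \<rho> e \<prec> \<pi> \<longrightarrow> E \<pi> (theta \<delta> m e z) = 0)
    \<and> E (tadd \<rho> e) (theta \<delta> m e z) = E \<rho> z"
proof -
  let ?S = "{e. theta \<delta> m e z \<in> KK \<and> (\<forall>\<pi>\<in>I. tadd \<rho> e \<prec> \<pi> \<longrightarrow> E \<pi> (theta \<delta> m e z) = 0)
    \<and> E (tadd \<rho> e) (theta \<delta> m e z) = E \<rho> z \<and> e \<in> Theta m}"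
  have "e \<in> ?S"
  proof (rule upset_ge[of ?S m "\<lambda>_. 0" e])
    fix e k assume eS: "e \<in> ?S" and k: "k \<in> {1..m}"
    let ?y = "theta \<delta> m e z" and ?r = "tadd \<rho> e"
    have y: "?y \<in> KK" "\<And>\<pi>. \<pi> \<in> I \<Longrightarrow> ?r \<prec> \<pi> \<Longrightarrow> E \<pi> ?y = 0" "E ?r ?y = E \<rho> z" "e \<in> Theta m" using eS by auto
    have rI: "?r \<in> I" by (rule tadd_I[OF r y(4)])
    have eq: "theta \<delta> m (e(k := Suc (e k))) z = \<delta> k ?y" using delta_theta[OF ds k] by simp
    have te: "tadd \<rho> (e(k := Suc (e k))) = tadd ?r (unitv k)" by (auto simp: tadd_def unitv_def)
    have eT: "e(k := Suc (e k)) \<in> Theta m" using y(4) k by (auto simp: Theta_def)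
    have rk: "tadd ?r (unitv k) \<in> I" by (rule tadd_I[OF rI unitv_Theta[OF k]])
    have "E (tadd ?r (unitv k)) (\<delta> k ?y) = E \<rho> z"
      using E_delta[OF k rI y(1)] y(2)[OF rk lt_unit[OF k]] y(3) derivation_zero[OF d[OF k]] by simp
    moreover have "\<forall>\<pi>\<in>I. tadd ?r (unitv k) \<prec> \<pi> \<longrightarrow> E \<pi> (\<delta> k ?y) = 0"
      using E_delta_vanish[OF k y(1,2)] by blast
    ultimately show "e(k := Suc (e k)) \<in> ?S" using dKK[OF k y(1)] eT unfolding mem_Collect_eq eq te by blast
  next
    have "tadd \<rho> (\<lambda>_. 0) = \<rho>" by (simp add: tadd_def)
    then show "(\<lambda>_. 0) \<in> ?S" using z van by (simp add: theta_zero Theta_def)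
    show "(\<lambda>_. 0) \<in> Theta m" by (simp add: Theta_def)
  qed (use e in auto)
  then show ?thesis by simp
qed

lemma finite_support:
  assumes "z \<in> KK"
  shows "finite {\<pi>\<in>I. E \<pi> z \<noteq> 0}"
proof -
  obtain T where T: "finite T" "T \<subseteq> I" "z \<in> field_adjoin F (U ` T)"
    using adjoin_finite[OF F assms[unfolded KK_def]] by blast
  have "E \<pi> z = 0" if p: "\<pi> \<in> I" "\<pi> \<notin> T" for \<pi>
  proof (rule derivation_vanish_adjoin[OF E_der[OF p(1)] E_F[OF p(1)] _ T(3)])
    fix c assume "c \<in> U ` T"
    then obtain j where "j \<in> I" "j \<noteq> \<pi>" "c = U j" using T(2) p(2) by blast
    then show "E \<pi> c = 0" using E_U[OF p(1)] by simp
  qed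
  then have "{\<pi>\<in>I. E \<pi> z \<noteq> 0} \<subseteq> T" by blast
  then show ?thesis using T(1) finite_subset by blast
qed

lemma support_adjoin:
  assumes "z \<in> KK" "\<And>\<pi>. \<pi> \<in> I \<Longrightarrow> \<pi> \<notin> S \<Longrightarrow> E \<pi> z = 0"
  shows "z \<in> field_adjoin F (U ` (I \<inter> S))"
  by (rule constants_of_dual_derivations[OF F E_der E_F E_U assms(1)[unfolded KK_def] assms(2)])

lemma leader_exists:
  assumes "z \<in> KK" "z \<notin> F"
  shows "\<exists>\<rho>\<in>I. E \<rho> z \<noteq> 0 \<and> (\<forall>\<pi>\<in>I. \<rho> \<prec> \<pi> \<longrightarrow> E \<pi> z = 0)"
proof -
  let ?S = "{\<pi>\<in>I. E \<pi> z \<noteq> 0}"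
  have "?S \<noteq> {}"
  proof
    assume "?S = {}"
    then have "z \<in> field_adjoin F (U ` (I \<inter> {}))" by (intro support_adjoin assms) auto
    moreover have "field_adjoin F {} \<subseteq> F" by (rule adjoin_least[OF F]) auto
    ultimately show False using assms(2) by auto
  qed
  have "\<exists>\<rho>\<in>?S. \<forall>\<pi>\<in>?S. \<pi> \<noteq> \<rho> \<longrightarrow> \<pi> \<prec> \<rho>"
  proof (rule finite_strict_max[OF finite_support[OF assms(1)] \<open>?S \<noteq> {}\<close>])
    show "a \<prec> b \<or> b \<prec> a" if "a \<in> ?S" "b \<in> ?S" "a \<noteq> b" for a b using lt_total that by blast
    show "a \<prec> c" if "a \<prec> b" "b \<prec> c" for a b c using rlt_trans[OF that] .
  qed
  then obtain \<rho> where rS: "\<rho> \<in> ?S" and rm: "\<forall>\<pi>\<in>?S. \<pi> \<noteq> \<rho> \<longrightarrow> \<pi> \<prec> \<rho>" by blast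
  have "E \<pi> z = 0" if "\<pi> \<in> I" "\<rho> \<prec> \<pi>" for \<pi>
  proof (rule ccontr)
    assume "E \<pi> z \<noteq> 0"
    moreover have "\<pi> \<noteq> \<rho>" using that(2) rlt_irrefl by blast
    ultimately have "\<pi> \<prec> \<rho>" using rm that(1) by blast
    then show False using rlt_asym that(2) by blast
  qed
  then show ?thesis using rS by blast
qed

text \<open>The derivatives of \<open>v\<close> have the distinct leaders
  \<open>tadd \<rho> e\<close>, and the partial derivation by such a leader kills \<open>F\<close>
  and all lower derivatives of \<open>v\<close>. Hence \<open>v\<close> can take the place of the
  indeterminates.\<close>

lemma element_is_indeterminate:
  assumes "v \<in> KK" "v \<notin> F"
  shows "dframe m \<delta> F 1 (\<lambda>_. v)"
proof
  obtain \<rho> where r: "\<rho> \<in> I" "E \<rho> v \<noteq> 0" "\<And>\<pi>. \<pi> \<in> I \<Longrightarrow> \<rho> \<prec> \<pi> \<Longrightarrow> E \<pi> v = 0" using leader_exists[OF assms] by blast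
  have L: "theta \<delta> m e v \<in> KK \<and> (\<forall>\<pi>\<in>I. tadd \<rho> e \<prec> \<pi> \<longrightarrow> E \<pi> (theta \<delta> m e v) = 0)
    \<and> E (tadd \<rho> e) (theta \<delta> m e v) = E \<rho> v" if "e \<in> Theta m" for e
    by (rule E_leading[OF assms(1) r(1) _ that]) (rule r(3))
  show "delta_indeterminates m \<delta> F 1 (\<lambda>_. v)"
    unfolding delta_indeterminates_def
  proof (rule alg_independent_triangular[OF F, where lt = "rlt m"])
    show "rlt m a b \<or> rlt m b a" if "a \<in> Theta m \<times> {1..1}" "b \<in> Theta m \<times> {1..1}" "a \<noteq> b" for a b
      using rlt_total that by blast
    show "rlt m a c" if "rlt m a b" "rlt m b c" for a b c using rlt_trans[OF that] .
  next
    fix i assume i: "i \<in> Theta m \<times> {1..1::nat}"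
    let ?V = "\<lambda>(e, j). theta \<delta> m e v"
    obtain e where e: "i = (e, 1)" "e \<in> Theta m" using i by auto
    have rI: "tadd \<rho> e \<in> I" by (rule tadd_I[OF r(1) e(2)])
    show "?V i \<notin> dcl (F \<union> ?V ` {j \<in> Theta m \<times> {1..1}. rlt m j i})"
    proof
      assume "?V i \<in> dcl (F \<union> ?V ` {j \<in> Theta m \<times> {1..1}. rlt m j i})"
      then have "E (tadd \<rho> e) (?V i) = 0"
      proof (rule dclD[OF _ E_der[OF rI]])
        fix s assume "s \<in> F \<union> ?V ` {j \<in> Theta m \<times> {1..1}. rlt m j i}"
        then show "E (tadd \<rho> e) s = 0"
        proof
          assume "s \<in> F" then show ?thesis by (rule E_F[OF rI])
        next
          assume "s \<in> ?V ` {j \<in> Theta m \<times> {1..1}. rlt m j i}"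
          then obtain e' where e': "e' \<in> Theta m" "rlt m (e', 1) (e, 1)" "s = theta \<delta> m e' v" using e(1) by auto
          have "rlt m (tadd (e', 1) (fst \<rho>)) (tadd (e, 1) (fst \<rho>))" using e'(2) by (simp add: rlt_tadd)
          \<comment> \<open>Both indices have the same component \<open>snd \<rho>\<close>, which
            does not influence the comparison.\<close>
          moreover have "rlt m (tadd \<rho> e') (tadd \<rho> e) \<longleftrightarrow> rlt m (tadd (e', 1) (fst \<rho>)) (tadd (e, 1) (fst \<rho>))"
          proof -
            have "key m (tadd \<rho> a) l = (if l \<le> m then key m (tadd (a, 1) (fst \<rho>)) l else snd \<rho>)" for a l
              unfolding key_def tadd_def by (simp add: add.commute)
            moreover have "key m (tadd (a, 1) (fst \<rho>)) l = 1" if "\<not> l \<le> m" for a l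
              using that unfolding key_def tadd_def by simp
            ultimately show ?thesis unfolding rlt_def by (metis (no_types, lifting) less_irrefl)
          qed
          ultimately have "tadd \<rho> e' \<prec> tadd \<rho> e" by blast
          then show ?thesis using L[OF e'(1)] rI unfolding e'(3) by blast
        qed
      qed
      then show False using L[OF e(2)] r(2) e(1) by simp
    qed
  qed
qed (rule ds, rule dF)

end

lemma hom_on_prod:
  "is_subfield M \<Longrightarrow> hom_on M h \<Longrightarrow> (\<And>i. i \<in> A \<Longrightarrow> g i \<in> M) \<Longrightarrow> h (prod g A) = (\<Prod>i\<in>A. h (g i))"
  by (induction A rule: infinite_finite_induct) (simp_all add: hom_on_one hom_on_mult subfield_prod)

lemma hom_on_ev:
  assumes M: "is_subfield M" and h: "hom_on M h" and p: "mp_over K J p" "K \<subseteq> M" and x: "\<And>j. j \<in> J \<Longrightarrow> x j \<in> M"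
  shows "h (ev x p) = meval h (\<lambda>i. h (x i)) p"
proof -
  have xM: "x i \<in> M" if "\<mu> \<in> Poly_Mapping.keys p" "i \<in> Poly_Mapping.keys \<mu>" for \<mu> i
    using mp_over_keys[OF p(1) that(1)] that(2) x by blast
  have mM: "monoval x \<mu> \<in> M" if "\<mu> \<in> Poly_Mapping.keys p" for \<mu>
    unfolding monoval_def using xM[OF that] by (intro subfield_prod[OF M] subfield_power[OF M])
  have cM: "Poly_Mapping.lookup p \<mu> \<in> M" for \<mu> using mp_over_lookup[OF p(1)] p(2) by blast
  have m: "h (monoval x \<mu>) = monoval (\<lambda>i. h (x i)) \<mu>" if "\<mu> \<in> Poly_Mapping.keys p" for \<mu>
  proof -
    have "h (monoval x \<mu>) = (\<Prod>i\<in>Poly_Mapping.keys \<mu>. h (x i ^ Poly_Mapping.lookup \<mu> i))"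
      unfolding monoval_def using xM[OF that] by (intro hom_on_prod[OF M h] subfield_power[OF M])
    also have "\<dots> = (\<Prod>i\<in>Poly_Mapping.keys \<mu>. h (x i) ^ Poly_Mapping.lookup \<mu> i)"
      using xM[OF that] by (intro prod.cong refl hom_on_power[OF M h])
    finally show ?thesis unfolding monoval_def .
  qed
  have "h (ev x p) = (\<Sum>\<mu>\<in>Poly_Mapping.keys p. h (Poly_Mapping.lookup p \<mu> * monoval x \<mu>))"
    unfolding meval_def using cM mM by (intro hom_on_sum[OF M h] subfield_mult[OF M])
  also have "\<dots> = (\<Sum>\<mu>\<in>Poly_Mapping.keys p. h (Poly_Mapping.lookup p \<mu>) * monoval (\<lambda>i. h (x i)) \<mu>)"
    using cM mM m by (intro sum.cong refl) (simp add: hom_on_mult[OF h])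
  finally show ?thesis unfolding meval_def .
qed

lemma der_on_compose: "hom_on M h \<Longrightarrow> derivation D \<Longrightarrow> der_on M h (\<lambda>z. D (h z))"
  unfolding der_on_def by (simp add: hom_on_add hom_on_mult derivation_add[of D] derivation_mult[of D])

lemma algebraic_over_member:
  fixes z :: "'a::field_char_0"
  assumes "is_subfield L" "z \<in> L"
  shows "algebraic_over L z"
  using assms(2) dcl_base[of L] by (simp add: algebraic_over_iff_dcl[OF assms(1)] subsetD)

lemma poly_over_linear_product:
  assumes "is_subfield M" "\<And>x. x \<in># A \<Longrightarrow> x \<in> M"
  shows "poly_over M (\<Prod>x\<in>#A. [:- x, 1:])"
  using assms(2)
proof (induction A)
  case empty
  show ?case by (simp add: poly_over_1[OF assms(1)])
next
  case (add a A)
  have "poly_over M [:- a, 1:]" using add.prems assms(1)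
    by (intro poly_over_pCons poly_over_0 subfield_one subfield_uminus) auto
  moreover have "poly_over M (\<Prod>x\<in>#A. [:- x, 1:])" by (rule add.IH) (use add.prems in auto)
  ultimately show ?case unfolding image_mset_add_mset prod_mset.add_mset by (rule poly_over_mult[OF assms(1)])
qed

section \<open>Subfields with a principal set of leaders\<close>

locale lueroth_frame = dframe +
  fixes G :: "'a set" and f :: "nat \<Rightarrow> nat" and j0 :: nat
  assumes dG: "delta_subfield m \<delta> G" and FG: "F \<subseteq> G" and GK: "G \<subseteq> KK" and fT: "f \<in> Theta m" and j0: "j0 \<in> {1..n}"
    and leaders: "{i\<in>I. U i \<in> dcl (G \<union> U ` {j\<in>I. rlt m j i})} = {(e, j0) | e. e \<in> Theta m \<and> (\<forall>i. f i \<le> e i)}"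
begin

text \<open>\<open>w0\<close> is the lowest leader, \<open>Ld\<close> the set of leaders, \<open>B\<close> the parametric derivatives and \<open>Lo\<close> the
  ones below \<open>w0\<close>.\<close>

definition w0 where "w0 = (f, j0)"
definition Ld where "Ld = {(e, j0) | e. e \<in> Theta m \<and> (\<forall>i. f i \<le> e i)}"
definition B where "B = I - Ld"
definition below where "below i = {j\<in>I. j \<prec> i}"
definition Lo where "Lo = below w0"
definition x0 where "x0 = U w0"
definition N0 where "N0 = field_adjoin G (U ` Lo)"

lemma G: "is_subfield G" using dG by (simp add: delta_subfield_def)
lemma dGG: "k \<in> {1..m} \<Longrightarrow> g \<in> G \<Longrightarrow> \<delta> k g \<in> G" using dG by (simp add: delta_subfield_def)
lemma Ld_I: "Ld \<subseteq> I" using leaders unfolding Ld_def by blast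
lemma w0_Ld: "w0 \<in> Ld" unfolding Ld_def w0_def using fT by blast
lemma w0_I: "w0 \<in> I" using w0_Ld Ld_I by blast
lemma Ld_iff: "i \<in> I \<Longrightarrow> i \<in> Ld \<longleftrightarrow> U i \<in> dcl (G \<union> U ` below i)" using leaders unfolding Ld_def below_def by blast
lemma below_I: "below i \<subseteq> I" unfolding below_def by blast
lemma fin_below: "finite (below i)" unfolding below_def by (rule finite_below)
lemma below_trans: "i \<prec> i' \<Longrightarrow> below i \<subseteq> below i'" unfolding below_def using rlt_trans by blast

lemma Ld_offset:
  assumes "i \<in> Ld"
  shows "\<exists>\<tau>\<in>Theta m. i = tadd w0 \<tau>"
proof -
  obtain e where e: "i = (e, j0)" "e \<in> Theta m" "\<forall>l. f l \<le> e l" using assms unfolding Ld_def by blast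
  have "i = tadd w0 (\<lambda>l. e l - f l)" unfolding tadd_def w0_def e(1) using e(3) by auto
  moreover have "(\<lambda>l. e l - f l) \<in> Theta m" using e(2) unfolding Theta_def by simp
  ultimately show ?thesis by blast
qed

lemma Ld_step:
  assumes "i \<in> Ld" "i \<noteq> w0"
  shows "\<exists>k\<in>{1..m}. \<exists>i'\<in>Ld. i = tadd i' (unitv k)"
proof -
  obtain e where e: "i = (e, j0)" "e \<in> Theta m" "\<forall>l. f l \<le> e l" using assms unfolding Ld_def by blast
  have "\<exists>k. e k \<noteq> f k"
  proof (rule ccontr)
    assume "\<not> ?thesis"
    then have "e = f" by (intro ext) simp
    then show False using assms(2) e(1) unfolding w0_def by simp
  qed
  then obtain k where k: "e k \<noteq> f k" by blast
  have k1: "f k < e k" using spec[OF e(3), of k] k by simp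
  have km: "k \<in> {1..m}"
  proof (rule ccontr)
    assume "k \<notin> {1..m}"
    then have "e k = 0" using e(2) unfolding Theta_def by blast
    then show False using k1 by simp
  qed
  let ?i = "(e(k := e k - 1), j0)"
  have "?i \<in> Ld" unfolding Ld_def using e k1 km by (auto simp: Theta_def)
  moreover have "i = tadd ?i (unitv k)" unfolding e(1) tadd_unitv using k1 by simp
  ultimately show ?thesis using km by blast
qed

lemma w0_least: "i \<in> Ld \<Longrightarrow> \<not> i \<prec> w0"
proof
  assume i: "i \<in> Ld" "i \<prec> w0"
  obtain \<tau> where t: "\<tau> \<in> Theta m" "i = tadd w0 \<tau>" using Ld_offset[OF i(1)] by blast
  show False
  proof (cases "\<tau> = (\<lambda>_. 0)")
    case True
    then have "i = w0" using t(2) by (simp add: tadd_def)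
    then show False using i(2) rlt_irrefl by simp
  next
    case False
    then have "w0 \<prec> i" unfolding t(2) by (rule rlt_tadd_self[OF t(1)])
    then show False using i(2) rlt_asym by blast
  qed
qed

lemma Lo_B: "Lo \<subseteq> B"
  unfolding Lo_def below_def B_def using w0_least by blast

lemma Lo_I: "Lo \<subseteq> I" unfolding Lo_def by (rule below_I)
lemma fin_Lo: "finite Lo" unfolding Lo_def by (rule fin_below)
lemma B_I: "B \<subseteq> I" unfolding B_def by blast

lemma indB: "alg_independent G B U"
proof (rule alg_independent_triangular[OF G, where lt = "rlt m"])
  show "a \<prec> b \<or> b \<prec> a" if "a \<in> B" "b \<in> B" "a \<noteq> b" for a b using lt_total that B_I by blast
  show "a \<prec> c" if "a \<prec> b" "b \<prec> c" for a b c using rlt_trans[OF that] .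
  fix i assume i: "i \<in> B"
  have "G \<union> U ` {j\<in>B. j \<prec> i} \<subseteq> G \<union> U ` below i" unfolding below_def using B_I by blast
  moreover have "U i \<notin> dcl (G \<union> U ` below i)" using Ld_iff i unfolding B_def by blast
  ultimately show "U i \<notin> dcl (G \<union> U ` {j\<in>B. j \<prec> i})" using dcl_mono by blast
qed

lemma x0_alg: "algebraic_over N0 x0"
  unfolding N0_def x0_def Lo_def algebraic_over_iff_dcl[OF is_subfield_adjoin] dcl_adjoin
  using Ld_iff[OF w0_I] w0_Ld by blast

text \<open>If \<open>D\<close> kills \<open>G\<close> and all derivatives below \<rho>, then
  \<open>D g = D (U \<rho>) * E \<rho> g\<close>, as \<open>g\<close> is rational in
  \<open>U \<rho>\<close> and lower ones. Here \<open>D g = 0\<close> and \<open>E \<rho> g\<close>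
  is nonzero.\<close>

lemma leader_in_Ld:
  assumes g: "g \<in> G" and r: "\<rho> \<in> I" "E \<rho> g \<noteq> 0" "\<And>\<pi>. \<pi> \<in> I \<Longrightarrow> \<rho> \<prec> \<pi> \<Longrightarrow> E \<pi> g = 0"
  shows "\<rho> \<in> Ld"
  unfolding Ld_iff[OF r(1)]
proof (rule dclI)
  fix D assume D: "derivation D" "\<And>s. s \<in> G \<union> U ` below \<rho> \<Longrightarrow> D s = 0"
  have gK: "g \<in> KK" using g GK by blast
  have "g \<in> field_adjoin F (U ` (I \<inter> insert \<rho> (below \<rho>)))"
  proof (rule support_adjoin[OF gK])
    fix \<pi> assume p: "\<pi> \<in> I" "\<pi> \<notin> insert \<rho> (below \<rho>)"
    then have "\<rho> \<prec> \<pi>" using lt_total[OF p(1) r(1)] unfolding below_def by blast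
    then show "E \<pi> g = 0" using r(3) p(1) by blast
  qed
  moreover have "derivation (\<lambda>z. 1 * D z + (- D (U \<rho>)) * E \<rho> z)"
    by (rule derivation_lincomb[OF D(1) E_der[OF r(1)]])
  ultimately have "1 * D g + (- D (U \<rho>)) * E \<rho> g = 0"
  proof (rule derivation_vanish_adjoin[rotated -1])
    fix c assume "c \<in> F"
    then show "1 * D c + (- D (U \<rho>)) * E \<rho> c = 0" using D(2)[of c] FG E_F[OF r(1)] by auto
  next
    fix c assume "c \<in> U ` (I \<inter> insert \<rho> (below \<rho>))"
    then obtain j where j: "j \<in> I" "c = U j" "j = \<rho> \<or> j \<in> below \<rho>" by blast
    show "1 * D c + (- D (U \<rho>)) * E \<rho> c = 0"
    proof (cases "j = \<rho>")
      case True
      then show ?thesis using j E_U[OF r(1) r(1)] by simp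
    next
      case False
      then show ?thesis using j E_U[OF r(1) j(1)] D(2)[of c] by simp
    qed
  qed
  moreover have "D g = 0" using D(2) g by blast
  ultimately show "D (U \<rho>) = 0" using r(2) by simp
qed

lemma leaders_generated:
  assumes base: "algebraic_over (field_adjoin (Gam w0) (U ` Lo)) x0"
    and mono: "\<And>i k. i \<in> Ld \<Longrightarrow> k \<in> {1..m} \<Longrightarrow> Gam i \<subseteq> Gam (tadd i (unitv k))"
    and del: "\<And>i k g. i \<in> Ld \<Longrightarrow> k \<in> {1..m} \<Longrightarrow> g \<in> Gam i \<Longrightarrow> \<delta> k g \<in> Gam (tadd i (unitv k))"
    and i: "i \<in> Ld"
  shows "algebraic_over (field_adjoin (Gam i) (U ` below i)) (U i) \<and>
    (i \<noteq> w0 \<longrightarrow> U i \<in> field_adjoin (Gam i) (U ` below i))"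
proof -
  have "i \<in> I" using i Ld_I by blast
  then have "i \<in> Ld \<longrightarrow> algebraic_over (field_adjoin (Gam i) (U ` below i)) (U i) \<and>
    (i \<noteq> w0 \<longrightarrow> U i \<in> field_adjoin (Gam i) (U ` below i))"
  proof (induction i rule: lt_induct)
    case (less i)
    show ?case
    proof (cases "i \<in> Ld \<and> i \<noteq> w0")
      case False
      then show ?thesis using base unfolding x0_def Lo_def by blast
    next
      case True
      then obtain k i' where k: "k \<in> {1..m}" "i' \<in> Ld" "i = tadd i' (unitv k)" using Ld_step[of i] True by blast
      have lt: "i' \<prec> i" unfolding k(3) by (rule lt_unit[OF k(1)])
      have i'I: "i' \<in> I" using k(2) Ld_I by blast
      define L where "L = field_adjoin (Gam i) (U ` below i)"
      define L0 where "L0 = field_adjoin (Gam i') (U ` below i')"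
      have L: "is_subfield L" "Gam i \<subseteq> L" unfolding L_def by (rule is_subfield_adjoin, rule adjoin_base)
      have LU: "U j \<in> L" if "j \<in> below i" for j
        unfolding L_def using adjoin_gens[of "U ` below i" "Gam i"] that by blast
      have sub: "Gam i' \<subseteq> Gam i" unfolding k(3) by (rule mono[OF k(2,1)])
      have "\<delta> k (U i') \<in> L"
      proof (rule derivation_maps_algebraic[OF d[OF k(1)] L(1), of L0])
        show "is_subfield L0" unfolding L0_def by (rule is_subfield_adjoin)
        show "L0 \<subseteq> L" unfolding L0_def L_def
          by (rule adjoin_mono[OF sub image_mono[OF below_trans[OF lt]]])
        show "U i' \<in> L" by (rule LU) (simp add: below_def lt i'I)
        show "algebraic_over L0 (U i')" unfolding L0_def using less.IH[OF i'I lt] k(2) by blast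
        fix z assume "z \<in> L0"
        then show "\<delta> k z \<in> L" unfolding L0_def
        proof (rule derivation_maps_adjoin[OF d[OF k(1)] L(1), rotated -1])
          show "Gam i' \<subseteq> L" using sub L(2) by blast
          show "U ` below i' \<subseteq> L" using below_trans[OF lt] LU by blast
          show "\<delta> k z \<in> L" if "z \<in> Gam i'" for z
            using del[OF k(2,1) that] L(2) unfolding k(3) by blast
          show "\<delta> k z \<in> L" if z: "z \<in> U ` below i'" for z
          proof -
            obtain j where j: "j \<in> I" "j \<prec> i'" "z = U j" using z unfolding below_def by blast
            have "tadd j (unitv k) \<in> below i"
              unfolding below_def k(3) using tadd_I[OF j(1) unitv_Theta[OF k(1)]] j(2) by (simp add: rlt_tadd)
            then show ?thesis unfolding j(3) dU[OF k(1)] by (rule LU)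
          qed
        qed
      qed
      then have "U i \<in> L" unfolding dU[OF k(1)] k(3) .
      then show ?thesis using algebraic_over_member[OF L(1)] unfolding L_def by blast
    qed
  qed
  then show ?thesis using i by blast
qed

lemma KK_generated:
  assumes H: "delta_subfield m \<delta> H" "F \<subseteq> H" and alg: "algebraic_over (field_adjoin H (U ` Lo)) x0"
  shows "KK \<subseteq> field_adjoin H (U ` B \<union> {x0})"
proof -
  let ?L = "field_adjoin H (U ` B \<union> {x0})"
  have "U i \<in> ?L" if "i \<in> I" for i
    using that
  proof (induction i rule: lt_induct)
    case (less i)
    show ?case
    proof (cases "i \<in> Ld")
      case False
      then have "U i \<in> U ` B \<union> {x0}" using less.hyps unfolding B_def by blast
      then show ?thesis using adjoin_gens[of "U ` B \<union> {x0}" H] by blast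
    next
      case True
      show ?thesis
      proof (cases "i = w0")
        case True
        then show ?thesis using adjoin_gens[of "U ` B \<union> {x0}" H] unfolding x0_def by blast
      next
        case False
        have "U i \<in> field_adjoin H (U ` below i)"
          using leaders_generated[of "\<lambda>_. H", OF alg _ _ True] H(1) False unfolding delta_subfield_def by blast
        moreover have "field_adjoin H (U ` below i) \<subseteq> ?L"
        proof (rule adjoin_least[OF is_subfield_adjoin adjoin_base])
          show "U ` below i \<subseteq> ?L" using less.IH unfolding below_def by blast
        qed
        ultimately show ?thesis by blast
      qed
    qed
  qed
  then show ?thesis unfolding KK_def using H(2) adjoin_base[of H "U ` B \<union> {x0}"]
    by (intro adjoin_least is_subfield_adjoin) blast+
qed

lemma N0: "is_subfield N0" unfolding N0_def by (rule is_subfield_adjoin)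
lemma G_N0: "G \<subseteq> N0" unfolding N0_def by (rule adjoin_base)
lemma U_N0: "j \<in> Lo \<Longrightarrow> U j \<in> N0" unfolding N0_def using adjoin_gens[of "U ` Lo" G] by blast
lemma dual_B:
  assumes "b \<in> B"
  shows "\<exists>D. derivation D \<and> (\<forall>g\<in>G. D g = 0) \<and> (\<forall>j\<in>B. D (U j) = (if j = b then 1 else 0))"
  by (rule alg_independent_dual[OF G indB assms])

text \<open>The embedding of \<open>G\<close> is extended three times: the derivatives in
  \<open>Lo\<close> are rescaled, \<open>x0\<close> goes to a root of the transported polynomial,
  and the other parametric derivatives are fixed. By \<open>KK_generated\<close> this reaches
  \<open>KK\<close>. The map on \<open>N0\<close> precedes the choice of the root and is common to
  all conjugates.\<close>

lemma sigma_exists: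
  fixes c :: "(nat \<Rightarrow> nat) \<times> nat \<Rightarrow> nat"
  assumes f0: "min_poly N0 x0 f0" and c: "\<And>j. j \<in> Lo \<Longrightarrow> c j > 0"
  shows "\<exists>\<sigma>\<^sub>1. hom_on N0 \<sigma>\<^sub>1 \<and> (\<forall>g\<in>G. \<sigma>\<^sub>1 g = to_ac g) \<and> (\<forall>j\<in>Lo. \<sigma>\<^sub>1 (U j) = to_ac (of_nat (c j) * U j)) \<and>
    (\<forall>y. poly (map_poly \<sigma>\<^sub>1 f0) y = 0 \<longrightarrow>
      (\<exists>\<sigma>. hom_on KK \<sigma> \<and> (\<forall>z\<in>N0. \<sigma> z = \<sigma>\<^sub>1 z) \<and> (\<forall>j\<in>B - Lo. \<sigma> (U j) = to_ac (U j)) \<and> \<sigma> x0 = y))"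
proof -
  have ind1: "alg_independent G Lo U" by (rule alg_independent_subset[OF indB Lo_B])
  have "alg_independent (to_ac ` G) Lo (\<lambda>j. to_ac (of_nat (c j) * U j))"
  proof (rule dual_imp_alg_independent[OF to_ac_subfield[OF G]])
    fix i assume i: "i \<in> Lo"
    obtain D where D: "derivation D" "\<And>g. g \<in> G \<Longrightarrow> D g = 0" "\<And>j. j \<in> B \<Longrightarrow> D (U j) = (if j = i then 1 else 0)"
      using dual_B[of i] i Lo_B by blast
    obtain D' where D': "derivation D'" "\<And>x. D' (to_ac x) = to_ac (D x)" using derivation_lift_ac[OF D(1)] by blast
    let ?D = "\<lambda>z. inverse (of_nat (c i)) * D' z + 0 * D' z"
    have "derivation ?D" by (rule derivation_lincomb[OF D'(1) D'(1)])
    moreover have "?D g = 0" if g: "g \<in> to_ac ` G" for g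
    proof -
      obtain a where "a \<in> G" "g = to_ac a" using g by blast
      then show ?thesis using D'(2)[of a] D(2)[of a] by simp
    qed
    moreover have "?D (to_ac (of_nat (c j) * U j)) = (if j = i then 1 else 0)" if j: "j \<in> Lo" for j
    proof -
      have "j \<in> B" using j Lo_B by blast
      then have "D (of_nat (c j) * U j) = of_nat (c j) * (if j = i then 1 else 0)"
        using D(3) derivation_of_nat[OF D(1)] by (simp add: derivation_mult[OF D(1)])
      then have "D' (to_ac (of_nat (c j) * U j)) = of_nat (c j) * (if j = i then 1 else 0)"
        unfolding D'(2) by simp
      then show ?thesis using c[OF i] by simp
    qed
    ultimately show "\<exists>D. derivation D \<and> (\<forall>g\<in>to_ac ` G. D g = 0) \<and>
       (\<forall>j\<in>Lo. D (to_ac (of_nat (c j) * U j)) = (if j = i then 1 else 0))" by blast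
  qed
  then obtain \<sigma>1 where s1: "hom_on N0 \<sigma>1" "\<And>g. g \<in> G \<Longrightarrow> \<sigma>1 g = to_ac g" "\<And>j. j \<in> Lo \<Longrightarrow> \<sigma>1 (U j) = to_ac (of_nat (c j) * U j)"
    using hom_extend_independent[OF G hom_on_to_ac ind1] unfolding N0_def by blast
  have "\<exists>\<sigma>. hom_on KK \<sigma> \<and> (\<forall>z\<in>N0. \<sigma> z = \<sigma>1 z) \<and> (\<forall>j\<in>B - Lo. \<sigma> (U j) = to_ac (U j)) \<and> \<sigma> x0 = y"
    if y: "poly (map_poly \<sigma>1 f0) y = 0" for y
  proof -
    define N1 where "N1 = field_adjoin N0 {x0}"
    have N1: "is_subfield N1" "N0 \<subseteq> N1" "x0 \<in> N1"
      unfolding N1_def using is_subfield_adjoin[of N0 "{x0}"] adjoin_base[of N0 "{x0}"] adjoin_gens[of "{x0}" N0] by auto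
    obtain \<sigma>2 where s2: "hom_on N1 \<sigma>2" "\<And>z. z \<in> N0 \<Longrightarrow> \<sigma>2 z = \<sigma>1 z" "\<sigma>2 x0 = y"
      using hom_extend_algebraic[OF N0 s1(1) f0 y] unfolding N1_def by blast
    \<comment> \<open>The image of \<sigma>2 is algebraic over \<open>G\<close> and the
      \<open>U Lo\<close>, so a derivation that kills these kills it. Therefore the remaining
      parametric derivatives stay independent over the image.\<close>
    have kill: "D' (\<sigma>2 z) = 0" if D': "derivation D'" "\<And>g. g \<in> G \<Longrightarrow> D' (to_ac g) = 0"
      "\<And>j. j \<in> Lo \<Longrightarrow> D' (to_ac (U j)) = 0" and z: "z \<in> N1" for D' z
    proof -
      have der: "der_on N1 \<sigma>2 (\<lambda>z. D' (\<sigma>2 z))" by (rule der_on_compose[OF s2(1) D'(1)])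
      have 0: "D' (\<sigma>2 z) = 0" if "z \<in> N0" for z
      proof (rule der_on_vanish_adjoin[OF N1(1) s2(1) der _ _ _ _ that[unfolded N0_def]])
        show "G \<subseteq> N1" using G_N0 N1(2) by blast
        show "U ` Lo \<subseteq> N1" using U_N0 N1(2) by blast
        show "D' (\<sigma>2 x) = 0" if "x \<in> G" for x
          using s2(2)[of x] s1(2)[OF that] G_N0 that D'(2)[OF that] by auto
        show "D' (\<sigma>2 x) = 0" if x: "x \<in> U ` Lo" for x
        proof -
          obtain j where j: "j \<in> Lo" "x = U j" using x by blast
          have "\<sigma>2 x = of_nat (c j) * to_ac (U j)" unfolding j(2) s2(2)[OF U_N0[OF j(1)]] s1(3)[OF j(1)] by simp
          then show ?thesis using D'(3)[OF j(1)] derivation_of_nat[OF D'(1)] by (simp add: derivation_mult[OF D'(1)])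
        qed
      qed
      have x: "D' (\<sigma>2 x0) = 0"
        by (rule der_on_vanish_algebraic[OF N1(1) s2(1) der N1(2) N0 N1(3) 0 x0_alg])
      show ?thesis
        by (rule der_on_vanish_adjoin[OF N1(1) s2(1) der N1(2) _ 0 _ z[unfolded N1_def]]) (use x N1(3) in auto)
    qed
    have kill': "D z = 0" if D: "derivation D" "\<And>g. g \<in> G \<Longrightarrow> D g = 0" "\<And>j. j \<in> Lo \<Longrightarrow> D (U j) = 0" and z: "z \<in> N1" for D z
    proof -
      have 0: "D z = 0" if "z \<in> N0" for z
        by (rule derivation_vanish_adjoin[OF D(1,2) _ that[unfolded N0_def]]) (use D(3) in auto)
      have "x0 \<in> dcl N0" using x0_alg by (simp add: algebraic_over_iff_dcl[OF N0])
      then have "D x0 = 0" by (rule dclD[OF _ D(1) 0])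
      then show ?thesis by (intro derivation_vanish_adjoin[OF D(1) 0 _ z[unfolded N1_def]]) auto
    qed
    have dual: "\<exists>D. derivation D \<and> (\<forall>g\<in>G. D g = 0) \<and> (\<forall>j\<in>Lo. D (U j) = 0) \<and> (\<forall>j\<in>B - Lo. D (U j) = (if j = b then 1 else 0))"
      if b: "b \<in> B - Lo" for b
    proof -
      obtain D where D: "derivation D" "\<forall>g\<in>G. D g = 0" "\<forall>j\<in>B. D (U j) = (if j = b then 1 else 0)" using dual_B[OF DiffD1[OF b]] by (elim exE conjE)
      have "D (U j) = 0" if "j \<in> Lo" for j using bspec[OF D(3), of j] Lo_B b that by auto
      moreover have "\<forall>j\<in>B - Lo. D (U j) = (if j = b then 1 else 0)" using D(3) by (intro ballI) (erule bspec, blast)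
      ultimately show ?thesis using D(1,2) by (intro exI[of _ D] conjI ballI) simp_all
    qed
    have ind2: "alg_independent N1 (B - Lo) U"
    proof (rule dual_imp_alg_independent[OF N1(1)])
      fix b assume b: "b \<in> B - Lo"
      obtain D where D0: "derivation D" "\<forall>g\<in>G. D g = 0" "\<forall>j\<in>Lo. D (U j) = 0"
        "\<forall>j\<in>B - Lo. D (U j) = (if j = b then 1 else 0)" using dual[OF b] by (elim exE conjE)
      note D = D0(1) bspec[OF D0(2)] bspec[OF D0(3)] D0(4)
      show "\<exists>D. derivation D \<and> (\<forall>c\<in>N1. D c = 0) \<and> (\<forall>j\<in>B - Lo. D (U j) = (if j = b then 1 else 0))"
        using kill'[OF D(1-3)] by (intro exI[of _ D] conjI ballI D(1)) (simp_all add: bspec[OF D(4)])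
    qed
    have "is_subfield (\<sigma>2 ` N1)"
      unfolding is_subfield_def
    proof (intro conjI ballI)
      show "1 \<in> \<sigma>2 ` N1" using hom_on_one[OF s2(1)] subfield_one[OF N1(1)] by (metis imageI)
      fix x y assume "x \<in> \<sigma>2 ` N1"
      then obtain a where a: "a \<in> N1" "x = \<sigma>2 a" by blast
      show "inverse x \<in> \<sigma>2 ` N1"
        unfolding a(2) hom_on_inverse[OF N1(1) s2(1) a(1), symmetric] by (rule imageI[OF subfield_inverse[OF N1(1) a(1)]])
      assume "y \<in> \<sigma>2 ` N1"
      then obtain b where b: "b \<in> N1" "y = \<sigma>2 b" by blast
      show "x - y \<in> \<sigma>2 ` N1" unfolding a(2) b(2) hom_on_diff[OF N1(1) s2(1) a(1) b(1), symmetric]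
        by (rule imageI[OF subfield_diff[OF N1(1) a(1) b(1)]])
      show "x * y \<in> \<sigma>2 ` N1" unfolding a(2) b(2) hom_on_mult[OF s2(1) a(1) b(1), symmetric]
        by (rule imageI[OF subfield_mult[OF N1(1) a(1) b(1)]])
    qed
    then have ind3: "alg_independent (\<sigma>2 ` N1) (B - Lo) (\<lambda>j. to_ac (U j))"
    proof (rule dual_imp_alg_independent)
      fix b assume b: "b \<in> B - Lo"
      obtain D where D0: "derivation D" "\<forall>g\<in>G. D g = 0" "\<forall>j\<in>Lo. D (U j) = 0"
        "\<forall>j\<in>B - Lo. D (U j) = (if j = b then 1 else 0)" using dual[OF b] by (elim exE conjE)
      note D = D0(1) bspec[OF D0(2)] bspec[OF D0(3)] D0(4)
      obtain D' where D': "derivation D'" "\<And>x. D' (to_ac x) = to_ac (D x)" using derivation_lift_ac[OF D(1)] by blast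
      have "\<forall>c\<in>\<sigma>2 ` N1. D' c = 0"
      proof (intro ballI)
        fix c assume "c \<in> \<sigma>2 ` N1"
        then obtain z where z: "z \<in> N1" "c = \<sigma>2 z" by blast
        show "D' c = 0" unfolding z(2) by (rule kill[OF D'(1) _ _ z(1)]) (simp_all add: D'(2) D(2,3))
      qed
      moreover have "\<forall>j\<in>B - Lo. D' (to_ac (U j)) = (if j = b then 1 else 0)" unfolding D'(2) using D(4) by simp
      ultimately show "\<exists>D. derivation D \<and> (\<forall>c\<in>\<sigma>2 ` N1. D c = 0) \<and> (\<forall>j\<in>B - Lo. D (to_ac (U j)) = (if j = b then 1 else 0))"
        using D'(1) by (intro exI[of _ D'] conjI)
    qed
    obtain \<sigma> where s: "hom_on (field_adjoin N1 (U ` (B - Lo))) \<sigma>" "\<And>z. z \<in> N1 \<Longrightarrow> \<sigma> z = \<sigma>2 z"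
      "\<And>j. j \<in> B - Lo \<Longrightarrow> \<sigma> (U j) = to_ac (U j)"
      using hom_extend_independent[OF N1(1) s2(1) ind2 ind3] by blast
    have "KK \<subseteq> field_adjoin N1 (U ` (B - Lo))"
    proof -
      have "KK \<subseteq> field_adjoin G (U ` B \<union> {x0})"
        by (rule KK_generated[OF dG FG x0_alg[unfolded N0_def]])
      moreover have "U ` B \<union> {x0} = U ` Lo \<union> {x0} \<union> U ` (B - Lo)" using Lo_B by blast
      ultimately show ?thesis unfolding N1_def N0_def adjoin_adjoin by (simp add: Un_assoc)
    qed
    then have "hom_on KK \<sigma>" using hom_on_subset[OF s(1)] by blast
    moreover have "\<forall>z\<in>N0. \<sigma> z = \<sigma>1 z" using s(2) s2(2) N1(2) by (metis subsetD)
    moreover have "\<sigma> x0 = y" using s(2)[OF N1(3)] s2(3) by simp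
    ultimately show ?thesis using s(3) by blast
  qed
  then show ?thesis using s1 by blast
qed

end

lemma is_subfield_ball:
  "is_subfield M \<Longrightarrow> (\<And>\<pi>. \<pi> \<in> P \<Longrightarrow> is_subfield {x. D \<pi> x = 0}) \<Longrightarrow> is_subfield {x\<in>M. \<forall>\<pi>\<in>P. D \<pi> x = 0}"
  unfolding is_subfield_def by blast

context lueroth_frame
begin

section \<open>How conjugation interacts with differentiation\<close>

context
  fixes \<sigma> :: "'a \<Rightarrow> 'a alg_closure" and EH and \<tau>0 \<rho>
  assumes s: "hom_on KK \<sigma>" and sG: "\<And>g. g \<in> G \<Longrightarrow> \<sigma> g = to_ac g"
    and sB: "\<And>b. b \<in> B \<Longrightarrow> \<exists>c::nat. \<sigma> (U b) = of_nat c * to_ac (U b)"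
    and EH: "\<And>\<pi>. \<pi> \<in> I \<Longrightarrow> derivation (EH \<pi>)" "\<And>\<pi> z. \<pi> \<in> I \<Longrightarrow> EH \<pi> (to_ac z) = to_ac (E \<pi> z)"
    and t0: "\<tau>0 \<in> Theta m" "\<tau>0 \<noteq> (\<lambda>_. 0)" and r: "\<rho> = tadd w0 \<tau>0"
    and alg: "algebraic_over (field_adjoin {g\<in>G. \<forall>\<pi>\<in>I. \<rho> \<prec> \<pi> \<longrightarrow> E \<pi> g = 0} (U ` Lo)) x0"
begin

text \<open>The partial derivative of the conjugate \<sigma> \<open>z\<close> by
  \<open>U \<pi>\<close>; its vanishing expresses that \<pi> does not occur there.\<close>

definition \<Phi> where "\<Phi> \<pi> z = EH \<pi> (\<sigma> z)"
text \<open>The elements of \<open>G\<close> without derivatives above \<open>i + \<tau>0\<close>.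
  For \<open>w0\<close> the bound is \<rho>, and \<open>\<delta> k\<close> raises the bound in step
  with \<open>i\<close>, as \<open>leaders_generated\<close> requires.\<close>

definition Gam where "Gam i = {g\<in>G. \<forall>\<pi>\<in>I. tadd i \<tau>0 \<prec> \<pi> \<longrightarrow> E \<pi> g = 0}"

lemma shift_I: "i \<in> I \<Longrightarrow> tadd i \<tau>0 \<in> I" by (rule tadd_I[OF _ t0(1)])
lemma shift_gt: "i \<prec> tadd i \<tau>0" by (rule rlt_tadd_self[OF t0])

lemma Phi_der: "\<pi> \<in> I \<Longrightarrow> der_on KK \<sigma> (\<Phi> \<pi>)"
  unfolding \<Phi>_def by (rule der_on_compose[OF s EH(1)])

lemma Phi_G: "\<pi> \<in> I \<Longrightarrow> g \<in> G \<Longrightarrow> \<Phi> \<pi> g = to_ac (E \<pi> g)"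
  unfolding \<Phi>_def using sG EH(2) by simp

lemma Phi_B:
  assumes "\<pi> \<in> I" "b \<in> B" "b \<noteq> \<pi>"
  shows "\<Phi> \<pi> (U b) = 0"
proof -
  obtain c :: nat where c: "\<sigma> (U b) = of_nat c * to_ac (U b)" using sB[OF assms(2)] by blast
  have "b \<in> I" using assms(2) B_I by blast
  then have "EH \<pi> (to_ac (U b)) = 0" using EH(2)[OF assms(1)] E_U[OF assms(1)] assms(3) by simp
  then show ?thesis unfolding \<Phi>_def c
    using derivation_of_nat[OF EH(1)[OF assms(1)], of c] by (simp add: derivation_mult[OF EH(1)[OF assms(1)]])
qed

lemma Gam_G: "Gam i \<subseteq> G" unfolding Gam_def by blast

lemma Gam_generates:
  assumes "i \<in> Ld"
  shows "algebraic_over (field_adjoin (Gam i) (U ` below i)) (U i)"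
proof (rule conjunct1[OF leaders_generated[of Gam, OF _ _ _ assms]])
  show "algebraic_over (field_adjoin (Gam w0) (U ` Lo)) x0" using alg unfolding Gam_def r .
  fix i k assume i: "i \<in> Ld" and k: "k \<in> {1..m}"
  have lt: "tadd i \<tau>0 \<prec> tadd (tadd i (unitv k)) \<tau>0" unfolding rlt_tadd by (rule lt_unit[OF k])
  show "Gam i \<subseteq> Gam (tadd i (unitv k))" unfolding Gam_def using rlt_trans[OF lt] by blast
  fix g assume g: "g \<in> Gam i"
  have gG: "g \<in> G" using g Gam_G by blast
  have "E \<pi> (\<delta> k g) = 0" if p: "\<pi> \<in> I" "tadd (tadd i (unitv k)) \<tau>0 \<prec> \<pi>" for \<pi>
  proof (rule E_delta_vanish[OF k subsetD[OF GK gG] _ p(1)])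
    show "E \<pi> g = 0" if "\<pi> \<in> I" "tadd i \<tau>0 \<prec> \<pi>" for \<pi> using g that unfolding Gam_def by blast
    show "tadd (tadd i \<tau>0) (unitv k) \<prec> \<pi>" using p(2) tadd_commute[of i \<tau>0 "unitv k"] by simp
  qed
  then show "\<delta> k g \<in> Gam (tadd i (unitv k))" unfolding Gam_def using dGG[OF k gG] by blast
qed

text \<open>Differentiating transports the coefficient \<open>\<Phi> \<rho> x0\<close> of the derivative \<open>\<rho> = w0 + \<tau>0\<close> in \<open>\<sigma> x0\<close> to every
  leader \<open>i\<close>: the highest derivative in \<open>\<sigma> (U i)\<close> is at most \<open>i + \<tau>0\<close>, with the same coefficient.\<close>

lemma Phi_leader:
  assumes "i \<in> Ld"
  shows "\<Phi> (tadd i \<tau>0) (U i) = \<Phi> \<rho> x0 \<and> (\<forall>\<pi>\<in>I. tadd i \<tau>0 \<prec> \<pi> \<longrightarrow> \<Phi> \<pi> (U i) = 0)"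
proof -
  have "i \<in> I" using assms Ld_I by blast
  then have "i \<in> Ld \<longrightarrow> \<Phi> (tadd i \<tau>0) (U i) = \<Phi> \<rho> x0 \<and> (\<forall>\<pi>\<in>I. tadd i \<tau>0 \<prec> \<pi> \<longrightarrow> \<Phi> \<pi> (U i) = 0)"
  proof (induction i rule: lt_induct)
    case (less i)
    have below0: "\<Phi> \<pi> (U j) = 0" if j: "j \<in> I" "j \<prec> i" and p: "\<pi> \<in> I" "tadd j \<tau>0 \<prec> \<pi>" for j \<pi>
    proof (cases "j \<in> Ld")
      case True
      then show ?thesis using less.IH[OF j] p by blast
    next
      case False
      have "j \<prec> \<pi>" by (rule rlt_trans[OF shift_gt p(2)])
      then have "j \<noteq> \<pi>" using rlt_irrefl by blast
      then show ?thesis using Phi_B[OF p(1)] False j(1) unfolding B_def by blast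
    qed
    show ?case
    proof
      assume iL: "i \<in> Ld"
      show "\<Phi> (tadd i \<tau>0) (U i) = \<Phi> \<rho> x0 \<and> (\<forall>\<pi>\<in>I. tadd i \<tau>0 \<prec> \<pi> \<longrightarrow> \<Phi> \<pi> (U i) = 0)"
      proof (cases "i = w0")
        case True
        \<comment> \<open>\<open>x0\<close> is algebraic over elements whose conjugates involve
          nothing above \<rho>: those of \<open>Gam w0\<close> by definition, the derivatives in
          \<open>Lo\<close> because \<sigma> only rescales them.\<close>
        have "\<Phi> \<pi> (U i) = 0" if p: "\<pi> \<in> I" "tadd i \<tau>0 \<prec> \<pi>" for \<pi>
        proof -
          let ?L = "field_adjoin (Gam i) (U ` below i)"
          have sub: "Gam i \<subseteq> KK" "U ` below i \<subseteq> KK" using Gam_G GK UK below_I by blast+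
          show ?thesis
          proof (rule der_on_vanish_algebraic[OF KK s Phi_der[OF p(1)] _ is_subfield_adjoin UK[OF less.hyps] _ Gam_generates[OF iL]])
            show "?L \<subseteq> KK" by (rule adjoin_least[OF KK sub])
            fix z assume "z \<in> ?L"
            then show "\<Phi> \<pi> z = 0"
            proof (rule der_on_vanish_adjoin[OF KK s Phi_der[OF p(1)] sub, rotated -1])
              fix g assume g: "g \<in> Gam i"
              then have "E \<pi> g = 0" using p unfolding Gam_def by blast
              then show "\<Phi> \<pi> g = 0" using Phi_G[OF p(1)] g Gam_G by (simp add: subset_eq)
            next
              fix g assume "g \<in> U ` below i"
              then obtain j where j: "j \<in> I" "j \<prec> i" "g = U j" unfolding below_def by blast
              have "tadd j \<tau>0 \<prec> \<pi>" by (rule rlt_trans[OF _ p(2)]) (simp add: rlt_tadd j(2))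
              then show "\<Phi> \<pi> g = 0" unfolding j(3) using below0[OF j(1,2) p(1)] by blast
            qed
          qed
        qed
        then show ?thesis unfolding True r x0_def by blast
      next
        case False
        obtain k i' where k: "k \<in> {1..m}" "i' \<in> Ld" "i = tadd i' (unitv k)" using Ld_step[OF iL False] by blast
        have lt: "i' \<prec> i" unfolding k(3) by (rule lt_unit[OF k(1)])
        have i'I: "i' \<in> I" using k(2) Ld_I by blast
        let ?p' = "tadd i' \<tau>0"
        have pp: "tadd i \<tau>0 = tadd ?p' (unitv k)" unfolding k(3) by (rule tadd_commute)
        have p'I: "?p' \<in> I" by (rule shift_I[OF i'I])
        have p'lt: "?p' \<prec> tadd i \<tau>0" by (simp add: rlt_tadd lt)
        have gen: "algebraic_over (field_adjoin (Gam i') (U ` below i')) (U i')" by (rule Gam_generates[OF k(2)])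
        \<comment> \<open>\<sigma> is not assumed to commute with \<open>\<delta> k\<close>. But on
          the kernel of \<open>\<Phi> \<pi>\<close> the map
          \<open>\<Phi> \<pi> (\<delta> k z)\<close> is again a derivation along \<sigma>; so it
          agrees with \<open>Q\<close> at \<open>U i'\<close> as soon as it does on
          \<open>Gam i'\<close> and the derivatives below \<open>i'\<close>.\<close>
        have trans: "\<Phi> \<pi> (U i) = c" if p: "\<pi> \<in> I" "?p' \<prec> \<pi>"
          and Q: "der_on KK \<sigma> Q" and
            g: "\<And>g. g \<in> Gam i' \<Longrightarrow> \<Phi> \<pi> (\<delta> k g) = Q g"
            and j: "\<And>j. j \<in> I \<Longrightarrow> j \<prec> i' \<Longrightarrow> \<Phi> \<pi> (U (tadd j (unitv k))) = Q (U j)"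
            and dv: "Q (U i') = c" for \<pi> Q c
        proof -
          define N where "N = {z\<in>KK. \<Phi> \<pi> z = 0}"
          have N: "is_subfield N" unfolding N_def by (rule der_on_kernel_subfield[OF KK s Phi_der[OF p(1)]])
          have NK: "N \<subseteq> KK" unfolding N_def by blast
          have sN: "hom_on N \<sigma>" by (rule hom_on_subset[OF s NK])
          let ?T = "\<lambda>z. \<Phi> \<pi> (\<delta> k z) - Q z"
          have "der_on N \<sigma> (\<lambda>z. \<Phi> \<pi> (\<delta> k z))"
            unfolding der_on_def
          proof (intro ballI conjI)
            fix a b assume ab: "a \<in> N" "b \<in> N"
            have K: "a \<in> KK" "b \<in> KK" "\<delta> k a \<in> KK" "\<delta> k b \<in> KK" using ab NK dKK[OF k(1)] by blast+
            have z: "\<Phi> \<pi> a = 0" "\<Phi> \<pi> b = 0" using ab unfolding N_def by blast+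
            note D = Phi_der[OF p(1)]
            show "\<Phi> \<pi> (\<delta> k (a + b)) = \<Phi> \<pi> (\<delta> k a) + \<Phi> \<pi> (\<delta> k b)"
              unfolding derivation_add[OF d[OF k(1)]] by (rule der_on_add[OF D K(3,4)])
            show "\<Phi> \<pi> (\<delta> k (a * b)) = \<Phi> \<pi> (\<delta> k a) * \<sigma> b + \<sigma> a * \<Phi> \<pi> (\<delta> k b)"
              unfolding derivation_mult[OF d[OF k(1)]]
                der_on_add[OF D subfield_mult[OF KK K(3,2)] subfield_mult[OF KK K(1,4)]]
                der_on_mult[OF D K(3,2)] der_on_mult[OF D K(1,4)] z by simp
          qed
          then have der: "der_on N \<sigma> ?T" by (rule der_on_minus[OF _ der_on_subset[OF Q NK]])
          have gN: "Gam i' \<subseteq> N"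
          proof
            fix g assume g: "g \<in> Gam i'"
            then have "E \<pi> g = 0" "g \<in> G" using p unfolding Gam_def by blast+
            then show "g \<in> N" unfolding N_def using Phi_G[OF p(1)] GK by auto
          qed
          have jN: "U j \<in> N" if j: "j \<in> I" "j \<prec> i' \<or> j = i'" for j
          proof -
            have "j \<prec> i" using j(2) lt rlt_trans by blast
            moreover have "tadd j \<tau>0 \<prec> \<pi>"
            proof (cases "j = i'")
              case False
              then have "tadd j \<tau>0 \<prec> ?p'" using j(2) by (simp add: rlt_tadd)
              then show ?thesis by (rule rlt_trans[OF _ p(2)])
            qed (use p(2) in simp)
            ultimately have "\<Phi> \<pi> (U j) = 0" using below0[OF j(1) _ p(1)] by blast
            then show ?thesis unfolding N_def using UK[OF j(1)] by blast
          qed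
          have bN: "U ` below i' \<subseteq> N" unfolding below_def using jN by blast
          have "?T (U i') = 0"
          proof (rule der_on_vanish_algebraic[OF N sN der _ is_subfield_adjoin _ _ gen])
            show "field_adjoin (Gam i') (U ` below i') \<subseteq> N" by (rule adjoin_least[OF N gN bN])
            show "U i' \<in> N" using jN[OF i'I] by blast
            fix z assume "z \<in> field_adjoin (Gam i') (U ` below i')"
            then show "?T z = 0"
            proof (rule der_on_vanish_adjoin[OF N sN der gN bN, rotated -1])
              show "?T x = 0" if "x \<in> Gam i'" for x using g[OF that] by simp
              show "?T x = 0" if x: "x \<in> U ` below i'" for x
              proof -
                obtain l where l: "l \<in> I" "l \<prec> i'" "x = U l" using x unfolding below_def by blast
                show ?thesis unfolding l(3) dU[OF k(1)] using j[OF l(1,2)] by simp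
              qed
            qed
          qed
          then show ?thesis unfolding dU[OF k(1)] k(3) using dv by simp
        qed
        have up0: "\<Phi> \<pi> (U (tadd j (unitv k))) = 0" if j: "j \<in> I" "j \<prec> i'" and p: "\<pi> \<in> I" "tadd i \<tau>0 = \<pi> \<or> tadd i \<tau>0 \<prec> \<pi>" for j \<pi>
        proof -
          have lt': "tadd j (unitv k) \<prec> i" unfolding k(3) rlt_tadd by (rule j(2))
          then have "tadd (tadd j (unitv k)) \<tau>0 \<prec> tadd i \<tau>0" by (simp add: rlt_tadd)
          then have "tadd (tadd j (unitv k)) \<tau>0 \<prec> \<pi>" using p(2) rlt_trans by blast
          then show ?thesis using below0[OF tadd_I[OF j(1) unitv_Theta[OF k(1)]] lt' p(1)] by blast
        qed
        show ?thesis
        proof (intro conjI ballI impI)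
          have piI: "tadd i \<tau>0 \<in> I" by (rule shift_I[OF less.hyps])
          \<comment> \<open>Here \<open>Q\<close> is \<open>\<Phi> ?p'\<close>, by the commutation
            rule \<open>E_delta\<close>; so the coefficient passes unchanged from \<open>i'\<close>
            to \<open>i\<close>.\<close>
          show "\<Phi> (tadd i \<tau>0) (U i) = \<Phi> \<rho> x0"
          proof (rule trans[OF piI p'lt Phi_der[OF p'I]])
            fix g assume g: "g \<in> Gam i'"
            have gG: "g \<in> G" using g Gam_G by blast
            have "E (tadd i \<tau>0) g = 0" using g piI p'lt unfolding Gam_def by blast
            then have "E (tadd i \<tau>0) (\<delta> k g) = E ?p' g"
              using E_delta[OF k(1) p'I subsetD[OF GK gG]] derivation_zero[OF d[OF k(1)]] unfolding pp by simp
            then show "\<Phi> (tadd i \<tau>0) (\<delta> k g) = \<Phi> ?p' g"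
              unfolding Phi_G[OF piI dGG[OF k(1) gG]] Phi_G[OF p'I gG] by simp
          next
            fix j assume j: "j \<in> I" "j \<prec> i'"
            have "\<Phi> ?p' (U j) = 0" by (rule below0[OF j(1) rlt_trans[OF j(2) lt] p'I]) (simp add: rlt_tadd j(2))
            then show "\<Phi> (tadd i \<tau>0) (U (tadd j (unitv k))) = \<Phi> ?p' (U j)" using up0[OF j piI] by simp
          next
            show "\<Phi> ?p' (U i') = \<Phi> \<rho> x0" using less.IH[OF i'I lt] k(2) by blast
          qed
        next
          fix \<pi> assume p: "\<pi> \<in> I" "tadd i \<tau>0 \<prec> \<pi>"
          show "\<Phi> \<pi> (U i) = 0"
          proof (rule trans[OF p(1) rlt_trans[OF p'lt p(2)], of "\<lambda>_. 0"])
            show "der_on KK \<sigma> (\<lambda>_. 0)" by (simp add: der_on_def)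
            fix g assume g: "g \<in> Gam i'"
            have gG: "g \<in> G" using g Gam_G by blast
            have "E \<pi> (\<delta> k g) = 0"
            proof (rule E_delta_vanish[OF k(1) subsetD[OF GK gG] _ p(1)])
              show "E \<pi> g = 0" if "\<pi> \<in> I" "?p' \<prec> \<pi>" for \<pi> using g that unfolding Gam_def by blast
              show "tadd ?p' (unitv k) \<prec> \<pi>" using p(2) unfolding pp .
            qed
            then show "\<Phi> \<pi> (\<delta> k g) = 0" unfolding Phi_G[OF p(1) dGG[OF k(1) gG]] by simp
          next
            fix j assume j: "j \<in> I" "j \<prec> i'"
            show "\<Phi> \<pi> (U (tadd j (unitv k))) = 0" using up0[OF j p(1)] p(2) by blast
          qed simp
        qed
      qed
    qed
  qed
  then show ?thesis using assms by blast
qed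

text \<open>Apply \<open>EH (\<rho> + \<tau>0)\<close> to \<open>\<sigma> \<gamma> = \<gamma>\<close>, where \<open>\<gamma>\<close> is written as a rational function of derivatives up to \<open>\<rho>\<close>.\<close>

lemma Phi_x0_zero:
  assumes rL: "\<rho> \<in> Ld" and g: "\<gamma> \<in> G" "\<And>\<pi>. \<pi> \<in> I \<Longrightarrow> \<rho> \<prec> \<pi> \<Longrightarrow> E \<pi> \<gamma> = 0" "E \<rho> \<gamma> \<noteq> 0"
  shows "EH \<rho> (\<sigma> x0) = 0"
proof -
  have rI: "\<rho> \<in> I" using rL Ld_I by blast
  let ?p = "tadd \<rho> \<tau>0"
  have pI: "?p \<in> I" by (rule shift_I[OF rI])
  have gK: "\<gamma> \<in> KK" using g(1) GK by blast
  \<comment> \<open>The chain rule: \<gamma> depends on \<open>U \<rho>\<close> with coefficient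
    \<open>E \<rho> \<gamma>\<close>, and by \<open>Phi_leader\<close> the conjugate of
    \<open>U \<rho>\<close> contains \<open>\<rho> + \<tau>0\<close> with coefficient
    \<open>\<Phi> \<rho> x0\<close>. The lower derivatives contribute nothing there.\<close>
  let ?T = "\<lambda>z. \<Phi> ?p z - \<sigma> (E \<rho> z) * \<Phi> \<rho> x0"
  have "der_on KK \<sigma> (\<lambda>z. \<sigma> (E \<rho> z))"
    unfolding der_on_def
  proof (intro ballI conjI)
    fix a b assume ab: "a \<in> KK" "b \<in> KK"
    have K: "E \<rho> a \<in> KK" "E \<rho> b \<in> KK" using ab by (auto intro: E_KK[OF rI])
    show "\<sigma> (E \<rho> (a + b)) = \<sigma> (E \<rho> a) + \<sigma> (E \<rho> b)"
      unfolding derivation_add[OF E_der[OF rI]] by (rule hom_on_add[OF s K])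
    show "\<sigma> (E \<rho> (a * b)) = \<sigma> (E \<rho> a) * \<sigma> b + \<sigma> a * \<sigma> (E \<rho> b)"
      unfolding derivation_mult[OF E_der[OF rI]] hom_on_add[OF s subfield_mult[OF KK K(1) ab(2)] subfield_mult[OF KK ab(1) K(2)]]
        hom_on_mult[OF s K(1) ab(2)] hom_on_mult[OF s ab(1) K(2)] ..
  qed
  then have der: "der_on KK \<sigma> ?T" by (rule der_on_minus[OF Phi_der[OF pI] der_on_scale])
  have "\<gamma> \<in> field_adjoin F (U ` (I \<inter> insert \<rho> (below \<rho>)))"
  proof (rule support_adjoin[OF gK])
    fix \<pi> assume p: "\<pi> \<in> I" "\<pi> \<notin> insert \<rho> (below \<rho>)"
    then have "\<rho> \<prec> \<pi>" using lt_total[OF p(1) rI] unfolding below_def by blast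
    then show "E \<pi> \<gamma> = 0" using g(2) p(1) by blast
  qed
  then have "?T \<gamma> = 0"
  proof (rule der_on_vanish_adjoin[OF KK s der FK, rotated -1])
    show "U ` (I \<inter> insert \<rho> (below \<rho>)) \<subseteq> KK" using UK by blast
    have s0: "\<sigma> 0 = 0" "\<sigma> 1 = 1" using hom_on_zero[OF KK s] hom_on_one[OF s] .
    show "?T z = 0" if "z \<in> F" for z
      using Phi_G[OF pI subsetD[OF FG that]] E_F[OF pI that] E_F[OF rI that] s0 by simp
    show "?T z = 0" if z: "z \<in> U ` (I \<inter> insert \<rho> (below \<rho>))" for z
    proof -
      obtain j where j: "j \<in> I" "z = U j" "j = \<rho> \<or> j \<in> below \<rho>" using z by blast
      show ?thesis
      proof (cases "j = \<rho>")
        case True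
        then show ?thesis using Phi_leader[OF rL] E_U[OF rI rI] s0 unfolding j(2) by simp
      next
        case False
        then have lt: "j \<prec> \<rho>" using j(3) unfolding below_def by blast
        have "\<Phi> ?p (U j) = 0"
        proof (cases "j \<in> Ld")
          case True
          have "tadd j \<tau>0 \<prec> ?p" by (simp add: rlt_tadd lt)
          then show ?thesis using Phi_leader[OF True] pI by blast
        next
          case False
          have "j \<noteq> ?p" using rlt_trans[OF lt shift_gt] rlt_irrefl by metis
          then show ?thesis using Phi_B[OF pI] False j(1) unfolding B_def by blast
        qed
        then show ?thesis using E_U[OF rI j(1)] False s0 unfolding j(2) by simp
      qed
    qed
  qed
  \<comment> \<open>\<sigma> fixes \<gamma>, which involves nothing above \<rho>.\<close>
  moreover have "\<Phi> ?p \<gamma> = 0" using Phi_G[OF pI g(1)] g(2)[OF pI shift_gt] by simp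
  moreover have "\<sigma> (E \<rho> \<gamma>) \<noteq> 0" using hom_on_eq_0_iff[OF KK s E_KK[OF rI gK]] g(3) by simp
  ultimately show ?thesis unfolding \<Phi>_def by simp
qed

end

end

lemma alg_independent_base_mono:
  assumes "alg_independent M' J x" "M \<subseteq> M'"
  shows "alg_independent M J x"
  unfolding alg_independent_alt
proof (intro allI impI)
  fix p assume p: "mp_over M J p" "ev x p = 0"
  have "mp_over M' J p" by (rule mp_over_mono[OF p(1) assms(2) subset_refl])
  then show "p = 0" using assms(1) p(2) unfolding alg_independent_alt by simp
qed

lemma coeffs_in_subfield_of_roots:
  fixes p :: "'a::alg_closed_field poly"
  assumes M: "is_subfield M" and p: "lead_coeff p = 1" and roots: "\<And>y. poly p y = 0 \<Longrightarrow> y \<in> M"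
  shows "poly_over M p"
proof -
  have p0: "p \<noteq> 0" using p by auto
  obtain A where A: "p = smult (lead_coeff p) (\<Prod>x\<in>#A. [:- x, 1:])" using alg_closed_imp_factorization[OF p0] by blast
  then have pA: "p = (\<Prod>x\<in>#A. [:- x, 1:])" using p by simp
  have "y \<in> M" if "y \<in># A" for y
  proof (rule roots)
    have "[:- y, 1:] dvd p" unfolding pA using that by (intro dvd_prod_mset) simp
    then show "poly p y = 0" by (simp add: poly_eq_0_iff_dvd)
  qed
  then show ?thesis unfolding pA by (rule poly_over_linear_product[OF M])
qed

section \<open>Generated differential subfields\<close>

lemma delta_adjoin_delta_subfield:
  assumes ds: "delta_structure m \<delta>" and dF: "delta_subfield m \<delta> F"
  shows "delta_subfield m \<delta> (delta_adjoin m \<delta> F A)"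
  unfolding delta_subfield_def
proof (intro conjI ballI)
  let ?S = "{theta \<delta> m e a | e a. e \<in> Theta m \<and> a \<in> A}"
  let ?L = "field_adjoin F ?S"
  show "is_subfield (delta_adjoin m \<delta> F A)" unfolding delta_adjoin_def by (rule is_subfield_adjoin)
  fix k z assume k: "k \<in> {1..m}" and z: "z \<in> delta_adjoin m \<delta> F A"
  have d: "derivation (\<delta> k)" using ds k unfolding delta_structure_def by blast
  show "\<delta> k z \<in> delta_adjoin m \<delta> F A"
    unfolding delta_adjoin_def
  proof (rule derivation_maps_adjoin[OF d is_subfield_adjoin adjoin_base adjoin_gens _ _ z[unfolded delta_adjoin_def]])
    show "\<delta> k x \<in> ?L" if "x \<in> F" for x
      using dF k that adjoin_base[of F ?S] unfolding delta_subfield_def by blast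
    show "\<delta> k x \<in> ?L" if x: "x \<in> ?S" for x
    proof -
      obtain e a where e: "x = theta \<delta> m e a" "e \<in> Theta m" "a \<in> A" using x by blast
      have "e(k := Suc (e k)) \<in> Theta m" using e(2) k by (auto simp: Theta_def)
      then have "\<delta> k x \<in> ?S" unfolding e(1) delta_theta[OF ds k] using e(3) by blast
      then show ?thesis using adjoin_gens[of ?S F] by blast
    qed
  qed
qed

lemma theta_closed:
  assumes "\<And>k z. k \<in> {1..j} \<Longrightarrow> z \<in> L \<Longrightarrow> \<delta> k z \<in> L" "z \<in> L"
  shows "theta \<delta> j e z \<in> L"
  using assms
proof (induction j arbitrary: z)
  case (Suc j)
  have "(\<delta> (Suc j) ^^ l) z \<in> L" for l by (induction l) (use Suc.prems in auto)
  then show ?case using Suc.IH Suc.prems(1) by simp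
qed simp

lemma delta_adjoin_least:
  assumes L: "delta_subfield m \<delta> L" "F \<subseteq> L" "A \<subseteq> L"
  shows "delta_adjoin m \<delta> F A \<subseteq> L"
  unfolding delta_adjoin_def
proof (rule adjoin_least[OF _ L(2)])
  show "is_subfield L" using L(1) by (simp add: delta_subfield_def)
  have "theta \<delta> m e a \<in> L" if "a \<in> A" for e a
    by (rule theta_closed) (use L that in \<open>auto simp: delta_subfield_def\<close>)
  then show "{theta \<delta> m e a | e a. e \<in> Theta m \<and> a \<in> A} \<subseteq> L" by blast
qed

lemma delta_adjoin_base: "F \<subseteq> delta_adjoin m \<delta> F A"
  unfolding delta_adjoin_def by (rule adjoin_base)

lemma delta_adjoin_gens: "a \<in> A \<Longrightarrow> a \<in> delta_adjoin m \<delta> F A"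
proof -
  assume "a \<in> A"
  then have "theta \<delta> m (\<lambda>_. 0) a \<in> {theta \<delta> m e a | e a. e \<in> Theta m \<and> a \<in> A}" by (auto simp: Theta_def)
  then show ?thesis unfolding delta_adjoin_def theta_zero
    using adjoin_gens[of "{theta \<delta> m e a | e a. e \<in> Theta m \<and> a \<in> A}" F] by blast
qed

context lueroth_frame
begin

text \<open>The elements of \<open>G\<close> that are rational in the \<open>U \<pi>\<close> with
  \<pi> in \<open>S\<close>, by \<open>support_adjoin\<close>; in terms of derivations the subfield
  property is evident.\<close>

definition Gm where "Gm S = {g\<in>G. \<forall>\<pi>\<in>I - S. E \<pi> g = 0}"

lemma Gm: "is_subfield (Gm S)"
  unfolding Gm_def by (rule is_subfield_ball[OF G]) (rule derivation_kernel[OF E_der], blast)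

lemma Gm_G: "Gm S \<subseteq> G" unfolding Gm_def by blast
lemma F_Gm: "F \<subseteq> Gm S" unfolding Gm_def using FG E_F by blast
lemma Gm_mono: "S \<subseteq> T \<Longrightarrow> Gm S \<subseteq> Gm T" unfolding Gm_def by blast

text \<open>Suppose that some element of \<open>Gm S\<close> involves the highest derivative \<open>\<rho> = w0 + \<tau>0\<close>. By \<open>Phi_x0_zero\<close>
  no conjugate of \<open>x0\<close> over \<open>N0\<close> involves \<open>\<rho>\<close>, even after the derivatives in \<open>Lo\<close> have been rescaled by the
  powers \<open>b j ^ t\<close> of primes. Hence the values of the coefficients of \<open>f0\<close>, as rational functions
  in \<open>U Lo\<close>, at the points \<open>(b j ^ t)\<close> do not involve \<open>\<rho>\<close>, and these values determine their field of definition.\<close>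

lemma drop_highest:
  assumes f0: "min_poly N0 x0 f0" and r: "\<rho> \<in> I" "w0 \<prec> \<rho>" and S: "\<And>\<pi>. \<pi> \<in> S \<Longrightarrow> \<pi> = \<rho> \<or> \<pi> \<prec> \<rho>"
    and co: "poly_over (field_adjoin (Gm S) (U ` Lo)) f0"
  shows "poly_over (field_adjoin (Gm (S - {\<rho>})) (U ` Lo)) f0"
proof (cases "\<forall>\<gamma>\<in>Gm S. E \<rho> \<gamma> = 0")
  case True
  then have "Gm S \<subseteq> Gm (S - {\<rho>})" unfolding Gm_def by blast
  then show ?thesis by (rule poly_over_mono[OF co adjoin_mono[OF _ subset_refl]])
next
  case False
  then obtain \<gamma> where g: "\<gamma> \<in> Gm S" "E \<rho> \<gamma> \<noteq> 0" by blast
  have van: "E \<pi> z = 0" if "z \<in> Gm S" "\<pi> \<in> I" "\<rho> \<prec> \<pi>" for z \<pi>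
  proof -
    have "\<pi> \<notin> S" using S[of \<pi>] that(3) rlt_asym rlt_irrefl by blast
    then show ?thesis using that unfolding Gm_def by blast
  qed
  have gG: "\<gamma> \<in> G" using g(1) Gm_G by blast
  have rL: "\<rho> \<in> Ld" by (rule leader_in_Ld[OF gG r(1) g(2) van[OF g(1)]])
  obtain \<tau>0 where t0: "\<tau>0 \<in> Theta m" "\<rho> = tadd w0 \<tau>0" using Ld_offset[OF rL] by blast
  have t0': "\<tau>0 \<noteq> (\<lambda>_. 0)"
  proof
    assume "\<tau>0 = (\<lambda>_. 0)"
    then have "\<rho> = w0" using t0(2) by (simp add: tadd_def)
    then show False using r(2) rlt_irrefl by simp
  qed
  have f0': "poly_over N0 f0" "lead_coeff f0 = 1" "poly f0 x0 = 0" "f0 \<noteq> 0" using f0 by (auto simp: min_poly_def)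
  let ?Gr = "{g\<in>G. \<forall>\<pi>\<in>I. \<rho> \<prec> \<pi> \<longrightarrow> E \<pi> g = 0}"
  \<comment> \<open>\<open>f0\<close> itself shows that \<open>x0\<close> is algebraic over elements
    without derivatives above \<rho>, which the transport along the leaders requires.\<close>
  have alg: "algebraic_over (field_adjoin ?Gr (U ` Lo)) x0"
  proof -
    have "Gm S \<subseteq> ?Gr" using van Gm_G by blast
    then have "poly_over (field_adjoin ?Gr (U ` Lo)) f0" by (rule poly_over_mono[OF co adjoin_mono[OF _ subset_refl]])
    then show ?thesis using f0' unfolding algebraic_over_def poly_over_def by blast
  qed
  have "\<forall>\<pi>. \<exists>D. \<pi> \<in> I \<longrightarrow> derivation D \<and> (\<forall>z. D (to_ac z) = to_ac (E \<pi> z))"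
    using derivation_lift_ac[OF E_der] by meson
  then obtain EH where EH0: "\<And>\<pi>. \<pi> \<in> I \<longrightarrow> derivation (EH \<pi>) \<and> (\<forall>z. EH \<pi> (to_ac z) = to_ac (E \<pi> z))" by metis
  have EH: "derivation (EH \<pi>)" "EH \<pi> (to_ac z) = to_ac (E \<pi> z)" if "\<pi> \<in> I" for \<pi> z using EH0 that by blast+
  obtain b where b: "prime_family b Lo" using prime_family_exists[OF fin_Lo] by blast
  have bpos: "b j > 0" if "j \<in> Lo" for j
    using b that unfolding prime_family_def by (simp add: prime_gt_0_nat)
  have scaled: "E \<rho> (ev (\<lambda>j. pt b t j * U j) p / ev (\<lambda>j. pt b t j * U j) q) = 0"
    if pq: "mp_over G Lo p" "mp_over G Lo q" "ev U q \<noteq> 0" "coeff f0 i = ev U p / ev U q" for t p q i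
  proof -
    have bt: "0 < b j ^ t" if "j \<in> Lo" for j using bpos[OF that] by simp
    obtain s1 where s1: "hom_on N0 s1" "\<forall>g\<in>G. s1 g = to_ac g" "\<forall>j\<in>Lo. s1 (U j) = to_ac (of_nat (b j ^ t) * U j)"
      and ext: "\<forall>y. poly (map_poly s1 f0) y = 0 \<longrightarrow>
        (\<exists>\<sigma>. hom_on KK \<sigma> \<and> (\<forall>z\<in>N0. \<sigma> z = s1 z) \<and> (\<forall>j\<in>B - Lo. \<sigma> (U j) = to_ac (U j)) \<and> \<sigma> x0 = y)"
      by (rule exE[OF sigma_exists[OF f0, of "\<lambda>j. b j ^ t"]], erule bt, elim conjE, rule that, assumption+)
    \<comment> \<open>All roots are conjugates and hence free of \<rho>, so the coefficients of this
      monic polynomial are too.\<close>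
    have "poly_over {z. EH \<rho> z = 0} (map_poly s1 f0)"
    proof (rule coeffs_in_subfield_of_roots[OF derivation_kernel[OF EH(1)[OF r(1)]]])
      show "lead_coeff (map_poly s1 f0) = 1"
        unfolding degree_map_poly_hom[OF N0 s1(1) f0'(1)] coeff_map_poly_hom[OF N0 s1(1)] f0'(2) by (rule hom_on_one[OF s1(1)])
      fix y assume "poly (map_poly s1 f0) y = 0"
      then obtain \<sigma> where s: "hom_on KK \<sigma>" "\<forall>z\<in>N0. \<sigma> z = s1 z" "\<forall>j\<in>B - Lo. \<sigma> (U j) = to_ac (U j)" "\<sigma> x0 = y"
        using ext by blast
      have "EH \<rho> (\<sigma> x0) = 0"
      proof (rule Phi_x0_zero[OF s(1) _ _ EH t0(1) t0' t0(2) alg rL gG van[OF g(1)] g(2)])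
        fix g assume "g \<in> G"
        then show "\<sigma> g = to_ac g" using s(2) s1(2) G_N0 by (metis subsetD)
      next
        fix b' assume b': "b' \<in> B"
        show "\<exists>c::nat. \<sigma> (U b') = of_nat c * to_ac (U b')"
        proof (cases "b' \<in> Lo")
          case True
          then have "\<sigma> (U b') = of_nat (b b' ^ t) * to_ac (U b')" using s(2) s1(3) U_N0[OF True] by simp
          then show ?thesis by blast
        next
          case False
          then have "\<sigma> (U b') = of_nat 1 * to_ac (U b')" using s(3) b' by simp
          then show ?thesis by blast
        qed
      qed
      then show "y \<in> {z. EH \<rho> z = 0}" using s(4) by simp
    qed
    then have "EH \<rho> (s1 (coeff f0 i)) = 0"
      using poly_overD[of "{z. EH \<rho> z = 0}" "map_poly s1 f0" i] unfolding coeff_map_poly_hom[OF N0 s1(1)] by simp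
    \<comment> \<open>The image of an expression in \<open>U Lo\<close> is its value at the rescaled
      point.\<close>
    moreover have "s1 (ev U r) = to_ac (ev (\<lambda>j. pt b t j * U j) r)" if r: "mp_over G Lo r" for r
    proof -
      have 1: "s1 (ev U r) = meval s1 (\<lambda>j. s1 (U j)) r" by (rule hom_on_ev[OF N0 s1(1) r G_N0 U_N0])
      have 2: "to_ac (ev (\<lambda>j. pt b t j * U j) r) = meval to_ac (\<lambda>j. to_ac (pt b t j * U j)) r"
        by (rule meval_compose) simp_all
      have "monoval (\<lambda>j. s1 (U j)) \<mu> = monoval (\<lambda>j. to_ac (pt b t j * U j)) \<mu>" if mu: "\<mu> \<in> Poly_Mapping.keys r" for \<mu>
        unfolding monoval_def
      proof (intro prod.cong refl)
        fix j assume "j \<in> Poly_Mapping.keys \<mu>"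
        then have "j \<in> Lo" using mp_over_keys[OF r mu] by blast
        then show "s1 (U j) ^ Poly_Mapping.lookup \<mu> j = to_ac (pt b t j * U j) ^ Poly_Mapping.lookup \<mu> j"
          using s1(3) by (simp add: pt_def)
      qed
      moreover have "s1 (Poly_Mapping.lookup r \<mu>) = to_ac (Poly_Mapping.lookup r \<mu>)" for \<mu>
        using s1(2) mp_over_lookup[OF r] by blast
      ultimately have "meval s1 (\<lambda>j. s1 (U j)) r = meval to_ac (\<lambda>j. to_ac (pt b t j * U j)) r"
        unfolding meval_def by (intro sum.cong refl) simp
      then show ?thesis unfolding 1 2 .
    qed
    moreover have "ev U p \<in> N0" "ev U q \<in> N0" unfolding N0_def by (rule ev_in_adjoin[OF pq(1)], rule ev_in_adjoin[OF pq(2)])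
    ultimately have "EH \<rho> (to_ac (ev (\<lambda>j. pt b t j * U j) p / ev (\<lambda>j. pt b t j * U j) q)) = 0"
      using pq by (simp add: divide_inverse hom_on_mult[OF s1(1)] hom_on_inverse[OF N0 s1(1)] subfield_inverse[OF N0])
    then show ?thesis unfolding EH(2)[OF r(1)] by simp
  qed
  have rLo: "\<rho> \<notin> Lo" unfolding Lo_def below_def using r(2) rlt_asym by blast
  show ?thesis
    unfolding poly_over_def
  proof
    fix i
    obtain p q where pq: "mp_over (Gm S) Lo p" "mp_over (Gm S) Lo q" "ev U q \<noteq> 0" "coeff f0 i = ev U p / ev U q"
      using adjoin_quotient[OF Gm poly_overD[OF co]] by blast
    note pqG = mp_over_mono[OF pq(1) Gm_G subset_refl] mp_over_mono[OF pq(2) Gm_G subset_refl]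
    note pqU = mp_over_mono[OF pq(1) subset_UNIV subset_refl] mp_over_mono[OF pq(2) subset_UNIV subset_refl]
    show "coeff f0 i \<in> field_adjoin (Gm (S - {\<rho>})) (U ` Lo)"
      unfolding pq(4)
    proof (rule rational_function_descent[OF G Gm Gm_G b fin_Lo alg_independent_subset[OF indB Lo_B] pqG pq(3)])
      fix t assume t: "ev (pt b t) q \<noteq> (0::'a)"
      let ?c = "ev (pt b t) p / ev (pt b t) q"
      \<comment> \<open>Known at the rescaled points; it is passed on to the integer points, where
        the value of the function lies in \<open>Gm S\<close>.\<close>
      have "E \<rho> ?c = 0"
      proof (rule scaled_derivation_zero[OF b fin_Lo E_der[OF r(1)] _ _ pqU _ t])
        show "E \<rho> (U j) = 0" if "j \<in> Lo" for j
          using E_U[OF r(1), of j] that Lo_I rLo by auto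
        show "U j \<noteq> 0" if j: "j \<in> Lo" for j
        proof
          assume "U j = 0"
          then have "E j (U j) = 0" using derivation_zero[OF E_der[of j]] j Lo_I by auto
          then show False using E_U[of j j] j Lo_I by auto
        qed
        show "E \<rho> (ev (\<lambda>j. pt b t j * U j) p / ev (\<lambda>j. pt b t j * U j) q) = 0" for t
          by (rule scaled[OF pqG pq(3,4)])
      qed
      moreover have "?c \<in> Gm S"
      proof (rule subfield_divide[OF Gm])
        show "ev (pt b t) p \<in> Gm S"
          by (rule meval_in_subfield[OF Gm _ pq(1)]) (simp_all add: pt_def subfield_power subfield_of_nat Gm)
        show "ev (pt b t) q \<in> Gm S"
          by (rule meval_in_subfield[OF Gm _ pq(2)]) (simp_all add: pt_def subfield_power subfield_of_nat Gm)
      qed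
      ultimately show "?c \<in> Gm (S - {\<rho>})" unfolding Gm_def by blast
    qed
  qed
qed

text \<open>An element of \<open>N0\<close> needs finitely many elements of \<open>G\<close>, each
  with finite support.\<close>

lemma finite_initial_support:
  assumes z: "z \<in> N0"
  shows "\<exists>S. finite S \<and> S \<subseteq> I \<and> z \<in> field_adjoin (Gm S) (U ` Lo)"
proof -
  have "N0 \<subseteq> field_adjoin (field_adjoin F (U ` Lo)) ((\<lambda>g. g) ` G)"
    unfolding N0_def adjoin_adjoin image_ident
    using adjoin_gens[of "U ` Lo \<union> G" F] by (intro adjoin_least is_subfield_adjoin) auto
  then have "z \<in> field_adjoin (field_adjoin F (U ` Lo)) ((\<lambda>g. g) ` G)" using z by blast
  from adjoin_finite[OF is_subfield_adjoin this] obtain T where T: "finite T" "T \<subseteq> G"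
    "z \<in> field_adjoin (field_adjoin F (U ` Lo)) T" by auto
  define S where "S = (\<Union>g\<in>T. {\<pi>\<in>I. E \<pi> g \<noteq> 0})"
  have "finite S" unfolding S_def using T GK finite_support by (intro finite_UN_I) blast+
  moreover have "S \<subseteq> I" unfolding S_def by blast
  moreover have "T \<subseteq> Gm S" unfolding Gm_def S_def using T(2) by blast
  then have "field_adjoin (field_adjoin F (U ` Lo)) T \<subseteq> field_adjoin (Gm S) (U ` Lo)"
    unfolding adjoin_adjoin using F_Gm[of S] adjoin_base[of "Gm S" "U ` Lo"] adjoin_gens[of "U ` Lo" "Gm S"]
    by (intro adjoin_least is_subfield_adjoin) blast+
  ultimately show ?thesis using T(3) by blast
qed

text \<open>The finitely many derivatives above \<open>w0\<close> are removed from the top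
  downwards, since \<open>drop_highest\<close> requires \<rho> to be the highest index in
  \<open>S\<close>.\<close>

lemma min_poly_low_support:
  assumes f0: "min_poly N0 x0 f0"
  shows "poly_over (field_adjoin (Gm (insert w0 Lo)) (U ` Lo)) f0"
proof -
  have f0': "poly_over N0 f0" using f0 by (simp add: min_poly_def)
  have "\<forall>i. \<exists>S. finite S \<and> S \<subseteq> I \<and> coeff f0 i \<in> field_adjoin (Gm S) (U ` Lo)"
    using finite_initial_support poly_overD[OF f0'] by blast
  then obtain T where T: "\<And>i. finite (T i) \<and> T i \<subseteq> I \<and> coeff f0 i \<in> field_adjoin (Gm (T i)) (U ` Lo)" by metis
  have "poly_over (field_adjoin (Gm (insert w0 Lo)) (U ` Lo)) f0"
    if "finite S" "S \<subseteq> I" "poly_over (field_adjoin (Gm S) (U ` Lo)) f0" for S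
    using that
  proof (induction "card S" arbitrary: S rule: less_induct)
    case less
    let ?T = "{\<pi>\<in>S. w0 \<prec> \<pi>}"
    show ?case
    proof (cases "?T = {}")
      case True
      then have "S \<subseteq> insert w0 Lo" unfolding Lo_def below_def using less.prems(2) lt_total[OF w0_I] by blast
      then show ?thesis by (intro poly_over_mono[OF less.prems(3)] adjoin_mono Gm_mono) auto
    next
      case False
      have "\<exists>\<rho>\<in>?T. \<forall>\<pi>\<in>?T. \<pi> \<noteq> \<rho> \<longrightarrow> \<pi> \<prec> \<rho>"
      proof (rule finite_strict_max[OF _ False])
        show "finite ?T" using less.prems(1) by simp
        show "a \<prec> b \<or> b \<prec> a" if "a \<in> ?T" "b \<in> ?T" "a \<noteq> b" for a b using lt_total that less.prems(2) by blast
        show "a \<prec> c" if "a \<prec> b" "b \<prec> c" for a b c using rlt_trans[OF that] .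
      qed
      then obtain \<rho> where r: "\<rho> \<in> S" "w0 \<prec> \<rho>" "\<forall>\<pi>\<in>?T. \<pi> \<noteq> \<rho> \<longrightarrow> \<pi> \<prec> \<rho>" by blast
      have rI: "\<rho> \<in> I" using r(1) less.prems(2) by blast
      have "\<pi> = \<rho> \<or> \<pi> \<prec> \<rho>" if p: "\<pi> \<in> S" for \<pi>
      proof (cases "w0 \<prec> \<pi>")
        case True
        then show ?thesis using r(3) p by blast
      next
        case False
        then have "\<pi> = w0 \<or> \<pi> \<prec> w0" using lt_total[OF w0_I, of \<pi>] p less.prems(2) by blast
        then show ?thesis using r(2) rlt_trans by blast
      qed
      then have "poly_over (field_adjoin (Gm (S - {\<rho>})) (U ` Lo)) f0"
        by (rule drop_highest[OF f0 rI r(2) _ less.prems(3)])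
      moreover have "card (S - {\<rho>}) < card S" by (rule psubset_card_mono[OF less.prems(1)]) (use r(1) in blast)
      ultimately show ?thesis using less.hyps[of "S - {\<rho>}"] less.prems(1,2) by blast
    qed
  qed
  note ind = this
  let ?S = "\<Union>i\<le>degree f0. T i"
  have "poly_over (field_adjoin (Gm ?S) (U ` Lo)) f0"
    unfolding poly_over_def
  proof
    fix i
    show "coeff f0 i \<in> field_adjoin (Gm ?S) (U ` Lo)"
    proof (cases "i \<le> degree f0")
      case True
      then have "field_adjoin (Gm (T i)) (U ` Lo) \<subseteq> field_adjoin (Gm ?S) (U ` Lo)"
        by (intro adjoin_mono Gm_mono) auto
      then show ?thesis using T by blast
    next
      case False
      then show ?thesis by (simp add: coeff_eq_0 subfield_zero[OF is_subfield_adjoin])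
    qed
  qed
  then show ?thesis by (rule ind[rotated -1]) (use T in auto)
qed

text \<open>Lueroth's theorem is applied between \<open>M\<close> and \<open>M(x0)\<close>.
  \<open>H\<close> contains the coefficients of \<open>f0\<close>, so \<open>x0\<close> is algebraic
  over \<open>H\<close> but not over \<open>M\<close>, and \<open>H\<close> is larger than
  \<open>M\<close>. The finitely many \<open>U Lo\<close> in the generator are then specialised
  away.\<close>

lemma low_generator: "\<exists>v\<in>Gm (insert w0 Lo). Gm (insert w0 Lo) = field_adjoin F {v}"
proof -
  define \<Gamma> where "\<Gamma> = Gm (insert w0 Lo)"
  define M where "M = field_adjoin F (U ` Lo)"
  define H where "H = field_adjoin \<Gamma> (U ` Lo)"
  have Gs: "is_subfield \<Gamma>" "F \<subseteq> \<Gamma>" "\<Gamma> \<subseteq> G" unfolding \<Gamma>_def by (rule Gm, rule F_Gm, rule Gm_G)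
  have M: "is_subfield M" unfolding M_def by (rule is_subfield_adjoin)
  have H: "is_subfield H" unfolding H_def by (rule is_subfield_adjoin)
  obtain f0 where f0: "min_poly N0 x0 f0" using min_poly_exists[OF N0 x0_alg] by blast
  have fH: "poly_over H f0" unfolding H_def \<Gamma>_def by (rule min_poly_low_support[OF f0])
  have tr: "\<not> algebraic_over M x0"
  proof -
    have "w0 \<notin> Lo" unfolding Lo_def below_def using rlt_irrefl by blast
    then have "F \<union> U ` Lo \<subseteq> F \<union> U ` (I - {w0})" using Lo_I by blast
    then have "U w0 \<notin> dcl (F \<union> U ` Lo)" by (rule alg_independent_not_dcl[OF F ind w0_I])
    then show ?thesis unfolding M_def algebraic_over_iff_dcl[OF is_subfield_adjoin] dcl_adjoin x0_def .
  qed
  have Gx: "\<Gamma> \<subseteq> field_adjoin M {x0}"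
  proof
    fix g assume g: "g \<in> \<Gamma>"
    then have gK: "g \<in> KK" using Gs(3) GK by blast
    have "g \<in> field_adjoin F (U ` (I \<inter> insert w0 Lo))"
      by (rule support_adjoin[OF gK]) (use g in \<open>auto simp: \<Gamma>_def Gm_def\<close>)
    moreover have "U ` (I \<inter> insert w0 Lo) = U ` Lo \<union> {x0}" using w0_I Lo_I unfolding x0_def by blast
    ultimately show "g \<in> field_adjoin M {x0}" unfolding M_def adjoin_adjoin by simp
  qed
  have "M \<subseteq> H" unfolding M_def H_def by (rule adjoin_mono[OF Gs(2) subset_refl])
  moreover have "M \<noteq> H"
  proof
    assume "M = H"
    then have "poly_over M f0" using fH by simp
    moreover have "f0 \<noteq> 0" "poly f0 x0 = 0" using f0 by (auto simp: min_poly_def)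
    ultimately show False using tr unfolding algebraic_over_def poly_over_def by blast
  qed
  moreover have "H \<subseteq> field_adjoin M {x0}"
    unfolding H_def
  proof (rule adjoin_least[OF is_subfield_adjoin Gx])
    show "U ` Lo \<subseteq> field_adjoin M {x0}"
      using adjoin_gens[of "U ` Lo" F] adjoin_base[of M "{x0}"] unfolding M_def by blast
  qed
  ultimately obtain c where c: "c \<in> H" "H = field_adjoin M {c}"
    using lueroth[OF M H _ _ tr] by blast
  have "\<exists>v\<in>\<Gamma>. \<Gamma> = field_adjoin F {v}"
  proof (rule field_generator_by_specialisation[OF F Gs(1,2) fin_Lo])
    show "alg_independent \<Gamma> Lo U"
      by (rule alg_independent_base_mono[OF alg_independent_subset[OF indB Lo_B] Gs(3)])
    show "c \<in> field_adjoin \<Gamma> (U ` Lo)" using c(1) unfolding H_def .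
    show "\<Gamma> \<subseteq> field_adjoin (field_adjoin F (U ` Lo)) {c}"
      using c(2) adjoin_base[of \<Gamma> "U ` Lo"] unfolding H_def M_def by simp
  qed
  then show ?thesis unfolding \<Gamma>_def .
qed

text \<open>The coefficients of the minimal polynomial over \<open>G(U B)\<close> are killed by the derivations dual to
  \<open>B - Lo\<close>, so they lie in \<open>N0\<close> already.\<close>

lemma degree_min_poly_B:
  assumes f0: "min_poly N0 x0 f0" and h: "min_poly (field_adjoin G (U ` B)) x0 h"
  shows "degree f0 \<le> degree h"
proof -
  let ?L = "field_adjoin N0 (U ` (B - Lo))"
  have Leq: "field_adjoin G (U ` B) = ?L"
    unfolding N0_def adjoin_adjoin image_Un[symmetric] using Lo_B by (simp add: Un_absorb1)
  note h = h[unfolded Leq]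
  have h': "poly_over ?L h" "poly h x0 = 0" "h \<noteq> 0" "lead_coeff h = 1" using h by (auto simp: min_poly_def)
  define D where "D b = (SOME D. derivation D \<and> (\<forall>g\<in>G. D g = 0) \<and> (\<forall>j\<in>B. D (U j) = (if j = b then 1 else 0)))" for b
  have D0: "derivation (D b) \<and> (\<forall>g\<in>G. D b g = 0) \<and> (\<forall>j\<in>B. D b (U j) = (if j = b then 1 else 0))" if "b \<in> B - Lo" for b
    using someI_ex[OF dual_B[OF DiffD1[OF that]]] unfolding D_def .
  have D: "derivation (D b)" "g \<in> G \<Longrightarrow> D b g = 0" "j \<in> B \<Longrightarrow> D b (U j) = (if j = b then 1 else 0)" if "b \<in> B - Lo" for b g j
    using D0[OF that] by blast+
  have DN: "D b z = 0" if b: "b \<in> B - Lo" and z: "z \<in> N0" for b z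
  proof (rule derivation_vanish_adjoin[OF D(1)[OF b] D(2)[OF b] _ z[unfolded N0_def]])
    fix x assume "x \<in> U ` Lo"
    then obtain j where j: "j \<in> Lo" "x = U j" by blast
    have "j \<noteq> b" "j \<in> B" using j(1) b Lo_B by auto
    then show "D b x = 0" unfolding j(2) using D(3)[OF b] by simp
  qed
  have "coeff h i \<in> N0" for i
  proof -
    have "D b (coeff h i) = 0" if b: "b \<in> B - Lo" for b
    proof -
      have "x0 \<in> dcl N0" using x0_alg by (simp add: algebraic_over_iff_dcl[OF N0])
      then have x: "D b x0 = 0" by (rule dclD[OF _ D(1)[OF b] DN[OF b]])
      have "poly_over UNIV h" by (simp add: poly_over_def)
      \<comment> \<open>\<open>D b\<close> kills \<open>x0\<close>, so only the coefficients are
        differentiated. The leading coefficient \<open>1\<close> is lost, and minimality forces the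
        result to be zero.\<close>
      from derivation_poly[OF D(1)[OF b] this, of x0] have "poly (map_poly (D b) h) x0 = 0"
        using h'(2) x derivation_zero[OF D(1)[OF b]] by simp
      moreover have "poly_over ?L (map_poly (D b) h)"
        unfolding poly_over_def
      proof
        fix l
        have "D b (coeff h l) \<in> ?L"
        proof (rule derivation_maps_adjoin[OF D(1)[OF b] is_subfield_adjoin adjoin_base adjoin_gens _ _ poly_overD[OF h'(1)]])
          show "D b z \<in> ?L" if "z \<in> N0" for z using DN[OF b that] subfield_zero[OF is_subfield_adjoin] by simp
          show "D b z \<in> ?L" if z: "z \<in> U ` (B - Lo)" for z
          proof -
            obtain j where j: "j \<in> B" "z = U j" using z by blast
            show ?thesis unfolding j(2) D(3)[OF b j(1)]
              by (simp add: subfield_zero[OF is_subfield_adjoin] subfield_one[OF is_subfield_adjoin])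
          qed
        qed
        then show "coeff (map_poly (D b) h) l \<in> ?L" by (simp add: coeff_map_poly derivation_zero[OF D(1)[OF b]])
      qed
      moreover have "degree (map_poly (D b) h) < degree h"
      proof -
        have "coeff (map_poly (D b) h) l = 0" if "degree h \<le> l" for l
          using that h'(4) derivation_one[OF D(1)[OF b]] derivation_zero[OF D(1)[OF b]]
          by (cases "l = degree h") (simp_all add: coeff_map_poly coeff_eq_0)
        then have "\<not> degree h \<le> degree (map_poly (D b) h) \<or> map_poly (D b) h = 0"
          by (metis leading_coeff_0_iff)
        then show ?thesis using min_poly_degree_pos[OF h] by auto
      qed
      ultimately have "map_poly (D b) h = 0" by (intro min_poly_small[OF h])
      then have "coeff (map_poly (D b) h) i = 0" by simp
      then show ?thesis by (simp add: coeff_map_poly derivation_zero[OF D(1)[OF b]])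
    qed
    note kill = this
    have "coeff h i \<in> field_adjoin N0 (U ` ((B - Lo) \<inter> {}))"
    proof (rule constants_of_dual_derivations[OF N0, where D = D])
      show "D b (U j) = (if j = b then 1 else 0)" if "b \<in> B - Lo" "j \<in> B - Lo" for b j
        by (rule D(3)[OF that(1) DiffD1[OF that(2)]])
    qed (rule D(1), assumption, rule DN, assumption+, rule poly_overD[OF h'(1)], rule kill, assumption)
    moreover have "field_adjoin N0 {} \<subseteq> N0" by (rule adjoin_least[OF N0]) auto
    ultimately show ?thesis by auto
  qed
  then have "poly_over N0 h" by (simp add: poly_over_def)
  then show ?thesis using f0 h'(2,3) by (auto simp: min_poly_def)
qed

text \<open>Over \<open>G'(U B)\<close> an element \<open>g\<close> of \<open>G\<close> is a
  polynomial in \<open>x0\<close> of degree below that of \<open>f0\<close>, which is at most the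
  degree of \<open>x0\<close> over \<open>G(U B)\<close>. So this polynomial is the constant
  \<open>g\<close>, and independence of \<open>U B\<close> over \<open>G\<close> brings
  \<open>g\<close> down from \<open>G'(U B)\<close> to \<open>G'\<close>.\<close>

theorem existence: "\<exists>v\<in>G. G = delta_adjoin m \<delta> F {v}"
proof -
  obtain v where v: "v \<in> Gm (insert w0 Lo)" "Gm (insert w0 Lo) = field_adjoin F {v}" using low_generator by blast
  have vG: "v \<in> G" using v(1) Gm_G by blast
  define G' where "G' = delta_adjoin m \<delta> F {v}"
  have dG': "delta_subfield m \<delta> G'" unfolding G'_def by (rule delta_adjoin_delta_subfield[OF ds dF])
  have G'G: "G' \<subseteq> G" unfolding G'_def by (rule delta_adjoin_least[OF dG FG]) (use vG in simp)
  have FG': "F \<subseteq> G'" unfolding G'_def by (rule delta_adjoin_base)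
  have G': "is_subfield G'" using dG' by (simp add: delta_subfield_def)
  have vG': "v \<in> G'" unfolding G'_def by (rule delta_adjoin_gens) simp
  have "Gm (insert w0 Lo) \<subseteq> G'" unfolding v(2) by (rule adjoin_least[OF G' FG']) (use vG' in simp)
  moreover obtain f0 where f0: "min_poly N0 x0 f0" using min_poly_exists[OF N0 x0_alg] by blast
  ultimately have co: "poly_over (field_adjoin G' (U ` Lo)) f0"
    by (intro poly_over_mono[OF min_poly_low_support[OF f0]] adjoin_mono) auto
  have f0': "f0 \<noteq> 0" "poly f0 x0 = 0" using f0 by (auto simp: min_poly_def)
  then have alg: "algebraic_over (field_adjoin G' (U ` Lo)) x0"
    using co unfolding algebraic_over_def poly_over_def by blast
  let ?L = "field_adjoin G' (U ` B)"
  have coL: "poly_over ?L f0" by (intro poly_over_mono[OF co] adjoin_mono) (use Lo_B in auto)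
  then have "algebraic_over ?L x0" using f0' unfolding algebraic_over_def poly_over_def by blast
  then obtain f1 where f1: "min_poly ?L x0 f1" using min_poly_exists[OF is_subfield_adjoin] by blast
  have deg1: "degree f1 \<le> degree f0" using f1 coL f0' by (auto simp: min_poly_def)
  have "G \<subseteq> G'"
  proof
    fix g assume g: "g \<in> G"
    then have "g \<in> field_adjoin ?L {x0}"
      using KK_generated[OF dG' FG' alg] GK unfolding adjoin_adjoin by blast
    then obtain r where r: "poly_over ?L r" "degree r < degree f1" "g = poly r x0"
      using adjoin_algebraic_poly[OF is_subfield_adjoin f1] by blast
    let ?LG = "field_adjoin G (U ` B)"
    have LG: "is_subfield ?LG" by (rule is_subfield_adjoin)
    have LLG: "?L \<subseteq> ?LG" by (rule adjoin_mono[OF G'G subset_refl])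
    have "poly_over ?LG f0" by (rule poly_over_mono[OF coL LLG])
    then have "algebraic_over ?LG x0" using f0' unfolding algebraic_over_def poly_over_def by blast
    then obtain h where h: "min_poly ?LG x0 h" using min_poly_exists[OF LG] by blast
    have "poly_over ?LG [:g:]" using g adjoin_base[of G "U ` B"] LG by (intro poly_over_pCons poly_over_0) auto
    then have "poly_over ?LG (r - [:g:])" by (rule poly_over_diff[OF LG poly_over_mono[OF r(1) LLG]])
    moreover have "degree (r - [:g:]) < degree h"
    proof -
      have "degree (r - [:g:]) \<le> degree r" using degree_diff_le_max[of r "[:g:]"] by simp
      then show ?thesis using r(2) deg1 degree_min_poly_B[OF f0 h] by simp
    qed
    moreover have "poly (r - [:g:]) x0 = 0" using r(3) by simp
    ultimately have "r - [:g:] = 0" by (intro min_poly_small[OF h])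
    then have "coeff r 0 = g" by simp
    then have "g \<in> ?L" using poly_overD[OF r(1), of 0] by simp
    then show "g \<in> G'" by (rule adjoin_inter[OF G' G'G G indB g])
  qed
  then show ?thesis using G'G vG unfolding G'_def by blast
qed

end

section \<open>The leaders prescribed by the dimension polynomial\<close>

context dframe
begin

lemma U_inj: "inj_on U I"
proof (rule inj_onI)
  fix i j assume ij: "i \<in> I" "j \<in> I" "U i = U j"
  then have "E i (U j) = 1" using E_U[OF ij(1) ij(1)] by simp
  then show "i = j" using E_U[OF ij(1,2)] by (simp split: if_splits)
qed

context
  fixes G assumes dG: "delta_subfield m \<delta> G"
begin

definition lead where "lead = {i\<in>I. U i \<in> dcl (G \<union> U ` {j\<in>I. j \<prec> i})}"

lemma G0: "is_subfield G" using dG by (simp add: delta_subfield_def)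

text \<open>If a derivation \<open>D\<close> kills \<open>G\<close> and all derivatives below \<open>\<delta> k (U i)\<close>, then its commutator with \<open>\<delta> k\<close>
  kills \<open>G\<close> and all derivatives below \<open>U i\<close>.\<close>

lemma lead_upset:
  assumes i: "i \<in> lead" and k: "k \<in> {1..m}"
  shows "tadd i (unitv k) \<in> lead"
proof -
  have iI: "i \<in> I" and iD: "U i \<in> dcl (G \<union> U ` {j\<in>I. j \<prec> i})" using i unfolding lead_def by blast+
  let ?i = "tadd i (unitv k)"
  have "U ?i \<in> dcl (G \<union> U ` {j\<in>I. j \<prec> ?i})"
  proof (rule dclI)
    fix D assume D: "derivation D" "\<And>s. s \<in> G \<union> U ` {j\<in>I. j \<prec> ?i} \<Longrightarrow> D s = 0"
    have DU: "D (U j) = 0" if "j \<in> I" "j \<prec> ?i" for j using D(2) that by blast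
    have d0: "\<delta> k 0 = 0" by (rule derivation_zero[OF d[OF k]])
    let ?C = "\<lambda>z. D (\<delta> k z) - \<delta> k (D z)"
    have "?C (U i) = 0"
    proof (rule dclD[OF iD derivation_commutator[OF D(1) d[OF k]]])
      fix s assume "s \<in> G \<union> U ` {j\<in>I. j \<prec> i}"
      then show "?C s = 0"
      proof
        assume s: "s \<in> G"
        then have "\<delta> k s \<in> G" using dG k unfolding delta_subfield_def by blast
        then have "D (\<delta> k s) = 0" "D s = 0" using s by (auto intro: D(2))
        then show ?thesis using d0 by simp
      next
        assume "s \<in> U ` {j\<in>I. j \<prec> i}"
        then obtain j where j: "j \<in> I" "j \<prec> i" "s = U j" by blast
        have "D (U j) = 0" by (rule DU[OF j(1) rlt_trans[OF j(2) lt_unit[OF k]]])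
        moreover have "D (U (tadd j (unitv k))) = 0"
          by (rule DU[OF tadd_I[OF j(1) unitv_Theta[OF k]]]) (simp add: rlt_tadd j(2))
        ultimately show ?thesis unfolding j(3) dU[OF k] using d0 by simp
      qed
    qed
    moreover have "D (U i) = 0" by (rule DU[OF iI lt_unit[OF k]])
    ultimately show "D (U ?i) = 0" using d0 unfolding dU[OF k] by simp
  qed
  then show ?thesis unfolding lead_def using tadd_I[OF iI unitv_Theta[OF k]] by blast
qed

lemma nonlead_independent: "alg_independent G (I - lead) U"
proof (rule alg_independent_triangular[OF G0, where lt = "rlt m"])
  show "a \<prec> b \<or> b \<prec> a" if "a \<in> I - lead" "b \<in> I - lead" "a \<noteq> b" for a b using lt_total that by blast
  show "a \<prec> c" if "a \<prec> b" "b \<prec> c" for a b c using rlt_trans[OF that] .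
  fix i assume i: "i \<in> I - lead"
  have "G \<union> U ` {j\<in>I - lead. j \<prec> i} \<subseteq> G \<union> U ` {j\<in>I. j \<prec> i}" by blast
  moreover have "U i \<notin> dcl (G \<union> U ` {j\<in>I. j \<prec> i})" using i unfolding lead_def by blast
  ultimately show "U i \<notin> dcl (G \<union> U ` {j\<in>I - lead. j \<prec> i})" using dcl_mono by blast
qed

text \<open>In an orderly ranking a leader of order at most \<open>t\<close> depends on derivatives
  of order at most \<open>t\<close> only. By induction on the ranking, the others of order at most
  \<open>t\<close> are a transcendence basis.\<close>

lemma trdeg_nonlead:
  "trdeg G (field_adjoin G (\<Union>j\<in>{1..n}. derivs_upto m \<delta> t (u j))) = card {i\<in>I - lead. theta_ord m (fst i) \<le> t}"
proof -
  define W where "W = {i\<in>I. theta_ord m (fst i) \<le> t}"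
  define N where "N = {i\<in>I - lead. theta_ord m (fst i) \<le> t}"
  have Weq: "(\<Union>j\<in>{1..n}. derivs_upto m \<delta> t (u j)) = U ` W"
    unfolding W_def U_def I_def derivs_upto_def by force
  have NW: "N \<subseteq> W" "W \<subseteq> I" unfolding N_def W_def by blast+
  have "W \<subseteq> {e\<in>Theta m. theta_ord m e \<le> t} \<times> {1..n}" unfolding W_def I_def by auto
  then have "finite W"
    by (rule finite_subset) (rule finite_cartesian_product[OF conjunct1[OF finite_card_Theta] finite_atLeastAtMost])
  then have "finite N" using NW(1) by (rule rev_finite_subset)
  have gen: "i \<in> W \<longrightarrow> U i \<in> dcl (G \<union> U ` N)" if "i \<in> I" for i
    using that
  proof (induction i rule: lt_induct)
    case (less i)
    show ?case
    proof
      assume iW: "i \<in> W"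
      show "U i \<in> dcl (G \<union> U ` N)"
      proof (cases "i \<in> lead")
        case False
        then have "U i \<in> G \<union> U ` N" using iW unfolding N_def W_def by blast
        then show ?thesis by (rule subsetD[OF dcl_base])
      next
        case True
        have "U j \<in> dcl (G \<union> U ` N)" if j: "j \<in> I" "j \<prec> i" for j
        proof -
          have "j \<in> W" using j rlt_orderly[OF j(2)] iW unfolding W_def by auto
          then show ?thesis using less.IH[OF j] by simp
        qed
        then have "G \<union> U ` {j\<in>I. j \<prec> i} \<subseteq> dcl (G \<union> U ` N)" using dcl_base[of "G \<union> U ` N"] by blast
        then have "dcl (G \<union> U ` {j\<in>I. j \<prec> i}) \<subseteq> dcl (G \<union> U ` N)" by (rule dcl_closed)
        then show ?thesis using True unfolding lead_def by blast
      qed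
    qed
  qed
  have injN: "inj_on U N" by (rule inj_on_subset[OF U_inj]) (use NW in blast)
  have "transcendence_basis G (field_adjoin G (U ` W)) (U ` N)"
    unfolding transcendence_basis_dcl
  proof (intro conjI)
    show "U ` N \<subseteq> field_adjoin G (U ` W)" using adjoin_gens[of "U ` W" G] NW(1) by blast
    show "field_adjoin G (U ` W) \<subseteq> dcl (G \<union> U ` N)"
    proof (rule adjoin_least[OF is_subfield_dcl])
      show "G \<subseteq> dcl (G \<union> U ` N)" using dcl_base[of "G \<union> U ` N"] by blast
      show "U ` W \<subseteq> dcl (G \<union> U ` N)" using gen NW(2) by blast
    qed
    show "alg_independent G (U ` N) (\<lambda>b. b)"
    proof (rule dual_imp_alg_independent[OF G0])
      fix b assume "b \<in> U ` N"
      then obtain i where i: "i \<in> N" "b = U i" by blast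
      have "alg_independent G N U" by (rule alg_independent_subset[OF nonlead_independent]) (auto simp: N_def)
      from alg_independent_dual[OF G0 this i(1)] obtain D where D: "derivation D" "\<forall>c\<in>G. D c = 0"
        "\<forall>j\<in>N. D (U j) = (if j = i then 1 else 0)" by (elim exE conjE)
      have "\<forall>j\<in>U ` N. D j = (if j = b then 1 else 0)"
      proof
        fix y assume "y \<in> U ` N"
        then obtain j where j: "j \<in> N" "y = U j" by blast
        have "y = b \<longleftrightarrow> j = i" unfolding j(2) i(2) using inj_on_eq_iff[OF injN j(1) i(1)] .
        then show "D y = (if y = b then 1 else 0)" using D(3) j by simp
      qed
      then show "\<exists>D. derivation D \<and> (\<forall>c\<in>G. D c = 0) \<and> (\<forall>j\<in>U ` N. D j = (if j = b then 1 else 0))"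
        using D(1,2) by (intro exI[of _ D] conjI)
    qed
  qed
  from trdeg_eq_card[OF G0 this] show ?thesis
    unfolding Weq N_def[symmetric] using \<open>finite N\<close> card_image[OF injN] by simp
qed

text \<open>The first term of the polynomial counts all derivatives of order at most
  \<open>t\<close>, so for large \<open>t\<close> the subtracted binomial coefficient counts the
  leaders.\<close>

lemma lead_principal:
  assumes m: "m > 1" and w: "is_diff_dim_poly m \<delta> G n u
    (of_nat n * binomial_poly (int m) m - binomial_poly (int m - int s) m)"
  shows "\<exists>f\<in>Theta m. \<exists>j0\<in>{1..n}. lead = {(e, j0) | e. e \<in> Theta m \<and> (\<forall>i. f i \<le> e i)}"
proof -
  let ?L = "\<lambda>t. {i\<in>lead. theta_ord m (fst i) \<le> t}"
  obtain t1 where t1: "\<And>t. t \<ge> t1 \<Longrightarrow> poly (of_nat n * binomial_poly (int m) m - binomial_poly (int m - int s) m) (of_nat t) =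
      of_nat (trdeg G (field_adjoin G (\<Union>j\<in>{1..n}. derivs_upto m \<delta> t (u j))))"
    using w unfolding is_diff_dim_poly_def eventually_sequentially by blast
  have card: "card (?L t) = (t - s + m) choose m" if t: "t \<ge> max t1 s" for t
  proof -
    let ?W = "{i\<in>I. theta_ord m (fst i) \<le> t}" and ?N = "{i\<in>I - lead. theta_ord m (fst i) \<le> t}"
    have "?W = {e\<in>Theta m. theta_ord m e \<le> t} \<times> {1..n}" unfolding I_def by auto
    then have W: "finite ?W" "card ?W = n * ((t + m) choose m)"
      using finite_card_Theta[of m t] by (simp_all add: card_cartesian_product)
    have "card ?W = card ?N + card (?L t)"
    proof -
      have "?W = ?N \<union> ?L t" "?N \<inter> ?L t = {}" unfolding lead_def by blast+
      moreover have "finite ?N" "finite (?L t)" using W(1) by (auto elim: rev_finite_subset simp: lead_def)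
      ultimately show ?thesis by (simp add: card_Un_disjoint)
    qed
    then have 1: "(of_nat (card ?N) :: rat) = of_nat n * of_nat ((t + m) choose m) - of_nat (card (?L t))"
      unfolding W(2) of_nat_mult[symmetric] by simp
    \<comment> \<open>For \<open>t \<ge> s\<close> the truncated subtraction is exact, and the
      binomial polynomial takes the value of an ordinary binomial coefficient.\<close>
    have e1: "(of_nat t :: rat) + of_int (int m - int s) = of_nat (t - s + m)" using t by (simp add: of_nat_diff)
    have e2: "(of_nat t :: rat) + of_int (int m) = of_nat (t + m)" by simp
    have "poly (of_nat n) x = (of_nat n :: rat)" for x by simp
    then have "poly (of_nat n * binomial_poly (int m) m - binomial_poly (int m - int s) m) (of_nat t :: rat) =
      of_nat n * of_nat ((t + m) choose m) - of_nat ((t - s + m) choose m)"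
      by (simp only: poly_diff poly_mult poly_binomial_poly e1 e2 binomial_gbinomial)
    then have "(of_nat (card (?L t)) :: rat) = of_nat ((t - s + m) choose m)"
      using t1[of t] t 1 unfolding trdeg_nonlead by simp
    then show ?thesis by (simp only: of_nat_eq_iff)
  qed
  have "\<exists>f\<in>Theta m. \<exists>j0\<in>{1..n}. theta_ord m f = s \<and> lead = {(e, j0) | e. e \<in> Theta m \<and> (\<forall>i. f i \<le> e i)}"
  proof (rule upset_principal[OF m, where ?t0.0 = "max t1 s"])
    show "lead \<subseteq> Theta m \<times> {1..n}" unfolding lead_def I_def by blast
    show "(e(k := Suc (e k)), j) \<in> lead" if "(e, j) \<in> lead" "k \<in> {1..m}" for e j k
      using lead_upset[OF that] unfolding tadd_unitv .
  qed (use card in auto)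
  then show ?thesis by blast
qed

end

theorem existence_from_dimension_polynomial:
  assumes "m > 1" "delta_subfield m \<delta> G" "F \<subseteq> G" "G \<subseteq> KK"
    and "is_diff_dim_poly m \<delta> G n u (of_nat n * binomial_poly (int m) m - binomial_poly (int m - int s) m)"
  shows "\<exists>v\<in>G. G = delta_adjoin m \<delta> F {v}"
proof -
  obtain f j0 where f: "f \<in> Theta m" "j0 \<in> {1..n}" "lead G = {(e, j0) | e. e \<in> Theta m \<and> (\<forall>i. f i \<le> e i)}"
    using lead_principal[OF assms(2,1,5)] by blast
  interpret lueroth_frame m \<delta> F n u G f j0
    by unfold_locales (use assms f in \<open>simp_all add: lead_def\<close>)
  show ?thesis by (rule existence)
qed

end

section \<open>Comparison of generators\<close>

text \<open>The leader of \<open>v2\<close> in terms of \<open>v1\<close> and the leader of \<open>v1\<close> in terms of \<open>v2\<close> add up to the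
  leader of \<open>v1\<close> in terms of itself, which has order zero.\<close>

lemma mutual_generators:
  fixes v1 v2 :: "'a::field_char_0"
  assumes "dframe m \<delta> F 1 (\<lambda>_. v1)" "dframe m \<delta> F 1 (\<lambda>_. v2)"
    and "v2 \<in> delta_adjoin m \<delta> F {v1}" "v1 \<in> delta_adjoin m \<delta> F {v2}" "v2 \<notin> F" "v1 \<notin> F"
  shows "v2 \<in> field_adjoin F {v1} \<and> v1 \<in> field_adjoin F {v2} \<and> \<not> algebraic_over F v1"
proof -
  interpret A: dframe m \<delta> F 1 "\<lambda>_. v1" by (rule assms(1))
  interpret B: dframe m \<delta> F 1 "\<lambda>_. v2" by (rule assms(2))
  let ?o = "(\<lambda>_. 0, 1) :: (nat \<Rightarrow> nat) \<times> nat"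
  have oI: "?o \<in> A.I" unfolding A.I_def by (simp add: Theta_def)
  have in_A: "v2 \<in> A.KK" and in_B: "v1 \<in> B.KK" using assms(3,4) unfolding A.KK_delta_adjoin B.KK_delta_adjoin by simp_all
  have Uo: "A.U ?o = v1" "B.U ?o = v2" unfolding A.U_def B.U_def by (simp_all add: theta_zero)
  obtain r2 where r2: "r2 \<in> A.I" "A.E r2 v2 \<noteq> 0" "\<And>\<pi>. \<pi> \<in> A.I \<Longrightarrow> rlt m r2 \<pi> \<Longrightarrow> A.E \<pi> v2 = 0"
    using A.leader_exists[OF in_A assms(5)] by blast
  obtain r1 where r1: "r1 \<in> B.I" "B.E r1 v1 \<noteq> 0" "\<And>\<pi>. \<pi> \<in> B.I \<Longrightarrow> rlt m r1 \<pi> \<Longrightarrow> B.E \<pi> v1 = 0"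
    using B.leader_exists[OF in_B assms(6)] by blast
  obtain a b where ab: "r2 = (a, 1)" "a \<in> Theta m" "r1 = (b, 1)" "b \<in> Theta m"
    using r1(1) r2(1) unfolding A.I_def B.I_def by auto
  have sw: "tadd (a, 1) e = tadd (e, 1) a" for e :: "nat \<Rightarrow> nat" unfolding tadd_def by (simp add: add.commute)
  let ?p = "tadd r2 b"
  have pI: "?p \<in> A.I" by (rule A.tadd_I[OF r2(1) ab(4)])
  have lead: "theta \<delta> m e v2 \<in> A.KK \<and> (\<forall>\<pi>\<in>A.I. rlt m (tadd r2 e) \<pi> \<longrightarrow> A.E \<pi> (theta \<delta> m e v2) = 0)
    \<and> A.E (tadd r2 e) (theta \<delta> m e v2) = A.E r2 v2" if "e \<in> Theta m" for e
    by (rule A.E_leading[OF in_A r2(1) _ that]) (rule r2(3))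
  let ?S = "insert r1 {j. rlt m j r1}"
  have "v1 \<in> field_adjoin F (B.U ` (B.I \<inter> ?S))"
  proof (rule B.support_adjoin[OF in_B])
    fix \<pi> assume p: "\<pi> \<in> B.I" "\<pi> \<notin> ?S"
    then have "rlt m r1 \<pi>" using B.lt_total[OF p(1) r1(1)] by blast
    then show "B.E \<pi> v1 = 0" using r1(3) p(1) by blast
  qed
  \<comment> \<open>The chain rule for \<open>v1\<close> as a function of \<open>v2\<close>: at
    \<open>?p\<close> only the leader \<open>r1\<close> contributes, with the product of both
    leading coefficients.\<close>
  moreover have "derivation (\<lambda>z. 1 * A.E ?p z + (- A.E r2 v2) * B.E r1 z)"
    by (rule derivation_lincomb[OF A.E_der[OF pI] B.E_der[OF r1(1)]])
  ultimately have "1 * A.E ?p v1 + (- A.E r2 v2) * B.E r1 v1 = 0"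
  proof (rule derivation_vanish_adjoin[rotated -1])
    fix c assume "c \<in> F"
    then show "1 * A.E ?p c + (- A.E r2 v2) * B.E r1 c = 0" using A.E_F[OF pI] B.E_F[OF r1(1)] by simp
  next
    fix c assume "c \<in> B.U ` (B.I \<inter> ?S)"
    then obtain j where j: "j \<in> B.I" "c = B.U j" "j = r1 \<or> rlt m j r1" by blast
    obtain e where e: "j = (e, 1)" "e \<in> Theta m" using j(1) unfolding B.I_def by auto
    have ce: "c = theta \<delta> m e v2" unfolding j(2) B.U_def e(1) by simp
    show "1 * A.E ?p c + (- A.E r2 v2) * B.E r1 c = 0"
    proof (cases "j = r1")
      case True
      then have "e = b" using e(1) ab(3) by simp
      then show ?thesis using lead[OF e(2)] B.E_U[OF r1(1) r1(1)] True j(2) ce by simp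
    next
      case False
      then have lt: "rlt m (e, 1) (b, 1)" using j(3) unfolding e(1) ab(3) by blast
      have "rlt m (tadd r2 e) ?p" unfolding ab(1) sw rlt_tadd by (rule lt)
      then have "A.E ?p c = 0" unfolding ce using lead[OF e(2)] pI by blast
      moreover have "B.E r1 c = 0" unfolding j(2) using B.E_U[OF r1(1) j(1)] False by simp
      ultimately show ?thesis by simp
    qed
  qed
  then have "A.E ?p v1 \<noteq> 0" using r1(2) r2(2) by auto
  \<comment> \<open>\<open>v1\<close> is itself the variable with index \<open>?o\<close>, so
    \<open>?o\<close> is the only index with nonzero partial derivative.\<close>
  then have "?p = ?o" using A.E_U[OF pI oI] unfolding Uo(1) by (simp split: if_splits)
  then have "\<And>l. a l + b l = 0" unfolding ab(1) tadd_def by (simp add: fun_eq_iff)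
  then have ro: "r1 = ?o" "r2 = ?o" unfolding ab(1,3) by (simp_all add: fun_eq_iff)
  \<comment> \<open>\<open>?o\<close> is the least index, so an element with leader
    \<open>?o\<close> involves no other derivative.\<close>
  have min: "\<pi> = ?o \<or> rlt m ?o \<pi>" if p: "\<pi> \<in> A.I" for \<pi>
  proof -
    obtain e where e: "\<pi> = (e, 1)" "e \<in> Theta m" using p unfolding A.I_def by auto
    have "\<pi> = tadd ?o e" unfolding e(1) tadd_def by simp
    then show ?thesis using rlt_tadd_self[OF e(2), where i = ?o] by (cases "e = (\<lambda>_. 0)") (simp_all add: e(1))
  qed
  have "v2 \<in> field_adjoin F (A.U ` (A.I \<inter> {?o}))"
  proof (rule A.support_adjoin[OF in_A])
    fix \<pi> assume p: "\<pi> \<in> A.I" "\<pi> \<notin> {?o}"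
    show "A.E \<pi> v2 = 0" by (rule r2(3)[OF p(1)]) (use min[OF p(1)] p(2) in \<open>simp add: ro\<close>)
  qed
  moreover have "v1 \<in> field_adjoin F (B.U ` (B.I \<inter> {?o}))"
  proof (rule B.support_adjoin[OF in_B])
    fix \<pi> assume p: "\<pi> \<in> B.I" "\<pi> \<notin> {?o}"
    show "B.E \<pi> v1 = 0" by (rule r1(3)[OF p(1)]) (use min[OF p(1)] p(2) in \<open>simp add: ro\<close>)
  qed
  moreover have "A.I \<inter> {?o} = {?o}" "B.I \<inter> {?o} = {?o}" using oI by simp_all
  moreover have "v1 \<notin> dcl F"
    by (rule alg_independent_not_dcl[OF A.F A.ind oI, unfolded Uo(1)]) (rule Un_upper1)
  ultimately show ?thesis by (simp only: Uo image_insert image_empty algebraic_over_iff_dcl[OF A.F] simp_thms)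
qed

theorem theorem3p1:
  fixes \<delta> :: "nat \<Rightarrow> 'a::field_char_0 \<Rightarrow> 'a"
    and F G :: "'a set"
    and u :: "nat \<Rightarrow> 'a"
    and m n s :: nat
  assumes "m > 1"
    and "delta_structure m \<delta>"
    and "delta_subfield m \<delta> F"
    and "delta_indeterminates m \<delta> F n u"
    and "delta_subfield m \<delta> G"
    and "F \<subset> G"
    and "G \<subseteq> delta_adjoin m \<delta> F (u ` {1..n})"
    and "is_diff_dim_poly m \<delta> G n u
           (of_nat n * binomial_poly (int m) m - binomial_poly (int m - int s) m)"
  shows "(\<exists>v\<in>G. G = delta_adjoin m \<delta> F {v}) \<and>
         (\<forall>v1\<in>G. \<forall>v2\<in>G. G = delta_adjoin m \<delta> F {v1} \<longrightarrow> G = delta_adjoin m \<delta> F {v2} \<longrightarrow>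
            (\<exists>a\<in>F. \<exists>b\<in>F. \<exists>c\<in>F. \<exists>d\<in>F. c * v1 + d \<noteq> 0 \<and> v2 = (a * v1 + b) / (c * v1 + d)))"
proof -
  interpret dframe m \<delta> F n u by (rule dframe.intro[OF assms(2-4)])
  have GK: "G \<subseteq> KK" using assms(7) unfolding KK_delta_adjoin .
  show ?thesis
  proof (intro conjI ballI impI)
    show "\<exists>v\<in>G. G = delta_adjoin m \<delta> F {v}"
      by (rule existence_from_dimension_polynomial[OF assms(1,5) psubset_imp_subset[OF assms(6)] GK assms(8)])
  next
    fix v1 v2 assume v: "v1 \<in> G" "v2 \<in> G" and gen: "G = delta_adjoin m \<delta> F {v1}" "G = delta_adjoin m \<delta> F {v2}"
    have notF: "v \<notin> F" if g: "G = delta_adjoin m \<delta> F {v}" for v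
    proof
      assume "v \<in> F"
      then have "G \<subseteq> F" unfolding g by (intro delta_adjoin_least[OF assms(3)]) auto
      then show False using assms(6) by blast
    qed
    have fr: "dframe m \<delta> F 1 (\<lambda>_. v)" if "v \<in> G" "G = delta_adjoin m \<delta> F {v}" for v
      by (rule element_is_indeterminate[OF subsetD[OF GK that(1)] notF[OF that(2)]])
    have in1: "v2 \<in> delta_adjoin m \<delta> F {v1}" and in2: "v1 \<in> delta_adjoin m \<delta> F {v2}"
      using v gen by simp_all
    have "v2 \<in> field_adjoin F {v1} \<and> v1 \<in> field_adjoin F {v2} \<and> \<not> algebraic_over F v1"
      by (rule mutual_generators[OF fr[OF v(1) gen(1)] fr[OF v(2) gen(2)] in1 in2 notF[OF gen(2)] notF[OF gen(1)]])
    then show "\<exists>a\<in>F. \<exists>b\<in>F. \<exists>c\<in>F. \<exists>d\<in>F. c * v1 + d \<noteq> 0 \<and> v2 = (a * v1 + b) / (c * v1 + d)"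
      using moebius_of_mutual_generators[OF F] by blast
  qed
qed

end
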